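(* Let $-\infty<a<b<\infty$, let $\psi:[a,b]\to\mathbb{C}$ be measurable and bounded, let $\phi$ be a measurable function with $\phi^2=2\psi$, and let $$J=\begin{pmatrix}-1&0\\0&1\end{pmatrix},\qquad R(x)=\begin{pmatrix}1-|\psi(x)|&\psi(x)\\-\overline{\psi(x)}&1+|\psi(x)|\end{pmatrix}.$$ For $a<\zeta\le b$ let $S_\zeta$ be the operator on $L^2(a,\zeta)$ $$(S_\zeta f)(x)=f(x)+\frac{i}{2\pi}\,\mathrm{p.v.}\!\int_a^\zeta\frac{\phi(x)\overline{\phi(t)}-\overline{\phi(x)}\phi(t)}{x-t}f(t)\,dt .$$ Suppose that $S_b$ is positive and invertible. Put $F_1(x)=\begin{pmatrix}\phi(x)\\-\overline{\phi(x)}\end{pmatrix}$, $\Phi(\zeta,x)=(S_\zeta^{-1}F_1)(x)$ (with $S_\zeta^{-1}$ applied entrywise), and $$\sigma_1(\zeta)=\frac1{2\pi}\int_a^\zeta F_1(x)\Phi^*(\zeta,x)\,dx\quad(a<\zeta\le b),\qquad \sigma_1(a)=0 .$$ Then $$W(z)=\overset{\curvearrowleft}{\int_a^b}\exp\left[-iJ\,\frac{d\sigma_1(t)}{t-z}\right],\qquad z\notin[a,b],$$ is a solution of the problem of constructing the matrix function $W(z)$ corresponding to the $J$-module $R(x)$, i.e. of the Riemann--Hilbert problem $$W_+(x)=W_-(x)R^2(x)\quad\text{for a.e. }x\in[a,b],\qquad W(z)\to I\ (z\to\infty),$$ with $W$ analytic off $[a,b]$.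
   Context: $W_\pm(x)=\lim_{y\to\pm0}W(x+iy)$. The matrices $R(x)$ of the displayed form are exactly the $2\times2$ matrices with positive eigenvalues satisfying $JR=R^*J$, $RJR^*\ge J$ and $(R-I)^2=0$ (the paper's "Z-class" of $J$-modules). The multiplicative integral $\overset{\curvearrowleft}{\int_a^b}\exp[-iJ\,d\sigma_1(t)/(t-z)]$ is the limit, as the mesh of the partition $a=t_0<\dots<t_n=b$ tends to $0$, of the products $\exp\bigl[-iJ\frac{\sigma_1(t_n)-\sigma_1(t_{n-1})}{\tau_n-z}\bigr]\cdots\exp\bigl[-iJ\frac{\sigma_1(t_1)-\sigma_1(t_0)}{\tau_1-z}\bigr]$, $\tau_k\in[t_{k-1},t_k]$ (factors with larger $t$ stand to the left). *)

theory Defs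
  imports "HOL-Analysis.Analysis"
begin

section \<open>The space \<open>L\<^sup>2(a,c)\<close> and operators on it\<close>

text \<open>Elements of \<open>L\<^sup>2(a,c)\<close> are represented by functions \<open>real \<Rightarrow> complex\<close>, of which only the
  restriction to the open interval matters, and only up to equality almost everywhere.\<close>

definition L2 :: "real \<Rightarrow> real \<Rightarrow> (real \<Rightarrow> complex) set" where
  "L2 a c = {f. f \<in> borel_measurable (lebesgue_on {a<..<c}) \<and>
               integrable (lebesgue_on {a<..<c}) (\<lambda>x. (cmod (f x))\<^sup>2)}"

definition ae_eq :: "real \<Rightarrow> real \<Rightarrow> (real \<Rightarrow> complex) \<Rightarrow> (real \<Rightarrow> complex) \<Rightarrow> bool" where
  "ae_eq a c f g \<longleftrightarrow> (AE x in lebesgue_on {a<..<c}. f x = g x)"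

definition L2_inner :: "real \<Rightarrow> real \<Rightarrow> (real \<Rightarrow> complex) \<Rightarrow> (real \<Rightarrow> complex) \<Rightarrow> complex" where
  "L2_inner a c f g = (LINT x|lebesgue_on {a<..<c}. f x * cnj (g x))"

definition L2_norm :: "real \<Rightarrow> real \<Rightarrow> (real \<Rightarrow> complex) \<Rightarrow> real" where
  "L2_norm a c f = sqrt (LINT x|lebesgue_on {a<..<c}. (cmod (f x))\<^sup>2)"

definition L2_bounded_op :: "real \<Rightarrow> real \<Rightarrow> ((real \<Rightarrow> complex) \<Rightarrow> (real \<Rightarrow> complex)) \<Rightarrow> bool" where
  "L2_bounded_op a c T \<longleftrightarrow>
     (\<forall>f\<in>L2 a c. T f \<in> L2 a c) \<and>
     (\<forall>f\<in>L2 a c. \<forall>g\<in>L2 a c. ae_eq a c f g \<longrightarrow> ae_eq a c (T f) (T g)) \<and>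
     (\<forall>f\<in>L2 a c. \<forall>g\<in>L2 a c. ae_eq a c (T (\<lambda>x. f x + g x)) (\<lambda>x. T f x + T g x)) \<and>
     (\<forall>k. \<forall>f\<in>L2 a c. ae_eq a c (T (\<lambda>x. k * f x)) (\<lambda>x. k * T f x)) \<and>
     (\<exists>C. \<forall>f\<in>L2 a c. L2_norm a c (T f) \<le> C * L2_norm a c f)"

definition L2_positive :: "real \<Rightarrow> real \<Rightarrow> ((real \<Rightarrow> complex) \<Rightarrow> (real \<Rightarrow> complex)) \<Rightarrow> bool" where
  "L2_positive a c T \<longleftrightarrow> (\<forall>f\<in>L2 a c. L2_inner a c (T f) f \<in> \<real>\<^sub>\<ge>\<^sub>0)"

definition L2_invertible :: "real \<Rightarrow> real \<Rightarrow> ((real \<Rightarrow> complex) \<Rightarrow> (real \<Rightarrow> complex)) \<Rightarrow> bool" where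
  "L2_invertible a c T \<longleftrightarrow>
     (\<exists>T'. L2_bounded_op a c T' \<and>
           (\<forall>f\<in>L2 a c. ae_eq a c (T (T' f)) f \<and> ae_eq a c (T' (T f)) f))"

text \<open>A representative of \<open>T\<^sup>-\<^sup>1 g\<close>; for invertible \<open>T\<close> it is determined up to a null set.\<close>

definition L2_inv ::
    "real \<Rightarrow> real \<Rightarrow> ((real \<Rightarrow> complex) \<Rightarrow> (real \<Rightarrow> complex)) \<Rightarrow> (real \<Rightarrow> complex) \<Rightarrow> (real \<Rightarrow> complex)" where
  "L2_inv a c T g = (SOME f. f \<in> L2 a c \<and> ae_eq a c (T f) g)"

section \<open>The operators \<open>S\<^sub>\<zeta>\<close> and the matrix function \<open>\<sigma>\<^sub>1\<close>\<close>

text \<open>Cauchy principal value at \<open>t = x\<close> of the integral of \<open>k\<close> over \<open>(a,c)\<close>; the limit need only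
  exist for almost every \<open>x\<close>.\<close>

definition pv_integral :: "real \<Rightarrow> real \<Rightarrow> real \<Rightarrow> (real \<Rightarrow> complex) \<Rightarrow> complex" where
  "pv_integral a c x k =
     Lim (at_right 0) (\<lambda>\<epsilon>. LINT t|lebesgue_on {t. a < t \<and> t < c \<and> \<epsilon> < \<bar>x - t\<bar>}. k t)"

definition S_op :: "(real \<Rightarrow> complex) \<Rightarrow> real \<Rightarrow> real \<Rightarrow> (real \<Rightarrow> complex) \<Rightarrow> (real \<Rightarrow> complex)" where
  "S_op \<phi> a \<zeta> f = (\<lambda>x. f x + \<i> / (2 * of_real pi) *
     pv_integral a \<zeta> x (\<lambda>t. (\<phi> x * cnj (\<phi> t) - cnj (\<phi> x) * \<phi> t) / of_real (x - t) * f t))"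

definition F1 :: "(real \<Rightarrow> complex) \<Rightarrow> real \<Rightarrow> complex ^ 2" where
  "F1 \<phi> x = vector [\<phi> x, - cnj (\<phi> x)]"

definition Phi :: "(real \<Rightarrow> complex) \<Rightarrow> real \<Rightarrow> real \<Rightarrow> real \<Rightarrow> complex ^ 2" where
  "Phi \<phi> a \<zeta> x = (\<chi> i. L2_inv a \<zeta> (S_op \<phi> a \<zeta>) (\<lambda>y. F1 \<phi> y $ i) x)"

text \<open>Column times conjugate-transposed column, \<open>u v\<^sup>*\<close>.\<close>

definition outer :: "complex ^ 2 \<Rightarrow> complex ^ 2 \<Rightarrow> complex ^ 2 ^ 2" where
  "outer u v = (\<chi> i j. u $ i * cnj (v $ j))"

definition sigma1 :: "(real \<Rightarrow> complex) \<Rightarrow> real \<Rightarrow> real \<Rightarrow> complex ^ 2 ^ 2" where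
  "sigma1 \<phi> a \<zeta> =
     (if \<zeta> = a then 0
      else (1 / (2 * pi)) *\<^sub>R (LINT x|lebesgue_on {a<..<\<zeta>}. outer (F1 \<phi> x) (Phi \<phi> a \<zeta> x)))"

section \<open>Matrix exponential and multiplicative integral\<close>

text \<open>The type class function \<open>exp\<close> is not applicable to the vector type of square matrices.\<close>

primrec matpow :: "complex ^ 2 ^ 2 \<Rightarrow> nat \<Rightarrow> complex ^ 2 ^ 2" where
  "matpow A 0 = mat 1"
| "matpow A (Suc n) = A ** matpow A n"

definition matexp :: "complex ^ 2 ^ 2 \<Rightarrow> complex ^ 2 ^ 2" where
  "matexp A = (\<Sum>n. (1 / fact n) *\<^sub>R matpow A n)"

definition mscale :: "complex \<Rightarrow> complex ^ 2 ^ 2 \<Rightarrow> complex ^ 2 ^ 2" where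
  "mscale c A = (\<chi> i j. c * A $ i $ j)"

definition Jmat :: "complex ^ 2 ^ 2" where
  "Jmat = vector [vector [-1, 0], vector [0, 1]]"

text \<open>\<open>left_prod E n = E (n-1) ** \<dots> ** E 0\<close>.\<close>

primrec left_prod :: "(nat \<Rightarrow> complex ^ 2 ^ 2) \<Rightarrow> nat \<Rightarrow> complex ^ 2 ^ 2" where
  "left_prod E 0 = mat 1"
| "left_prod E (Suc n) = E n ** left_prod E n"

text \<open>Tags are indexed by the left end point: \<open>\<tau> k\<close> lies in \<open>[t k, t (k+1)]\<close>.\<close>

definition tagged_partition :: "real \<Rightarrow> real \<Rightarrow> nat \<Rightarrow> (nat \<Rightarrow> real) \<Rightarrow> (nat \<Rightarrow> real) \<Rightarrow> bool" where
  "tagged_partition a b n t \<tau> \<longleftrightarrow>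
     t 0 = a \<and> t n = b \<and> (\<forall>k<n. t k < t (Suc k) \<and> \<tau> k \<in> {t k..t (Suc k)})"

definition mult_product ::
    "(real \<Rightarrow> complex ^ 2 ^ 2) \<Rightarrow> complex \<Rightarrow> nat \<Rightarrow> (nat \<Rightarrow> real) \<Rightarrow> (nat \<Rightarrow> real) \<Rightarrow> complex ^ 2 ^ 2" where
  "mult_product \<sigma> z n t \<tau> =
     left_prod (\<lambda>k. matexp (mscale (- \<i> / (of_real (\<tau> k) - z)) (Jmat ** (\<sigma> (t (Suc k)) - \<sigma> (t k))))) n"

definition has_mult_integral ::
    "(real \<Rightarrow> complex ^ 2 ^ 2) \<Rightarrow> real \<Rightarrow> real \<Rightarrow> complex \<Rightarrow> complex ^ 2 ^ 2 \<Rightarrow> bool" where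
  "has_mult_integral \<sigma> a b z M \<longleftrightarrow>
     (\<forall>\<epsilon>>0. \<exists>\<delta>>0. \<forall>n t \<tau>. tagged_partition a b n t \<tau> \<and> (\<forall>k<n. t (Suc k) - t k < \<delta>)
        \<longrightarrow> dist (mult_product \<sigma> z n t \<tau>) M < \<epsilon>)"

definition mult_integral ::
    "(real \<Rightarrow> complex ^ 2 ^ 2) \<Rightarrow> real \<Rightarrow> real \<Rightarrow> complex \<Rightarrow> complex ^ 2 ^ 2" where
  "mult_integral \<sigma> a b z = (THE M. has_mult_integral \<sigma> a b z M)"

section \<open>The Riemann--Hilbert problem\<close>

definition Rmat :: "(real \<Rightarrow> complex) \<Rightarrow> real \<Rightarrow> complex ^ 2 ^ 2" where
  "Rmat \<psi> x = vector [vector [1 - of_real (cmod (\<psi> x)), \<psi> x],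
                      vector [- cnj (\<psi> x), 1 + of_real (cmod (\<psi> x))]]"

text \<open>The jump condition includes the existence, almost everywhere, of the boundary values
  \<open>W\<^sub>\<plusminus>(x) = lim W(x + iy)\<close> as \<open>y\<close> tends to \<open>\<plusminus>0\<close>.\<close>

definition solves_RH ::
    "(real \<Rightarrow> complex ^ 2 ^ 2) \<Rightarrow> real \<Rightarrow> real \<Rightarrow> (complex \<Rightarrow> complex ^ 2 ^ 2) \<Rightarrow> bool" where
  "solves_RH R a b W \<longleftrightarrow>
     (\<forall>i j. (\<lambda>z. W z $ i $ j) analytic_on - (complex_of_real ` {a..b})) \<and>
     (W \<longlongrightarrow> mat 1) at_infinity \<and>
     (AE x in lebesgue_on {a..b}. \<exists>Wp Wm.
        ((\<lambda>y. W (Complex x y)) \<longlongrightarrow> Wp) (at_right 0) \<and>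
        ((\<lambda>y. W (Complex x y)) \<longlongrightarrow> Wm) (at_left 0) \<and>
        Wp = Wm ** (R x ** R x))"

end

theory Submission
  imports Defs "HOL-Probability.Sinc_Integral"
begin

text \<open>
  Write \<open>F = F\<^sub>1\<close>, \<open>G = cnj F\<close> and let \<open>u\<^sub>\<zeta> = S\<^sub>\<zeta>\<inverse> F\<close>, extended by zero. The theorem holds because the Cauchy
  transform \<open>W\<^sub>\<zeta>(z) = I - (i/2\<pi>) J \<integral> u\<^sub>\<zeta> G\<^sup>T / (x - z) dx\<close> is at the same time the solution of the
  Riemann--Hilbert problem for \<open>\<zeta> = b\<close> and, as a function of \<open>\<zeta>\<close>, the solution of the difference equation
  that defines the multiplicative integral of \<open>\<sigma>\<^sub>1\<close>.

  \<^emph>\<open>The jump.\<close> The boundary values of a Cauchy transform of a density \<open>g\<close> are \<open>- H g \<plusminus> i\<pi> g\<close> with the Hilbert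
  transform \<open>H\<close>, so that \<open>W\<^sub>+ - W\<^sub>- = J u G\<^sup>T\<close>. As \<open>F\<^sup>* J F = 0\<close>, the equation \<open>S\<^sub>b u = F\<close>, read pointwise, says
  exactly that \<open>W\<^sub>- J F = J u\<close>. Hence \<open>W\<^sub>+ = W\<^sub>- (I + J F F\<^sup>*)\<close>, and \<open>I + J F F\<^sup>* = R\<^sup>2\<close>. This is
  \<open>Wm_jump\<close> and \<open>Rmat_square\<close>.

  \<^emph>\<open>The multiplicative integral.\<close> Multiplication by \<open>x\<close> commutes with \<open>S\<close> up to an operator of rank two. This gives
  the inverse \<open>M\<^sub>\<zeta>\<close> of \<open>W\<^sub>\<zeta>\<close> as a second Cauchy transform, and for \<open>\<zeta>\<^sub>1 \<le> \<zeta>\<^sub>2\<close> and \<open>w = u\<^sub>\<zeta>\<^sub>2 - u\<^sub>\<zeta>\<^sub>1\<close> the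
  identity \<open>W\<^sub>\<zeta>\<^sub>2 - W\<^sub>\<zeta>\<^sub>1 = - (i/2\<pi>) J (\<integral> (S w) v\<^sub>\<zeta>\<^sub>2\<^sup>T / (x - z) dx) W\<^sub>\<zeta>\<^sub>2\<close>, where \<open>v = cnj u\<close>. The integrand
  lives on \<open>(\<zeta>\<^sub>1, \<zeta>\<^sub>2)\<close>, where \<open>1 / (x - z)\<close> is nearly \<open>1 / (\<tau> - z)\<close>, and without that factor the integral
  is the increment of \<open>2\<pi> \<sigma>\<^sub>1\<close>. The error is at most a constant times the length of the interval times the increment of
  \<open>trace \<sigma>\<^sub>1\<close>, because \<open>S\<close> is bounded and \<open>\<langle>S w, w\<rangle> \<ge> \<delta> |w|\<^sup>2\<close>; since \<open>trace \<sigma>\<^sub>1\<close> is increasing and continuous, a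
  discrete Gronwall argument turns the difference equation into convergence of the products
  (\<open>has_mult_integral_of_difference_equation\<close>, \<open>Wm_has_mult_integral\<close>).

  \<^emph>\<open>The analysis behind it.\<close> Both parts need that \<open>H\<close> exists almost everywhere as a principal value, is bounded and
  antisymmetric on square-integrable functions and gives the boundary values of Cauchy transforms. On each horizontal
  line, the values of a Cauchy transform from above and from below are orthogonal (\<open>cauchy_tr_orthogonal\<close>); so their
  sum, which approximates \<open>- 2 H f\<close>, has the same norm as their difference, a Poisson integral, which is a contraction.
  The limit \<open>g\<close> of the sums therefore exists in norm, the sums are the Poisson integrals of \<open>g\<close>, and Lebesgue's
  differentiation theorem gives convergence almost everywhere (\<open>cauchy_sum_limit\<close>). Coercivity of \<open>S\<close> follows from
  positivity and invertibility (\<open>coercive_of_positive_invertible\<close>) and passes to all the \<open>S\<^sub>\<zeta>\<close>, so that a contraction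
  argument produces \<open>u\<^sub>\<zeta>\<close> (\<open>solution_exists\<close>).
\<close>

section \<open>Lebesgue points\<close>

definition lebesgue_point :: "(real \<Rightarrow> 'a::{banach, second_countable_topology}) \<Rightarrow> real \<Rightarrow> bool" where
  "lebesgue_point g x \<longleftrightarrow>
     ((\<lambda>r. (LINT t:cball x r|lborel. norm (g t - g x)) / r) \<longlongrightarrow> 0) (at_right 0)"

text \<open>Vitali's lemma selects disjoint balls among those of radius \<open>r\<close> with mass more than \<open>l r\<close>; their fivefold
  enlargements, of length \<open>10 r\<close>, still cover. The union \<open>T\<close> of the enlargements is measurable, so nothing need be known about
  the set of bad points itself.\<close>

lemma weak_type_maximal:
  fixes h :: "real \<Rightarrow> real"
  assumes h: "integrable lborel h" "\<And>x. 0 \<le> h x" and l: "0 < l"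
  obtains T where "T \<in> lmeasurable" "measure lebesgue T \<le> 10 / l * (LINT x|lborel. h x)"
    "\<And>x r. 0 < r \<Longrightarrow> r \<le> 1 \<Longrightarrow> l * r < (LINT t:cball x r|lborel. h t) \<Longrightarrow> x \<in> T"
proof -
  define K where "K = {p :: real \<times> real. 0 < snd p \<and> snd p \<le> 1 \<and>
     l * snd p < (LINT t:cball (fst p) (snd p)|lborel. h t)}"
  define S where "S = fst ` K"
  have S: "S \<subseteq> (\<Union>p\<in>K. cball (fst p) (snd p))"
    unfolding S_def K_def by force
  obtain C where C: "countable C" "C \<subseteq> K"
    "pairwise (\<lambda>i j. disjnt (cball (fst i) (snd i)) (cball (fst j) (snd j))) C"
    "S \<subseteq> (\<Union>i\<in>C. cball (fst i) (5 * snd i))"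
    by (rule Vitali_covering_lemma_cballs[OF S, of 1]) (auto simp: K_def)
  define T where "T = (\<Union>i\<in>C. cball (fst i) (5 * snd i))"
  have Tm: "T \<in> sets borel" unfolding T_def using C(1) by auto
  have setint: "integrable lborel (\<lambda>t. indicator A t * h t)" if "A \<in> sets borel" for A
    using that h(1) by (simp add: integrable_real_mult_indicator mult.commute)
  have pos: "0 < snd i" if "i \<in> C" for i using that C(2) by (auto simp: K_def)
  have ball: "emeasure lborel (cball (fst i) (5 * snd i)) \<le>
     ennreal (10 / l) * (\<integral>\<^sup>+t. ennreal (h t) * indicator (cball (fst i) (snd i)) t \<partial>lborel)" if "i \<in> C" for i
  proof -
    have "emeasure lborel (cball (fst i) (5 * snd i)) = ennreal (10 * snd i)"
      using pos[OF that] by (simp add: cball_eq_atLeastAtMost)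
    also have "\<dots> \<le> ennreal (10 / l * (LINT t:cball (fst i) (snd i)|lborel. h t))"
    proof (rule ennreal_leI)
      have "l * snd i \<le> (LINT t:cball (fst i) (snd i)|lborel. h t)"
        using that C(2) by (auto simp: K_def)
      then show "10 * snd i \<le> 10 / l * (LINT t:cball (fst i) (snd i)|lborel. h t)"
        using l by (simp add: field_simps)
    qed
    also have "\<dots> = ennreal (10 / l) * ennreal (LINT t:cball (fst i) (snd i)|lborel. h t)"
      using l by (intro ennreal_mult) (auto simp: set_lebesgue_integral_def h)
    also have "ennreal (LINT t:cball (fst i) (snd i)|lborel. h t) =
       (\<integral>\<^sup>+t. ennreal (indicator (cball (fst i) (snd i)) t * h t) \<partial>lborel)"
      unfolding set_lebesgue_integral_def
      by (subst nn_integral_eq_integral) (auto intro!: setint simp: h)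
    also have "\<dots> = (\<integral>\<^sup>+t. ennreal (h t) * indicator (cball (fst i) (snd i)) t \<partial>lborel)"
      by (intro nn_integral_cong) (auto simp: indicator_def)
    finally show ?thesis .
  qed
  have disj: "disjoint_family_on (\<lambda>i. cball (fst i) (snd i)) C"
    using C(3) by (auto simp: disjoint_family_on_def pairwise_def disjnt_def)
  have [measurable]: "h \<in> borel_measurable borel" using h(1) by auto
  have "emeasure lborel T = (\<integral>\<^sup>+t. indicator T t \<partial>lborel)"
    using Tm by simp
  also have "\<dots> \<le> (\<integral>\<^sup>+t. (\<integral>\<^sup>+i. indicator (cball (fst i) (5 * snd i)) t \<partial>count_space C) \<partial>lborel)"
  proof (rule nn_integral_mono)
    fix t :: real
    show "indicator T t \<le> (\<integral>\<^sup>+i. indicator (cball (fst i) (5 * snd i)) t \<partial>count_space C)"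
    proof (cases "t \<in> T")
      case True
      then obtain i where i: "i \<in> C" "t \<in> cball (fst i) (5 * snd i)" unfolding T_def by auto
      have "indicator T t = (\<integral>\<^sup>+j. indicator {i} j \<partial>count_space C)"
        using True i by simp
      also have "\<dots> \<le> (\<integral>\<^sup>+j. indicator (cball (fst j) (5 * snd j)) t \<partial>count_space C)"
        using i by (intro nn_integral_mono) (auto simp: indicator_def)
      finally show ?thesis .
    qed auto
  qed
  also have "\<dots> = (\<integral>\<^sup>+i. (\<integral>\<^sup>+t. indicator (cball (fst i) (5 * snd i)) t \<partial>lborel) \<partial>count_space C)"
    using C(1) by (subst nn_integral_count_space_nn_integral) (auto intro!: borel_measurable_indicator)
  also have "\<dots> = (\<integral>\<^sup>+i. emeasure lborel (cball (fst i) (5 * snd i)) \<partial>count_space C)"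
    by (intro nn_integral_cong) simp
  also have "\<dots> \<le> (\<integral>\<^sup>+i. ennreal (10 / l) * (\<integral>\<^sup>+t. ennreal (h t) * indicator (cball (fst i) (snd i)) t \<partial>lborel) \<partial>count_space C)"
    using ball by (intro nn_integral_mono) auto
  also have "\<dots> = ennreal (10 / l) * (\<integral>\<^sup>+i. (\<integral>\<^sup>+t. ennreal (h t) * indicator (cball (fst i) (snd i)) t \<partial>lborel) \<partial>count_space C)"
    by (intro nn_integral_cmult) auto
  finally have le1: "emeasure lborel T \<le> ennreal (10 / l) * (\<integral>\<^sup>+i. (\<integral>\<^sup>+t. ennreal (h t) * indicator (cball (fst i) (snd i)) t \<partial>lborel) \<partial>count_space C)" .
  have "(\<integral>\<^sup>+i. (\<integral>\<^sup>+t. ennreal (h t) * indicator (cball (fst i) (snd i)) t \<partial>lborel) \<partial>count_space C) =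
     (\<integral>\<^sup>+i. emeasure (density lborel (\<lambda>t. ennreal (h t))) (cball (fst i) (snd i)) \<partial>count_space C)"
    by (intro nn_integral_cong) (simp add: emeasure_density)
  also have "\<dots> = emeasure (density lborel (\<lambda>t. ennreal (h t))) (\<Union>i\<in>C. cball (fst i) (snd i))"
    using C(1) disj by (subst emeasure_UN_countable) auto
  also have "\<dots> \<le> emeasure (density lborel (\<lambda>t. ennreal (h t))) UNIV"
    by (intro emeasure_mono) auto
  also have "\<dots> = ennreal (LINT x|lborel. h x)"
    using h by (subst emeasure_density) (auto simp: nn_integral_eq_integral)
  finally have "emeasure lborel T \<le> ennreal (10 / l) * ennreal (LINT x|lborel. h x)"
    using le1 by (intro order.trans[OF le1] mult_left_mono) auto
  also have "\<dots> = ennreal (10 / l * (LINT x|lborel. h x))"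
    using l by (intro ennreal_mult[symmetric]) (auto simp: h)
  finally have le: "emeasure lborel T \<le> ennreal (10 / l * (LINT x|lborel. h x))" .
  have nn: "0 \<le> 10 / l * (LINT x|lborel. h x)" using l h by (simp add: integral_nonneg)
  show thesis
  proof
    have fin: "emeasure lebesgue T \<le> ennreal (10 / l * (LINT x|lborel. h x))"
      using le Tm by simp
    show "T \<in> lmeasurable"
      using fin Tm by (intro fmeasurableI) (auto simp: le_less_trans)
    show "measure lebesgue T \<le> 10 / l * (LINT x|lborel. h x)"
      using fin nn by (simp add: measure_def enn2real_leI)
    fix x r assume "0 < r" "r \<le> 1" "l * r < (LINT t:cball x r|lborel. h t)"
    then have "(x, r) \<in> K" by (simp add: K_def)
    then have "x \<in> S" unfolding S_def by force
    then show "x \<in> T" using C(4) unfolding T_def by blast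
  qed
qed

lemma set_integrable_norm_diff_cball:
  fixes g :: "real \<Rightarrow> 'a::{banach, second_countable_topology}"
  assumes "integrable lborel g"
  shows "set_integrable lborel (cball x r) (\<lambda>t. norm (g t - c))"
proof -
  have "set_integrable lborel (cball x r) g" unfolding set_integrable_def
    using assms by (intro integrable_mult_indicator) auto
  moreover have "set_integrable lborel (cball x r) (\<lambda>t. c)"
    by (rule set_integrable_subset[of _ "cball x (max r 0)"]) 
       (auto simp: set_integrable_def cball_eq_atLeastAtMost)
  ultimately show ?thesis by (intro set_integrable_norm set_integral_diff)
qed

lemma set_integrable_cball:
  fixes g :: "real \<Rightarrow> 'a::{banach, second_countable_topology}"
  assumes "integrable lborel g"
  shows "set_integrable lborel (cball x r) g"
  unfolding set_integrable_def using assms by (intro integrable_mult_indicator) auto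

text \<open>The class of functions with Lebesgue points almost everywhere is closed in \<open>L\<^sup>1\<close>: outside a set controlled by the
  weak type inequality for \<open>g - h\<close>, the mean oscillation of \<open>g\<close> exceeds that of \<open>h\<close> by at most \<open>3 l\<close>.\<close>

lemma lebesgue_points_closed:
  fixes g :: "real \<Rightarrow> 'a::{banach, second_countable_topology}"
  assumes g: "integrable lborel g"
    and approx: "\<And>e. 0 < e \<Longrightarrow> \<exists>h. integrable lborel h \<and> (AE x in lborel. lebesgue_point h x) \<and>
       (LINT x|lborel. norm (g x - h x)) < e"
  shows "AE x in lborel. lebesgue_point g x"
proof -
  define Bad where "Bad l = {x. \<not> eventually (\<lambda>r. (LINT t:cball x r|lborel. norm (g t - g x)) \<le> 4 * l * r) (at_right 0)}" for l :: real
  have bad: "negligible (Bad l)" if l: "0 < l" for l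
    unfolding negligible_outer_le
  proof (intro allI impI)
    fix e :: real assume e: "0 < e"
    obtain h where h: "integrable lborel h" "AE x in lborel. lebesgue_point h x"
      "(LINT x|lborel. norm (g x - h x)) < e * l / 11" using approx[of "e * l / 11"] e l by auto
    define d where "d x = norm (g x - h x)" for x
    have d: "integrable lborel d" unfolding d_def using g h by auto
    have [measurable]: "d \<in> borel_measurable borel" using d by auto
    obtain T where T: "T \<in> lmeasurable" "measure lebesgue T \<le> 10 / l * (LINT x|lborel. d x)"
      "\<And>x r. 0 < r \<Longrightarrow> r \<le> 1 \<Longrightarrow> l * r < (LINT t:cball x r|lborel. d t) \<Longrightarrow> x \<in> T"
      by (rule weak_type_maximal[OF d _ l]) (auto simp: d_def)
    define V where "V = {x. l \<le> d x}"
    have Vm: "V \<in> sets borel" unfolding V_def by measurable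
    have "emeasure lborel V = emeasure lborel {x \<in> space lborel. l \<le> d x}" by (simp add: V_def)
    also have "\<dots> \<le> ennreal (1 / l * (LINT x|lborel. d x))"
      using d[unfolded d_def[abs_def]] l by (intro integral_Markov_inequality) (auto simp: d_def[abs_def])
    finally have Vle: "emeasure lebesgue V \<le> ennreal (1 / l * (LINT x|lborel. d x))" using Vm by simp
    have dn: "0 \<le> (LINT x|lborel. d x)" by (simp add: d_def)
    have V1: "V \<in> lmeasurable" using Vle Vm by (intro fmeasurableI) (auto simp: le_less_trans)
    have V2: "measure lebesgue V \<le> 1 / l * (LINT x|lborel. d x)"
      using Vle dn l by (simp add: measure_def enn2real_leI)
    obtain N where N: "N \<in> null_sets lborel" "{x. \<not> lebesgue_point h x} \<subseteq> N"
      using h(2) by (auto elim!: AE_E simp: null_sets_def)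
    then have N': "N \<in> lmeasurable" "measure lebesgue N = 0"
      using null_sets_completionI[of N lborel]
      by (auto intro: negligible_imp_measurable simp: negligible_iff_null_sets measure_eq_0_null_sets)
    show "\<exists>T. Bad l \<subseteq> T \<and> T \<in> lmeasurable \<and> measure lebesgue T \<le> e"
    proof (intro exI conjI)
      show "T \<union> V \<union> N \<in> lmeasurable" using T V1 N' by auto
      have "measure lebesgue (T \<union> V \<union> N) \<le> measure lebesgue T + measure lebesgue V + measure lebesgue N"
        using T V1 N' by (meson add_mono_thms_linordered_semiring(3) fmeasurable.Un fmeasurableD measure_Un_le order_trans)
      also have "\<dots> \<le> 11 / l * (LINT x|lborel. d x)" using T V2 N' l by (simp add: field_simps)
      also have "\<dots> \<le> e" using h(3) l by (simp add: d_def field_simps)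
      finally show "measure lebesgue (T \<union> V \<union> N) \<le> e" .
      show "Bad l \<subseteq> T \<union> V \<union> N"
      proof (rule subsetI, rule ccontr)
        fix x assume x: "x \<in> Bad l" "x \<notin> T \<union> V \<union> N"
        then have "lebesgue_point h x" using N by auto
        then have "eventually (\<lambda>r. (LINT t:cball x r|lborel. norm (h t - h x)) / r < l) (at_right 0)"
          unfolding lebesgue_point_def using l by (rule order_tendstoD)
        moreover have "eventually (\<lambda>r::real. 0 < r \<and> r < 1) (at_right 0)"
          using eventually_at_right_real[of 0 "1::real"] by (simp add: eventually_mono)
        ultimately have "eventually (\<lambda>r. (LINT t:cball x r|lborel. norm (g t - g x)) \<le> 4 * l * r) (at_right 0)"
        proof eventually_elim
          case (elim r)
          have i1: "set_integrable lborel (cball x r) d" using d by (rule set_integrable_cball)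
          have i2: "set_integrable lborel (cball x r) (\<lambda>t. norm (h t - h x))"
            using h(1) by (rule set_integrable_norm_diff_cball)
          have i3: "set_integrable lborel (cball x r) (\<lambda>t. d x)"
            using elim by (auto simp: set_integrable_def cball_eq_atLeastAtMost)
          have "(LINT t:cball x r|lborel. norm (g t - g x)) \<le>
            (LINT t:cball x r|lborel. (d t + norm (h t - h x)) + d x)"
          proof (rule set_integral_mono)
            show "set_integrable lborel (cball x r) (\<lambda>t. norm (g t - g x))"
              using g by (rule set_integrable_norm_diff_cball)
            show "set_integrable lborel (cball x r) (\<lambda>t. (d t + norm (h t - h x)) + d x)"
              using i1 i2 i3 by (intro set_integral_add)
            fix t
            have "g t - g x = (g t - h t) + (h t - h x) - (g x - h x)" by simp
            then show "norm (g t - g x) \<le> (d t + norm (h t - h x)) + d x"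
              unfolding d_def by (smt (verit) norm_triangle_ineq norm_triangle_ineq4)
          qed
          also have "\<dots> = (LINT t:cball x r|lborel. d t) + (LINT t:cball x r|lborel. norm (h t - h x)) + 2 * r * d x"
            using i1 i2 i3 elim by (simp add: set_integral_add(2) set_integral_add(1))
              (simp add: set_lebesgue_integral_def cball_eq_atLeastAtMost)
          also have "(LINT t:cball x r|lborel. d t) \<le> l * r" using T(3)[of r x] elim x by force
          also have "(LINT t:cball x r|lborel. norm (h t - h x)) \<le> l * r" using elim by (simp add: field_simps)
          also have "2 * r * d x \<le> 2 * r * l" using elim x by (intro mult_left_mono) (auto simp: V_def)
          finally show ?case by simp
        qed
        then show False using x by (simp add: Bad_def)
      qed
    qed
  qed
  have "negligible (\<Union>n. Bad (1 / real (Suc n)))"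
    by (intro negligible_countable_Union) (auto intro!: bad)
  then have "(\<Union>n. Bad (1 / real (Suc n))) \<in> null_sets lebesgue" by (simp add: negligible_iff_null_sets)
  then have "AE x in lebesgue. x \<notin> (\<Union>n. Bad (1 / real (Suc n)))" by (rule AE_not_in)
  then have "AE x in lborel. x \<notin> (\<Union>n. Bad (1 / real (Suc n)))" by (simp add: AE_completion_iff)
  then show ?thesis
  proof eventually_elim
    case (elim x)
    show ?case unfolding lebesgue_point_def
    proof (rule tendstoI)
      fix e :: real assume "0 < e"
      then obtain n where n: "1 / real (Suc n) < e / 4"
        using reals_Archimedean[of "e/4"] by (auto simp: inverse_eq_divide)
      have "eventually (\<lambda>r. (LINT t:cball x r|lborel. norm (g t - g x)) \<le> 4 * (1 / real (Suc n)) * r) (at_right 0)"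
        using elim by (auto simp: Bad_def)
      moreover have "eventually (\<lambda>r::real. 0 < r) (at_right 0)" by (rule eventually_at_right_less)
      ultimately show "eventually (\<lambda>r. dist ((LINT t:cball x r|lborel. norm (g t - g x)) / r) 0 < e) (at_right 0)"
      proof eventually_elim
        case (elim r)
        have "0 \<le> (LINT t:cball x r|lborel. norm (g t - g x))" 
          unfolding set_lebesgue_integral_def by (intro Bochner_Integration.integral_nonneg) auto
        moreover have "(LINT t:cball x r|lborel. norm (g t - g x)) / r \<le> 4 * (1 / real (Suc n))"
          using elim by (simp add: divide_le_eq)
        ultimately show ?case using n elim by (simp add: abs_of_nonneg)
      qed
    qed
  qed
qed

lemma lebesgue_point_continuous:
  fixes g :: "real \<Rightarrow> 'a::{banach, second_countable_topology}"
  assumes g: "integrable lborel g" and c: "isCont g x"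
  shows "lebesgue_point g x"
  unfolding lebesgue_point_def
proof (rule tendstoI)
  fix e :: real assume e: "0 < e"
  obtain d where d: "d > 0" "\<And>t. dist t x < d \<Longrightarrow> dist (g t) (g x) < e / 4"
    using c e unfolding continuous_at_eps_delta by (metis zero_less_divide_iff zero_less_numeral)
  have "eventually (\<lambda>r::real. 0 < r \<and> r < d) (at_right 0)"
    using eventually_at_right_real[OF d(1)] by (simp add: eventually_mono)
  then show "eventually (\<lambda>r. dist ((LINT t:cball x r|lborel. norm (g t - g x)) / r) 0 < e) (at_right 0)"
  proof eventually_elim
    case (elim r)
    have "(LINT t:cball x r|lborel. norm (g t - g x)) \<le> (LINT t:cball x r|lborel. e / 4)"
      using elim d(2) g
      by (intro set_integral_mono set_integrable_norm_diff_cball)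
        (auto simp: set_integrable_def cball_eq_atLeastAtMost dist_norm norm_minus_commute intro: less_imp_le)
    also have "\<dots> = r * e / 2" using elim by (simp add: set_lebesgue_integral_def cball_eq_atLeastAtMost)
    finally have "(LINT t:cball x r|lborel. norm (g t - g x)) \<le> e / 2 * r" by (simp add: mult.commute)
    then have "(LINT t:cball x r|lborel. norm (g t - g x)) / r < e"
      using elim e by (simp add: divide_less_eq) (smt (verit) mult_pos_pos)
    moreover have "0 \<le> (LINT t:cball x r|lborel. norm (g t - g x))" 
      unfolding set_lebesgue_integral_def by (intro Bochner_Integration.integral_nonneg) auto
    ultimately show ?case using e elim by (auto simp: abs_of_nonneg)
  qed
qed

text \<open>By the closure lemma it suffices to treat indicators, and these are approximated by Urysohn functions between a
  closed subset and an open superset.\<close>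

theorem AE_lebesgue_point:
  fixes g :: "real \<Rightarrow> 'a::{banach, second_countable_topology}"
  assumes "integrable lborel g"
  shows "AE x in lborel. lebesgue_point g x"
  using assms
proof (induct rule: integrable_induct)
  case (base A c)
  show ?case
  proof (rule lebesgue_points_closed)
    show gi: "integrable lborel (\<lambda>x. indicator A x *\<^sub>R c)" using base by auto
    fix e :: real assume e: "0 < e"
    define e' where "e' = e / (2 * (norm c + 1))"
    have nc: "0 < norm c + 1" using norm_ge_zero[of c] by linarith
    have e': "0 < e'" using e nc by (simp add: e'_def)
    have e2: "e' + e' = e / (norm c + 1)"
      unfolding e'_def using nc by (simp add: divide_simps)
    have Al: "A \<in> sets lebesgue" using base by auto
    obtain U where U: "open U" "A \<subseteq> U" "(U - A) \<in> lmeasurable" "emeasure lebesgue (U - A) < ennreal e'"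
      using sets_lebesgue_outer_open[OF Al e'] by blast
    obtain C where C: "closed C" "C \<subseteq> A" "(A - C) \<in> lmeasurable" "emeasure lebesgue (A - C) < ennreal e'"
      using sets_lebesgue_inner_closed[OF Al e'] by blast
    obtain u :: "real \<Rightarrow> real" where u: "continuous_on UNIV u" "\<And>x. u x \<in> closed_segment 1 0"
      "\<And>x. x \<in> C \<Longrightarrow> u x = 1" "\<And>x. x \<in> - U \<Longrightarrow> u x = 0"
      using Urysohn_local[of UNIV C "-U" "1::real" 0] U C by (auto simp: subset_iff)
    have u01: "0 \<le> u x" "u x \<le> 1" for x using u(2)[of x] by (auto simp: closed_segment_eq_real_ivl split: if_splits)
    have [measurable]: "u \<in> borel_measurable borel" using u(1) by (rule borel_measurable_continuous_onI)
    have [measurable]: "U \<in> sets borel" "C \<in> sets borel" "A \<in> sets borel" using U C base by auto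
    have Um: "emeasure lborel (U - A) < ennreal e'" "emeasure lborel (A - C) < ennreal e'"
      using U C by auto
    have D: "emeasure lborel (U - C) < ennreal (e / (norm c + 1))"
    proof -
      have "U - C = (U - A) \<union> (A - C)" using U C by auto
      then have "emeasure lborel (U - C) \<le> emeasure lborel (U - A) + emeasure lborel (A - C)"
        using emeasure_subadditive[of "U - A" lborel "A - C"] by simp
      also have "\<dots> < ennreal e' + ennreal e'" using Um by (rule add_strict_mono)
      also have "\<dots> = ennreal (e / (norm c + 1))" using e' e2 by (subst ennreal_plus[symmetric]) auto
      finally show ?thesis .
    qed
    have diff: "norm (indicator A x *\<^sub>R c - u x *\<^sub>R c) \<le> indicator (U - C) x * norm c" for x
    proof -
      have "\<bar>indicator A x - u x\<bar> \<le> (indicator (U - C) x :: real)"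
        using u01[of x] u(3)[of x] u(4)[of x] U(2) C(2) by (auto simp: indicator_def)
      then show ?thesis unfolding scaleR_diff_left[symmetric] norm_scaleR by (intro mult_right_mono) auto
    qed
    have UCi: "integrable lborel (indicator (U - C) :: real \<Rightarrow> real)"
      using less_trans[OF D ennreal_less_top] by (intro integrable_real_indicator) auto
    have di: "integrable lborel (\<lambda>x. indicator A x *\<^sub>R c - u x *\<^sub>R c)"
      by (rule Bochner_Integration.integrable_bound[of _ "\<lambda>x. indicator (U - C) x * norm c"])
         (use diff UCi in auto)
    have ui: "integrable lborel (\<lambda>x. u x *\<^sub>R c)"
      using Bochner_Integration.integrable_diff[OF gi di] by simp
    show "\<exists>h. integrable lborel h \<and> (AE x in lborel. lebesgue_point h x) \<and> (LINT x|lborel. norm (indicator A x *\<^sub>R c - h x)) < e"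
    proof (intro exI conjI)
      show "integrable lborel (\<lambda>x. u x *\<^sub>R c)" by (rule ui)
      have "isCont (\<lambda>x. u x *\<^sub>R c) x" for x
        using u(1) by (intro continuous_intros) (simp add: continuous_on_eq_continuous_at)
      then show "AE x in lborel. lebesgue_point (\<lambda>x. u x *\<^sub>R c) x"
        by (intro AE_I2 lebesgue_point_continuous ui) auto
      have "(LINT x|lborel. norm (indicator A x *\<^sub>R c - u x *\<^sub>R c)) \<le> (LINT x|lborel. indicator (U - C) x * norm c)"
        using di UCi diff by (intro integral_mono) auto
      also have "\<dots> = measure lborel (U - C) * norm c" by simp
      also have "\<dots> \<le> e / (norm c + 1) * norm c"
        using D e by (intro mult_right_mono) (auto simp: measure_def intro!: enn2real_leI)
      also have "\<dots> < e" using e nc by (simp add: pos_divide_less_eq)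
      finally show "(LINT x|lborel. norm (indicator A x *\<^sub>R c - u x *\<^sub>R c)) < e" .
    qed
  qed
next
  case (add f g)
  from add(2,4) show ?case
  proof eventually_elim
    case (elim x)
    have "((\<lambda>r. (LINT t:cball x r|lborel. norm (f t - f x)) / r + (LINT t:cball x r|lborel. norm (g t - g x)) / r) \<longlongrightarrow> 0 + 0) (at_right 0)"
      using elim unfolding lebesgue_point_def by (rule tendsto_add)
    then have lim: "((\<lambda>r. (LINT t:cball x r|lborel. norm (f t - f x)) / r + (LINT t:cball x r|lborel. norm (g t - g x)) / r) \<longlongrightarrow> 0) (at_right 0)" by simp
    show ?case unfolding lebesgue_point_def
    proof (rule real_tendsto_sandwich[OF _ _ tendsto_const lim])
      show "\<forall>\<^sub>F r in at_right 0. 0 \<le> (LINT t:cball x r|lborel. norm (f t + g t - (f x + g x))) / r"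
        using eventually_at_right_less[of "0::real"]
        by eventually_elim (auto simp: set_lebesgue_integral_def intro!: divide_nonneg_pos integral_nonneg)
      show "\<forall>\<^sub>F r in at_right 0. (LINT t:cball x r|lborel. norm (f t + g t - (f x + g x))) / r \<le>
          (LINT t:cball x r|lborel. norm (f t - f x)) / r + (LINT t:cball x r|lborel. norm (g t - g x)) / r"
        using eventually_at_right_less[of "0::real"]
      proof eventually_elim
        case (elim r)
        have "(LINT t:cball x r|lborel. norm (f t + g t - (f x + g x))) \<le> (LINT t:cball x r|lborel. norm (f t - f x) + norm (g t - g x))"
        proof (rule set_integral_mono)
          show "set_integrable lborel (cball x r) (\<lambda>t. norm (f t - f x) + norm (g t - g x))"
            using add by (intro set_integral_add set_integrable_norm_diff_cball)
          show "set_integrable lborel (cball x r) (\<lambda>t. norm (f t + g t - (f x + g x)))"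
            using add by (intro set_integrable_norm_diff_cball) auto
          fix t show "norm (f t + g t - (f x + g x)) \<le> norm (f t - f x) + norm (g t - g x)"
            by (metis add_diff_add norm_triangle_ineq)
        qed
        also have "\<dots> = (LINT t:cball x r|lborel. norm (f t - f x)) + (LINT t:cball x r|lborel. norm (g t - g x))"
          using add by (intro set_integral_add set_integrable_norm_diff_cball)
        finally show ?case using elim by (simp add: field_simps)
      qed
    qed
  qed
next
  case (lim f s)
  show ?case
  proof (rule lebesgue_points_closed[OF lim(5)])
    fix e :: real assume e: "0 < e"
    have [measurable]: "f \<in> borel_measurable borel" "\<And>i. s i \<in> borel_measurable borel" using lim(1,5) by auto
    have "(\<lambda>i. LINT x|lborel. norm (f x - s i x)) \<longlonglongrightarrow> (LINT x|(lborel::real measure). 0)"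
    proof (rule integral_dominated_convergence[where w="\<lambda>x. 3 * norm (f x)"])
      show "AE x in lborel. (\<lambda>i. norm (f x - s i x)) \<longlonglongrightarrow> 0"
        using lim(3) by (auto intro!: AE_I2 tendsto_eq_intros)
      show "AE x in lborel. norm (norm (f x - s i x)) \<le> 3 * norm (f x)" for i
      proof (rule AE_I2)
        fix x have "norm (f x - s i x) \<le> norm (f x) + norm (s i x)" by (rule norm_triangle_ineq4)
        then show "norm (norm (f x - s i x)) \<le> 3 * norm (f x)" using lim(4)[of x i] by simp
      qed
    qed (use lim(5) in auto)
    then have "eventually (\<lambda>i. (LINT x|lborel. norm (f x - s i x)) < e) sequentially"
      using e by (intro order_tendstoD) auto
    then obtain i where "(LINT x|lborel. norm (f x - s i x)) < e" by (auto simp: eventually_sequentially)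
    then show "\<exists>h. integrable lborel h \<and> (AE x in lborel. lebesgue_point h x) \<and> (LINT x|lborel. norm (f x - h x)) < e"
      using lim(1,2) by blast
  qed
qed

section \<open>Square-integrable functions on the line\<close>

definition sq :: "(real \<Rightarrow> complex) \<Rightarrow> bool" where
  "sq f \<longleftrightarrow> f \<in> borel_measurable borel \<and> integrable lborel (\<lambda>x. (cmod (f x))\<^sup>2)"

definition nrm :: "(real \<Rightarrow> complex) \<Rightarrow> real" where
  "nrm f = sqrt (LINT x|lborel. (cmod (f x))\<^sup>2)"

lemma sq_measurable[measurable_dest]: "sq f \<Longrightarrow> f \<in> borel_measurable borel"
  by (simp add: sq_def)

lemma sq_integrable: "sq f \<Longrightarrow> integrable lborel (\<lambda>x. (cmod (f x))\<^sup>2)"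
  by (simp add: sq_def)

lemma nrm_nonneg[simp]: "0 \<le> nrm f"
  by (simp add: nrm_def)

lemma nrm_sq: "(nrm f)\<^sup>2 = (LINT x|lborel. (cmod (f x))\<^sup>2)"
  by (simp add: nrm_def)

lemma sqI_bound:
  assumes "f \<in> borel_measurable borel" "integrable lborel g" "\<And>x. (cmod (f x))\<^sup>2 \<le> g x"
  shows "sq f"
  unfolding sq_def using assms
  by (auto intro!: Bochner_Integration.integrable_bound[OF assms(2)] AE_I2 simp: abs_of_nonneg)
    (metis abs_ge_self order_trans)

lemma cmod_add_sq_le: "(cmod (a + b))\<^sup>2 \<le> 2 * (cmod a)\<^sup>2 + 2 * (cmod b)\<^sup>2"
proof -
  have "(cmod (a + b))\<^sup>2 \<le> (cmod a + cmod b)\<^sup>2"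
    by (intro power_mono norm_triangle_ineq) auto
  also have "\<dots> \<le> 2 * (cmod a)\<^sup>2 + 2 * (cmod b)\<^sup>2"
    using sum_squares_bound[of "cmod a" "cmod b"] by (simp add: power2_sum)
  finally show ?thesis .
qed

lemma sq_add: "sq f \<Longrightarrow> sq g \<Longrightarrow> sq (\<lambda>x. f x + g x)"
  by (rule sqI_bound[where g="\<lambda>x. 2 * (cmod (f x))\<^sup>2 + 2 * (cmod (g x))\<^sup>2"])
    (auto simp: sq_integrable sq_measurable cmod_add_sq_le)

lemma sq_mult_bounded:
  assumes "sq f" "h \<in> borel_measurable borel" "\<And>x. cmod (h x) \<le> B"
  shows "sq (\<lambda>x. h x * f x)"
proof (rule sqI_bound[where g="\<lambda>x. B\<^sup>2 * (cmod (f x))\<^sup>2"])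
  show "(cmod (h x * f x))\<^sup>2 \<le> B\<^sup>2 * (cmod (f x))\<^sup>2" for x
    unfolding norm_mult power_mult_distrib using assms(3)[of x]
    by (intro mult_right_mono power_mono) auto
qed (use assms in \<open>auto simp: sq_integrable sq_measurable\<close>)

lemma nrm_mult_bounded:
  assumes "sq f" "h \<in> borel_measurable borel" "\<And>x. cmod (h x) \<le> B"
  shows "nrm (\<lambda>x. h x * f x) \<le> B * nrm f"
proof -
  have B: "0 \<le> B" using assms(3)[of 0] norm_ge_zero order_trans by blast
  have "(LINT x|lborel. (cmod (h x * f x))\<^sup>2) \<le> (LINT x|lborel. B\<^sup>2 * (cmod (f x))\<^sup>2)"
  proof (rule integral_mono)
    show "integrable lborel (\<lambda>x. (cmod (h x * f x))\<^sup>2)"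
      using sq_mult_bounded[OF assms] by (rule sq_integrable)
    show "(cmod (h x * f x))\<^sup>2 \<le> B\<^sup>2 * (cmod (f x))\<^sup>2" for x
      unfolding norm_mult power_mult_distrib using assms(3)[of x]
      by (intro mult_right_mono power_mono) auto
  qed (use assms(1) in \<open>auto simp: sq_integrable\<close>)
  then have "nrm (\<lambda>x. h x * f x) \<le> sqrt (B\<^sup>2 * (LINT x|lborel. (cmod (f x))\<^sup>2))"
    unfolding nrm_def by simp
  then show ?thesis using B by (simp add: real_sqrt_mult nrm_def)
qed

lemma sq_scale: "sq f \<Longrightarrow> sq (\<lambda>x. c * f x)"
  by (rule sq_mult_bounded[where B="cmod c"]) auto

lemma nrm_scale: "nrm (\<lambda>x. c * f x) = cmod c * nrm f"
  by (simp add: nrm_def norm_mult power_mult_distrib real_sqrt_mult)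

lemma sq_minus: "sq f \<Longrightarrow> sq (\<lambda>x. - f x)"
  using sq_scale[of f "-1"] by simp

lemma sq_diff: "sq f \<Longrightarrow> sq g \<Longrightarrow> sq (\<lambda>x. f x - g x)"
  using sq_add[of f "\<lambda>x. - g x"] by (simp add: sq_minus)

lemma sq_cnj: "sq f \<Longrightarrow> sq (\<lambda>x. cnj (f x))"
  unfolding sq_def by (auto intro: borel_measurable_continuous_on[OF continuous_on_cnj[OF continuous_on_id]])

lemma nrm_cnj[simp]: "nrm (\<lambda>x. cnj (f x)) = nrm f"
  by (simp add: nrm_def)

lemma nrm_minus_commute: "nrm (\<lambda>x. f x - g x) = nrm (\<lambda>x. g x - f x)"
  by (simp add: nrm_def norm_minus_commute)

lemma sq_zero[simp]: "sq (\<lambda>x. 0)"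
  by (simp add: sq_def)

lemma sq_sum: "(\<And>i. i \<in> I \<Longrightarrow> sq (f i)) \<Longrightarrow> sq (\<lambda>x. \<Sum>i\<in>I. f i x)"
  by (induction I rule: infinite_finite_induct) (auto intro: sq_add)

lemma nrm_cong_AE:
  assumes "AE x in lborel. f x = g x" "f \<in> borel_measurable borel" "g \<in> borel_measurable borel"
  shows "nrm f = nrm g"
  unfolding nrm_def using assms by (intro arg_cong[where f=sqrt] integral_cong_AE) auto

lemma sq_cong_AE:
  assumes "sq f" "AE x in lborel. f x = g x" "g \<in> borel_measurable borel"
  shows "sq g"
  unfolding sq_def
proof
  have [measurable]: "f \<in> borel_measurable borel" "g \<in> borel_measurable borel" using assms by auto
  show "integrable lborel (\<lambda>x. (cmod (g x))\<^sup>2)"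
    using assms by (intro integrable_cong_AE_imp[OF sq_integrable[OF assms(1)]]) auto
qed (use assms in auto)

lemma nrm_eq_0: "sq f \<Longrightarrow> nrm f = 0 \<Longrightarrow> AE x in lborel. f x = 0"
  using integral_nonneg_eq_0_iff_AE[OF sq_integrable, of f] by (simp add: nrm_def)

lemma sq_prod_integrable_norm:
  assumes "sq f" "sq g"
  shows "integrable lborel (\<lambda>x. cmod (f x) * cmod (g x))"
proof (rule Bochner_Integration.integrable_bound)
  show "integrable lborel (\<lambda>x. (cmod (f x))\<^sup>2 + (cmod (g x))\<^sup>2)"
    using assms by (auto simp: sq_integrable)
  have [measurable]: "f \<in> borel_measurable borel" "g \<in> borel_measurable borel" using assms by (auto simp: sq_measurable)
  show "(\<lambda>x. cmod (f x) * cmod (g x)) \<in> borel_measurable lborel" by measurable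
  have "cmod (f x) * cmod (g x) \<le> (cmod (f x))\<^sup>2 + (cmod (g x))\<^sup>2" for x
  proof -
    have "0 \<le> cmod (f x) * cmod (g x)" by simp
    then show ?thesis using sum_squares_bound[of "cmod (f x)" "cmod (g x)"] by linarith
  qed
  then show "AE x in lborel. norm (cmod (f x) * cmod (g x)) \<le> norm ((cmod (f x))\<^sup>2 + (cmod (g x))\<^sup>2)"
    by (intro AE_I2) (simp add: abs_of_nonneg)
qed

lemma sq_prod_integrable:
  assumes "sq f" "sq g"
  shows "integrable lborel (\<lambda>x. f x * g x)"
proof -
  have [measurable]: "f \<in> borel_measurable borel" "g \<in> borel_measurable borel" using assms by (auto simp: sq_measurable)
  show ?thesis
    by (rule Bochner_Integration.integrable_bound[OF sq_prod_integrable_norm[OF assms]])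
      (auto simp: norm_mult)
qed

lemma Cauchy_Schwarz_norm:
  assumes "sq f" "sq g"
  shows "(LINT x|lborel. cmod (f x) * cmod (g x)) \<le> nrm f * nrm g"
proof -
  define a b c where "a = (nrm f)\<^sup>2" "b = (LINT x|lborel. cmod (f x) * cmod (g x))" "c = (nrm g)\<^sup>2"
  note abc = this
  note int = sq_integrable[OF assms(1)] sq_integrable[OF assms(2)] sq_prod_integrable_norm[OF assms]
  have b0: "0 \<le> b" unfolding abc by (intro Bochner_Integration.integral_nonneg) auto
  have "b\<^sup>2 \<le> a * c"
  proof (cases "c = 0")
    case True
    then have "AE x in lborel. g x = 0" using nrm_eq_0[OF assms(2)] by (simp add: abc)
    then have "AE x in lborel. cmod (f x) * cmod (g x) = 0" by eventually_elim auto
    then have "b = 0" unfolding abc by (rule integral_eq_zero_AE)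
    then show ?thesis using True by simp
  next
    case False
    then have c: "0 < c" by (simp add: abc)
    have "0 \<le> (LINT x|lborel. (c * cmod (f x) - b * cmod (g x))\<^sup>2)"
      by (intro Bochner_Integration.integral_nonneg) auto
    also have "\<dots> = (LINT x|lborel. (c\<^sup>2 * (cmod (f x))\<^sup>2 + b\<^sup>2 * (cmod (g x))\<^sup>2) - 2 * c * b * (cmod (f x) * cmod (g x)))"
      by (intro Bochner_Integration.integral_cong) (auto simp: power2_eq_square algebra_simps)
    also have "\<dots> = c\<^sup>2 * a + b\<^sup>2 * c - 2 * c * b * b"
      using int by (simp add: abc nrm_sq)
    also have "\<dots> = c * (a * c - b\<^sup>2)" by (simp add: power2_eq_square algebra_simps)
    finally show ?thesis using c by (simp add: zero_le_mult_iff)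
  qed
  also have "\<dots> = (nrm f * nrm g)\<^sup>2" by (simp add: abc power_mult_distrib)
  finally show ?thesis using abs_le_square_iff[of b "nrm f * nrm g"] b0
    by (auto simp: abc)
qed

lemma Cauchy_Schwarz:
  assumes "sq f" "sq g"
  shows "cmod (LINT x|lborel. f x * g x) \<le> nrm f * nrm g"
proof -
  have "cmod (LINT x|lborel. f x * g x) \<le> (LINT x|lborel. cmod (f x * g x))"
    by (rule integral_norm_bound)
  then show ?thesis using Cauchy_Schwarz_norm[OF assms] by (simp add: norm_mult)
qed

lemma nrm_triangle:
  assumes "sq f" "sq g"
  shows "nrm (\<lambda>x. f x + g x) \<le> nrm f + nrm g"
proof -
  note int = sq_integrable[OF assms(1)] sq_integrable[OF assms(2)] sq_prod_integrable_norm[OF assms]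
  have "(nrm (\<lambda>x. f x + g x))\<^sup>2 \<le> (LINT x|lborel. (cmod (f x))\<^sup>2 + (cmod (g x))\<^sup>2 + 2 * (cmod (f x) * cmod (g x)))"
    unfolding nrm_sq
  proof (rule integral_mono)
    show "(cmod (f x + g x))\<^sup>2 \<le> (cmod (f x))\<^sup>2 + (cmod (g x))\<^sup>2 + 2 * (cmod (f x) * cmod (g x))" for x
      using power_mono[OF norm_triangle_ineq[of "f x" "g x"], of 2] by (simp add: power2_sum)
  qed (use int sq_integrable[OF sq_add[OF assms]] in auto)
  also have "\<dots> = (nrm f)\<^sup>2 + (nrm g)\<^sup>2 + 2 * (LINT x|lborel. cmod (f x) * cmod (g x))"
    using int by (simp add: nrm_sq)
  also have "\<dots> \<le> (nrm f + nrm g)\<^sup>2"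
    using Cauchy_Schwarz_norm[OF assms] by (simp add: power2_sum)
  finally show ?thesis by (rule power2_le_imp_le) simp
qed

lemma nrm_triangle3:
  assumes "sq f" "sq g" "sq h"
  shows "nrm (\<lambda>x. f x - h x) \<le> nrm (\<lambda>x. f x - g x) + nrm (\<lambda>x. g x - h x)"
  using nrm_triangle[OF sq_diff[OF assms(1,2)] sq_diff[OF assms(2,3)]] by simp

lemma nrm_sum:
  assumes "finite I" "\<And>i. i \<in> I \<Longrightarrow> sq (f i)"
  shows "nrm (\<lambda>x. \<Sum>i\<in>I. f i x) \<le> (\<Sum>i\<in>I. nrm (f i))"
  using assms
proof (induction I rule: finite_induct)
  case (insert i I)
  have "nrm (\<lambda>x. f i x + (\<Sum>i\<in>I. f i x)) \<le> nrm (f i) + nrm (\<lambda>x. \<Sum>i\<in>I. f i x)"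
    using insert by (intro nrm_triangle sq_sum) auto
  then show ?case using insert by simp
qed (simp add: nrm_def)

lemma nn_integral_sq: "sq f \<Longrightarrow> (\<integral>\<^sup>+x. ennreal ((cmod (f x))\<^sup>2) \<partial>lborel) = ennreal ((nrm f)\<^sup>2)"
  by (simp add: nrm_sq nn_integral_eq_integral sq_integrable)

lemma sqI_nn_integral:
  assumes "f \<in> borel_measurable borel" "(\<integral>\<^sup>+x. ennreal ((cmod (f x))\<^sup>2) \<partial>lborel) \<le> ennreal (B\<^sup>2)"
  shows "sq f" "nrm f \<le> \<bar>B\<bar>"
proof -
  show "sq f" unfolding sq_def using assms
    by (auto simp: integrable_iff_bounded intro: le_less_trans)
  then have "ennreal ((nrm f)\<^sup>2) \<le> ennreal (B\<^sup>2)" using assms nn_integral_sq by simp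
  then have "(nrm f)\<^sup>2 \<le> B\<^sup>2" by simp
  then show "nrm f \<le> \<bar>B\<bar>" using abs_le_square_iff[of "nrm f" B] by simp
qed

text \<open>Fatou's lemma makes the norm lower semicontinuous under convergence almost everywhere.\<close>

lemma Fatou_sq:
  assumes f: "\<And>n. sq (f n)" and g: "g \<in> borel_measurable borel"
    and lim: "AE x in lborel. (\<lambda>n. f n x) \<longlonglongrightarrow> g x"
    and B: "\<And>n. nrm (f n) \<le> B"
  shows "sq g" "nrm g \<le> B"
proof -
  have B0: "0 \<le> B" using B[of 0] nrm_nonneg order_trans by blast
  have [measurable]: "\<And>n. f n \<in> borel_measurable borel" "g \<in> borel_measurable borel"
    using f g by (auto simp: sq_measurable)
  have "(\<integral>\<^sup>+x. ennreal ((cmod (g x))\<^sup>2) \<partial>lborel) \<le> (\<integral>\<^sup>+x. liminf (\<lambda>n. ennreal ((cmod (f n x))\<^sup>2)) \<partial>lborel)"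
  proof (rule nn_integral_mono_AE)
    show "AE x in lborel. ennreal ((cmod (g x))\<^sup>2) \<le> liminf (\<lambda>n. ennreal ((cmod (f n x))\<^sup>2))"
      using lim
    proof eventually_elim
      case (elim x)
      then have "(\<lambda>n. ennreal ((cmod (f n x))\<^sup>2)) \<longlonglongrightarrow> ennreal ((cmod (g x))\<^sup>2)"
        by (intro tendsto_intros)
      then show ?case using lim_imp_Liminf[OF sequentially_bot] by (metis order_refl)
    qed
  qed
  also have "\<dots> \<le> liminf (\<lambda>n. \<integral>\<^sup>+x. ennreal ((cmod (f n x))\<^sup>2) \<partial>lborel)"
    by (intro nn_integral_liminf) auto
  also have "\<dots> \<le> liminf (\<lambda>n. ennreal (B\<^sup>2))"
    using B f by (intro Liminf_mono always_eventually allI) (auto simp: nn_integral_sq power_mono)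
  also have "\<dots> = ennreal (B\<^sup>2)" by (intro lim_imp_Liminf) auto
  finally have le: "(\<integral>\<^sup>+x. ennreal ((cmod (g x))\<^sup>2) \<partial>lborel) \<le> ennreal (B\<^sup>2)" .
  show "sq g" "nrm g \<le> B" using sqI_nn_integral[OF g le] B0 by auto
qed

text \<open>Completeness: along a subsequence whose increments are summable in norm, the sum of the
  absolute increments is itself square-integrable, hence finite almost everywhere.\<close>

theorem Riesz_Fischer:
  assumes f: "\<And>n. sq (f n)"
    and cauchy: "\<And>e. 0 < e \<Longrightarrow> \<exists>N. \<forall>m\<ge>N. \<forall>n\<ge>N. nrm (\<lambda>x. f m x - f n x) \<le> e"
  obtains g where "sq g" "(\<lambda>n. nrm (\<lambda>x. f n x - g x)) \<longlonglongrightarrow> 0"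
proof -
  obtain N where N: "\<And>e m n. 0 < e \<Longrightarrow> N e \<le> m \<Longrightarrow> N e \<le> n \<Longrightarrow> nrm (\<lambda>x. f m x - f n x) \<le> e"
    using cauchy by metis
  define k where "k = rec_nat (N 1) (\<lambda>i r. max (Suc r) (N ((1/2) ^ Suc i)))"
  have k0: "k 0 = N 1" and kS: "k (Suc i) = max (Suc (k i)) (N ((1/2) ^ Suc i))" for i
    by (simp_all add: k_def)
  have kN: "N ((1/2) ^ i) \<le> k i" for i by (cases i) (auto simp: k0 kS)
  have kmono: "strict_mono k" by (rule strict_monoI_Suc) (simp add: kS)
  define d where "d i x = f (k (Suc i)) x - f (k i) x" for i x
  have dsq: "sq (d i)" for i unfolding d_def[abs_def] using f by (intro sq_diff)
  have dn: "nrm (d i) \<le> (1/2) ^ i" for i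
    unfolding d_def[abs_def] using kN[of i] strict_monoD[OF kmono, of i "Suc i"] by (intro N) auto
  have [measurable]: "\<And>n. f n \<in> borel_measurable borel" "\<And>n. d n \<in> borel_measurable borel"
    using f dsq by (auto simp: sq_measurable)
  define D where "D n x = (\<Sum>i<n. cmod (d i x))" for n x
  have [measurable]: "\<And>n. D n \<in> borel_measurable borel" unfolding D_def by measurable
  have dn_sq: "sq (\<lambda>x. complex_of_real (cmod (d i x)))" for i
    using dsq[of i] by (simp add: sq_def)
  have Dbound: "(\<integral>\<^sup>+x. ennreal ((D n x)\<^sup>2) \<partial>lborel) \<le> ennreal 4" for n
  proof -
    have s: "sq (\<lambda>x. \<Sum>i<n. complex_of_real (cmod (d i x)))" by (intro sq_sum dn_sq)
    have "nrm (\<lambda>x. \<Sum>i<n. complex_of_real (cmod (d i x))) \<le> (\<Sum>i<n. nrm (\<lambda>x. complex_of_real (cmod (d i x))))"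
      by (intro nrm_sum dn_sq) auto
    also have "\<dots> = (\<Sum>i<n. nrm (d i))" by (simp add: nrm_def)
    also have "\<dots> \<le> (\<Sum>i<n. (1/2) ^ i)" by (intro sum_mono dn)
    also have "\<dots> \<le> 2" by (simp add: sum_gp_strict)
    finally have "(nrm (\<lambda>x. \<Sum>i<n. complex_of_real (cmod (d i x))))\<^sup>2 \<le> 4" using power_mono[of _ 2 2] by fastforce
    moreover have "(\<integral>\<^sup>+x. ennreal ((D n x)\<^sup>2) \<partial>lborel) = ennreal ((nrm (\<lambda>x. \<Sum>i<n. complex_of_real (cmod (d i x))))\<^sup>2)"
      using nn_integral_sq[OF s] by (simp add: D_def norm_of_real sum_nonneg flip: of_real_sum)
    ultimately show ?thesis using ennreal_leI by metis
  qed
  have "(\<integral>\<^sup>+x. (SUP n. ennreal ((D n x)\<^sup>2)) \<partial>lborel) = (SUP n. \<integral>\<^sup>+x. ennreal ((D n x)\<^sup>2) \<partial>lborel)"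
  proof (rule nn_integral_monotone_convergence_SUP)
    show "incseq (\<lambda>n x. ennreal ((D n x)\<^sup>2))"
      by (intro incseq_SucI le_funI ennreal_leI power_mono) (auto simp: D_def sum_nonneg)
  qed auto
  also have "\<dots> \<le> ennreal 4" using Dbound by (intro SUP_least)
  also have "\<dots> < \<infinity>" by simp
  finally have "(\<integral>\<^sup>+x. (SUP n. ennreal ((D n x)\<^sup>2)) \<partial>lborel) \<noteq> \<infinity>" by simp
  then have "AE x in lborel. (SUP n. ennreal ((D n x)\<^sup>2)) \<noteq> \<infinity>"
    by (intro nn_integral_PInf_AE) auto
  then have conv: "AE x in lborel. convergent (\<lambda>i. f (k i) x)"
  proof eventually_elim
    case (elim x)
    obtain c where c: "(SUP n. ennreal ((D n x)\<^sup>2)) = ennreal c" "0 \<le> c"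
      using elim by (cases "SUP n. ennreal ((D n x)\<^sup>2)") auto
    have "(\<Sum>i<n. cmod (d i x)) \<le> sqrt c" for n
    proof -
      have "ennreal ((D n x)\<^sup>2) \<le> ennreal c" unfolding c(1)[symmetric] by (rule SUP_upper) simp
      then have "(D n x)\<^sup>2 \<le> c" using c(2) by simp
      then show ?thesis unfolding D_def by (rule real_le_rsqrt)
    qed
    then have "summable (\<lambda>i. cmod (d i x))"
      by (intro summableI_nonneg_bounded[where x="sqrt c"]) auto
    then have "summable (\<lambda>i. d i x)" by (rule summable_norm_cancel)
    then have "convergent (\<lambda>n. \<Sum>i<n. d i x)" by (simp add: summable_iff_convergent)
    moreover have "(\<Sum>i<n. d i x) = f (k n) x - f (k 0) x" for n
      unfolding d_def by (rule sum_lessThan_telescope)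
    ultimately have "convergent (\<lambda>n. f (k n) x - f (k 0) x)" by simp
    then show ?case using convergent_diff_const_right_iff by blast
  qed
  define g where "g x = lim (\<lambda>i. f (k i) x)" for x
  have gm[measurable]: "g \<in> borel_measurable borel"
    unfolding g_def by (rule borel_measurable_lim_metric) auto
  have lim: "AE x in lborel. (\<lambda>i. f (k i) x) \<longlonglongrightarrow> g x"
    using conv by eventually_elim (simp add: g_def convergent_LIMSEQ_iff)
  have tail: "sq (\<lambda>x. g x - f n x)" "nrm (\<lambda>x. f n x - g x) \<le> e" if "0 < e" "N e \<le> n" for n e
  proof -
    have a: "sq (\<lambda>x. f (k (N e + i)) x - f n x)" for i using f by (intro sq_diff)
    have l: "AE x in lborel. (\<lambda>i. f (k (N e + i)) x - f n x) \<longlonglongrightarrow> g x - f n x"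
      using lim
    proof eventually_elim
      case (elim x)
      then have "(\<lambda>i. f (k (N e + i)) x) \<longlonglongrightarrow> g x"
        using LIMSEQ_ignore_initial_segment[of _ _ "N e"] by (simp add: add.commute)
      then show ?case by (intro tendsto_intros)
    qed
    have b: "nrm (\<lambda>x. f (k (N e + i)) x - f n x) \<le> e" for i
      using strict_mono_imp_increasing[OF kmono, of "N e + i"] that by (intro N) auto
    show "sq (\<lambda>x. g x - f n x)" using Fatou_sq(1)[OF a _ l b] by simp
    show "nrm (\<lambda>x. f n x - g x) \<le> e" using Fatou_sq(2)[OF a _ l b] by (simp add: nrm_minus_commute)
  qed
  show thesis
  proof
    show "sq g" using sq_add[OF tail(1)[of 1 "N 1"] f[of "N 1"]] by simp
    show "(\<lambda>n. nrm (\<lambda>x. f n x - g x)) \<longlonglongrightarrow> 0"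
    proof (rule LIMSEQ_I)
      fix r :: real assume "0 < r"
      then show "\<exists>no. \<forall>n\<ge>no. norm (nrm (\<lambda>x. f n x - g x) - 0) < r"
        using tail(2)[of "r/2"] by (intro exI[of _ "N (r/2)"]) force
    qed
  qed
qed

text \<open>For functions with bounded norms, convergence almost everywhere becomes convergence in norm
  as soon as no norm is lost in the limit; this is Fatou's lemma for
  \<open>2 |f\<^sub>n|\<^sup>2 + 2 |g|\<^sup>2 - |f\<^sub>n - g|\<^sup>2\<close>.\<close>

lemma AE_convergence_imp_nrm_convergence:
  assumes f: "\<And>n. sq (f n)" and g: "sq g"
    and lim: "AE x in lborel. (\<lambda>n. f n x) \<longlonglongrightarrow> g x"
    and le: "\<And>n. nrm (f n) \<le> nrm g"
  shows "(\<lambda>n. nrm (\<lambda>x. f n x - g x)) \<longlonglongrightarrow> 0"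
proof -
  have [measurable]: "\<And>n. f n \<in> borel_measurable borel" "g \<in> borel_measurable borel"
    using f g by (auto simp: sq_measurable)
  define h where "h n x = 2 * (cmod (f n x))\<^sup>2 + 2 * (cmod (g x))\<^sup>2 - (cmod (f n x - g x))\<^sup>2" for n x
  have h0: "0 \<le> h n x" for n x
    using cmod_add_sq_le[of "f n x" "- g x"] by (simp add: h_def)
  have hi: "integrable lborel (h n)" for n unfolding h_def[abs_def]
    using sq_integrable[OF f] sq_integrable[OF g] sq_integrable[OF sq_diff[OF f g]] by auto
  have hint: "(LINT x|lborel. h n x) \<le> 4 * (nrm g)\<^sup>2 - (nrm (\<lambda>x. f n x - g x))\<^sup>2" for n
  proof -
    have "(LINT x|lborel. h n x) = 2 * (nrm (f n))\<^sup>2 + 2 * (nrm g)\<^sup>2 - (nrm (\<lambda>x. f n x - g x))\<^sup>2"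
      unfolding h_def[abs_def] using sq_integrable[OF f] sq_integrable[OF g] sq_integrable[OF sq_diff[OF f g]]
      by (simp add: nrm_sq)
    moreover have "(nrm (f n))\<^sup>2 \<le> (nrm g)\<^sup>2" using le by (intro power_mono) auto
    ultimately show ?thesis by simp
  qed
  have "ennreal (4 * (nrm g)\<^sup>2) = (\<integral>\<^sup>+x. ennreal (4 * (cmod (g x))\<^sup>2) \<partial>lborel)"
    using sq_integrable[OF g] by (subst nn_integral_eq_integral) (auto simp: nrm_sq)
  also have "\<dots> \<le> (\<integral>\<^sup>+x. liminf (\<lambda>n. ennreal (h n x)) \<partial>lborel)"
  proof (rule nn_integral_mono_AE)
    show "AE x in lborel. ennreal (4 * (cmod (g x))\<^sup>2) \<le> liminf (\<lambda>n. ennreal (h n x))"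
      using lim
    proof eventually_elim
      case (elim x)
      have "(\<lambda>n. h n x) \<longlonglongrightarrow> 2 * (cmod (g x))\<^sup>2 + 2 * (cmod (g x))\<^sup>2 - (cmod (g x - g x))\<^sup>2"
        unfolding h_def using elim by (intro tendsto_intros)
      then have "(\<lambda>n. ennreal (h n x)) \<longlonglongrightarrow> ennreal (4 * (cmod (g x))\<^sup>2)"
        by (intro tendsto_ennrealI) simp
      then show ?case by (simp add: lim_imp_Liminf)
    qed
  qed
  also have "\<dots> \<le> liminf (\<lambda>n. \<integral>\<^sup>+x. ennreal (h n x) \<partial>lborel)"
    unfolding h_def by (intro nn_integral_liminf) auto
  also have "\<dots> \<le> liminf (\<lambda>n. ennreal (4 * (nrm g)\<^sup>2 - (nrm (\<lambda>x. f n x - g x))\<^sup>2))"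
  proof (intro Liminf_mono always_eventually allI)
    fix n
    have "(\<integral>\<^sup>+x. ennreal (h n x) \<partial>lborel) = ennreal (LINT x|lborel. h n x)"
      using h0 by (intro nn_integral_eq_integral hi) auto
    then show "(\<integral>\<^sup>+x. ennreal (h n x) \<partial>lborel) \<le> ennreal (4 * (nrm g)\<^sup>2 - (nrm (\<lambda>x. f n x - g x))\<^sup>2)"
      using hint[of n] by (simp add: ennreal_leI)
  qed
  finally have main: "ennreal (4 * (nrm g)\<^sup>2) \<le> liminf (\<lambda>n. ennreal (4 * (nrm g)\<^sup>2 - (nrm (\<lambda>x. f n x - g x))\<^sup>2))" .
  have "(\<lambda>n. (nrm (\<lambda>x. f n x - g x))\<^sup>2) \<longlonglongrightarrow> 0"
  proof (rule LIMSEQ_I)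
    fix r :: real assume r: "0 < r"
    have nn: "0 \<le> 4 * (nrm g)\<^sup>2 - (nrm (\<lambda>x. f n x - g x))\<^sup>2" for n
      using hint[of n] Bochner_Integration.integral_nonneg[of lborel "h n"] h0 by (meson order_trans)
    have "\<forall>\<^sub>F n in sequentially. 4 * (nrm g)\<^sup>2 - r < 4 * (nrm g)\<^sup>2 - (nrm (\<lambda>x. f n x - g x))\<^sup>2"
    proof (cases "4 * (nrm g)\<^sup>2 - r < 0")
      case True
      show ?thesis
      proof (intro always_eventually allI)
        fix n show "4 * (nrm g)\<^sup>2 - r < 4 * (nrm g)\<^sup>2 - (nrm (\<lambda>x. f n x - g x))\<^sup>2"
          using True nn[of n] by linarith
      qed
    next
      case False
      then have "ennreal (4 * (nrm g)\<^sup>2 - r) < ennreal (4 * (nrm g)\<^sup>2)"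
        using r by (subst ennreal_less_iff) auto
      then have "ennreal (4 * (nrm g)\<^sup>2 - r) < liminf (\<lambda>n. ennreal (4 * (nrm g)\<^sup>2 - (nrm (\<lambda>x. f n x - g x))\<^sup>2))"
        using main by (rule less_le_trans)
      then have "\<forall>\<^sub>F n in sequentially. ennreal (4 * (nrm g)\<^sup>2 - r) < ennreal (4 * (nrm g)\<^sup>2 - (nrm (\<lambda>x. f n x - g x))\<^sup>2)"
        by (rule less_LiminfD)
      then show ?thesis by (rule eventually_mono) (use False in \<open>auto simp: ennreal_less_iff\<close>)
    qed
    then show "\<exists>no. \<forall>n\<ge>no. norm ((nrm (\<lambda>x. f n x - g x))\<^sup>2 - 0) < r"
      by (auto simp: eventually_sequentially)
  qed
  then have "(\<lambda>n. sqrt ((nrm (\<lambda>x. f n x - g x))\<^sup>2)) \<longlonglongrightarrow> sqrt 0" by (rule tendsto_real_sqrt)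
  then show ?thesis by simp
qed

text \<open>Jensen's inequality for the square, with respect to the measure with density \<open>w\<close>.\<close>

lemma weighted_Cauchy_Schwarz:
  fixes w :: "real \<Rightarrow> real" and f :: "real \<Rightarrow> complex"
  assumes "\<And>x. 0 \<le> w x" "integrable lborel w" "integrable lborel (\<lambda>x. w x * (cmod (f x))\<^sup>2)"
    and fm[measurable]: "f \<in> borel_measurable borel"
  shows "integrable lborel (\<lambda>x. w x * f x)"
    and "(cmod (LINT x|lborel. w x * f x))\<^sup>2 \<le> (LINT x|lborel. w x) * (LINT x|lborel. w x * (cmod (f x))\<^sup>2)"
proof -
  define p where "p x = complex_of_real (sqrt (w x))" for x
  define q where "q x = complex_of_real (sqrt (w x)) * f x" for x
  have [measurable]: "w \<in> borel_measurable borel" using assms(2) by auto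
  have p: "(cmod (p x))\<^sup>2 = w x" and q: "(cmod (q x))\<^sup>2 = w x * (cmod (f x))\<^sup>2" for x
    using assms(1)[of x] by (auto simp: p_def q_def norm_mult power_mult_distrib)
  have sp: "sq p" "sq q" using assms unfolding sq_def p q by (auto simp: p_def[abs_def] q_def[abs_def])
  have pq: "p x * q x = w x * f x" for x
    using assms(1)[of x] by (simp add: p_def q_def mult.assoc[symmetric] flip: of_real_mult)
  show "integrable lborel (\<lambda>x. w x * f x)" using sq_prod_integrable[OF sp] by (simp add: pq)
  have "cmod (LINT x|lborel. w x * f x) \<le> nrm p * nrm q" using Cauchy_Schwarz[OF sp] by (simp add: pq)
  then have "(cmod (LINT x|lborel. w x * f x))\<^sup>2 \<le> (nrm p * nrm q)\<^sup>2" by (intro power_mono) auto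
  also have "\<dots> = (LINT x|lborel. w x) * (LINT x|lborel. w x * (cmod (f x))\<^sup>2)"
    by (simp add: power_mult_distrib nrm_sq p q)
  finally show "(cmod (LINT x|lborel. w x * f x))\<^sup>2 \<le> (LINT x|lborel. w x) * (LINT x|lborel. w x * (cmod (f x))\<^sup>2)" .
qed

section \<open>Cauchy and Poisson integrals of square-integrable functions\<close>

lemma LINT_FTC_real_line:
  fixes f F :: "real \<Rightarrow> complex"
  assumes "\<And>x. (F has_vector_derivative f x) (at x)" "\<And>x. isCont f x" "integrable lborel f"
    and "(F \<longlongrightarrow> A) at_bot" "(F \<longlongrightarrow> B) at_top"
  shows "(LINT x|lborel. f x) = B - A"
proof -
  have "(LBINT x=-\<infinity>..\<infinity>. f x) = B - A"
  proof (rule interval_integral_FTC_integrable)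
    show "((F \<circ> real_of_ereal) \<longlongrightarrow> A) (at_right (-\<infinity>))" "((F \<circ> real_of_ereal) \<longlongrightarrow> B) (at_left \<infinity>)"
      using assms(4,5) by (simp_all add: ereal_tendsto_simps)
    show "set_integrable lborel (einterval (-\<infinity>) \<infinity>) f"
      using assms(3) by (simp add: set_integrable_def)
  qed (use assms in auto)
  then show ?thesis by (simp add: interval_lebesgue_integral_def set_lebesgue_integral_def)
qed

text \<open>A branch of \<open>log (u - z)\<close>, up to a constant; written with \<open>arctan\<close> it is smooth on the whole line whichever half
  plane contains \<open>z\<close>.\<close>

definition cauchy_log :: "complex \<Rightarrow> real \<Rightarrow> complex" where
  "cauchy_log z u = of_real (ln ((u - Re z)\<^sup>2 + (Im z)\<^sup>2) / 2) + \<i> * of_real (arctan ((u - Re z) / Im z))"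

lemma cauchy_log_deriv:
  assumes "Im z \<noteq> 0"
  shows "(cauchy_log z has_vector_derivative 1 / (of_real u - z)) (at u)"
proof -
  define p q where "p = Re z" "q = Im z"
  have q: "q \<noteq> 0" using assms by (simp add: p_q_def)
  define D where "D = (u - p)\<^sup>2 + q\<^sup>2"
  have D: "0 < D" using q unfolding D_def by (simp add: add_nonneg_pos)
  have 1: "((\<lambda>u. ln ((u - p)\<^sup>2 + q\<^sup>2) / 2) has_vector_derivative (u - p) / D) (at u)"
  proof -
    have d: "((\<lambda>u. (u - p)\<^sup>2 + q\<^sup>2) has_real_derivative 2 * (u - p)) (at u)"
      by (auto intro!: derivative_eq_intros)
    have "((\<lambda>u. ln ((u - p)\<^sup>2 + q\<^sup>2) / 2) has_real_derivative (1 / ((u - p)\<^sup>2 + q\<^sup>2) * (2 * (u - p))) / 2) (at u)"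
      using D unfolding D_def by (intro DERIV_cdivide DERIV_chain2[OF DERIV_ln_divide d])
    also have "1 / ((u - p)\<^sup>2 + q\<^sup>2) * (2 * (u - p)) / 2 = (u - p) / D"
    proof -
      have "1 / E * (2 * w) / 2 = w / E" for E w :: real by simp
      then show ?thesis unfolding D_def .
    qed
    finally show ?thesis by (simp only: has_real_derivative_iff_has_vector_derivative)
  qed
  have 2: "((\<lambda>u. arctan ((u - p) / q)) has_vector_derivative q / D) (at u)"
    unfolding has_real_derivative_iff_has_vector_derivative[symmetric]
  proof -
    have "((\<lambda>u. arctan ((u - p) / q)) has_real_derivative (inverse (1 + ((u - p) / q)\<^sup>2) * (1 / q))) (at u)"
      using q by (auto intro!: derivative_eq_intros)
    moreover have "inverse (1 + ((u - p) / q)\<^sup>2) * (1 / q) = q / D"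
    proof -
      have "1 + ((u - p) / q)\<^sup>2 = D / q\<^sup>2" using q by (simp add: D_def field_simps)
      then show ?thesis using q D by (simp add: power2_eq_square)
    qed
    ultimately show "((\<lambda>u. arctan ((u - p) / q)) has_real_derivative q / D) (at u)" by simp
  qed
  have "(cauchy_log z has_vector_derivative of_real ((u - p) / D) + \<i> * of_real (q / D)) (at u)"
    unfolding cauchy_log_def[abs_def] p_q_def[symmetric]
    by (intro has_vector_derivative_add has_vector_derivative_mult_right has_vector_derivative_of_real
        1[unfolded has_real_derivative_iff_has_vector_derivative[symmetric]]
        2[unfolded has_real_derivative_iff_has_vector_derivative[symmetric]])
  moreover have "of_real ((u - p) / D) + \<i> * of_real (q / D) = 1 / (of_real u - z)"
  proof -
    have nz: "of_real u - z \<noteq> 0" using assms by (auto simp: complex_eq_iff)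
    have inv: "1 / w = cnj w / (w * cnj w)" if "w \<noteq> 0" for w :: complex using that by simp
    have "1 / (of_real u - z) = cnj (of_real u - z) / ((of_real u - z) * cnj (of_real u - z))" by (rule inv[OF nz])
    also have "\<dots> = cnj (of_real u - z) / of_real ((cmod (of_real u - z))\<^sup>2)"
      by (simp only: complex_norm_square)
    also have "(cmod (of_real u - z))\<^sup>2 = D" by (simp add: cmod_power2 D_def p_q_def)
    also have "cnj (of_real u - z) = of_real (u - p) + \<i> * of_real q" by (simp add: complex_eq_iff p_q_def)
    finally show ?thesis by (simp add: add_divide_distrib)
  qed
  ultimately show ?thesis by simp
qed

lemma of_real_minus_nonzero: "Im z \<noteq> 0 \<Longrightarrow> complex_of_real u - z \<noteq> 0"
  by (auto simp: complex_eq_iff)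

lemma cmod_kernel_ge: "\<bar>Im z\<bar> \<le> cmod (complex_of_real u - z)"
  using abs_Im_le_cmod[of "complex_of_real u - z"] by simp

lemma sq_kernel:
  assumes "Im z \<noteq> 0"
  shows "sq (\<lambda>t. 1 / (of_real t - z))"
proof (rule sqI_bound[where g="\<lambda>t. (2 + (1 + 2 * (Re z)\<^sup>2) / (Im z)\<^sup>2) * inverse (1 + t\<^sup>2)"])
  show "integrable lborel (\<lambda>t. (2 + (1 + 2 * (Re z)\<^sup>2) / (Im z)\<^sup>2) * inverse (1 + t\<^sup>2))"
    using integrable_inverse_1_plus_square by (simp add: set_integrable_def)
  fix t
  define p q where "p = Re z" "q = Im z"
  have q: "q \<noteq> 0" using assms by (simp add: p_q_def)
  have D: "0 < (t - p)\<^sup>2 + q\<^sup>2" using q by (simp add: add_nonneg_pos)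
  have T: "0 < 1 + t\<^sup>2" by (simp add: add_pos_nonneg)
  have "t\<^sup>2 \<le> 2 * (t - p)\<^sup>2 + 2 * p\<^sup>2" using sum_squares_bound[of "t - p" p] by (simp add: power2_eq_square algebra_simps)
  then have "1 + t\<^sup>2 \<le> 2 * (t - p)\<^sup>2 + (1 + 2 * p\<^sup>2)" by simp
  also have "\<dots> = 2 * (t - p)\<^sup>2 + (1 + 2 * p\<^sup>2) / q\<^sup>2 * q\<^sup>2" using q by simp
  also have "\<dots> \<le> (2 + (1 + 2 * p\<^sup>2) / q\<^sup>2) * ((t - p)\<^sup>2 + q\<^sup>2)"
    by (simp add: distrib_left distrib_right add_nonneg_nonneg)
  finally have "1 / ((t - p)\<^sup>2 + q\<^sup>2) \<le> (2 + (1 + 2 * p\<^sup>2) / q\<^sup>2) * inverse (1 + t\<^sup>2)"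
    using D T by (simp add: divide_simps mult.commute)
  then show "(cmod (1 / (complex_of_real t - z)))\<^sup>2 \<le> (2 + (1 + 2 * (Re z)\<^sup>2) / (Im z)\<^sup>2) * inverse (1 + t\<^sup>2)"
    by (simp add: norm_divide power_divide cmod_power2 p_q_def)
qed simp

lemma cauchy_log_diff_limits:
  assumes "Im a \<noteq> 0" "Im b \<noteq> 0"
  shows "((\<lambda>u. cauchy_log a u - cauchy_log b u) \<longlongrightarrow> \<i> * of_real (pi / 2 * (sgn (Im a) - sgn (Im b)))) at_top"
    and "((\<lambda>u. cauchy_log a u - cauchy_log b u) \<longlongrightarrow> - \<i> * of_real (pi / 2 * (sgn (Im a) - sgn (Im b)))) at_bot"
proof -
  have l0: "((\<lambda>u. ln ((u - p)\<^sup>2 + q\<^sup>2) - ln (u\<^sup>2)) \<longlongrightarrow> 0) at_top" if "q \<noteq> 0" for p q :: real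
  proof -
    have d: "((\<lambda>u. c / u) \<longlongrightarrow> 0) at_top" for c :: real
      by (intro tendsto_divide_0[OF tendsto_const] filterlim_at_top_imp_at_infinity filterlim_ident)
    have "((\<lambda>u. ln ((1 - p / u)\<^sup>2 + (q / u)\<^sup>2)) \<longlongrightarrow> ln ((1 - 0)\<^sup>2 + 0\<^sup>2)) at_top"
      by (intro tendsto_intros d) auto
    then have "((\<lambda>u. ln ((1 - p / u)\<^sup>2 + (q / u)\<^sup>2)) \<longlongrightarrow> 0) at_top" by simp
    moreover have "\<forall>\<^sub>F u in at_top. ln ((1 - p / u)\<^sup>2 + (q / u)\<^sup>2) = ln ((u - p)\<^sup>2 + q\<^sup>2) - ln (u\<^sup>2)"
      using eventually_gt_at_top[of 0]
    proof eventually_elim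
      case (elim u)
      have pos: "0 < (u - p)\<^sup>2 + q\<^sup>2" using that by (simp add: add_nonneg_pos)
      have "(1 - p / u)\<^sup>2 + (q / u)\<^sup>2 = ((u - p)\<^sup>2 + q\<^sup>2) / u\<^sup>2"
        using elim by (simp add: add_divide_distrib diff_divide_distrib flip: power_divide)
      then show ?case using pos elim ln_divide_pos[of "(u - p)\<^sup>2 + q\<^sup>2" "u\<^sup>2"] by simp
    qed
    ultimately show ?thesis by (rule Lim_transform_eventually)
  qed
  have l: "((\<lambda>u. ln ((u - p)\<^sup>2 + q\<^sup>2) / 2 - ln ((u - p')\<^sup>2 + q'\<^sup>2) / 2) \<longlongrightarrow> 0) at_top" if "q \<noteq> 0" "q' \<noteq> 0" for p q p' q' :: real
  proof -
    have "((\<lambda>u. ((ln ((u - p)\<^sup>2 + q\<^sup>2) - ln (u\<^sup>2)) - (ln ((u - p')\<^sup>2 + q'\<^sup>2) - ln (u\<^sup>2))) / 2) \<longlongrightarrow> (0 - 0) / 2) at_top"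
      using that by (intro tendsto_intros l0) auto
    then show ?thesis by (simp add: diff_divide_distrib)
  qed
  have l': "((\<lambda>u. ln ((u - p)\<^sup>2 + q\<^sup>2) / 2 - ln ((u - p')\<^sup>2 + q'\<^sup>2) / 2) \<longlongrightarrow> 0) at_bot" if "q \<noteq> 0" "q' \<noteq> 0" for p q p' q' :: real
  proof -
    have "(- u - p)\<^sup>2 = (u - - p)\<^sup>2" for u p :: real by (simp add: power2_eq_square algebra_simps)
    then show ?thesis unfolding filterlim_at_bot_mirror using l[OF that, of "-p" "-p'"] by simp
  qed
  have apos: "((\<lambda>u. arctan ((u - p) / q)) \<longlongrightarrow> pi / 2) at_top" if "0 < q" for p q :: real
  proof -
    have "filterlim (\<lambda>u. - p + u) at_top at_top"
      by (intro filterlim_tendsto_add_at_top[OF tendsto_const] filterlim_ident)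
    then have "filterlim (\<lambda>u. 1 / q * (- p + u)) at_top at_top"
      using that by (intro filterlim_tendsto_pos_mult_at_top[OF tendsto_const]) auto
    then have "((\<lambda>u. arctan (1 / q * (- p + u))) \<longlongrightarrow> pi / 2) at_top"
      by (rule filterlim_compose[OF tendsto_arctan_at_top])
    then show ?thesis by (simp add: diff_divide_distrib add.commute)
  qed
  have a: "((\<lambda>u. arctan ((u - p) / q)) \<longlongrightarrow> pi / 2 * sgn q) at_top" if "q \<noteq> 0" for p q :: real
  proof (cases "0 < q")
    case True
    then show ?thesis using apos by simp
  next
    case False
    have "((\<lambda>u. - arctan ((u - p) / - q)) \<longlongrightarrow> - (pi / 2)) at_top"
      using False that by (intro tendsto_minus apos) simp
    then show ?thesis using False that by (simp add: arctan_minus)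
  qed
  have a': "((\<lambda>u. arctan ((u - p) / q)) \<longlongrightarrow> - (pi / 2 * sgn q)) at_bot" if "q \<noteq> 0" for p q :: real
  proof -
    have "(- u - p) / q = - ((u - - p) / q)" for u by (simp add: minus_divide_left)
    then have "arctan ((- u - p) / q) = - arctan ((u - - p) / q)" for u by (metis arctan_minus)
    then show ?thesis unfolding filterlim_at_bot_mirror using tendsto_minus[OF a[OF that, of "-p"]] by simp
  qed
  have eq: "cauchy_log a u - cauchy_log b u = of_real (ln ((u - Re a)\<^sup>2 + (Im a)\<^sup>2) / 2 - ln ((u - Re b)\<^sup>2 + (Im b)\<^sup>2) / 2)
     + \<i> * of_real (arctan ((u - Re a) / Im a) - arctan ((u - Re b) / Im b))" for u
    by (simp add: cauchy_log_def algebra_simps)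
  show "((\<lambda>u. cauchy_log a u - cauchy_log b u) \<longlongrightarrow> \<i> * of_real (pi / 2 * (sgn (Im a) - sgn (Im b)))) at_top"
  proof -
    have "((\<lambda>u. cauchy_log a u - cauchy_log b u) \<longlongrightarrow> of_real 0 + \<i> * of_real (pi / 2 * sgn (Im a) - pi / 2 * sgn (Im b))) at_top"
      unfolding eq using assms by (intro tendsto_intros l a) auto
    then show ?thesis by (simp only: right_diff_distrib of_real_0 add_0_left)
  qed
  show "((\<lambda>u. cauchy_log a u - cauchy_log b u) \<longlongrightarrow> - \<i> * of_real (pi / 2 * (sgn (Im a) - sgn (Im b)))) at_bot"
  proof -
    have "((\<lambda>u. cauchy_log a u - cauchy_log b u) \<longlongrightarrow> of_real 0 + \<i> * of_real (- (pi / 2 * sgn (Im a)) - (- (pi / 2 * sgn (Im b))))) at_bot"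
      unfolding eq using assms by (intro tendsto_intros l' a') auto
    moreover have "of_real 0 + \<i> * of_real (- (pi / 2 * sgn (Im a)) - (- (pi / 2 * sgn (Im b)))) = - \<i> * of_real (pi / 2 * (sgn (Im a) - sgn (Im b)))"
      by (simp add: algebra_simps)
    ultimately show ?thesis by metis
  qed
qed

lemma filterlim_abs_minus_const:
  "filterlim (\<lambda>u. \<bar>u\<bar> - c) at_top at_top" "filterlim (\<lambda>u. \<bar>u\<bar> - c) at_top at_bot" for c :: real
proof -
  have "filterlim (\<lambda>u::real. - c + \<bar>u\<bar>) at_top at_top"
    by (intro filterlim_tendsto_add_at_top[OF tendsto_const] filterlim_abs_real)
  then show 1: "filterlim (\<lambda>u. \<bar>u\<bar> - c) at_top at_top" by simp
  show "filterlim (\<lambda>u. \<bar>u\<bar> - c) at_top at_bot" unfolding filterlim_at_bot_mirror using 1 by simp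
qed

text \<open>The residue theorem for two simple poles, by explicit primitives. That the integral vanishes for poles on the same
  side is what makes boundary values from the two half planes orthogonal; its value for poles on opposite sides is the
  semigroup law of the Poisson and conjugate Poisson kernels.\<close>

lemma integral_kernel_product:
  assumes "Im a \<noteq> 0" "Im b \<noteq> 0"
  shows "(LINT u|lborel. 1 / (of_real u - a) * (1 / (of_real u - b))) =
     \<i> * of_real (pi * (sgn (Im a) - sgn (Im b))) / (a - b)"
proof (cases "a = b")
  case True
  have "(LINT u|lborel. 1 / (of_real u - a) * (1 / (of_real u - a))) = 0 - 0"
  proof (rule LINT_FTC_real_line)
    fix u
    show "((\<lambda>u. - (1 / (of_real u - a))) has_vector_derivative 1 / (of_real u - a) * (1 / (of_real u - a))) (at u)"
      using of_real_minus_nonzero[OF assms(1), of u]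
      by (auto intro!: derivative_eq_intros has_vector_derivative_real_field simp: field_simps power2_eq_square)
    show "isCont (\<lambda>u. 1 / (of_real u - a) * (1 / (of_real u - a))) u"
      using of_real_minus_nonzero[OF assms(1), of u] by (intro continuous_intros) auto
    show "integrable lborel (\<lambda>u. 1 / (of_real u - a) * (1 / (of_real u - a)))"
      by (intro sq_prod_integrable sq_kernel assms)
    have ge: "\<bar>u\<bar> - cmod a \<le> cmod (complex_of_real u - a)" for u
      using norm_triangle_ineq2[of "complex_of_real u" a] by simp
    have "filterlim (\<lambda>u. complex_of_real u - a) at_infinity at_top"
      unfolding filterlim_at_infinity_conv_norm_at_top
      by (rule filterlim_at_top_mono[OF _ always_eventually[OF allI[OF ge]]])
        (simp add: filterlim_abs_minus_const)
    then show "((\<lambda>u. - (1 / (of_real u - a))) \<longlongrightarrow> 0) at_top"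
      using tendsto_divide_0[OF tendsto_const[of "-1"]] by force
    have "filterlim (\<lambda>u. complex_of_real u - a) at_infinity at_bot"
      unfolding filterlim_at_infinity_conv_norm_at_top
      by (rule filterlim_at_top_mono[OF _ always_eventually[OF allI[OF ge]]])
        (simp add: filterlim_abs_minus_const)
    then show "((\<lambda>u. - (1 / (of_real u - a))) \<longlongrightarrow> 0) at_bot"
      using tendsto_divide_0[OF tendsto_const[of "-1"]] by force
  qed
  then show ?thesis using True by simp
next
  case False
  let ?s = "of_real (pi / 2 * (sgn (Im a) - sgn (Im b)))"
  have "(LINT u|lborel. 1 / (of_real u - a) * (1 / (of_real u - b))) = (\<i> * ?s) / (a - b) - (- \<i> * ?s) / (a - b)"
  proof (rule LINT_FTC_real_line)
    fix u
    have nz: "of_real u - a \<noteq> 0" "of_real u - b \<noteq> 0" "a - b \<noteq> 0"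
      using of_real_minus_nonzero[OF assms(1), of u] of_real_minus_nonzero[OF assms(2), of u] False by auto
    have "((\<lambda>u. (cauchy_log a u - cauchy_log b u) / (a - b)) has_vector_derivative
       (1 / (of_real u - a) - 1 / (of_real u - b)) / (a - b)) (at u)"
      by (intro has_vector_derivative_divide has_vector_derivative_diff cauchy_log_deriv assms)
    moreover have "(1 / A - 1 / B) / (B - A) = 1 / A * (1 / B)" if "A \<noteq> 0" "B \<noteq> 0" "B - A \<noteq> 0" for A B :: complex
    proof -
      have "1 / A - 1 / B = (B - A) / (A * B)" using that by (simp add: diff_frac_eq)
      then show ?thesis using that by simp
    qed
    from this[OF nz(1,2)] have "(1 / (of_real u - a) - 1 / (of_real u - b)) / (a - b) = 1 / (of_real u - a) * (1 / (of_real u - b))"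
      using nz by simp
    ultimately show "((\<lambda>u. (cauchy_log a u - cauchy_log b u) / (a - b)) has_vector_derivative
       1 / (of_real u - a) * (1 / (of_real u - b))) (at u)" by simp
    show "isCont (\<lambda>u. 1 / (of_real u - a) * (1 / (of_real u - b))) u"
      using nz by (intro continuous_intros) auto
    show "integrable lborel (\<lambda>u. 1 / (of_real u - a) * (1 / (of_real u - b)))"
      by (intro sq_prod_integrable sq_kernel assms)
    show "((\<lambda>u. (cauchy_log a u - cauchy_log b u) / (a - b)) \<longlongrightarrow> (\<i> * ?s) / (a - b)) at_top"
      "((\<lambda>u. (cauchy_log a u - cauchy_log b u) / (a - b)) \<longlongrightarrow> (- \<i> * ?s) / (a - b)) at_bot"
      using False by (intro tendsto_divide cauchy_log_diff_limits assms tendsto_const; simp)+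
  qed
  also have "\<dots> = (\<i> * ?s + \<i> * ?s) / (a - b)" by (simp only: diff_divide_distrib[symmetric] mult_minus_left diff_minus_eq_add)
  also have "\<i> * ?s + \<i> * ?s = \<i> * (of_real (2 * (pi / 2 * (sgn (Im a) - sgn (Im b)))))"
    by (simp only: distrib_left[symmetric] of_real_add[symmetric] mult_2)
  also have "2 * (pi / 2 * (sgn (Im a) - sgn (Im b))) = pi * (sgn (Im a) - sgn (Im b))" by simp
  finally show ?thesis .
qed

lemma nrm_kernel:
  assumes "Im z \<noteq> 0"
  shows "(nrm (\<lambda>t. 1 / (of_real t - z)))\<^sup>2 = pi / \<bar>Im z\<bar>"
proof -
  have "complex_of_real ((nrm (\<lambda>t. 1 / (of_real t - z)))\<^sup>2) = (LINT t|lborel. of_real ((cmod (1 / (of_real t - z)))\<^sup>2))"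
    unfolding nrm_sq by (rule integral_complex_of_real[symmetric])
  also have "\<dots> = (LINT t|lborel. 1 / (of_real t - z) * (1 / (of_real t - cnj z)))"
    by (intro Bochner_Integration.integral_cong) (auto simp: norm_divide power_divide complex_norm_square simp del: of_real_power)
  also have "\<dots> = \<i> * of_real (pi * (sgn (Im z) - sgn (Im (cnj z)))) / (z - cnj z)"
    using assms by (intro integral_kernel_product) auto
  also have "\<dots> = of_real (pi * (2 * sgn (Im z)) / (2 * Im z))"
    by (simp add: complex_diff_cnj sgn_minus)
  also have "pi * (2 * sgn (Im z)) / (2 * Im z) = pi / \<bar>Im z\<bar>"
    using assms by (auto simp: sgn_if)
  finally show ?thesis by (simp only: of_real_eq_iff)
qed

lemma nrm_kernel':
  "Im z \<noteq> 0 \<Longrightarrow> nrm (\<lambda>t. 1 / (of_real t - z)) = sqrt (pi / \<bar>Im z\<bar>)"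
  using nrm_kernel[of z] by (intro real_sqrt_unique[symmetric]) auto

definition cauchy_tr :: "(real \<Rightarrow> complex) \<Rightarrow> complex \<Rightarrow> complex" where
  "cauchy_tr f z = (LINT t|lborel. f t / (of_real t - z))"

lemma cauchy_integrable:
  assumes "sq f" "Im z \<noteq> 0"
  shows "integrable lborel (\<lambda>t. f t / (of_real t - z))"
  using sq_prod_integrable[OF assms(1) sq_kernel[OF assms(2)]] by simp

lemma cauchy_tr_measurable[measurable]:
  assumes [measurable]: "f \<in> borel_measurable borel"
  shows "(\<lambda>x. cauchy_tr f (Complex x y)) \<in> borel_measurable borel"
  unfolding cauchy_tr_def Complex_eq by measurable

lemma cauchy_tr_bound:
  assumes "sq f" "Im z \<noteq> 0"
  shows "cmod (cauchy_tr f z) \<le> nrm f * sqrt (pi / \<bar>Im z\<bar>)"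
  using Cauchy_Schwarz[OF assms(1) sq_kernel[OF assms(2)]] nrm_kernel'[OF assms(2)]
  by (simp add: cauchy_tr_def)

lemma cauchy_tr_diff:
  assumes "sq f" "sq g" "Im z \<noteq> 0"
  shows "cauchy_tr (\<lambda>x. f x - g x) z = cauchy_tr f z - cauchy_tr g z"
  unfolding cauchy_tr_def using assms by (simp add: diff_divide_distrib cauchy_integrable)

lemma cauchy_tr_add:
  assumes "sq f" "sq g" "Im z \<noteq> 0"
  shows "cauchy_tr (\<lambda>x. f x + g x) z = cauchy_tr f z + cauchy_tr g z"
  unfolding cauchy_tr_def using assms by (simp add: add_divide_distrib cauchy_integrable)

lemma cauchy_tr_scale: "cauchy_tr (\<lambda>x. c * f x) z = c * cauchy_tr f z"
  unfolding cauchy_tr_def times_divide_eq_right[symmetric] by (rule integral_mult_right_zero)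

lemma cauchy_tr_cnj: "cnj (cauchy_tr f z) = cauchy_tr (\<lambda>x. cnj (f x)) (cnj z)"
  unfolding cauchy_tr_def Bochner_Integration.integral_cnj[symmetric] by simp

text \<open>Jensen's inequality with weight \<open>|f|\<close>, then integration of the squared kernel by Tonelli's theorem.\<close>

lemma sq_cauchy_tr:
  assumes f: "integrable lborel f" and y: "y \<noteq> 0"
  shows "sq (\<lambda>x. cauchy_tr f (Complex x y))"
proof -
  define L where "L = (LINT t|lborel. cmod (f t))"
  have [measurable]: "f \<in> borel_measurable borel" using f by auto
  have L0: "0 \<le> L" by (simp add: L_def)
  define k where "k x t = (cmod (1 / (of_real t - Complex x y)))\<^sup>2" for x t
  have km[measurable]: "(\<lambda>(x, t). k x t) \<in> borel_measurable (borel \<Otimes>\<^sub>M borel)"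
    unfolding k_def Complex_eq by measurable
  have kle: "k x t \<le> 1 / y\<^sup>2" for x t
  proof -
    have "\<bar>y\<bar> \<le> cmod (of_real t - Complex x y)" using cmod_kernel_ge[of "Complex x y" t] by simp
    then have "y\<^sup>2 \<le> (cmod (of_real t - Complex x y))\<^sup>2" using abs_le_square_iff by fastforce
    then show ?thesis using y by (auto simp: k_def norm_divide power_divide intro!: divide_left_mono mult_pos_pos of_real_minus_nonzero)
  qed
  have int: "integrable lborel (\<lambda>t. cmod (f t) * k x t)" for x
  proof (rule Bochner_Integration.integrable_bound[of _ "\<lambda>t. cmod (f t) * (1 / y\<^sup>2)"])
    show "AE t in lborel. norm (cmod (f t) * k x t) \<le> norm (cmod (f t) * (1 / y\<^sup>2))"
    proof (rule AE_I2)
      fix t have "cmod (f t) * k x t \<le> cmod (f t) * (1 / y\<^sup>2)" by (intro mult_left_mono kle) auto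
      then show "norm (cmod (f t) * k x t) \<le> norm (cmod (f t) * (1 / y\<^sup>2))" by (simp add: k_def abs_mult)
    qed
    have "k x \<in> borel_measurable borel" unfolding k_def Complex_eq by measurable
    then show "(\<lambda>t. cmod (f t) * k x t) \<in> borel_measurable lborel" by measurable
  qed (use f in auto)
  have b1: "(cmod (cauchy_tr f (Complex x y)))\<^sup>2 \<le> L * (LINT t|lborel. cmod (f t) * k x t)" for x
  proof -
    have i: "integrable lborel (\<lambda>t. cmod (f t) * (cmod (complex_of_real (cmod (1 / (of_real t - Complex x y)))))\<^sup>2)"
      using int[of x] by (simp add: k_def)
    note W = weighted_Cauchy_Schwarz[of "\<lambda>t. cmod (f t)" "\<lambda>t. complex_of_real (cmod (1 / (of_real t - Complex x y)))", OF _ _ i]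
    have eq: "(LINT t|lborel. complex_of_real (cmod (f t)) * complex_of_real (cmod (1 / (of_real t - Complex x y))))
       = complex_of_real (LINT t|lborel. cmod (f t) * cmod (1 / (of_real t - Complex x y)))"
      by (simp flip: of_real_mult)
    have "cmod (cauchy_tr f (Complex x y)) \<le> (LINT t|lborel. cmod (f t) * cmod (1 / (of_real t - Complex x y)))"
      unfolding cauchy_tr_def by (rule order_trans[OF integral_norm_bound]) (simp add: norm_divide)
    then have "(cmod (cauchy_tr f (Complex x y)))\<^sup>2 \<le> (LINT t|lborel. cmod (f t) * cmod (1 / (of_real t - Complex x y)))\<^sup>2"
      by (intro power_mono) auto
    also have "\<dots> \<le> L * (LINT t|lborel. cmod (f t) * k x t)"
      using W(2) f unfolding eq L_def k_def by simp
    finally show ?thesis .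
  qed
  have "(\<integral>\<^sup>+x. ennreal ((cmod (cauchy_tr f (Complex x y)))\<^sup>2) \<partial>lborel) \<le>
     (\<integral>\<^sup>+x. ennreal L * (\<integral>\<^sup>+t. ennreal (cmod (f t) * k x t) \<partial>lborel) \<partial>lborel)"
  proof (rule nn_integral_mono)
    fix x :: real
    have "(\<integral>\<^sup>+t. ennreal (cmod (f t) * k x t) \<partial>lborel) = ennreal (LINT t|lborel. cmod (f t) * k x t)"
      by (intro nn_integral_eq_integral int) (auto simp: k_def)
    then show "ennreal ((cmod (cauchy_tr f (Complex x y)))\<^sup>2) \<le> ennreal L * (\<integral>\<^sup>+t. ennreal (cmod (f t) * k x t) \<partial>lborel)"
      using b1[of x] L0 by (simp add: ennreal_mult'[symmetric] ennreal_leI)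
  qed
  also have "\<dots> = ennreal L * (\<integral>\<^sup>+x. (\<integral>\<^sup>+t. ennreal (cmod (f t) * k x t) \<partial>lborel) \<partial>lborel)"
    by (intro nn_integral_cmult) measurable
  also have "(\<integral>\<^sup>+x. (\<integral>\<^sup>+t. ennreal (cmod (f t) * k x t) \<partial>lborel) \<partial>lborel) =
     (\<integral>\<^sup>+t. (\<integral>\<^sup>+x. ennreal (cmod (f t) * k x t) \<partial>lborel) \<partial>lborel)"
    by (rule lborel_pair.Fubini') measurable
  also have "\<dots> = (\<integral>\<^sup>+t. ennreal (cmod (f t)) * ennreal (pi / \<bar>y\<bar>) \<partial>lborel)"
  proof (rule nn_integral_cong)
    fix t :: real
    have sym: "k x t = (cmod (1 / (of_real x - Complex t (- y))))\<^sup>2" for x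
    proof -
      have "complex_of_real t - Complex x y = - (of_real x - Complex t (-y))" by (simp add: complex_eq_iff)
      then show ?thesis unfolding k_def norm_divide by (simp only: norm_minus_cancel)
    qed
    have "(\<integral>\<^sup>+x. ennreal (k x t) \<partial>lborel) = ennreal (pi / \<bar>y\<bar>)"
      unfolding sym using nn_integral_sq[OF sq_kernel, of "Complex t (-y)"] nrm_kernel[of "Complex t (-y)"] y by simp
    moreover have "(\<integral>\<^sup>+x. ennreal (cmod (f t) * k x t) \<partial>lborel) = ennreal (cmod (f t)) * (\<integral>\<^sup>+x. ennreal (k x t) \<partial>lborel)"
      by (simp add: ennreal_mult' nn_integral_cmult)
    ultimately show "(\<integral>\<^sup>+x. ennreal (cmod (f t) * k x t) \<partial>lborel) = ennreal (cmod (f t)) * ennreal (pi / \<bar>y\<bar>)" by simp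
  qed
  also have "\<dots> = ennreal L * ennreal (pi / \<bar>y\<bar>)"
    using f by (simp add: nn_integral_multc nn_integral_eq_integral L_def)
  finally have "(\<integral>\<^sup>+x. ennreal ((cmod (cauchy_tr f (Complex x y)))\<^sup>2) \<partial>lborel) \<le> ennreal ((sqrt (L * (L * (pi / \<bar>y\<bar>))))\<^sup>2)"
    using L0 by (simp add: ennreal_mult'[symmetric])
  then show ?thesis by (intro sqI_nn_integral) auto
qed

text \<open>The Cauchy integral at height \<open>y\<close> has minus the Cauchy integral at height \<open>- y\<close> as its transpose; antisymmetry of the
  Hilbert transform, orthogonality and the semigroup law all come from this use of Fubini's theorem.\<close>

lemma cauchy_tr_swap:
  assumes f: "integrable lborel f" and G: "sq G" and y: "y \<noteq> 0"
  shows "(LINT x|lborel. cauchy_tr f (Complex x y) * G x) = - (LINT t|lborel. f t * cauchy_tr G (Complex t (-y)))"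
proof -
  have [measurable]: "f \<in> borel_measurable borel" "G \<in> borel_measurable borel" using f G by (auto simp: sq_measurable)
  have sym: "complex_of_real t - Complex x y = - (of_real x - Complex t (-y))" for x t by (simp add: complex_eq_iff)
  have ig: "integrable lborel (\<lambda>x. G x / (of_real t - Complex x y))" for t
  proof -
    have "integrable lborel (\<lambda>x. - (G x / (of_real x - Complex t (-y))))"
      using y by (intro Bochner_Integration.integrable_minus cauchy_integrable G) simp
    then show ?thesis unfolding sym minus_divide_right .
  qed
  have int: "integrable (lborel \<Otimes>\<^sub>M lborel) (case_prod (\<lambda>t x. f t * (G x / (of_real t - Complex x y))))"
  proof (rule lborel_pair.Fubini_integrable)
    show "case_prod (\<lambda>t x. f t * (G x / (of_real t - Complex x y))) \<in> borel_measurable (lborel \<Otimes>\<^sub>M lborel)"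
      unfolding Complex_eq by measurable
    show "AE t in lborel. integrable lborel (\<lambda>x. case (t, x) of (t, x) \<Rightarrow> f t * (G x / (of_real t - Complex x y)))"
    proof (rule AE_I2)
      fix t show "integrable lborel (\<lambda>x. case (t, x) of (t, x) \<Rightarrow> f t * (G x / (of_real t - Complex x y)))"
        unfolding prod.case by (rule integrable_mult_right[OF ig])
    qed
    show "integrable lborel (\<lambda>t. LINT x|lborel. norm (case (t, x) of (t, x) \<Rightarrow> f t * (G x / (of_real t - Complex x y))))"
    proof (rule Bochner_Integration.integrable_bound[of _ "\<lambda>t. cmod (f t) * (nrm G * sqrt (pi / \<bar>y\<bar>))"])
      show "(\<lambda>t. LINT x|lborel. norm (case (t, x) of (t, x) \<Rightarrow> f t * (G x / (of_real t - Complex x y)))) \<in> borel_measurable lborel"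
        unfolding Complex_eq by measurable
      show "AE t in lborel. norm (LINT x|lborel. norm (case (t, x) of (t, x) \<Rightarrow> f t * (G x / (of_real t - Complex x y))))
          \<le> norm (cmod (f t) * (nrm G * sqrt (pi / \<bar>y\<bar>)))"
      proof (rule AE_I2)
        fix t :: real
        have "(LINT x|lborel. norm (case (t, x) of (t, x) \<Rightarrow> f t * (G x / (of_real t - Complex x y))))
          = cmod (f t) * (LINT x|lborel. cmod (G x) * cmod (1 / (of_real x - Complex t (-y))))"
        proof -
          have "norm (f t * (G x / (of_real t - Complex x y))) = cmod (f t) * (cmod (G x) * cmod (1 / (of_real x - Complex t (-y))))" for x
            unfolding sym norm_mult norm_divide norm_minus_cancel by simp
          then show ?thesis by simp
        qed
        moreover have "(LINT x|lborel. cmod (G x) * cmod (1 / (of_real x - Complex t (-y)))) \<le> nrm G * sqrt (pi / \<bar>y\<bar>)"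
          using Cauchy_Schwarz_norm[OF G sq_kernel, of "Complex t (-y)"] nrm_kernel'[of "Complex t (-y)"] y
          by simp
        moreover have "0 \<le> (LINT x|lborel. cmod (G x) * cmod (1 / (of_real x - Complex t (-y))))"
          by (intro Bochner_Integration.integral_nonneg) auto
        ultimately show "norm (LINT x|lborel. norm (case (t, x) of (t, x) \<Rightarrow> f t * (G x / (of_real t - Complex x y))))
          \<le> norm (cmod (f t) * (nrm G * sqrt (pi / \<bar>y\<bar>)))"
          by (simp add: abs_mult mult_left_mono)
      qed
    qed (use f in auto)
  qed
  have "(LINT x|lborel. cauchy_tr f (Complex x y) * G x) = (LINT x|lborel. LINT t|lborel. f t * (G x / (of_real t - Complex x y)))"
    unfolding cauchy_tr_def by (intro Bochner_Integration.integral_cong) (auto simp flip: integral_mult_left_zero)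
  also have "\<dots> = (LINT t|lborel. LINT x|lborel. f t * (G x / (of_real t - Complex x y)))"
    by (rule lborel_pair.Fubini_integral[OF int])
  also have "\<dots> = (LINT t|lborel. - (f t * cauchy_tr G (Complex t (-y))))"
    unfolding cauchy_tr_def
    by (simp only: sym minus_divide_right[symmetric] mult_minus_right Bochner_Integration.integral_minus integral_mult_right_zero)
  finally show ?thesis by simp
qed

text \<open>The semigroup property of the Cauchy integral: the boundary values on a horizontal line of a
  function analytic in the half plane beyond it reproduce that function, and are annihilated by the
  Cauchy integral on the other side.\<close>

lemma cauchy_tr_iterate:
  assumes f: "integrable lborel f" and y: "y \<noteq> 0" and z: "Im z \<noteq> 0"
  shows "cauchy_tr (\<lambda>x. cauchy_tr f (Complex x y)) z =
     of_real (pi * (sgn (Im z) + sgn y)) * \<i> * cauchy_tr f (z + Complex 0 y)"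
proof -
  have "cauchy_tr (\<lambda>x. cauchy_tr f (Complex x y)) z = (LINT x|lborel. cauchy_tr f (Complex x y) * (1 / (of_real x - z)))"
    by (simp add: cauchy_tr_def[of _ z])
  also have "\<dots> = - (LINT t|lborel. f t * cauchy_tr (\<lambda>x. 1 / (of_real x - z)) (Complex t (-y)))"
    by (rule cauchy_tr_swap[OF f sq_kernel[OF z] y])
  also have "\<dots> = - (LINT t|lborel. - (of_real (pi * (sgn (Im z) + sgn y)) * \<i>) * (f t / (of_real t - (z + Complex 0 y))))"
  proof -
    have "cauchy_tr (\<lambda>x. 1 / (of_real x - z)) (Complex t (-y)) = - (of_real (pi * (sgn (Im z) + sgn y)) * \<i>) / (of_real t - (z + Complex 0 y))" for t
    proof -
      have "cauchy_tr (\<lambda>x. 1 / (of_real x - z)) (Complex t (-y)) = (LINT x|lborel. 1 / (of_real x - z) * (1 / (of_real x - Complex t (-y))))"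
        by (simp add: cauchy_tr_def)
      also have "\<dots> = \<i> * of_real (pi * (sgn (Im z) - sgn (Im (Complex t (-y))))) / (z - Complex t (-y))"
        by (rule integral_kernel_product) (use y z in auto)
      also have "z - Complex t (-y) = - (of_real t - (z + Complex 0 y))" by (simp add: complex_eq_iff)
      also have "sgn (Im z) - sgn (Im (Complex t (-y))) = sgn (Im z) + sgn y" by (simp add: sgn_minus)
      also have "p / - q = - p / q" for p q :: complex by simp
      finally show ?thesis by (simp only: mult.commute)
    qed
    then show ?thesis by (simp add: mult.commute)
  qed
  also have "\<dots> = of_real (pi * (sgn (Im z) + sgn y)) * \<i> * cauchy_tr f (z + Complex 0 y)"
    unfolding cauchy_tr_def by (subst integral_mult_right_zero) simp
  finally show ?thesis .
qed

section \<open>Boundary behaviour at Lebesgue points\<close>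

lemma sq_indicator:
  assumes "sq f" "A \<in> sets borel"
  shows "sq (\<lambda>x. indicator A x * f x)"
  using assms by (intro sq_mult_bounded[where B=1]) (auto simp: indicator_def)

lemma sq_indicator_bounded: "A \<in> sets borel \<Longrightarrow> emeasure lborel A < \<infinity> \<Longrightarrow> sq (indicator A)"
proof -
  assume A: "A \<in> sets borel" "emeasure lborel A < \<infinity>"
  have "(cmod (indicator A x))\<^sup>2 = indicator A x" for x by (simp add: indicator_def)
  then show "sq (indicator A)" using A by (simp add: sq_def)
qed

lemma emeasure_cball_finite: "emeasure lborel (cball (x::real) r) < \<infinity>"
  by (rule emeasure_bounded_finite) simp

lemma sq_integrable_on_cball:
  assumes "sq f"
  shows "integrable lborel (\<lambda>x. indicator (cball a r) x * f x)"
  by (intro sq_prod_integrable sq_indicator_bounded assms) (auto simp: emeasure_cball_finite[simplified])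

text \<open>Being a Lebesgue point is a local property, so truncation reduces this to integrable functions.\<close>

lemma sq_AE_lebesgue_point:
  assumes "sq f"
  shows "AE x in lborel. lebesgue_point f x"
proof -
  have "AE x in lborel. \<forall>n. lebesgue_point (\<lambda>x. indicator (cball 0 (real n)) x * f x) x"
    unfolding AE_all_countable by (intro allI AE_lebesgue_point sq_integrable_on_cball assms)
  then show ?thesis
  proof eventually_elim
    case (elim x)
    obtain n where n: "\<bar>x\<bar> + 1 < real n" using reals_Archimedean2 by blast
    define h where "h = (\<lambda>x. indicator (cball 0 (real n)) x * f x)"
    have lp: "((\<lambda>r. (LINT t:cball x r|lborel. norm (h t - h x)) / r) \<longlongrightarrow> 0) (at_right 0)"
      using elim unfolding lebesgue_point_def h_def by blast
    show ?case unfolding lebesgue_point_def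
    proof (rule Lim_transform_eventually[OF lp])
      show "\<forall>\<^sub>F r in at_right 0. (LINT t:cball x r|lborel. norm (h t - h x)) / r = (LINT t:cball x r|lborel. norm (f t - f x)) / r"
        using eventually_at_right_real[of 0 "1::real"]
      proof (rule eventually_mono, simp)
        fix r :: real assume r: "r \<in> {0<..<1}"
        have "(LINT t:cball x r|lborel. norm (h t - h x)) = (LINT t:cball x r|lborel. norm (f t - f x))"
          by (intro set_lebesgue_integral_cong) (use r n in \<open>auto simp: h_def indicator_def dist_real_def\<close>)
        then show "(LINT t:cball x r|lborel. norm (h t - h x)) / r = (LINT t:cball x r|lborel. norm (f t - f x)) / r"
          by simp
      qed
    qed
  qed
qed

text \<open>A radial majorant, up to constants, both of the Poisson kernel and of the difference between the conjugate Poisson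
  kernel and the Hilbert kernel truncated at \<open>y\<close>.\<close>

definition kap :: "real \<Rightarrow> real \<Rightarrow> real" where
  "kap y u = y / (max y \<bar>u\<bar>)\<^sup>2"

lemma kap_nonneg: "0 \<le> y \<Longrightarrow> 0 \<le> kap y u"
  by (simp add: kap_def)

lemma kap_measurable[measurable]: "(\<lambda>u. kap y u) \<in> borel_measurable borel"
  unfolding kap_def by measurable

text \<open>The majorant is dominated by a sum of multiples \<open>4\<^sup>1\<^sup>-\<^sup>k / y\<close> of indicators of the balls of radius \<open>2\<^sup>k y\<close>.\<close>

lemma kap_dyadic:
  assumes "0 < y"
  obtains k :: nat where "\<bar>u\<bar> \<le> 2 ^ k * y" "kap y u \<le> 4 * (1/4) ^ k / y"
proof (cases "\<bar>u\<bar> \<le> y")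
  case True
  then show thesis using assms by (intro that[of 0]) (auto simp: kap_def max_def power2_eq_square field_simps)
next
  case False
  obtain n where n: "\<bar>u\<bar> / y < 2 ^ n" using real_arch_pow[of 2 "\<bar>u\<bar> / y"] by auto
  define k where "k = (LEAST k::nat. \<bar>u\<bar> \<le> 2 ^ k * y)"
  have "\<bar>u\<bar> \<le> 2 ^ n * y" using n assms by (simp add: divide_less_eq)
  then have k: "\<bar>u\<bar> \<le> 2 ^ k * y" unfolding k_def by (rule LeastI)
  have "k \<noteq> 0" using k False by (cases k) auto
  then obtain j where j: "k = Suc j" by (cases k) auto
  then have "\<not> \<bar>u\<bar> \<le> 2 ^ j * y" using not_less_Least[of j "\<lambda>k. \<bar>u\<bar> \<le> 2 ^ k * y"] by (simp add: k_def)
  then have "2 ^ j * y \<le> \<bar>u\<bar>" by simp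
  then have "(2 ^ j * y)\<^sup>2 \<le> \<bar>u\<bar>\<^sup>2" using assms by (intro power_mono) auto
  then have "y / \<bar>u\<bar>\<^sup>2 \<le> y / (2 ^ j * y)\<^sup>2"
    using assms False by (intro divide_left_mono mult_pos_pos) auto
  also have "\<dots> = 4 * (1/4) ^ k / y"
  proof -
    have "(2 ^ j * y)\<^sup>2 = 4 ^ j * y * y"
    proof -
      have "(2::real) ^ j * 2 ^ j = (2 * 2) ^ j" by (simp only: power_mult_distrib)
      then show ?thesis by (simp add: power2_eq_square ac_simps)
    qed
    then show ?thesis using assms by (simp add: j power_one_over field_simps)
  qed
  finally show thesis using k False by (intro that[of k]) (auto simp: kap_def max_def)
qed

text \<open>Over dyadic balls the integral is a series of mean oscillations with weights \<open>4 / 2\<^sup>k\<close>. Each term tends to zero at a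
  Lebesgue point, and the means are bounded uniformly: small radii by the Lebesgue point property, large ones by the
  Cauchy--Schwarz inequality. Tannery's theorem applies.\<close>

lemma kap_limit:
  assumes f: "sq f" and lp: "lebesgue_point f x"
  shows "0 < y \<Longrightarrow> integrable lborel (\<lambda>t. cmod (f t - f x) * kap y (t - x))"
    and "((\<lambda>y. LINT t|lborel. cmod (f t - f x) * kap y (t - x)) \<longlongrightarrow> 0) (at_right 0)"
proof -
  have [measurable]: "f \<in> borel_measurable borel" using f by (rule sq_measurable)
  define M where "M r = (LINT t:cball x r|lborel. norm (f t - f x))" for r
  have M0: "0 \<le> M r" for r unfolding M_def set_lebesgue_integral_def by (intro Bochner_Integration.integral_nonneg) auto
  have ifx: "integrable lborel (\<lambda>t. indicator (cball x r) t * f x)" for r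
    by (rule integrable_mult_left) (rule integrable_real_indicator[THEN integrable_of_real, simplified of_real_indicator], 
      auto simp: emeasure_cball_finite[simplified])
  have iM: "integrable lborel (\<lambda>t. indicator (cball x r) t *\<^sub>R norm (f t - f x))" for r
  proof -
    have "integrable lborel (\<lambda>t. norm (indicator (cball x r) t * f t - indicator (cball x r) t * f x))"
      by (intro Bochner_Integration.integrable_diff integrable_norm sq_integrable_on_cball f ifx)
    then show ?thesis by (rule Bochner_Integration.integrable_cong[THEN iffD1, rotated 2]) (auto simp: indicator_def)
  qed
  have lim: "((\<lambda>r. M r / r) \<longlongrightarrow> 0) (at_right 0)" using lp by (simp add: lebesgue_point_def M_def)
  then have "\<forall>\<^sub>F r in at_right 0. M r / r < 1" by (rule order_tendstoD) simp
  then obtain r0 where r0: "0 < r0" "\<And>r. 0 < r \<Longrightarrow> r < r0 \<Longrightarrow> M r / r < 1"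
    unfolding eventually_at_right_field by auto
  define A where "A = max 1 (nrm f * sqrt (2 / r0) + 2 * cmod (f x))"
  have A: "M r / r \<le> A" for r
  proof (cases "r < r0")
    case True
    show ?thesis
    proof (cases "0 < r")
      case True
      have "M r / r \<le> 1" using r0(2)[OF True \<open>r < r0\<close>] by (rule less_imp_le)
      also have "1 \<le> A" by (simp add: A_def)
      finally show ?thesis .
    next
      case False
      then have "M r / r \<le> 0" using M0 by (simp add: divide_nonneg_nonpos)
      also have "0 \<le> A" by (simp add: A_def)
      finally show ?thesis .
    qed
  next
    case False
    then have r: "0 < r" using r0 by simp
    have i1: "integrable lborel (\<lambda>t. cmod (indicator (cball x r) t) * cmod (f t))"
      by (intro sq_prod_integrable_norm sq_indicator_bounded f) (auto simp: emeasure_cball_finite[simplified])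
    have i2: "integrable lborel (\<lambda>t. indicator (cball x r) t * cmod (f x))"
    proof -
      have "indicator (cball x r) t * cmod (f x) = norm (indicator (cball x r) t * f x)" for t
        by (simp add: norm_mult indicator_def)
      then show ?thesis using integrable_norm[OF ifx[of r]] by simp
    qed
    have "M r \<le> (LINT t|lborel. cmod (indicator (cball x r) t) * cmod (f t) + indicator (cball x r) t * cmod (f x))"
      unfolding M_def set_lebesgue_integral_def
      by (intro integral_mono iM Bochner_Integration.integrable_add i1 i2) (auto simp: indicator_def norm_triangle_ineq4)
    also have "\<dots> = (LINT t|lborel. cmod (indicator (cball x r) t) * cmod (f t)) + 2 * r * cmod (f x)"
      using r i1 i2 by (simp add: cball_eq_atLeastAtMost)
    also have "(LINT t|lborel. cmod (indicator (cball x r) t) * cmod (f t)) \<le> nrm (indicator (cball x r)) * nrm f"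
      by (intro Cauchy_Schwarz_norm sq_indicator_bounded f) (auto simp: emeasure_cball_finite[simplified])
    also have "nrm (indicator (cball x r)) = sqrt (2 * r)"
    proof -
      have "(cmod (indicator (cball x r) t))\<^sup>2 = indicator (cball x r) t" for t by (simp add: indicator_def)
      then show ?thesis using r by (simp add: nrm_def cball_eq_atLeastAtMost)
    qed
    finally have "M r / r \<le> (sqrt (2 * r) * nrm f + 2 * r * cmod (f x)) / r" using r by (intro divide_right_mono) auto
    also have "\<dots> = nrm f * sqrt (2 / r) + 2 * cmod (f x)"
    proof -
      have "sqrt (2 * r) / r = sqrt (2 / r)" using r by (simp add: real_sqrt_divide real_sqrt_mult field_simps)
      then have "sqrt (2 * r) * nrm f / r = nrm f * sqrt (2 / r)" by (metis mult.commute times_divide_eq_right)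
      then show ?thesis using r by (simp add: add_divide_distrib)
    qed
    also have "\<dots> \<le> nrm f * sqrt (2 / r0) + 2 * cmod (f x)"
      using r0 False by (intro add_right_mono mult_left_mono) (auto intro!: divide_left_mono)
    also have "\<dots> \<le> A" by (simp add: A_def)
    finally show ?thesis .
  qed
  define a where "a k y = 4 * (1/2) ^ k * (M (2 ^ k * y) / (2 ^ k * y))" for k :: nat and y
  have abound: "\<bar>a k y\<bar> \<le> 4 * (1/2) ^ k * A" if "0 < y" for k y
  proof -
    have "0 \<le> M (2 ^ k * y) / (2 ^ k * y)" using M0 that by simp
    then have "\<bar>a k y\<bar> = 4 * (1/2) ^ k * (M (2 ^ k * y) / (2 ^ k * y))"
      unfolding a_def by (intro abs_of_nonneg mult_nonneg_nonneg) auto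
    also have "\<dots> \<le> 4 * (1/2) ^ k * A" by (intro mult_left_mono A) auto
    finally show ?thesis .
  qed
  have summ: "summable (\<lambda>k. 4 * (1/2) ^ k * A)"
    by (intro summable_mult2 summable_mult summable_geometric) simp
  have asum: "summable (\<lambda>k. a k y)" if "0 < y" for y
    by (rule summable_comparison_test'[OF summ, of 0]) (use abound[OF that] in simp)
  have key: "(\<integral>\<^sup>+t. ennreal (cmod (f t - f x) * kap y (t - x)) \<partial>lborel) \<le> ennreal (\<Sum>k. a k y)" if y: "0 < y" for y
  proof -
    have "(\<integral>\<^sup>+t. ennreal (cmod (f t - f x) * kap y (t - x)) \<partial>lborel) \<le>
      (\<integral>\<^sup>+t. (\<Sum>k. ennreal (4 * (1/4) ^ k / y) * ennreal (indicator (cball x (2 ^ k * y)) t *\<^sub>R norm (f t - f x))) \<partial>lborel)"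
    proof (rule nn_integral_mono)
      fix t :: real
      obtain k :: nat where k: "\<bar>t - x\<bar> \<le> 2 ^ k * y" "kap y (t - x) \<le> 4 * (1/4) ^ k / y"
        by (rule kap_dyadic[OF y])
      have "ennreal (cmod (f t - f x) * kap y (t - x)) \<le> ennreal (4 * (1/4) ^ k / y * norm (f t - f x))"
        using k by (intro ennreal_leI) (metis mult.commute mult_left_mono norm_ge_zero)
      also have "\<dots> = ennreal (4 * (1/4) ^ k / y) * ennreal (indicator (cball x (2 ^ k * y)) t *\<^sub>R norm (f t - f x))"
      proof -
        have "indicator (cball x (2 ^ k * y)) t *\<^sub>R norm (f t - f x) = norm (f t - f x)"
          using k by (simp add: dist_real_def abs_minus_commute)
        then show ?thesis using y by (simp only:) (intro ennreal_mult', simp)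
      qed
      also have "\<dots> \<le> (\<Sum>k. ennreal (4 * (1/4) ^ k / y) * ennreal (indicator (cball x (2 ^ k * y)) t *\<^sub>R norm (f t - f x)))"
        using sum_le_suminf[OF summableI, of "{k}"] by simp
      finally show "ennreal (cmod (f t - f x) * kap y (t - x)) \<le> (\<Sum>k. ennreal (4 * (1/4) ^ k / y) * ennreal (indicator (cball x (2 ^ k * y)) t *\<^sub>R norm (f t - f x)))" .
    qed
    also have "\<dots> = (\<Sum>k. ennreal (4 * (1/4) ^ k / y) * (\<integral>\<^sup>+t. ennreal (indicator (cball x (2 ^ k * y)) t *\<^sub>R norm (f t - f x)) \<partial>lborel))"
    proof -
      have [measurable]: "(\<lambda>t. ennreal (indicator (cball x r) t *\<^sub>R norm (f t - f x))) \<in> borel_measurable lborel" for r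
        by (intro measurable_compose[OF borel_measurable_integrable[OF iM] measurable_ennreal])
      show ?thesis
        by (intro trans[OF nn_integral_suminf] suminf_cong nn_integral_cmult) measurable
    qed
    also have "\<dots> = (\<Sum>k. ennreal (a k y))"
    proof (rule suminf_cong)
      fix k
      have "(\<integral>\<^sup>+t. ennreal (indicator (cball x (2 ^ k * y)) t *\<^sub>R norm (f t - f x)) \<partial>lborel) = ennreal (M (2 ^ k * y))"
        unfolding M_def set_lebesgue_integral_def by (intro nn_integral_eq_integral iM) auto
      moreover have "4 * (1/4) ^ k / y * M (2 ^ k * y) = a k y"
      proof -
        have "(4::real) ^ k = (2 * 2) ^ k" by simp
        also have "\<dots> = 2 ^ k * 2 ^ k" by (simp only: power_mult_distrib)
        finally have "(4::real) ^ k = 2 ^ k * 2 ^ k" .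
        then show ?thesis by (simp add: a_def power_one_over field_simps)
      qed
      ultimately show "ennreal (4 * (1/4) ^ k / y) * (\<integral>\<^sup>+t. ennreal (indicator (cball x (2 ^ k * y)) t *\<^sub>R norm (f t - f x)) \<partial>lborel) = ennreal (a k y)"
        using y M0 by (simp flip: ennreal_mult)
    qed
    also have "\<dots> = ennreal (\<Sum>k. a k y)"
      by (rule suminf_ennreal2) (use M0 y asum[OF y] in \<open>auto simp: a_def\<close>)
    finally show ?thesis .
  qed
  have int: "integrable lborel (\<lambda>t. cmod (f t - f x) * kap y (t - x))" if "0 < y" for y
  proof -
    have "(\<integral>\<^sup>+t. ennreal (norm (cmod (f t - f x) * kap y (t - x))) \<partial>lborel) \<le> ennreal (\<Sum>k. a k y)"
      using key[OF that] that by (simp add: kap_nonneg abs_mult)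
    then show ?thesis by (auto simp: integrable_iff_bounded intro: le_less_trans)
  qed
  then show "0 < y \<Longrightarrow> integrable lborel (\<lambda>t. cmod (f t - f x) * kap y (t - x))" .
  have le: "(LINT t|lborel. cmod (f t - f x) * kap y (t - x)) \<le> (\<Sum>k. a k y)" if "0 < y" for y
  proof -
    have "ennreal (LINT t|lborel. cmod (f t - f x) * kap y (t - x)) \<le> ennreal (\<Sum>k. a k y)"
      using key[OF that] that by (subst nn_integral_eq_integral[symmetric]) (auto simp: kap_nonneg int)
    moreover have "0 \<le> (\<Sum>k. a k y)"
      by (intro suminf_nonneg asum that) (use M0 that in \<open>auto simp: a_def\<close>)
    ultimately show ?thesis by simp
  qed
  have abound': "norm (a k y) \<le> 4 * (1/2) ^ k * A" for k y
  proof (cases "0 < y")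
    case False
    then have "M (2 ^ k * y) / (2 ^ k * y) = 0"
    proof (cases "y = 0")
      case False
      with \<open>\<not> 0 < y\<close> have "2 ^ k * y < 0" by (simp add: mult_pos_neg)
      then show ?thesis by (simp add: M_def set_lebesgue_integral_def)
    qed simp
    then have "a k y = 0" unfolding a_def by simp
    then show ?thesis by (simp add: A_def)
  qed (use abound in simp)
  have "((\<lambda>y. \<Sum>k. a k y) \<longlongrightarrow> (\<Sum>k::nat. 0)) (at_right 0)"
  proof (rule tannerys_theorem[THEN conjunct2, THEN conjunct2, OF _ always_eventually summ])
    show "\<forall>p. case p of (k, y) \<Rightarrow> norm (a k y) \<le> 4 * (1/2) ^ k * A" using abound' by auto
    fix k :: nat
    have "filterlim (\<lambda>y::real. 2 ^ k * y) (at_right 0) (at_right 0)"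
      by (rule filterlim_times_pos[of _ 0 _ "2 ^ k" 0, simplified]) (auto simp: filterlim_ident)
    then have "((\<lambda>y. 4 * (1/2) ^ k * (M (2 ^ k * y) / (2 ^ k * y))) \<longlongrightarrow> 4 * (1/2) ^ k * 0) (at_right 0)"
      by (intro tendsto_mult tendsto_const filterlim_compose[OF lim])
    then show "((\<lambda>y. a k y) \<longlongrightarrow> 0) (at_right 0)" by (simp add: a_def)
  qed simp
  then have lim2: "((\<lambda>y. \<Sum>k. a k y) \<longlongrightarrow> 0) (at_right 0)" by simp
  show "((\<lambda>y. LINT t|lborel. cmod (f t - f x) * kap y (t - x)) \<longlongrightarrow> 0) (at_right 0)"
  proof (rule real_tendsto_sandwich[OF _ _ tendsto_const lim2])
    show "\<forall>\<^sub>F y in at_right 0. 0 \<le> (LINT t|lborel. cmod (f t - f x) * kap y (t - x))"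
      using eventually_at_right_less[of "0::real"]
      by eventually_elim (auto intro!: Bochner_Integration.integral_nonneg simp: kap_nonneg)
    show "\<forall>\<^sub>F y in at_right 0. (LINT t|lborel. cmod (f t - f x) * kap y (t - x)) \<le> (\<Sum>k. a k y)"
      using eventually_at_right_less[of "0::real"] by eventually_elim (rule le)
  qed
qed

section \<open>The Hilbert transform\<close>

text \<open>The Poisson kernel of the upper half plane.\<close>

definition pk :: "real \<Rightarrow> real \<Rightarrow> real" where
  "pk y u = y / (pi * (u\<^sup>2 + y\<^sup>2))"

definition poisson :: "real \<Rightarrow> (real \<Rightarrow> complex) \<Rightarrow> real \<Rightarrow> complex" where
  "poisson y f x = (LINT t|lborel. of_real (pk y (x - t)) * f t)"

lemma pk_measurable[measurable]: "(\<lambda>u. pk y u) \<in> borel_measurable borel"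
  unfolding pk_def by measurable

lemma kernel_difference:
  assumes "0 < y"
  shows "1 / (of_real t - Complex x y) - 1 / (of_real t - Complex x (-y)) = 2 * pi * \<i> * of_real (pk y (x - t))"
    and "1 / (of_real t - Complex x y) + 1 / (of_real t - Complex x (-y)) = - 2 * of_real ((x - t) / ((x - t)\<^sup>2 + y\<^sup>2))"
proof -
  define w where "w = complex_of_real t - Complex x y"
  define D where "D = (x - t)\<^sup>2 + y\<^sup>2"
  have D: "D \<noteq> 0" using assms by (simp add: D_def sum_power2_eq_zero_iff)
  have cw: "complex_of_real t - Complex x (-y) = cnj w" by (simp add: w_def complex_eq_iff)
  have w0: "w \<noteq> 0" using assms by (auto simp: w_def complex_eq_iff)
  have ww: "w * cnj w = of_real D"
    by (simp add: complex_eq_iff w_def D_def power2_eq_square algebra_simps)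
  have "1 / w - 1 / cnj w = (cnj w - w) / (w * cnj w)" using w0 by (simp add: diff_frac_eq)
  also have "\<dots> = 2 * \<i> * of_real (y / D)" unfolding ww by (simp add: w_def complex_eq_iff)
  also have "y / D = pi * pk y (x - t)" by (simp add: pk_def D_def)
  finally show "1 / (of_real t - Complex x y) - 1 / (of_real t - Complex x (-y)) = 2 * pi * \<i> * of_real (pk y (x - t))"
    unfolding cw w_def[symmetric] by simp
  have "1 / w + 1 / cnj w = (cnj w + w) / (w * cnj w)" using w0 by (simp add: add_frac_eq)
  also have "\<dots> = - 2 * of_real ((x - t) / D)" unfolding ww by (simp add: w_def complex_eq_iff diff_divide_distrib)
  finally show "1 / (of_real t - Complex x y) + 1 / (of_real t - Complex x (-y)) = - 2 * of_real ((x - t) / ((x - t)\<^sup>2 + y\<^sup>2))"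
    unfolding cw w_def[symmetric] D_def .
qed

lemma cauchy_tr_jump:
  assumes "sq f" "0 < y"
  shows "cauchy_tr f (Complex x y) - cauchy_tr f (Complex x (-y)) = 2 * pi * \<i> * poisson y f x"
proof -
  have "cauchy_tr f (Complex x y) - cauchy_tr f (Complex x (-y)) =
     (LINT t|lborel. f t / (of_real t - Complex x y) - f t / (of_real t - Complex x (-y)))"
    unfolding cauchy_tr_def using assms cauchy_integrable[OF assms(1)] by (subst Bochner_Integration.integral_diff) auto
  also have "\<dots> = (LINT t|lborel. (2 * pi * \<i>) * (of_real (pk y (x - t)) * f t))"
  proof (rule Bochner_Integration.integral_cong[OF refl])
    fix t
    have "f t / (of_real t - Complex x y) - f t / (of_real t - Complex x (-y)) =
      f t * (1 / (of_real t - Complex x y) - 1 / (of_real t - Complex x (-y)))" by (simp add: right_diff_distrib)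
    also have "\<dots> = (2 * pi * \<i>) * (of_real (pk y (x - t)) * f t)"
      unfolding kernel_difference(1)[OF assms(2)] by (simp only: ac_simps)
    finally show "f t / (of_real t - Complex x y) - f t / (of_real t - Complex x (-y)) = (2 * pi * \<i>) * (of_real (pk y (x - t)) * f t)" .
  qed
  also have "\<dots> = (2 * pi * \<i>) * poisson y f x" unfolding poisson_def by (rule integral_mult_right_zero)
  finally show ?thesis .
qed

lemma pk_mass:
  assumes "0 < y"
  shows "integrable lborel (\<lambda>t. pk y (x - t))" "(LINT t|lborel. pk y (x - t)) = 1"
proof -
  have eq: "pk y (x - t) = (y / pi) * (cmod (1 / (of_real t - Complex x y)))\<^sup>2" for t
    by (simp add: pk_def norm_divide power_divide cmod_power2 power2_commute)
  have k: "sq (\<lambda>t. 1 / (of_real t - Complex x y))" using assms by (intro sq_kernel) simp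
  show "integrable lborel (\<lambda>t. pk y (x - t))" unfolding eq using sq_integrable[OF k] by simp
  have "(LINT t|lborel. pk y (x - t)) = (y / pi) * (nrm (\<lambda>t. 1 / (of_real t - Complex x y)))\<^sup>2"
    unfolding eq nrm_sq by simp
  then show "(LINT t|lborel. pk y (x - t)) = 1" using assms by (simp add: nrm_kernel)
qed

lemma pk_nonneg: "0 \<le> y \<Longrightarrow> 0 \<le> pk y u"
  by (simp add: pk_def)

lemma pk_le: "0 < y \<Longrightarrow> pk y u \<le> 1 / (pi * y)"
proof -
  assume y: "0 < y"
  have "y / (pi * (u\<^sup>2 + y\<^sup>2)) \<le> y / (pi * y\<^sup>2)"
    using y by (intro divide_left_mono mult_left_mono mult_pos_pos) (auto simp: add_nonneg_pos)
  then show ?thesis using y by (simp add: pk_def power2_eq_square)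
qed

text \<open>Jensen's inequality for the probability density \<open>pk y (x - t)\<close>, then Tonelli's theorem.\<close>

lemma poisson_contraction:
  assumes f: "sq f" and y: "0 < y"
  shows "sq (poisson y f)" "nrm (poisson y f) \<le> nrm f"
proof -
  have [measurable]: "f \<in> borel_measurable borel" using f by (rule sq_measurable)
  have pm: "poisson y f \<in> borel_measurable borel" unfolding poisson_def[abs_def] by measurable
  have int: "integrable lborel (\<lambda>t. pk y (x - t) * (cmod (f t))\<^sup>2)" for x
  proof (rule Bochner_Integration.integrable_bound[of _ "\<lambda>t. 1 / (pi * y) * (cmod (f t))\<^sup>2"])
    show "AE t in lborel. norm (pk y (x - t) * (cmod (f t))\<^sup>2) \<le> norm (1 / (pi * y) * (cmod (f t))\<^sup>2)"
    proof (rule AE_I2)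
      fix t
      have "pk y (x - t) * (cmod (f t))\<^sup>2 \<le> 1 / (pi * y) * (cmod (f t))\<^sup>2" by (intro mult_right_mono pk_le y) auto
      then show "norm (pk y (x - t) * (cmod (f t))\<^sup>2) \<le> norm (1 / (pi * y) * (cmod (f t))\<^sup>2)"
        using y by (simp add: abs_mult pk_nonneg)
    qed
  qed (use sq_integrable[OF f] in auto)
  have b: "(cmod (poisson y f x))\<^sup>2 \<le> (LINT t|lborel. pk y (x - t) * (cmod (f t))\<^sup>2)" for x
    using weighted_Cauchy_Schwarz(2)[of "\<lambda>t. pk y (x - t)" f, OF pk_nonneg pk_mass(1) int] y pk_mass(2)[OF y]
    by (simp add: poisson_def)
  have "(\<integral>\<^sup>+x. ennreal ((cmod (poisson y f x))\<^sup>2) \<partial>lborel) \<le> (\<integral>\<^sup>+x. (\<integral>\<^sup>+t. ennreal (pk y (x - t) * (cmod (f t))\<^sup>2) \<partial>lborel) \<partial>lborel)"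
  proof (rule nn_integral_mono)
    fix x :: real
    have "(\<integral>\<^sup>+t. ennreal (pk y (x - t) * (cmod (f t))\<^sup>2) \<partial>lborel) = ennreal (LINT t|lborel. pk y (x - t) * (cmod (f t))\<^sup>2)"
      using y by (intro nn_integral_eq_integral int) (auto simp: pk_nonneg)
    then show "ennreal ((cmod (poisson y f x))\<^sup>2) \<le> (\<integral>\<^sup>+t. ennreal (pk y (x - t) * (cmod (f t))\<^sup>2) \<partial>lborel)"
      using b by (simp add: ennreal_leI)
  qed
  also have "\<dots> = (\<integral>\<^sup>+t. (\<integral>\<^sup>+x. ennreal (pk y (x - t) * (cmod (f t))\<^sup>2) \<partial>lborel) \<partial>lborel)"
    unfolding pk_def by (rule lborel_pair.Fubini') measurable
  also have "\<dots> = (\<integral>\<^sup>+t. ennreal ((cmod (f t))\<^sup>2) \<partial>lborel)"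
  proof (rule nn_integral_cong)
    fix t :: real
    have sym: "pk y (x - t) = pk y (t - x)" for x by (simp add: pk_def power2_commute)
    have "(\<integral>\<^sup>+x. ennreal (pk y (x - t)) \<partial>lborel) = 1"
      unfolding sym using pk_mass[OF y, of t] y by (subst nn_integral_eq_integral) (auto simp: pk_nonneg)
    moreover have "(\<integral>\<^sup>+x. ennreal (pk y (x - t) * (cmod (f t))\<^sup>2) \<partial>lborel) = (\<integral>\<^sup>+x. ennreal (pk y (x - t)) \<partial>lborel) * ennreal ((cmod (f t))\<^sup>2)"
      using y by (simp add: ennreal_mult pk_nonneg nn_integral_multc)
    ultimately show "(\<integral>\<^sup>+x. ennreal (pk y (x - t) * (cmod (f t))\<^sup>2) \<partial>lborel) = ennreal ((cmod (f t))\<^sup>2)" by simp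
  qed
  also have "\<dots> = ennreal ((nrm f)\<^sup>2)" by (rule nn_integral_sq[OF f])
  finally have le: "(\<integral>\<^sup>+x. ennreal ((cmod (poisson y f x))\<^sup>2) \<partial>lborel) \<le> ennreal ((nrm f)\<^sup>2)" .
  show "sq (poisson y f)" "nrm (poisson y f) \<le> nrm f" using sqI_nn_integral[OF pm le] by auto
qed

lemma kap_le_pk: "0 < y \<Longrightarrow> kap y u \<le> 2 * pi * pk y u"
proof -
  assume y: "0 < y"
  have m: "u\<^sup>2 \<le> (max y \<bar>u\<bar>)\<^sup>2" "y\<^sup>2 \<le> (max y \<bar>u\<bar>)\<^sup>2" using y by (auto simp: abs_le_square_iff[symmetric])
  then have "u\<^sup>2 + y\<^sup>2 \<le> 2 * (max y \<bar>u\<bar>)\<^sup>2" by linarith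
  then have "y * (u\<^sup>2 + y\<^sup>2) \<le> y * (2 * (max y \<bar>u\<bar>)\<^sup>2)" using y by (intro mult_left_mono) auto
  moreover have "0 < u\<^sup>2 + y\<^sup>2" "0 < (max y \<bar>u\<bar>)\<^sup>2" using y by (auto simp: add_nonneg_pos max_def)
  ultimately show ?thesis by (simp add: kap_def pk_def divide_simps)
qed

lemma pk_le_kap: "0 < y \<Longrightarrow> pk y u \<le> 1 / pi * kap y u"
proof -
  assume y: "0 < y"
  have "(max y \<bar>u\<bar>)\<^sup>2 \<le> u\<^sup>2 + y\<^sup>2" by (auto simp: max_def)
  then have "y / (u\<^sup>2 + y\<^sup>2) \<le> y / (max y \<bar>u\<bar>)\<^sup>2"
    using y by (intro divide_left_mono mult_pos_pos) (auto simp: max_def add_nonneg_pos)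
  then have "1 / pi * (y / (u\<^sup>2 + y\<^sup>2)) \<le> 1 / pi * (y / (max y \<bar>u\<bar>)\<^sup>2)"
    by (rule mult_left_mono) simp
  then show ?thesis by (simp add: kap_def pk_def)
qed

lemma integrable_kap: "0 < y \<Longrightarrow> integrable lborel (\<lambda>t. kap y (x - t))"
  by (rule Bochner_Integration.integrable_bound[of _ "\<lambda>t. 2 * pi * pk y (x - t)"])
    (auto simp: pk_mass kap_le_pk kap_nonneg pk_nonneg intro!: AE_I2)

lemma approximate_identity:
  fixes K :: "real \<Rightarrow> real \<Rightarrow> real"
  assumes f: "sq f" and lp: "lebesgue_point f x"
    and Km[measurable]: "\<And>y. K y \<in> borel_measurable borel"
    and K: "\<And>y u. 0 < y \<Longrightarrow> \<bar>K y u\<bar> \<le> C * kap y u"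
  shows "0 < y \<Longrightarrow> integrable lborel (\<lambda>t. of_real (K y (x - t)) * f t)"
    and "((\<lambda>y. (LINT t|lborel. of_real (K y (x - t)) * f t) - of_real (LINT t|lborel. K y (x - t)) * f x) \<longlongrightarrow> 0) (at_right 0)"
proof -
  have [measurable]: "f \<in> borel_measurable borel" using f by (rule sq_measurable)
  have kap_sym: "kap y (x - t) = kap y (t - x)" for y t by (simp add: kap_def abs_minus_commute)
  have C: "0 \<le> C"
  proof -
    have "0 \<le> C * kap 1 0" using K[of 1 0] by simp
    then show ?thesis by (simp add: kap_def)
  qed
  have iK: "integrable lborel (\<lambda>t. K y (x - t))" if "0 < y" for y
    by (rule Bochner_Integration.integrable_bound[of _ "\<lambda>t. C * kap y (x - t)"])
      (use K[OF that] C that in \<open>auto simp: integrable_kap abs_mult kap_nonneg\<close>)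
  have bound: "cmod (of_real (K y (x - t)) * (f t - f x)) \<le> C * (cmod (f t - f x) * kap y (t - x))" if "0 < y" for y t
    using mult_right_mono[OF K[OF that, of "x - t"], of "cmod (f t - f x)"] by (simp add: norm_mult kap_sym ac_simps)
  have iKf0: "integrable lborel (\<lambda>t. of_real (K y (x - t)) * (f t - f x))" if "0 < y" for y
  proof (rule Bochner_Integration.integrable_bound)
    show "integrable lborel (\<lambda>t. C * (cmod (f t - f x) * kap y (t - x)))"
      using kap_limit(1)[OF f lp that] by simp
    show "AE t in lborel. norm (of_real (K y (x - t)) * (f t - f x)) \<le> norm (C * (cmod (f t - f x) * kap y (t - x)))"
      using bound[OF that] by (intro AE_I2) (simp add: order.trans[OF _ abs_ge_self])
  qed simp
  have iKx: "integrable lborel (\<lambda>t. of_real (K y (x - t)) * f x)" if "0 < y" for y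
    using iK[OF that] by simp
  have iKf: "integrable lborel (\<lambda>t. of_real (K y (x - t)) * f t)" if "0 < y" for y
    using Bochner_Integration.integrable_add[OF iKf0[OF that] iKx[OF that]] by (simp add: algebra_simps)
  then show "0 < y \<Longrightarrow> integrable lborel (\<lambda>t. of_real (K y (x - t)) * f t)" .
  have eq: "(LINT t|lborel. of_real (K y (x - t)) * f t) - of_real (LINT t|lborel. K y (x - t)) * f x =
     (LINT t|lborel. of_real (K y (x - t)) * (f t - f x))" if "0 < y" for y
    using iKf[OF that] iKx[OF that] by (simp add: right_diff_distrib)
  have le: "cmod (LINT t|lborel. of_real (K y (x - t)) * (f t - f x)) \<le> C * (LINT t|lborel. cmod (f t - f x) * kap y (t - x))" if "0 < y" for y
  proof -
    have "cmod (LINT t|lborel. of_real (K y (x - t)) * (f t - f x)) \<le> (LINT t|lborel. cmod (of_real (K y (x - t)) * (f t - f x)))"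
      by (rule integral_norm_bound)
    also have "\<dots> \<le> (LINT t|lborel. C * (cmod (f t - f x) * kap y (t - x)))"
      using kap_limit(1)[OF f lp that] iKf0[OF that] bound[OF that] by (intro integral_mono integrable_norm) auto
    finally show ?thesis by simp
  qed
  have lim: "((\<lambda>y. C * (LINT t|lborel. cmod (f t - f x) * kap y (t - x))) \<longlongrightarrow> 0) (at_right 0)"
    using tendsto_mult[OF tendsto_const kap_limit(2)[OF f lp], of C] by simp
  show "((\<lambda>y. (LINT t|lborel. of_real (K y (x - t)) * f t) - of_real (LINT t|lborel. K y (x - t)) * f x) \<longlongrightarrow> 0) (at_right 0)"
    by (rule Lim_null_comparison[OF _ lim])
      (use eventually_at_right_less[of "0::real"] in eventually_elim, simp add: eq le)
qed

lemma poisson_limit: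
  assumes "sq f" "lebesgue_point f x"
  shows "((\<lambda>y. poisson y f x) \<longlongrightarrow> f x) (at_right 0)"
proof -
  have "((\<lambda>y. (LINT t|lborel. of_real (pk y (x - t)) * f t) - of_real (LINT t|lborel. pk y (x - t)) * f x) \<longlongrightarrow> 0) (at_right 0)"
    by (rule approximate_identity(2)[OF assms, where C="1/pi"])
      (measurable, metis abs_of_nonneg less_imp_le pk_le_kap pk_nonneg)
  then have "((\<lambda>y. poisson y f x - f x) \<longlongrightarrow> 0) (at_right 0)"
    by (rule Lim_transform_eventually)
      (use eventually_at_right_less[of "0::real"] in eventually_elim, simp add: poisson_def pk_mass)
  then show ?thesis by (simp add: LIM_zero_iff)
qed

text \<open>Up to the factor \<open>- 2 \<pi>\<close> this is the conjugate Poisson integral.\<close>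

definition cauchy_sum :: "real \<Rightarrow> (real \<Rightarrow> complex) \<Rightarrow> real \<Rightarrow> complex" where
  "cauchy_sum y f x = cauchy_tr f (Complex x y) + cauchy_tr f (Complex x (-y))"

lemma cauchy_sum_measurable[measurable]:
  assumes [measurable]: "f \<in> borel_measurable borel"
  shows "cauchy_sum y f \<in> borel_measurable borel"
  unfolding cauchy_sum_def[abs_def] by measurable

text \<open>After conjugation both factors are analytic in the same half plane, and the Cauchy integral of the second over the line
  vanishes on the other side.\<close>

lemma cauchy_tr_orthogonal:
  assumes f: "integrable lborel f" and y: "0 < y" "0 < y'"
  shows "(LINT x|lborel. cauchy_tr f (Complex x y) * cnj (cauchy_tr f (Complex x (-y')))) = 0"
proof -
  define G where "G x = cauchy_tr (\<lambda>t. cnj (f t)) (Complex x y')" for x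
  have fc: "integrable lborel (\<lambda>t. cnj (f t))" using f by simp
  have G: "sq G" unfolding G_def[abs_def] using y by (intro sq_cauchy_tr fc) auto
  have cc: "cnj (Complex x (-y')) = Complex x y'" for x by (simp add: complex_eq_iff)
  have "(LINT x|lborel. cauchy_tr f (Complex x y) * cnj (cauchy_tr f (Complex x (-y')))) =
     (LINT x|lborel. cauchy_tr f (Complex x y) * G x)"
    by (simp add: G_def cauchy_tr_cnj cc)
  also have "\<dots> = - (LINT t|lborel. f t * cauchy_tr G (Complex t (-y)))"
    using y by (intro cauchy_tr_swap[OF f G]) simp
  also have "\<dots> = 0" unfolding G_def using y by (simp add: cauchy_tr_iterate[OF fc])
  finally show ?thesis .
qed

lemma nrm_add_eq_diff_of_orthogonal:
  assumes A: "sq A" and B: "sq B" and AB: "(LINT x|lborel. A x * cnj (B x)) = 0"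
  shows "nrm (\<lambda>x. A x + B x) = nrm (\<lambda>x. A x - B x)"
proof -
  have i: "integrable lborel (\<lambda>x. A x * cnj (B x))" by (intro sq_prod_integrable A sq_cnj B)
  have re: "(LINT x|lborel. Re (A x * cnj (B x))) = 0" unfolding integral_Re[OF i] AB by simp
  have "(nrm (\<lambda>x. A x + B x))\<^sup>2 - (nrm (\<lambda>x. A x - B x))\<^sup>2 = (LINT x|lborel. (cmod (A x + B x))\<^sup>2 - (cmod (A x - B x))\<^sup>2)"
    unfolding nrm_sq using sq_integrable[OF sq_add[OF A B]] sq_integrable[OF sq_diff[OF A B]] by simp
  also have "\<dots> = (LINT x|lborel. 4 * Re (A x * cnj (B x)))"
  proof -
    have "(cmod (a + b))\<^sup>2 - (cmod (a - b))\<^sup>2 = 4 * Re (a * cnj b)" for a b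
      unfolding cmod_power2 by (simp add: power2_eq_square algebra_simps)
    then show ?thesis by simp
  qed
  also have "\<dots> = 0" unfolding integral_mult_right_zero re by simp
  finally have "(nrm (\<lambda>x. A x + B x))\<^sup>2 = (nrm (\<lambda>x. A x - B x))\<^sup>2" by simp
  then show ?thesis by simp
qed

lemma sq_cauchy_sum: "integrable lborel f \<Longrightarrow> 0 < y \<Longrightarrow> sq (cauchy_sum y f)"
  unfolding cauchy_sum_def[abs_def] by (intro sq_add sq_cauchy_tr) auto

text \<open>By orthogonality, sums and differences of values from the two half planes have equal norms, and the difference is a
  Poisson integral.\<close>

lemma nrm_cauchy_sum_diff:
  assumes f: "integrable lborel f" "sq f" and y: "0 < y" "0 < y'"
  shows "nrm (\<lambda>x. cauchy_sum y f x - cauchy_sum y' f x) = 2 * pi * nrm (\<lambda>x. poisson y f x - poisson y' f x)"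
    and "nrm (cauchy_sum y f) = 2 * pi * nrm (poisson y f)"
proof -
  have sp: "sq (\<lambda>x. cauchy_tr f (Complex x s))" if "s \<noteq> 0" for s by (intro sq_cauchy_tr f that)
  define A where "A x = cauchy_tr f (Complex x y) - cauchy_tr f (Complex x y')" for x
  define B where "B x = cauchy_tr f (Complex x (-y)) - cauchy_tr f (Complex x (-y'))" for x
  have AB: "sq A" "sq B" unfolding A_def[abs_def] B_def[abs_def] using y by (auto intro!: sq_diff sp)
  have int: "integrable lborel (\<lambda>x. cauchy_tr f (Complex x s) * cnj (cauchy_tr f (Complex x (-s'))))" if "0 < s" "0 < s'" for s s'
    using that by (intro sq_prod_integrable sq_cnj sp) auto
  have "(LINT x|lborel. A x * cnj (B x)) = (LINT x|lborel.
      (cauchy_tr f (Complex x y) * cnj (cauchy_tr f (Complex x (-y))) - cauchy_tr f (Complex x y) * cnj (cauchy_tr f (Complex x (-y'))))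
    - (cauchy_tr f (Complex x y') * cnj (cauchy_tr f (Complex x (-y))) - cauchy_tr f (Complex x y') * cnj (cauchy_tr f (Complex x (-y')))))"
    by (simp add: A_def B_def algebra_simps)
  also have "\<dots> = 0" using y by (simp add: int cauchy_tr_orthogonal[OF f(1)])
  finally have "nrm (\<lambda>x. A x + B x) = nrm (\<lambda>x. A x - B x)" by (intro nrm_add_eq_diff_of_orthogonal AB)
  moreover have "A x + B x = cauchy_sum y f x - cauchy_sum y' f x" for x by (simp add: A_def B_def cauchy_sum_def)
  moreover have "A x - B x = (2 * pi * \<i>) * (poisson y f x - poisson y' f x)" for x
  proof -
    have "A x - B x = (cauchy_tr f (Complex x y) - cauchy_tr f (Complex x (-y))) - (cauchy_tr f (Complex x y') - cauchy_tr f (Complex x (-y')))"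
      by (simp add: A_def B_def)
    then show ?thesis unfolding cauchy_tr_jump[OF f(2) y(1)] cauchy_tr_jump[OF f(2) y(2)] by (simp add: algebra_simps)
  qed
  ultimately show "nrm (\<lambda>x. cauchy_sum y f x - cauchy_sum y' f x) = 2 * pi * nrm (\<lambda>x. poisson y f x - poisson y' f x)"
    by (simp add: nrm_scale norm_mult)
  have "nrm (\<lambda>x. cauchy_tr f (Complex x y) + cauchy_tr f (Complex x (-y))) = nrm (\<lambda>x. cauchy_tr f (Complex x y) - cauchy_tr f (Complex x (-y)))"
    using y by (intro nrm_add_eq_diff_of_orthogonal sp cauchy_tr_orthogonal f) auto
  then show "nrm (cauchy_sum y f) = 2 * pi * nrm (poisson y f)"
    unfolding cauchy_tr_jump[OF f(2) y(1)] by (simp add: cauchy_sum_def[abs_def] nrm_scale norm_mult)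
qed

definition truncated :: "real \<Rightarrow> (real \<Rightarrow> complex) \<Rightarrow> real \<Rightarrow> complex" where
  "truncated y f x = (LINT t:{t. y < \<bar>x - t\<bar>}|lborel. f t / of_real (x - t))"

text \<open>The difference of the two kernels is odd, so its integral against the constant \<open>f x\<close> vanishes, and it is dominated by
  \<open>kap\<close>.\<close>

lemma truncated_minus_cauchy_sum_limit:
  assumes f: "sq f" and lp: "lebesgue_point f x"
  shows "((\<lambda>y. truncated y f x + cauchy_sum y f x / 2) \<longlongrightarrow> 0) (at_right 0)"
proof -
  define K where "K y u = u / (u\<^sup>2 + y\<^sup>2) - (if y < \<bar>u\<bar> then 1 / u else 0)" for y u :: real
  have [measurable]: "K y \<in> borel_measurable borel" for y unfolding K_def by measurable
  have Kb: "\<bar>K y u\<bar> \<le> 1 * kap y u" if y: "0 < y" for y u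
  proof (cases "y < \<bar>u\<bar>")
    case True
    then have u: "u \<noteq> 0" using y by auto
    have D: "0 < u\<^sup>2 + y\<^sup>2" using y by (simp add: add_nonneg_pos)
    have "K y u = - (y\<^sup>2 / (u * (u\<^sup>2 + y\<^sup>2)))"
      using True u D by (simp add: K_def field_simps power2_eq_square)
    then have "\<bar>K y u\<bar> = y\<^sup>2 / (\<bar>u\<bar> * (u\<^sup>2 + y\<^sup>2))" using D by (simp add: abs_mult)
    also have "\<dots> \<le> y\<^sup>2 / (y * u\<^sup>2)"
      using True y u by (intro divide_left_mono mult_mono mult_pos_pos) (auto simp: add_nonneg_pos)
    also have "\<dots> = kap y u" using True y by (simp add: kap_def max_def power2_eq_square)
    finally show ?thesis by simp
  next
    case False
    have D: "0 < u\<^sup>2 + y\<^sup>2" using y by (simp add: add_nonneg_pos)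
    have "\<bar>K y u\<bar> = \<bar>u\<bar> / (u\<^sup>2 + y\<^sup>2)" using False D by (simp add: K_def)
    also have "\<dots> \<le> y / y\<^sup>2" using False y D by (intro frac_le) auto
    also have "\<dots> = kap y u" using False by (simp add: kap_def max_def)
    finally show ?thesis by simp
  qed
  note ai = approximate_identity[OF f lp, of K 1, OF _ Kb]
  have zero: "(LINT t|lborel. K y (x - t)) = 0" for y
  proof -
    have "(LINT t|lborel. K y (x - t)) = (LINT t|lborel. K y (x - (2 * x + (-1) * t)))"
      using lborel_integral_real_affine[of "-1" "\<lambda>t. K y (x - t)" "2 * x"] by simp
    also have "\<dots> = (LINT t|lborel. - K y (x - t))"
    proof (rule Bochner_Integration.integral_cong[OF refl])
      fix t have "x - (2 * x + (-1) * t) = - (x - t)" by simp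
      moreover have "K y (- u) = - K y u" for u by (simp add: K_def)
      ultimately show "K y (x - (2 * x + (-1) * t)) = - K y (x - t)" by metis
    qed
    finally show ?thesis by simp
  qed
  have "((\<lambda>y. LINT t|lborel. of_real (K y (x - t)) * f t) \<longlongrightarrow> 0) (at_right 0)"
    using ai(2) by (simp add: zero)
  then have "((\<lambda>y. - (LINT t|lborel. of_real (K y (x - t)) * f t)) \<longlongrightarrow> 0) (at_right 0)"
    using tendsto_minus by fastforce
  then show ?thesis
  proof (rule Lim_transform_eventually)
    show "\<forall>\<^sub>F y in at_right 0. - (LINT t|lborel. of_real (K y (x - t)) * f t) = truncated y f x + cauchy_sum y f x / 2"
      using eventually_at_right_less[of "0::real"]
    proof eventually_elim
      case (elim y)
      have i1: "integrable lborel (\<lambda>t. of_real (K y (x - t)) * f t)" using ai(1) elim by simp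
      have i2: "integrable lborel (\<lambda>t. f t / (of_real t - Complex x s))" if "s \<noteq> 0" for s
        using that by (intro cauchy_integrable f) simp
      have pt: "indicator {t. y < \<bar>x - t\<bar>} t *\<^sub>R (f t / of_real (x - t)) =
        - (of_real (K y (x - t)) * f t) - (f t / (of_real t - Complex x y) + f t / (of_real t - Complex x (-y))) / 2" for t
      proof -
        have "f t / (of_real t - Complex x y) + f t / (of_real t - Complex x (-y)) =
          f t * (1 / (of_real t - Complex x y) + 1 / (of_real t - Complex x (-y)))" by (simp add: distrib_left)
        also have "\<dots> = - 2 * (of_real ((x - t) / ((x - t)\<^sup>2 + y\<^sup>2)) * f t)"
          unfolding kernel_difference(2)[OF elim] by (simp only: ac_simps)
        finally have e: "f t / (of_real t - Complex x y) + f t / (of_real t - Complex x (-y)) =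
          - 2 * (of_real ((x - t) / ((x - t)\<^sup>2 + y\<^sup>2)) * f t)" .
        have "of_real (K y (x - t)) = of_real ((x - t) / ((x - t)\<^sup>2 + y\<^sup>2)) - of_real (if y < \<bar>x - t\<bar> then 1 / (x - t) else 0)"
          unfolding K_def by (rule of_real_diff)
        moreover have "indicator {t. y < \<bar>x - t\<bar>} t *\<^sub>R (f t / of_real (x - t)) = of_real (if y < \<bar>x - t\<bar> then 1 / (x - t) else 0) * f t"
          by (simp add: indicator_def)
        moreover have "b * c = - (k * c) - (- 2 * (a * c)) / 2" if "k = a - b" for a b c k :: complex
          unfolding that by (simp add: algebra_simps)
        ultimately show ?thesis unfolding e by metis
      qed
      have "truncated y f x = (LINT t|lborel. - (of_real (K y (x - t)) * f t) - (f t / (of_real t - Complex x y) + f t / (of_real t - Complex x (-y))) / 2)"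
        unfolding truncated_def set_lebesgue_integral_def pt ..
      also have "\<dots> = - (LINT t|lborel. of_real (K y (x - t)) * f t) - cauchy_sum y f x / 2"
        using i1 i2[of y] i2[of "-y"] elim by (simp add: cauchy_sum_def cauchy_tr_def)
      finally show ?case by simp
    qed
  qed
qed

lemma cauchy_tr_tendsto:
  assumes f: "integrable lborel f" and z: "Im z \<noteq> 0" and w: "w \<longlonglongrightarrow> z"
  shows "(\<lambda>n. cauchy_tr f (w n)) \<longlonglongrightarrow> cauchy_tr f z"
proof -
  have "(\<lambda>n. Im (w n)) \<longlonglongrightarrow> Im z" using w by (rule tendsto_Im)
  then have "(\<lambda>n. \<bar>Im (w n)\<bar>) \<longlonglongrightarrow> \<bar>Im z\<bar>" by (rule tendsto_rabs)
  then have "\<forall>\<^sub>F n in sequentially. \<bar>Im z\<bar> / 2 < \<bar>Im (w n)\<bar>" using z by (intro order_tendstoD) auto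
  then obtain N where N: "\<And>n. N \<le> n \<Longrightarrow> \<bar>Im z\<bar> / 2 < \<bar>Im (w n)\<bar>" by (auto simp: eventually_sequentially)
  have "(\<lambda>n. cauchy_tr f (w (n + N))) \<longlonglongrightarrow> cauchy_tr f z"
    unfolding cauchy_tr_def
  proof (rule integral_dominated_convergence[where w="\<lambda>t. cmod (f t) * (2 / \<bar>Im z\<bar>)"])
    have [measurable]: "f \<in> borel_measurable borel" using f by auto
    show "(\<lambda>t. f t / (of_real t - z)) \<in> borel_measurable lborel"
      "\<And>n. (\<lambda>t. f t / (of_real t - w (n + N))) \<in> borel_measurable lborel" by measurable
    show "integrable lborel (\<lambda>t. cmod (f t) * (2 / \<bar>Im z\<bar>))" using f by auto
    show "AE t in lborel. (\<lambda>n. f t / (of_real t - w (n + N))) \<longlonglongrightarrow> f t / (of_real t - z)"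
      using of_real_minus_nonzero[OF z] LIMSEQ_ignore_initial_segment[OF w, of N]
      by (intro AE_I2 tendsto_intros) auto
    fix n
    show "AE t in lborel. norm (f t / (of_real t - w (n + N))) \<le> cmod (f t) * (2 / \<bar>Im z\<bar>)"
    proof (rule AE_I2)
      fix t
      have "\<bar>Im z\<bar> / 2 \<le> cmod (of_real t - w (n + N))" using N[of "n + N"] cmod_kernel_ge[of "w (n + N)" t] by simp
      then have "cmod (f t) / cmod (of_real t - w (n + N)) \<le> cmod (f t) / (\<bar>Im z\<bar> / 2)"
        using z N[of "n + N"] cmod_kernel_ge[of "w (n + N)" t] by (intro divide_left_mono mult_pos_pos) auto
      then show "norm (f t / (of_real t - w (n + N))) \<le> cmod (f t) * (2 / \<bar>Im z\<bar>)" by (simp add: norm_divide)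
    qed
  qed
  then show ?thesis by (rule LIMSEQ_offset)
qed

text \<open>Poisson integrals converge in norm, hence so do the sums at heights \<open>1 / (n + 1)\<close>, by equality of norms. By the
  semigroup law each sum is the Poisson integral of their limit \<open>g\<close>, so that it converges at every Lebesgue point
  of \<open>g\<close>.\<close>

lemma cauchy_sum_limit:
  assumes f: "integrable lborel f" "sq f"
  obtains g where "sq g" "(\<lambda>n. nrm (\<lambda>x. cauchy_sum (inverse (real (Suc n))) f x - g x)) \<longlonglongrightarrow> 0"
    "AE x in lborel. ((\<lambda>y. cauchy_sum y f x) \<longlongrightarrow> g x) (at_right 0)" "nrm g \<le> 2 * pi * nrm f"
proof -
  define e where "e n = inverse (real (Suc n))" for n
  have e0: "0 < e n" for n by (simp add: e_def)
  have e_lim: "e \<longlonglongrightarrow> 0" unfolding e_def[abs_def] by (rule LIMSEQ_inverse_real_of_nat)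
  have e_filt: "filterlim e (at_right 0) sequentially"
    using e_lim e0 by (intro tendsto_imp_filterlim_at_right) auto
  define S where "S n = cauchy_sum (e n) f" for n
  have S: "sq (S n)" for n unfolding S_def using e0 by (intro sq_cauchy_sum f)
  have P: "sq (poisson (e n) f)" "nrm (poisson (e n) f) \<le> nrm f" for n
    using poisson_contraction[OF f(2) e0] by auto
  have P_lim: "(\<lambda>n. nrm (\<lambda>x. poisson (e n) f x - f x)) \<longlonglongrightarrow> 0"
  proof (rule AE_convergence_imp_nrm_convergence[OF P(1) f(2) _ P(2)])
    show "AE x in lborel. (\<lambda>n. poisson (e n) f x) \<longlonglongrightarrow> f x"
      using sq_AE_lebesgue_point[OF f(2)]
      by eventually_elim (rule filterlim_compose[OF poisson_limit[OF f(2)] e_filt])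
  qed
  obtain g where g: "sq g" "(\<lambda>n. nrm (\<lambda>x. S n x - g x)) \<longlonglongrightarrow> 0"
  proof (rule Riesz_Fischer[OF S])
    fix r :: real assume r: "0 < r"
    have "\<forall>\<^sub>F n in sequentially. nrm (\<lambda>x. poisson (e n) f x - f x) < r / (4 * pi)"
      using r by (intro order_tendstoD[OF P_lim]) auto
    then obtain N where N: "\<And>n. N \<le> n \<Longrightarrow> nrm (\<lambda>x. poisson (e n) f x - f x) < r / (4 * pi)"
      by (auto simp: eventually_sequentially)
    show "\<exists>N. \<forall>m\<ge>N. \<forall>n\<ge>N. nrm (\<lambda>x. S m x - S n x) \<le> r"
    proof (intro exI allI impI)
      fix m n assume mn: "N \<le> m" "N \<le> n"
      have "nrm (\<lambda>x. S m x - S n x) = 2 * pi * nrm (\<lambda>x. poisson (e m) f x - poisson (e n) f x)"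
        unfolding S_def using e0 by (intro nrm_cauchy_sum_diff f)
      also have "\<dots> \<le> 2 * pi * (nrm (\<lambda>x. poisson (e m) f x - f x) + nrm (\<lambda>x. f x - poisson (e n) f x))"
        by (intro mult_left_mono nrm_triangle3 P f) auto
      also have "nrm (\<lambda>x. f x - poisson (e n) f x) = nrm (\<lambda>x. poisson (e n) f x - f x)" by (rule nrm_minus_commute)
      also have "2 * pi * (nrm (\<lambda>x. poisson (e m) f x - f x) + nrm (\<lambda>x. poisson (e n) f x - f x)) \<le> 2 * pi * (r / (4 * pi) + r / (4 * pi))"
        using N[OF mn(1)] N[OF mn(2)] by (intro mult_left_mono add_mono) auto
      also have "\<dots> = r" by simp
      finally show "nrm (\<lambda>x. S m x - S n x) \<le> r" .
    qed
  qed
  have rep: "cauchy_sum y f x = poisson y g x" if y: "0 < y" for y x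
  proof -
    have conv: "(\<lambda>n. cauchy_tr (S n) z) \<longlonglongrightarrow> cauchy_tr g z" if "Im z \<noteq> 0" for z
    proof -
      have bd: "\<forall>n. norm (cauchy_tr (S n) z - cauchy_tr g z) \<le> nrm (\<lambda>x. S n x - g x) * sqrt (pi / \<bar>Im z\<bar>)"
        unfolding cauchy_tr_diff[OF S g(1) that, symmetric] by (intro allI cauchy_tr_bound[OF sq_diff[OF S g(1)] that])
      have gl: "(\<lambda>n. nrm (\<lambda>x. S n x - g x) * sqrt (pi / \<bar>Im z\<bar>)) \<longlonglongrightarrow> 0"
        using tendsto_mult[OF g(2) tendsto_const[of "sqrt (pi / \<bar>Im z\<bar>)"]] by simp
      have "(\<lambda>n. cauchy_tr (S n) z - cauchy_tr g z) \<longlonglongrightarrow> 0"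
        by (rule Lim_null_comparison[OF always_eventually[OF bd] gl])
      then show ?thesis by (simp add: LIM_zero_iff)
    qed
    have l1: "(\<lambda>n. cauchy_tr (S n) (Complex x y) - cauchy_tr (S n) (Complex x (-y))) \<longlonglongrightarrow> 2 * pi * \<i> * poisson y g x"
      unfolding cauchy_tr_jump[OF g(1) y, symmetric] using y by (intro tendsto_diff conv) auto
    have eq: "cauchy_tr (S n) (Complex x y) - cauchy_tr (S n) (Complex x (-y)) = 2 * pi * \<i> * cauchy_sum (y + e n) f x" for n
    proof -
      have s: "sq (\<lambda>x. cauchy_tr f (Complex x s))" if "s \<noteq> 0" for s by (intro sq_cauchy_tr f that)
      have sp: "cauchy_tr (S n) z = cauchy_tr (\<lambda>x. cauchy_tr f (Complex x (e n))) z + cauchy_tr (\<lambda>x. cauchy_tr f (Complex x (- e n))) z"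
        if "Im z \<noteq> 0" for z
        unfolding S_def cauchy_sum_def[abs_def] using e0[of n] that by (intro cauchy_tr_add s) auto
      have it: "cauchy_tr (\<lambda>x. cauchy_tr f (Complex x s)) (Complex x u) = of_real (pi * (sgn u + sgn s)) * \<i> * cauchy_tr f (Complex x (u + s))"
        if "s \<noteq> 0" "u \<noteq> 0" for s u
      proof -
        have "Complex x u + Complex 0 s = Complex x (u + s)" by (simp add: complex_eq_iff)
        then show ?thesis using cauchy_tr_iterate[OF f(1) that(1), of "Complex x u"] that(2) by simp
      qed
      have "cauchy_tr (S n) (Complex x y) = of_real (pi * (1 + 1)) * \<i> * cauchy_tr f (Complex x (y + e n))"
        using it[of "e n" y] it[of "- e n" y] sp[of "Complex x y"] y e0[of n] by simp
      moreover have "cauchy_tr (S n) (Complex x (-y)) = - (of_real (pi * (1 + 1)) * \<i> * cauchy_tr f (Complex x (- (y + e n))))"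
        using it[of "e n" "-y"] it[of "- e n" "-y"] sp[of "Complex x (-y)"] y e0[of n] by simp
      ultimately show ?thesis by (simp add: cauchy_sum_def distrib_left)
    qed
    have l2: "(\<lambda>n. 2 * pi * \<i> * cauchy_sum (y + e n) f x) \<longlonglongrightarrow> 2 * pi * \<i> * cauchy_sum y f x"
    proof -
      have a: "(\<lambda>n. Complex x (y + e n)) \<longlonglongrightarrow> Complex x y"
        using tendsto_Complex[OF tendsto_const[of x] tendsto_add[OF tendsto_const[of y] e_lim]] by simp
      have b: "(\<lambda>n. Complex x (- (y + e n))) \<longlonglongrightarrow> Complex x (- y)"
        using tendsto_Complex[OF tendsto_const[of x] tendsto_minus[OF tendsto_add[OF tendsto_const[of y] e_lim]]] by simp
      show ?thesis unfolding cauchy_sum_def using y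
        by (intro tendsto_intros cauchy_tr_tendsto[OF f(1)] a b) auto
    qed
    have "2 * pi * \<i> * poisson y g x = 2 * pi * \<i> * cauchy_sum y f x"
      by (rule LIMSEQ_unique[OF l1[unfolded eq] l2])
    then show ?thesis by simp
  qed
  have AE: "AE x in lborel. ((\<lambda>y. cauchy_sum y f x) \<longlongrightarrow> g x) (at_right 0)"
    using sq_AE_lebesgue_point[OF g(1)]
  proof eventually_elim
    case (elim x)
    show ?case
      by (rule Lim_transform_eventually[OF poisson_limit[OF g(1) elim]])
        (use eventually_at_right_less[of "0::real"] in eventually_elim, simp add: rep)
  qed
  have "nrm g \<le> 2 * pi * nrm f"
  proof (rule Fatou_sq(2)[OF S])
    show "g \<in> borel_measurable borel" using g by (simp add: sq_measurable)
    show "AE x in lborel. (\<lambda>n. S n x) \<longlonglongrightarrow> g x"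
      using AE unfolding S_def by eventually_elim (rule filterlim_compose[OF _ e_filt])
    fix n show "nrm (S n) \<le> 2 * pi * nrm f"
      using nrm_cauchy_sum_diff(2)[OF f e0[of n] e0[of n]] P(2)[of n] by (simp add: S_def)
  qed
  then show thesis using that[OF g(1) _ AE] g(2) by (simp add: S_def e_def)
qed

text \<open>The limit is taken along a fixed sequence to make the function Borel measurable without an exceptional set.
  The normalization is that of the principal value of \<open>\<integral> f t / (x - t) dt\<close>.\<close>

definition hilb :: "(real \<Rightarrow> complex) \<Rightarrow> real \<Rightarrow> complex" where
  "hilb f x = - lim (\<lambda>n. cauchy_sum (inverse (real (Suc n))) f x) / 2"

lemma hilb_measurable[measurable]:
  assumes [measurable]: "f \<in> borel_measurable borel"
  shows "hilb f \<in> borel_measurable borel"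
proof -
  have [measurable]: "(\<lambda>x. lim (\<lambda>n. cauchy_sum (inverse (real (Suc n))) f x)) \<in> borel_measurable borel"
    by (rule borel_measurable_lim_metric) measurable
  show ?thesis unfolding hilb_def[abs_def] by measurable
qed

lemma inverse_Suc_at_right: "filterlim (\<lambda>n. inverse (real (Suc n))) (at_right 0) sequentially"
  by (intro tendsto_imp_filterlim_at_right LIMSEQ_inverse_real_of_nat) auto

theorem hilb:
  assumes f: "integrable lborel f" "sq f"
  shows sq_hilb: "sq (hilb f)" and nrm_hilb: "nrm (hilb f) \<le> pi * nrm f"
    and hilb_cauchy_sum: "AE x in lborel. ((\<lambda>y. cauchy_sum y f x) \<longlongrightarrow> - 2 * hilb f x) (at_right 0)"
    and hilb_L2_limit: "(\<lambda>n. nrm (\<lambda>x. cauchy_sum (inverse (real (Suc n))) f x - (- 2 * hilb f x))) \<longlonglongrightarrow> 0"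
    and hilb_truncated: "AE x in lborel. ((\<lambda>y. truncated y f x) \<longlongrightarrow> hilb f x) (at_right 0)"
    and hilb_upper: "AE x in lborel. ((\<lambda>y. cauchy_tr f (Complex x y)) \<longlongrightarrow> - hilb f x + \<i> * pi * f x) (at_right 0)"
    and hilb_lower: "AE x in lborel. ((\<lambda>y. cauchy_tr f (Complex x (-y))) \<longlongrightarrow> - hilb f x - \<i> * pi * f x) (at_right 0)"
proof -
  obtain g where g: "sq g" "(\<lambda>n. nrm (\<lambda>x. cauchy_sum (inverse (real (Suc n))) f x - g x)) \<longlonglongrightarrow> 0"
    "AE x in lborel. ((\<lambda>y. cauchy_sum y f x) \<longlongrightarrow> g x) (at_right 0)" "nrm g \<le> 2 * pi * nrm f"
    by (rule cauchy_sum_limit[OF f])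
  have [measurable]: "f \<in> borel_measurable borel" "g \<in> borel_measurable borel" using f g by auto
  have gh: "AE x in lborel. g x = - 2 * hilb f x"
    using g(3)
  proof eventually_elim
    case (elim x)
    then have "(\<lambda>n. cauchy_sum (inverse (real (Suc n))) f x) \<longlonglongrightarrow> g x"
      by (rule filterlim_compose[OF _ inverse_Suc_at_right])
    then show ?case by (simp add: hilb_def limI)
  qed
  have hg: "AE x in lborel. (-1/2) * g x = hilb f x" using gh by eventually_elim simp
  have cs_jump: "(cauchy_sum y f x + 2 * pi * \<i> * poisson y f x) / 2 = cauchy_tr f (Complex x y)"
    "(cauchy_sum y f x - 2 * pi * \<i> * poisson y f x) / 2 = cauchy_tr f (Complex x (-y))" if "0 < y" for x y
    unfolding cauchy_tr_jump[OF f(2) that, symmetric] cauchy_sum_def by simp_all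
  show 1: "sq (hilb f)" by (rule sq_cong_AE[OF sq_scale[OF g(1)] hg]) measurable
  have "nrm (hilb f) = nrm (\<lambda>x. (-1/2) * g x)"
    by (rule nrm_cong_AE[symmetric, OF hg]) measurable
  also have "\<dots> \<le> pi * nrm f" using g(4) by (subst nrm_scale) simp
  finally show "nrm (hilb f) \<le> pi * nrm f" .
  show cs: "AE x in lborel. ((\<lambda>y. cauchy_sum y f x) \<longlongrightarrow> - 2 * hilb f x) (at_right 0)"
    using g(3) gh by eventually_elim simp
  have "nrm (\<lambda>x. cauchy_sum (inverse (real (Suc n))) f x - (- 2 * hilb f x)) = nrm (\<lambda>x. cauchy_sum (inverse (real (Suc n))) f x - g x)" for n
    by (rule nrm_cong_AE) (use gh in \<open>eventually_elim, simp\<close>, measurable)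
  then show "(\<lambda>n. nrm (\<lambda>x. cauchy_sum (inverse (real (Suc n))) f x - (- 2 * hilb f x))) \<longlonglongrightarrow> 0"
    using g(2) by simp
  show "AE x in lborel. ((\<lambda>y. truncated y f x) \<longlongrightarrow> hilb f x) (at_right 0)"
    using cs sq_AE_lebesgue_point[OF f(2)]
  proof eventually_elim
    case (elim x)
    have "((\<lambda>y. (truncated y f x + cauchy_sum y f x / 2) - cauchy_sum y f x / 2) \<longlongrightarrow> 0 - (- 2 * hilb f x) / 2) (at_right 0)"
      by (intro tendsto_intros truncated_minus_cauchy_sum_limit f elim) simp
    then show ?case by simp
  qed
  show "AE x in lborel. ((\<lambda>y. cauchy_tr f (Complex x y)) \<longlongrightarrow> - hilb f x + \<i> * pi * f x) (at_right 0)"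
    using cs sq_AE_lebesgue_point[OF f(2)]
  proof eventually_elim
    case (elim x)
    have "((\<lambda>y. (cauchy_sum y f x + 2 * pi * \<i> * poisson y f x) / 2) \<longlongrightarrow> (- 2 * hilb f x + 2 * pi * \<i> * f x) / 2) (at_right 0)"
      by (intro tendsto_intros poisson_limit f elim) simp
    also have "(- 2 * hilb f x + 2 * pi * \<i> * f x) / 2 = - hilb f x + \<i> * pi * f x" by simp
    finally show ?case
      by (rule Lim_transform_eventually)
        (use eventually_at_right_less[of "0::real"] in eventually_elim, simp only: cs_jump)
  qed
  show "AE x in lborel. ((\<lambda>y. cauchy_tr f (Complex x (-y))) \<longlongrightarrow> - hilb f x - \<i> * pi * f x) (at_right 0)"
    using cs sq_AE_lebesgue_point[OF f(2)]
  proof eventually_elim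
    case (elim x)
    have "((\<lambda>y. (cauchy_sum y f x - 2 * pi * \<i> * poisson y f x) / 2) \<longlongrightarrow> (- 2 * hilb f x - 2 * pi * \<i> * f x) / 2) (at_right 0)"
      by (intro tendsto_intros poisson_limit f elim) simp
    also have "(- 2 * hilb f x - 2 * pi * \<i> * f x) / 2 = - hilb f x - \<i> * pi * f x" by (simp add: diff_divide_distrib)
    finally show ?case
      by (rule Lim_transform_eventually)
        (use eventually_at_right_less[of "0::real"] in eventually_elim, simp only: cs_jump)
  qed
qed

lemma sq_limit_pairing:
  assumes "\<And>n. sq (s n)" "sq h" "sq k" "(\<lambda>n. nrm (\<lambda>x. s n x - h x)) \<longlonglongrightarrow> 0"
  shows "(\<lambda>n. LINT x|lborel. s n x * k x) \<longlonglongrightarrow> (LINT x|lborel. h x * k x)"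
proof -
  have bd: "norm ((LINT x|lborel. s n x * k x) - (LINT x|lborel. h x * k x)) \<le> nrm (\<lambda>x. s n x - h x) * nrm k" for n
  proof -
    have "(LINT x|lborel. s n x * k x) - (LINT x|lborel. h x * k x) = (LINT x|lborel. (s n x - h x) * k x)"
      using assms by (simp add: left_diff_distrib sq_prod_integrable)
    then show ?thesis using Cauchy_Schwarz[OF sq_diff assms(3), of "s n" h] assms by simp
  qed
  have gl: "(\<lambda>n. nrm (\<lambda>x. s n x - h x) * nrm k) \<longlonglongrightarrow> 0"
    using tendsto_mult[OF assms(4) tendsto_const[of "nrm k"]] by simp
  have "(\<lambda>n. (LINT x|lborel. s n x * k x) - (LINT x|lborel. h x * k x)) \<longlonglongrightarrow> 0"
    by (rule Lim_null_comparison[OF always_eventually gl]) (use bd in blast)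
  then show ?thesis by (simp add: LIM_zero_iff)
qed

theorem hilb_antisymmetric:
  assumes f: "integrable lborel f" "sq f" and g: "integrable lborel g" "sq g"
  shows "(LINT x|lborel. hilb f x * g x) = - (LINT x|lborel. f x * hilb g x)"
proof -
  define e where "e n = inverse (real (Suc n))" for n
  have e0: "0 < e n" for n by (simp add: e_def)
  have lim: "(\<lambda>n. LINT x|lborel. cauchy_sum (e n) f x * g x) \<longlonglongrightarrow> (LINT x|lborel. (- 2 * hilb f x) * g x)"
    if f: "integrable lborel f" "sq f" and g: "sq g" for f g
    by (rule sq_limit_pairing[OF sq_cauchy_sum[OF f(1) e0] sq_scale[OF sq_hilb[OF f]] g])
      (use hilb_L2_limit[OF f] in \<open>simp add: e_def\<close>)
  have eq: "(LINT x|lborel. cauchy_sum (e n) f x * g x) = - (LINT x|lborel. cauchy_sum (e n) g x * f x)" for n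
  proof -
    have sp: "sq (\<lambda>x. cauchy_tr h (Complex x s))" if "s \<noteq> 0" "integrable lborel h" for s h by (intro sq_cauchy_tr that)
    have "(LINT x|lborel. cauchy_sum (e n) f x * g x) = (LINT x|lborel. cauchy_tr f (Complex x (e n)) * g x) + (LINT x|lborel. cauchy_tr f (Complex x (- e n)) * g x)"
      unfolding cauchy_sum_def distrib_right
      by (rule Bochner_Integration.integral_add) (use e0[of n] f g in \<open>auto intro!: sq_prod_integrable sp\<close>)
    also have "\<dots> = - (LINT t|lborel. f t * cauchy_tr g (Complex t (- e n))) - (LINT t|lborel. f t * cauchy_tr g (Complex t (e n)))"
      using e0[of n] by (simp add: cauchy_tr_swap[OF f(1) g(2)])
    also have "\<dots> = - ((LINT t|lborel. cauchy_tr g (Complex t (e n)) * f t) + (LINT t|lborel. cauchy_tr g (Complex t (- e n)) * f t))"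
      by (simp add: mult.commute)
    also have "(LINT t|lborel. cauchy_tr g (Complex t (e n)) * f t) + (LINT t|lborel. cauchy_tr g (Complex t (- e n)) * f t) = (LINT x|lborel. cauchy_sum (e n) g x * f x)"
      unfolding cauchy_sum_def distrib_right
      by (rule Bochner_Integration.integral_add[symmetric]) (use e0[of n] f g in \<open>auto intro!: sq_prod_integrable sp\<close>)
    finally show ?thesis .
  qed
  have "(\<lambda>n. LINT x|lborel. cauchy_sum (e n) f x * g x) \<longlonglongrightarrow> - (LINT x|lborel. (- 2 * hilb g x) * f x)"
    by (rule Lim_transform_eventually[OF tendsto_minus[OF lim[OF g f(2)]]]) (intro always_eventually allI eq[symmetric])
  then have "(LINT x|lborel. (- 2 * hilb f x) * g x) = - (LINT x|lborel. (- 2 * hilb g x) * f x)"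
    using lim[OF f g(2)] LIMSEQ_unique by blast
  moreover have "(LINT x|lborel. (- 2 * hilb f x) * g x) = - 2 * (LINT x|lborel. hilb f x * g x)" for f g
    by (simp only: mult.assoc integral_mult_right_zero)
  ultimately have "- 2 * (LINT x|lborel. hilb f x * g x) = - 2 * (- (LINT x|lborel. hilb g x * f x))" by simp
  then have "(LINT x|lborel. hilb f x * g x) = - (LINT x|lborel. hilb g x * f x)"
    by (metis mult_cancel_left neg_equal_0_iff_equal zero_neq_numeral)
  then show ?thesis by (simp only: mult.commute)
qed

section \<open>The integral operator with difference-quotient kernel\<close>

lemma cauchy_sum_add:
  assumes "sq f" "sq g" "0 < y"
  shows "cauchy_sum y (\<lambda>t. f t + g t) x = cauchy_sum y f x + cauchy_sum y g x"
  using assms by (simp add: cauchy_sum_def cauchy_tr_add)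

lemma cauchy_sum_scale: "cauchy_sum y (\<lambda>t. c * f t) x = c * cauchy_sum y f x"
  by (simp add: cauchy_sum_def cauchy_tr_scale distrib_left)

lemma cauchy_sum_cnj: "cauchy_sum y (\<lambda>t. cnj (f t)) x = cnj (cauchy_sum y f x)"
proof -
  have "cnj (Complex x s) = Complex x (- s)" for s by (simp add: complex_eq_iff)
  then show ?thesis by (simp add: cauchy_sum_def cauchy_tr_cnj)
qed

lemma hilb_eqI:
  assumes "((\<lambda>y. cauchy_sum y f x) \<longlongrightarrow> - 2 * L) (at_right 0)"
  shows "hilb f x = L"
  using filterlim_compose[OF assms inverse_Suc_at_right] by (simp add: hilb_def limI)

lemma hilb_add:
  assumes f: "integrable lborel f" "sq f" and g: "integrable lborel g" "sq g"
  shows "AE x in lborel. hilb (\<lambda>t. f t + g t) x = hilb f x + hilb g x"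
  using hilb_cauchy_sum[OF f] hilb_cauchy_sum[OF g]
proof eventually_elim
  case (elim x)
  have "((\<lambda>y. cauchy_sum y f x + cauchy_sum y g x) \<longlongrightarrow> - 2 * (hilb f x + hilb g x)) (at_right 0)"
    unfolding distrib_left by (intro tendsto_add elim)
  then have "((\<lambda>y. cauchy_sum y (\<lambda>t. f t + g t) x) \<longlongrightarrow> - 2 * (hilb f x + hilb g x)) (at_right 0)"
    by (rule Lim_transform_eventually)
      (use eventually_at_right_less[of "0::real"] in eventually_elim, simp add: cauchy_sum_add f g)
  from hilb_eqI[OF this] show ?case .
qed

lemma hilb_scale:
  assumes f: "integrable lborel f" "sq f"
  shows "AE x in lborel. hilb (\<lambda>t. c * f t) x = c * hilb f x"
  using hilb_cauchy_sum[OF f]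
proof eventually_elim
  case (elim x)
  have "((\<lambda>y. cauchy_sum y (\<lambda>t. c * f t) x) \<longlongrightarrow> - 2 * (c * hilb f x)) (at_right 0)"
    unfolding cauchy_sum_scale mult.left_commute[of "- 2"] by (intro tendsto_mult tendsto_const elim)
  from hilb_eqI[OF this] show ?case .
qed

lemma hilb_cnj:
  assumes f: "integrable lborel f" "sq f"
  shows "AE x in lborel. hilb (\<lambda>t. cnj (f t)) x = cnj (hilb f x)"
  using hilb_cauchy_sum[OF f]
proof eventually_elim
  case (elim x)
  have "((\<lambda>y. cauchy_sum y (\<lambda>t. cnj (f t)) x) \<longlongrightarrow> - 2 * cnj (hilb f x)) (at_right 0)"
    unfolding cauchy_sum_cnj using tendsto_cnj[OF elim] by simp
  from hilb_eqI[OF this] show ?case .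
qed

text \<open>The factor \<open>x - t\<close> cancels the singularity, so that the truncated integrals of the commutator tend to the plain
  integral of \<open>f\<close>.\<close>

lemma hilb_commutator:
  assumes f: "integrable lborel f" "sq f" and g: "integrable lborel (\<lambda>t. of_real t * f t)" "sq (\<lambda>t. of_real t * f t)"
  shows "AE x in lborel. of_real x * hilb f x - hilb (\<lambda>t. of_real t * f t) x = (LINT t|lborel. f t)"
  using hilb_truncated[OF f] hilb_truncated[OF g]
proof eventually_elim
  case (elim x)
  have [measurable]: "f \<in> borel_measurable borel" using f by auto
  have lim: "((\<lambda>y. of_real x * truncated y f x - truncated y (\<lambda>t. of_real t * f t) x) \<longlongrightarrow>
     of_real x * hilb f x - hilb (\<lambda>t. of_real t * f t) x) (at_right 0)"
    by (intro tendsto_intros elim)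
  define e where "e n = inverse (real (Suc n))" for n
  have e0: "0 < e n" for n by (simp add: e_def)
  have l1: "(\<lambda>n. of_real x * truncated (e n) f x - truncated (e n) (\<lambda>t. of_real t * f t) x) \<longlonglongrightarrow>
     of_real x * hilb f x - hilb (\<lambda>t. of_real t * f t) x"
    unfolding e_def by (rule filterlim_compose[OF lim inverse_Suc_at_right])
  have tr: "integrable lborel (\<lambda>t. indicator {t. y < \<bar>x - t\<bar>} t *\<^sub>R (h t / of_real (x - t)))"
    if y: "0 < y" and h: "integrable lborel h" for y and h :: "real \<Rightarrow> complex"
  proof (rule Bochner_Integration.integrable_bound[of _ "\<lambda>t. cmod (h t) / y"])
    have [measurable]: "h \<in> borel_measurable borel" using h by auto
    show "(\<lambda>t. indicator {t. y < \<bar>x - t\<bar>} t *\<^sub>R (h t / of_real (x - t))) \<in> borel_measurable lborel" by measurable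
    show "AE t in lborel. norm (indicator {t. y < \<bar>x - t\<bar>} t *\<^sub>R (h t / of_real (x - t))) \<le> norm (cmod (h t) / y)"
    proof (rule AE_I2)
      fix t
      show "norm (indicator {t. y < \<bar>x - t\<bar>} t *\<^sub>R (h t / of_real (x - t))) \<le> norm (cmod (h t) / y)"
      proof (cases "y < \<bar>x - t\<bar>")
        case True
        have "norm (h t / of_real (x - t)) = cmod (h t) / \<bar>x - t\<bar>" unfolding norm_divide norm_of_real ..
        also have "\<dots> \<le> cmod (h t) / y" using True y by (intro divide_left_mono) auto
        finally show ?thesis using True y by simp
      qed (use y in simp)
    qed
  qed (use h in auto)
  have eq: "of_real x * truncated y f x - truncated y (\<lambda>t. of_real t * f t) x = (LINT t|lborel. indicator {t. y < \<bar>x - t\<bar>} t *\<^sub>R f t)"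
    if y: "0 < y" for y
  proof -
    have "of_real x * truncated y f x - truncated y (\<lambda>t. of_real t * f t) x =
      (LINT t|lborel. of_real x * (indicator {t. y < \<bar>x - t\<bar>} t *\<^sub>R (f t / of_real (x - t))) - indicator {t. y < \<bar>x - t\<bar>} t *\<^sub>R (of_real t * f t / of_real (x - t)))"
      unfolding truncated_def set_lebesgue_integral_def
      by (simp only: Bochner_Integration.integral_diff[OF integrable_mult_right[OF tr[OF y f(1)]] tr[OF y g(1)]] integral_mult_right_zero)
    also have "\<dots> = (LINT t|lborel. indicator {t. y < \<bar>x - t\<bar>} t *\<^sub>R f t)"
    proof (rule Bochner_Integration.integral_cong[OF refl])
      fix t
      show "of_real x * (indicator {t. y < \<bar>x - t\<bar>} t *\<^sub>R (f t / of_real (x - t))) - indicator {t. y < \<bar>x - t\<bar>} t *\<^sub>R (of_real t * f t / of_real (x - t)) = indicator {t. y < \<bar>x - t\<bar>} t *\<^sub>R f t"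
      proof (cases "y < \<bar>x - t\<bar>")
        case True
        then have nz: "complex_of_real (x - t) \<noteq> 0" using y by auto
        have "of_real x * (f t / of_real (x - t)) - of_real t * f t / of_real (x - t) = (of_real (x - t) * f t) / of_real (x - t)"
          by (simp add: left_diff_distrib diff_divide_distrib)
        also have "\<dots> = f t" using nz by (rule nonzero_mult_div_cancel_left)
        finally show ?thesis using True by simp
      qed simp
    qed
    finally show ?thesis .
  qed
  have l2: "(\<lambda>n. LINT t|lborel. indicator {t. e n < \<bar>x - t\<bar>} t *\<^sub>R f t) \<longlonglongrightarrow> (LINT t|lborel. f t)"
  proof (rule integral_dominated_convergence[where w="\<lambda>t. cmod (f t)"])
    have "AE t in lborel. t \<noteq> x" by (rule AE_lborel_singleton)
    then show "AE t in lborel. (\<lambda>n. indicator {t. e n < \<bar>x - t\<bar>} t *\<^sub>R f t) \<longlonglongrightarrow> f t"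
    proof eventually_elim
      case (elim t)
      have "e \<longlonglongrightarrow> 0" unfolding e_def[abs_def] by (rule LIMSEQ_inverse_real_of_nat)
      then have "\<forall>\<^sub>F n in sequentially. e n < \<bar>x - t\<bar>" using elim by (intro order_tendstoD) auto
      then have "\<forall>\<^sub>F n in sequentially. indicator {t. e n < \<bar>x - t\<bar>} t *\<^sub>R f t = f t" by eventually_elim simp
      then show ?case by (rule tendsto_eventually)
    qed
    show "AE t in lborel. norm (indicator {t. e n < \<bar>x - t\<bar>} t *\<^sub>R f t) \<le> cmod (f t)" for n
      by (auto simp: indicator_def)
  qed (use f in auto)
  show ?case by (rule LIMSEQ_unique[OF l1[unfolded eq[OF e0]] l2])
qed

text \<open>Square-integrable Borel functions on \<open>(a, c)\<close>, extended by zero, so that functions for different \<open>c\<close> live in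
  the same space.\<close>

definition L2s :: "real \<Rightarrow> real \<Rightarrow> (real \<Rightarrow> complex) \<Rightarrow> bool" where
  "L2s a c f \<longleftrightarrow> sq f \<and> (\<forall>x. x \<notin> {a<..<c} \<longrightarrow> f x = 0)"

lemma L2s_sq: "L2s a c f \<Longrightarrow> sq f" by (simp add: L2s_def)

lemma L2s_measurable[measurable_dest]: "L2s a c f \<Longrightarrow> f \<in> borel_measurable borel"
  by (simp add: L2s_def sq_def)

lemma L2s_outside: "L2s a c f \<Longrightarrow> x \<notin> {a<..<c} \<Longrightarrow> f x = 0" by (simp add: L2s_def)

lemma L2s_integrable: assumes "L2s a c f" shows "integrable lborel f"
proof -
  have "integrable lborel (\<lambda>x. indicator {a<..<c} x * f x)"
  proof (intro sq_prod_integrable sq_indicator_bounded L2s_sq[OF assms])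
    show "emeasure lborel {a<..<c} < \<infinity>" by (rule emeasure_bounded_finite) simp
  qed simp
  moreover have "indicator {a<..<c} x * f x = f x" for x
    by (cases "x \<in> {a<..<c}") (simp_all add: L2s_outside[OF assms])
  ultimately show ?thesis by simp
qed

lemma L2s_mono: "L2s a c f \<Longrightarrow> c \<le> d \<Longrightarrow> L2s a d f"
  by (auto simp: L2s_def)

lemma L2s_zero[simp]: "L2s a c (\<lambda>x. 0)" by (simp add: L2s_def)

lemma L2s_add: "L2s a c f \<Longrightarrow> L2s a c g \<Longrightarrow> L2s a c (\<lambda>x. f x + g x)"
  by (auto simp: L2s_def sq_add)

lemma L2s_diff: "L2s a c f \<Longrightarrow> L2s a c g \<Longrightarrow> L2s a c (\<lambda>x. f x - g x)"
  by (auto simp: L2s_def sq_diff)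

lemma L2s_scale: "L2s a c f \<Longrightarrow> L2s a c (\<lambda>x. k * f x)"
  by (auto simp: L2s_def sq_scale)

lemma L2s_cnj: "L2s a c f \<Longrightarrow> L2s a c (\<lambda>x. cnj (f x))"
  by (auto simp: L2s_def sq_cnj)

lemma L2s_mult:
  assumes "L2s a c f" "h \<in> borel_measurable borel" "\<And>x. cmod (h x) \<le> B"
  shows "L2s a c (\<lambda>x. h x * f x)"
  using assms sq_mult_bounded[of f h B] by (auto simp: L2s_def)

lemma L2s_cut: "sq f \<Longrightarrow> L2s a c (\<lambda>x. indicator {a<..<c} x * f x)"
  by (auto simp: L2s_def sq_indicator)

lemma L2s_mult_var:
  assumes "L2s a c f"
  shows "L2s a c (\<lambda>x. of_real x * f x)"
proof -
  have "L2s a c (\<lambda>x. (indicator {a<..<c} x * of_real x) * f x)"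
  proof (rule L2s_mult[OF assms])
    show "cmod (indicator {a<..<c} x * of_real x) \<le> \<bar>a\<bar> + \<bar>c\<bar>" for x
      by (auto simp: indicator_def)
  qed simp
  moreover have "(indicator {a<..<c} x * of_real x) * f x = of_real x * f x" for x
    by (cases "x \<in> {a<..<c}") (simp_all add: L2s_outside[OF assms])
  ultimately show ?thesis by simp
qed

locale kernel_op =
  fixes a b :: real and \<phi> :: "real \<Rightarrow> complex" and B :: real
  assumes ab: "a < b" and phi_measurable[measurable]: "\<phi> \<in> borel_measurable borel"
    and phi_bound: "\<And>x. cmod (\<phi> x) \<le> B"
begin

definition S :: "(real \<Rightarrow> complex) \<Rightarrow> real \<Rightarrow> complex" where
  "S f x = f x + \<i> / (2 * of_real pi) *
     (\<phi> x * hilb (\<lambda>t. cnj (\<phi> t) * f t) x - cnj (\<phi> x) * hilb (\<lambda>t. \<phi> t * f t) x)"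

lemma B_nonneg: "0 \<le> B" using phi_bound[of 0] norm_ge_zero order_trans by blast

lemma cnj_phi_measurable[measurable]: "(\<lambda>x. cnj (\<phi> x)) \<in> borel_measurable borel"
  by (rule borel_measurable_continuous_on[OF continuous_on_cnj[OF continuous_on_id]]) simp

lemma mult_phi:
  assumes "L2s a b f"
  shows "L2s a b (\<lambda>t. \<phi> t * f t)" "L2s a b (\<lambda>t. cnj (\<phi> t) * f t)"
  using assms phi_bound by (auto intro!: L2s_mult)

lemmas good = L2s_integrable[OF mult_phi(1)] L2s_sq[OF mult_phi(1)] L2s_integrable[OF mult_phi(2)] L2s_sq[OF mult_phi(2)]

lemma S_measurable[measurable]: 
  assumes [measurable]: "f \<in> borel_measurable borel" 
  shows "S f \<in> borel_measurable borel"
  unfolding S_def[abs_def] by measurable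

lemma S_bounded:
  assumes f: "L2s a b f"
  shows "sq (S f)" "nrm (S f) \<le> (1 + B\<^sup>2) * nrm f"
proof -
  let ?p = "hilb (\<lambda>t. cnj (\<phi> t) * f t)" and ?q = "hilb (\<lambda>t. \<phi> t * f t)"
  have p: "sq ?p" "nrm ?p \<le> pi * (B * nrm f)"
  proof -
    show "sq ?p" using good[OF f] by (intro sq_hilb)
    have "nrm ?p \<le> pi * nrm (\<lambda>t. cnj (\<phi> t) * f t)" using good[OF f] by (intro nrm_hilb)
    also have "\<dots> \<le> pi * (B * nrm f)"
      using phi_bound by (intro mult_left_mono nrm_mult_bounded L2s_sq[OF f]) auto
    finally show "nrm ?p \<le> pi * (B * nrm f)" .
  qed
  have q: "sq ?q" "nrm ?q \<le> pi * (B * nrm f)"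
  proof -
    show "sq ?q" using good[OF f] by (intro sq_hilb)
    have "nrm ?q \<le> pi * nrm (\<lambda>t. \<phi> t * f t)" using good[OF f] by (intro nrm_hilb)
    also have "\<dots> \<le> pi * (B * nrm f)"
      using phi_bound by (intro mult_left_mono nrm_mult_bounded L2s_sq[OF f]) auto
    finally show "nrm ?q \<le> pi * (B * nrm f)" .
  qed
  have p': "sq (\<lambda>x. \<phi> x * ?p x)" "nrm (\<lambda>x. \<phi> x * ?p x) \<le> B * (pi * (B * nrm f))"
    using sq_mult_bounded[OF p(1) phi_measurable phi_bound] nrm_mult_bounded[OF p(1) phi_measurable phi_bound]
      mult_left_mono[OF p(2) B_nonneg] by auto
  have bc: "cmod (cnj (\<phi> x)) \<le> B" for x using phi_bound by simp
  have q': "sq (\<lambda>x. cnj (\<phi> x) * ?q x)" "nrm (\<lambda>x. cnj (\<phi> x) * ?q x) \<le> B * (pi * (B * nrm f))"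
    using sq_mult_bounded[OF q(1) cnj_phi_measurable bc] nrm_mult_bounded[OF q(1) cnj_phi_measurable bc]
      mult_left_mono[OF q(2) B_nonneg] by auto
  let ?d = "\<lambda>x. \<phi> x * ?p x + (- 1) * (cnj (\<phi> x) * ?q x)"
  have d: "sq ?d" by (intro sq_add sq_scale p' q')
  have dn: "nrm ?d \<le> B * (pi * (B * nrm f)) + B * (pi * (B * nrm f))"
  proof -
    have "nrm ?d \<le> nrm (\<lambda>x. \<phi> x * ?p x) + nrm (\<lambda>x. (- 1) * (cnj (\<phi> x) * ?q x))" by (intro nrm_triangle sq_scale p' q')
    also have "nrm (\<lambda>x. (- 1) * (cnj (\<phi> x) * ?q x)) = nrm (\<lambda>x. cnj (\<phi> x) * ?q x)" by (subst nrm_scale) simp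
    finally show ?thesis using p'(2) q'(2) by linarith
  qed
  have Seq: "S f = (\<lambda>x. f x + \<i> / (2 * of_real pi) * ?d x)" by (simp add: S_def[abs_def])
  show "sq (S f)" unfolding Seq by (intro sq_add sq_scale d L2s_sq[OF f])
  have "nrm (S f) \<le> nrm f + nrm (\<lambda>x. \<i> / (2 * of_real pi) * ?d x)"
    unfolding Seq by (intro nrm_triangle sq_scale d L2s_sq[OF f])
  also have "nrm (\<lambda>x. \<i> / (2 * of_real pi) * ?d x) = 1 / (2 * pi) * nrm ?d"
    by (subst nrm_scale) (simp add: norm_divide norm_mult)
  also have "\<dots> \<le> 1 / (2 * pi) * (B * (pi * (B * nrm f)) + B * (pi * (B * nrm f)))"
    by (intro mult_left_mono dn) auto
  also have "\<dots> = B\<^sup>2 * nrm f" by (simp add: power2_eq_square)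
  finally show "nrm (S f) \<le> (1 + B\<^sup>2) * nrm f" by (simp add: distrib_right)
qed

lemma S_add:
  assumes f: "L2s a b f" and g: "L2s a b g"
  shows "AE x in lborel. S (\<lambda>t. f t + g t) x = S f x + S g x"
  using hilb_add[OF good(1,2)[OF f] good(1,2)[OF g]] hilb_add[OF good(3,4)[OF f] good(3,4)[OF g]]
  by eventually_elim (simp add: S_def algebra_simps)

lemma S_scale:
  assumes f: "L2s a b f"
  shows "AE x in lborel. S (\<lambda>t. c * f t) x = c * S f x"
  using hilb_scale[OF good(1,2)[OF f], of c] hilb_scale[OF good(3,4)[OF f], of c]
  by eventually_elim (simp add: S_def algebra_simps)

lemma S_diff:
  assumes f: "L2s a b f" and g: "L2s a b g"
  shows "AE x in lborel. S (\<lambda>t. f t - g t) x = S f x - S g x"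
  using S_add[OF f L2s_scale[OF g, of "-1"]] S_scale[OF g, of "-1"] by eventually_elim simp

lemma S_cnj:
  assumes f: "L2s a b f"
  shows "AE x in lborel. S (\<lambda>t. cnj (f t)) x = cnj (S f x)"
  using hilb_cnj[OF good(1,2)[OF f]] hilb_cnj[OF good(3,4)[OF f]]
  by eventually_elim (simp add: S_def algebra_simps)

lemma S_symmetric:
  assumes f: "L2s a b f" and g: "L2s a b g"
  shows "(LINT x|lborel. S f x * g x) = (LINT x|lborel. f x * S g x)"
proof -
  have i: "integrable lborel (\<lambda>x. hilb (\<lambda>t. cnj (\<phi> t) * f t) x * (\<phi> x * g x))"
    "integrable lborel (\<lambda>x. hilb (\<lambda>t. \<phi> t * f t) x * (cnj (\<phi> x) * g x))"
    if "L2s a b f" "L2s a b g" for f g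
    using that by (auto intro!: sq_prod_integrable sq_hilb good)
  have fg: "integrable lborel (\<lambda>x. f x * g x)" using f g by (intro sq_prod_integrable L2s_sq)
  have expand: "(LINT x|lborel. S f x * g x) = (LINT x|lborel. f x * g x) + \<i> / (2 * of_real pi) *
     ((LINT x|lborel. hilb (\<lambda>t. cnj (\<phi> t) * f t) x * (\<phi> x * g x)) - (LINT x|lborel. hilb (\<lambda>t. \<phi> t * f t) x * (cnj (\<phi> x) * g x)))"
    if f: "L2s a b f" and g: "L2s a b g" for f g
  proof -
    have fg: "integrable lborel (\<lambda>x. f x * g x)" using f g by (intro sq_prod_integrable L2s_sq)
    have "(LINT x|lborel. S f x * g x) = (LINT x|lborel. f x * g x + \<i> / (2 * of_real pi) *
     (hilb (\<lambda>t. cnj (\<phi> t) * f t) x * (\<phi> x * g x) - hilb (\<lambda>t. \<phi> t * f t) x * (cnj (\<phi> x) * g x)))"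
      by (intro Bochner_Integration.integral_cong) (auto simp: S_def algebra_simps)
    then show ?thesis using fg i[OF f g] by simp
  qed
  have 1: "(LINT x|lborel. hilb (\<lambda>t. cnj (\<phi> t) * f t) x * (\<phi> x * g x)) = - (LINT x|lborel. hilb (\<lambda>t. \<phi> t * g t) x * (cnj (\<phi> x) * f x))"
    using hilb_antisymmetric[OF good(3,4)[OF f] good(1,2)[OF g]] by (simp add: mult.commute)
  have 2: "(LINT x|lborel. hilb (\<lambda>t. \<phi> t * f t) x * (cnj (\<phi> x) * g x)) = - (LINT x|lborel. hilb (\<lambda>t. cnj (\<phi> t) * g t) x * (\<phi> x * f x))"
    using hilb_antisymmetric[OF good(1,2)[OF f] good(3,4)[OF g]] by (simp add: mult.commute)
  have 3: "(LINT x|lborel. f x * S g x) = (LINT x|lborel. S g x * f x)" by (simp only: mult.commute)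
  have 4: "(LINT x|lborel. f x * g x) = (LINT x|lborel. g x * f x)" by (simp only: mult.commute)
  show ?thesis unfolding 3 expand[OF f g] expand[OF g f] 1 2 4 by simp
qed

lemma S_commutator:
  assumes f: "L2s a b f"
  shows "AE x in lborel. (of_real x - z) * S f x - S (\<lambda>t. (of_real t - z) * f t) x =
     \<i> / (2 * of_real pi) * (\<phi> x * (LINT t|lborel. cnj (\<phi> t) * f t) - cnj (\<phi> x) * (LINT t|lborel. \<phi> t * f t))"
proof -
  have comm: "AE x in lborel. (of_real x - z) * hilb h x - hilb (\<lambda>t. (of_real t - z) * h t) x = (LINT t|lborel. h t)"
    if h: "L2s a b h" for h
  proof -
    note g1 = L2s_integrable[OF h] L2s_sq[OF h]
    note g2 = L2s_integrable[OF L2s_mult_var[OF h]] L2s_sq[OF L2s_mult_var[OF h]]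
    note g3 = L2s_integrable[OF L2s_scale[OF h, of "- z"]] L2s_sq[OF L2s_scale[OF h, of "-z"]]
    have eq: "(\<lambda>t. of_real t * h t + - z * h t) = (\<lambda>t. (of_real t - z) * h t)" by (simp add: algebra_simps)
    show ?thesis using hilb_commutator[OF g1 g2] hilb_add[OF g2 g3] hilb_scale[OF g1, of "- z"]
      unfolding eq by eventually_elim (simp add: algebra_simps)
  qed
  have eq: "(of_real t - z) * (\<phi> t * f t) = \<phi> t * ((of_real t - z) * f t)"
    "(of_real t - z) * (cnj (\<phi> t) * f t) = cnj (\<phi> t) * ((of_real t - z) * f t)" for t by (simp_all add: ac_simps)
  show ?thesis using comm[OF mult_phi(1)[OF f]] comm[OF mult_phi(2)[OF f]] unfolding eq
  proof eventually_elim
    case (elim x)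
    have "(of_real x - z) * S f x - S (\<lambda>t. (of_real t - z) * f t) x = \<i> / (2 * of_real pi) *
      (\<phi> x * ((of_real x - z) * hilb (\<lambda>t. cnj (\<phi> t) * f t) x - hilb (\<lambda>t. cnj (\<phi> t) * ((of_real t - z) * f t)) x)
      - cnj (\<phi> x) * ((of_real x - z) * hilb (\<lambda>t. \<phi> t * f t) x - hilb (\<lambda>t. \<phi> t * ((of_real t - z) * f t)) x))"
    proof -
      have "w * (h + k * (p * P - q * Q)) - (w * h + k * (p * P' - q * Q')) = k * (p * (w * P - P') - q * (w * Q - Q'))"
        for w h k p q P Q P' Q' :: complex by (simp add: algebra_simps)
      then show ?thesis unfolding S_def by metis
    qed
    then show ?case unfolding elim .
  qed
qed

definition form :: "(real \<Rightarrow> complex) \<Rightarrow> (real \<Rightarrow> complex) \<Rightarrow> complex" where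
  "form f g = (LINT x|lborel. S f x * cnj (g x))"

text \<open>\<open>S\<close> is symmetric for the bilinear pairing and maps real functions to real functions.\<close>

lemma form_hermitian:
  assumes f: "L2s a b f" and g: "L2s a b g"
  shows "form f g = cnj (form g f)"
proof -
  have "form f g = (LINT x|lborel. f x * S (\<lambda>t. cnj (g t)) x)"
    unfolding form_def by (rule S_symmetric[OF f L2s_cnj[OF g]])
  also have "\<dots> = (LINT x|lborel. cnj (S g x * cnj (f x)))"
  proof (rule integral_cong_AE)
    show "AE x in lborel. f x * S (\<lambda>t. cnj (g t)) x = cnj (S g x * cnj (f x))"
      using S_cnj[OF g] by eventually_elim (simp add: mult.commute)
    have [measurable]: "f \<in> borel_measurable borel" "(\<lambda>t. cnj (g t)) \<in> borel_measurable borel" "g \<in> borel_measurable borel"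
      using f g L2s_cnj[OF g] by (auto intro: L2s_measurable)
    show "(\<lambda>x. f x * S (\<lambda>t. cnj (g t)) x) \<in> borel_measurable lborel" by measurable
    have "sq (S g)" "sq (\<lambda>x. cnj (f x))" using S_bounded(1)[OF g] sq_cnj[OF L2s_sq[OF f]] by auto
    then have "integrable lborel (\<lambda>x. cnj (S g x * cnj (f x)))" by (intro integrable_cnj sq_prod_integrable)
    then show "(\<lambda>x. cnj (S g x * cnj (f x))) \<in> borel_measurable lborel" by (rule borel_measurable_integrable)
  qed
  finally show ?thesis unfolding form_def Bochner_Integration.integral_cnj .
qed

lemma form_integrable: "L2s a b f \<Longrightarrow> L2s a b g \<Longrightarrow> integrable lborel (\<lambda>x. S f x * cnj (g x))"
  by (intro sq_prod_integrable S_bounded sq_cnj L2s_sq)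

lemma form_bound:
  assumes "L2s a b f" "L2s a b g"
  shows "cmod (form f g) \<le> (1 + B\<^sup>2) * nrm f * nrm g"
proof -
  have "cmod (form f g) \<le> nrm (S f) * nrm (\<lambda>x. cnj (g x))"
    unfolding form_def using assms by (intro Cauchy_Schwarz S_bounded sq_cnj L2s_sq)
  also have "\<dots> \<le> (1 + B\<^sup>2) * nrm f * nrm g"
    using S_bounded(2)[OF assms(1)] by (simp add: mult_right_mono)
  finally show ?thesis .
qed

text \<open>The quadratic polynomial whose nonnegativity yields coercivity.\<close>

lemma form_add_real:
  assumes f: "L2s a b f" and g: "L2s a b g"
  shows "form (\<lambda>x. f x + of_real t * g x) (\<lambda>x. f x + of_real t * g x) =
     form f f + of_real t * (form f g + form g f) + of_real (t\<^sup>2) * form g g"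
proof -
  note fg = L2s_scale[OF g, of "of_real t"]
  have [measurable]: "f \<in> borel_measurable borel" "g \<in> borel_measurable borel" using f g by (auto intro: L2s_measurable)
  have m: "sq (S (\<lambda>x. f x + of_real t * g x))" "sq (\<lambda>x. cnj (f x + of_real t * g x))"
    using S_bounded(1)[OF L2s_add[OF f fg]] sq_cnj[OF L2s_sq[OF L2s_add[OF f fg]]] by auto
  note ii = form_integrable[OF f f] form_integrable[OF f g] form_integrable[OF g f] form_integrable[OF g g]
  have "form (\<lambda>x. f x + of_real t * g x) (\<lambda>x. f x + of_real t * g x) =
    (LINT x|lborel. (S f x * cnj (f x) + of_real t * (S f x * cnj (g x) + S g x * cnj (f x))) + of_real (t\<^sup>2) * (S g x * cnj (g x)))"
    unfolding form_def
  proof (rule integral_cong_AE)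
    show "(\<lambda>x. S (\<lambda>x. f x + of_real t * g x) x * cnj (f x + of_real t * g x)) \<in> borel_measurable lborel"
      by (rule borel_measurable_integrable[OF sq_prod_integrable[OF m]])
    show "(\<lambda>x. (S f x * cnj (f x) + of_real t * (S f x * cnj (g x) + S g x * cnj (f x))) + of_real (t\<^sup>2) * (S g x * cnj (g x))) \<in> borel_measurable lborel"
      using ii by (intro borel_measurable_integrable[of lborel] Bochner_Integration.integrable_add integrable_mult_right)
    show "AE x in lborel. S (\<lambda>x. f x + of_real t * g x) x * cnj (f x + of_real t * g x) =
      (S f x * cnj (f x) + of_real t * (S f x * cnj (g x) + S g x * cnj (f x))) + of_real (t\<^sup>2) * (S g x * cnj (g x))"
      using S_add[OF f fg] S_scale[OF g, of "of_real t"]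
      by eventually_elim (simp add: algebra_simps power2_eq_square)
  qed
  then show ?thesis using ii unfolding form_def by simp
qed

end

locale coercive_kernel_op = kernel_op +
  fixes \<delta> :: real
  assumes delta_pos: "0 < \<delta>"
    and coercive: "\<And>f. L2s a b f \<Longrightarrow> \<delta> * (nrm f)\<^sup>2 \<le> Re (form f f)"
begin

text \<open>The bound is uniform in the right end point \<open>c\<close>: the restricted problem inherits the constant \<open>\<delta>\<close>.\<close>

lemma coercive_solution_bound:
  assumes f: "L2s a c f" "c \<le> b" and g: "sq g" and eq: "AE x in lborel. x \<in> {a<..<c} \<longrightarrow> S f x = g x"
  shows "\<delta> * nrm f \<le> nrm g"
proof -
  have fb: "L2s a b f" using f by (rule L2s_mono)
  have gm: "g \<in> borel_measurable borel" using g by (rule sq_measurable)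
  have "form f f = (LINT x|lborel. g x * cnj (f x))"
    unfolding form_def
  proof (rule integral_cong_AE)
    show "AE x in lborel. S f x * cnj (f x) = g x * cnj (f x)"
      using eq by eventually_elim (metis L2s_outside[OF f(1)] complex_cnj_zero mult_zero_right)
    show "(\<lambda>x. S f x * cnj (f x)) \<in> borel_measurable lborel"
      by (rule borel_measurable_integrable[OF form_integrable[OF fb fb]])
    show "(\<lambda>x. g x * cnj (f x)) \<in> borel_measurable lborel"
      by (rule borel_measurable_integrable[OF sq_prod_integrable[OF g sq_cnj[OF L2s_sq[OF fb]]]])
  qed
  then have "Re (form f f) \<le> nrm g * nrm f"
    using Cauchy_Schwarz[OF g sq_cnj[OF L2s_sq[OF fb]]] complex_Re_le_cmod[of "form f f"] by simp
  then have "\<delta> * nrm f * nrm f \<le> nrm g * nrm f" using coercive[OF fb] by (simp add: power2_eq_square)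
  then show ?thesis using nrm_nonneg[of f] by (cases "nrm f = 0") (auto simp: mult_le_cancel_right)
qed

lemma solution_unique:
  assumes f: "L2s a c f" and g: "L2s a c g" and c: "c \<le> b"
    and eq: "AE x in lborel. x \<in> {a<..<c} \<longrightarrow> S f x = S g x"
  shows "AE x in lborel. f x = g x"
proof -
  have d: "L2s a c (\<lambda>x. f x - g x)" using f g by (rule L2s_diff)
  have "AE x in lborel. x \<in> {a<..<c} \<longrightarrow> S (\<lambda>x. f x - g x) x = 0"
    using eq S_diff[OF L2s_mono[OF f c] L2s_mono[OF g c]] by eventually_elim simp
  from coercive_solution_bound[OF d c sq_zero this] have "\<delta> * nrm (\<lambda>x. f x - g x) \<le> 0" by (simp add: nrm_def)
  then have "nrm (\<lambda>x. f x - g x) \<le> 0" using delta_pos by (simp add: mult_le_0_iff)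
  then have "nrm (\<lambda>x. f x - g x) = 0" using nrm_nonneg[of "\<lambda>x. f x - g x"] by linarith
  then have "AE x in lborel. f x - g x = 0" by (rule nrm_eq_0[OF L2s_sq[OF d]])
  then show ?thesis by eventually_elim simp
qed

text \<open>For small \<open>k\<close> the map \<open>f \<mapsto> f - k (S f - g)\<close>, cut off to \<open>(a, c)\<close>, is a contraction, because
  \<open>|f - k S f|\<^sup>2 \<le> (1 - 2 k \<delta> + k\<^sup>2 M\<^sup>2) |f|\<^sup>2\<close>; the choice \<open>k = \<delta> / M\<^sup>2\<close> minimizes the factor.\<close>

theorem solution_exists:
  assumes c: "c \<le> b" and g: "sq g"
  obtains f where "L2s a c f" "AE x in lborel. x \<in> {a<..<c} \<longrightarrow> S f x = g x"
proof -
  define M where "M = 1 + B\<^sup>2"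
  have M: "0 < M" by (simp add: M_def add_pos_nonneg)
  define k where "k = \<delta> / M\<^sup>2"
  have k: "0 < k" using delta_pos M by (simp add: k_def)
  define q where "q = sqrt (max 0 (1 - \<delta>\<^sup>2 / M\<^sup>2))"
  have q0: "0 \<le> q" by (simp add: q_def)
  have q1: "q < 1"
  proof -
    have "0 < \<delta>\<^sup>2 / M\<^sup>2" using delta_pos M by simp
    then show ?thesis unfolding q_def real_sqrt_lt_1_iff by simp
  qed
  define T where "T f x = f x - of_real k * (indicator {a<..<c} x * S f x - indicator {a<..<c} x * g x)" for f x
  have T: "L2s a c (T f)" if "L2s a c f" for f
    unfolding T_def using that S_bounded(1)[OF L2s_mono[OF that c]] g
    by (intro L2s_diff L2s_scale L2s_cut)
  have contr0: "nrm (\<lambda>x. h x - of_real k * (indicator {a<..<c} x * S h x)) \<le> q * nrm h" if h: "L2s a c h" for h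
  proof -
    have hb: "L2s a b h" using h c by (rule L2s_mono)
    define H where "H x = indicator {a<..<c} x * S h x" for x
    have H: "sq H" unfolding H_def using S_bounded(1)[OF hb] by (intro sq_indicator) auto
    have Hn: "nrm H \<le> M * nrm h"
    proof -
      have "nrm H \<le> 1 * nrm (S h)" unfolding H_def
        using S_bounded(1)[OF hb] by (intro nrm_mult_bounded) (auto simp: indicator_def)
      then show ?thesis using S_bounded(2)[OF hb] by (simp add: M_def)
    qed
    have Hh: "(LINT x|lborel. H x * cnj (h x)) = form h h"
      unfolding form_def H_def
    proof (rule Bochner_Integration.integral_cong[OF refl])
      fix x show "indicator {a<..<c} x * S h x * cnj (h x) = S h x * cnj (h x)"
        by (cases "x \<in> {a<..<c}") (simp_all add: L2s_outside[OF h])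
    qed
    have iH: "integrable lborel (\<lambda>x. H x * cnj (h x))" by (intro sq_prod_integrable H sq_cnj L2s_sq[OF h])
    have "(nrm (\<lambda>x. h x - of_real k * H x))\<^sup>2 = (LINT x|lborel. (cmod (h x))\<^sup>2 - 2 * k * Re (H x * cnj (h x)) + k\<^sup>2 * (cmod (H x))\<^sup>2)"
      unfolding nrm_sq
    proof (rule Bochner_Integration.integral_cong[OF refl])
      fix x
      show "(cmod (h x - of_real k * H x))\<^sup>2 = (cmod (h x))\<^sup>2 - 2 * k * Re (H x * cnj (h x)) + k\<^sup>2 * (cmod (H x))\<^sup>2"
        unfolding cmod_power2 by (simp add: power2_eq_square algebra_simps)
    qed
    also have "\<dots> = (nrm h)\<^sup>2 - 2 * k * Re (form h h) + k\<^sup>2 * (nrm H)\<^sup>2"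
    proof -
      have iR: "integrable lborel (\<lambda>x. Re (H x * cnj (h x)))" using iH by (rule integrable_Re)
      have "(LINT x|lborel. Re (H x * cnj (h x))) = Re (form h h)" unfolding integral_Re[OF iH] Hh ..
      moreover have "(LINT x|lborel. (cmod (h x))\<^sup>2 - 2 * k * Re (H x * cnj (h x)) + k\<^sup>2 * (cmod (H x))\<^sup>2) =
        (LINT x|lborel. (cmod (h x))\<^sup>2) - 2 * k * (LINT x|lborel. Re (H x * cnj (h x))) + k\<^sup>2 * (LINT x|lborel. (cmod (H x))\<^sup>2)"
        by (simp only: Bochner_Integration.integral_add Bochner_Integration.integral_diff integral_mult_right_zero
            Bochner_Integration.integrable_diff integrable_mult_right iR sq_integrable[OF L2s_sq[OF h]] sq_integrable[OF H])
      ultimately show ?thesis by (simp only: nrm_sq)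
    qed
    also have "\<dots> \<le> (nrm h)\<^sup>2 - 2 * k * (\<delta> * (nrm h)\<^sup>2) + k\<^sup>2 * (M * nrm h)\<^sup>2"
      using coercive[OF hb] k Hn by (intro add_mono diff_mono mult_left_mono power_mono) auto
    also have "\<dots> = (1 - \<delta>\<^sup>2 / M\<^sup>2) * (nrm h)\<^sup>2"
      using M by (simp add: k_def power_mult_distrib power_divide power2_eq_square field_simps)
    also have "\<dots> \<le> q\<^sup>2 * (nrm h)\<^sup>2" by (intro mult_right_mono) (auto simp: q_def)
    finally have "(nrm (\<lambda>x. h x - of_real k * H x))\<^sup>2 \<le> (q * nrm h)\<^sup>2" by (simp add: power_mult_distrib)
    then show ?thesis unfolding H_def by (rule power2_le_imp_le) (simp add: q0)
  qed
  have contr: "nrm (\<lambda>x. T f x - T h x) \<le> q * nrm (\<lambda>x. f x - h x)" if f: "L2s a c f" and h: "L2s a c h" for f h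
  proof -
    have fb: "L2s a b f" and hb: "L2s a b h" using f h c by (auto intro: L2s_mono)
    have d: "L2s a c (\<lambda>x. f x - h x)" by (rule L2s_diff[OF f h])
    have "nrm (\<lambda>x. T f x - T h x) = nrm (\<lambda>x. (f x - h x) - of_real k * (indicator {a<..<c} x * S (\<lambda>x. f x - h x) x))"
    proof (rule nrm_cong_AE)
      show "AE x in lborel. T f x - T h x = (f x - h x) - of_real k * (indicator {a<..<c} x * S (\<lambda>x. f x - h x) x)"
        using S_diff[OF fb hb]
      proof eventually_elim
        case (elim x)
        show ?case unfolding T_def elim by (simp add: algebra_simps)
      qed
      show "(\<lambda>x. T f x - T h x) \<in> borel_measurable borel"
        using L2s_diff[OF T[OF f] T[OF h]] by (rule L2s_measurable)
      show "(\<lambda>x. (f x - h x) - of_real k * (indicator {a<..<c} x * S (\<lambda>x. f x - h x) x)) \<in> borel_measurable borel"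
        using L2s_diff[OF d L2s_scale[OF L2s_cut[OF S_bounded(1)[OF L2s_mono[OF d c]]]]] by (rule L2s_measurable)
    qed
    then show ?thesis using contr0[OF d] by simp
  qed
  define X where "X n = (T ^^ n) (\<lambda>x. 0)" for n
  have X0: "X 0 = (\<lambda>x. 0)" and XS: "X (Suc n) = T (X n)" for n by (simp_all add: X_def)
  have X: "L2s a c (X n)" for n by (induction n) (auto simp: X0 XS T)
  define D where "D = nrm (X 1)"
  have Xb: "nrm (X n) \<le> D / (1 - q)" for n
  proof (induction n)
    case 0 then show ?case using q1 by (simp add: X0 nrm_def D_def)
  next
    case (Suc n)
    have "nrm (X (Suc n)) = nrm (\<lambda>x. (T (X n) x - T (X 0) x) + X 1 x)" by (simp add: XS)
    also have "\<dots> \<le> nrm (\<lambda>x. T (X n) x - T (X 0) x) + nrm (X 1)"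
      by (intro nrm_triangle sq_diff L2s_sq[OF T] X L2s_sq[OF X])
    also have "\<dots> \<le> q * nrm (\<lambda>x. X n x - X 0 x) + D" using contr[OF X X, of n 0] by (simp add: D_def)
    also have "\<dots> \<le> q * (D / (1 - q)) + D" using Suc q0 by (intro add_right_mono mult_left_mono) (simp_all add: X0)
    also have "\<dots> = D / (1 - q)" using q1 by (simp add: field_simps)
    finally show ?case .
  qed
  have Xd: "nrm (\<lambda>x. X (n + j) x - X n x) \<le> q ^ n * (D / (1 - q))" for n j
  proof (induction n)
    case 0 then show ?case using Xb[of j] by (simp add: X0)
  next
    case (Suc n)
    have "nrm (\<lambda>x. X (Suc n + j) x - X (Suc n) x) \<le> q * nrm (\<lambda>x. X (n + j) x - X n x)"
      using contr[OF X X, of "n + j" n] by (simp add: XS)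
    also have "\<dots> \<le> q * (q ^ n * (D / (1 - q)))" by (intro mult_left_mono Suc q0)
    finally show ?case by simp
  qed
  have qlim: "(\<lambda>n. q ^ n * (D / (1 - q))) \<longlonglongrightarrow> 0"
    using tendsto_mult[OF LIMSEQ_realpow_zero[OF q0 q1] tendsto_const[of "D / (1 - q)"]] by simp
  obtain f0 where f0: "sq f0" "(\<lambda>n. nrm (\<lambda>x. X n x - f0 x)) \<longlonglongrightarrow> 0"
  proof (rule Riesz_Fischer[of X])
    show "sq (X n)" for n using X by (rule L2s_sq)
    fix e :: real assume e: "0 < e"
    have "\<forall>\<^sub>F n in sequentially. q ^ n * (D / (1 - q)) < e" using e by (intro order_tendstoD[OF qlim]) auto
    then obtain N where N: "\<And>n. N \<le> n \<Longrightarrow> q ^ n * (D / (1 - q)) < e" by (auto simp: eventually_sequentially)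
    have *: "nrm (\<lambda>x. X m x - X n x) \<le> e" if "N \<le> n" "n \<le> m" for m n
      using Xd[of n "m - n"] N[OF that(1)] that(2) by simp
    show "\<exists>N. \<forall>m\<ge>N. \<forall>n\<ge>N. nrm (\<lambda>x. X m x - X n x) \<le> e"
    proof (intro exI allI impI)
      fix m n assume "N \<le> m" "N \<le> n"
      then show "nrm (\<lambda>x. X m x - X n x) \<le> e"
        using *[of n m] *[of m n] nrm_minus_commute[of "X m" "X n"] by (cases "n \<le> m") auto
    qed
  qed
  define f where "f x = indicator {a<..<c} x * f0 x" for x
  have f: "L2s a c f" unfolding f_def using f0(1) by (rule L2s_cut)
  have flim: "(\<lambda>n. nrm (\<lambda>x. X n x - f x)) \<longlonglongrightarrow> 0"
  proof (rule real_tendsto_sandwich[OF _ _ tendsto_const f0(2)])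
    show "\<forall>\<^sub>F n in sequentially. nrm (\<lambda>x. X n x - f x) \<le> nrm (\<lambda>x. X n x - f0 x)"
    proof (intro always_eventually allI)
      fix n
      have "nrm (\<lambda>x. indicator {a<..<c} x * (X n x - f0 x)) \<le> 1 * nrm (\<lambda>x. X n x - f0 x)"
        using X f0(1) by (intro nrm_mult_bounded sq_diff L2s_sq[OF X]) (auto simp: indicator_def)
      moreover have "indicator {a<..<c} x * (X n x - f0 x) = X n x - f x" for x
        by (cases "x \<in> {a<..<c}") (simp_all add: f_def L2s_outside[OF X])
      ultimately show "nrm (\<lambda>x. X n x - f x) \<le> nrm (\<lambda>x. X n x - f0 x)" by simp
    qed
  qed simp
  have "nrm (\<lambda>x. T f x - f x) \<le> 0"
  proof (rule LIMSEQ_le_const)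
    show "(\<lambda>n. q * nrm (\<lambda>x. X n x - f x) + nrm (\<lambda>x. X (Suc n) x - f x)) \<longlonglongrightarrow> 0"
      using tendsto_add[OF tendsto_mult[OF tendsto_const[of q] flim] LIMSEQ_Suc[OF flim]] by simp
    show "\<exists>N. \<forall>n\<ge>N. nrm (\<lambda>x. T f x - f x) \<le> q * nrm (\<lambda>x. X n x - f x) + nrm (\<lambda>x. X (Suc n) x - f x)"
    proof (intro exI allI impI)
      fix n
      have "nrm (\<lambda>x. T f x - f x) \<le> nrm (\<lambda>x. T f x - X (Suc n) x) + nrm (\<lambda>x. X (Suc n) x - f x)"
        by (intro nrm_triangle3 L2s_sq[OF T] f L2s_sq[OF X] L2s_sq[OF f])
      also have "nrm (\<lambda>x. T f x - X (Suc n) x) \<le> q * nrm (\<lambda>x. f x - X n x)"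
        using contr[OF f X, of n] by (simp add: XS)
      also have "nrm (\<lambda>x. f x - X n x) = nrm (\<lambda>x. X n x - f x)" by (rule nrm_minus_commute)
      finally show "nrm (\<lambda>x. T f x - f x) \<le> q * nrm (\<lambda>x. X n x - f x) + nrm (\<lambda>x. X (Suc n) x - f x)" by simp
    qed
  qed
  then have "nrm (\<lambda>x. T f x - f x) = 0" using nrm_nonneg[of "\<lambda>x. T f x - f x"] by linarith
  then have "AE x in lborel. T f x - f x = 0" by (rule nrm_eq_0[OF sq_diff[OF L2s_sq[OF T[OF f]] L2s_sq[OF f]]])
  then have "AE x in lborel. x \<in> {a<..<c} \<longrightarrow> S f x = g x"
    by eventually_elim (use k in \<open>auto simp: T_def\<close>)
  with f show thesis by (rule that)
qed

end

section \<open>The resolvent matrix of the truncated operators\<close>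

lemma pair_cong:
  assumes f: "L2s a c f" and p: "sq p" and q: "sq q" and eq: "AE x in lborel. x \<in> {a<..<c} \<longrightarrow> p x = q x"
  shows "(LINT x|lborel. p x * f x) = (LINT x|lborel. q x * f x)"
proof (rule integral_cong_AE)
  show "AE x in lborel. p x * f x = q x * f x"
    using eq by eventually_elim (metis L2s_outside[OF f] mult_zero_right)
qed (rule borel_measurable_integrable[OF sq_prod_integrable], rule p q, rule L2s_sq[OF f])+

text \<open>Absolute continuity of the integral, at one point \<open>c\<close>.\<close>

lemma small_interval_nrm:
  assumes H: "sq H" and e: "0 < e"
  obtains r where "0 < r" "\<And>A. A \<in> sets borel \<Longrightarrow> A \<subseteq> {c - r<..<c + r} \<Longrightarrow> nrm (\<lambda>x. indicator A x * H x) < e"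
proof -
  have [measurable]: "H \<in> borel_measurable borel" using H by (rule sq_measurable)
  define I where "I n = {c - inverse (real (Suc n))<..<c + inverse (real (Suc n))}" for n
  have "(\<lambda>n. LINT x|lborel. (cmod (indicator (I n) x * H x))\<^sup>2) \<longlonglongrightarrow> (LINT x|(lborel :: real measure). 0)"
  proof (rule integral_dominated_convergence[where w="\<lambda>x. (cmod (H x))\<^sup>2"])
    have "AE x in lborel. x \<noteq> c" by (rule AE_lborel_singleton)
    then show "AE x in lborel. (\<lambda>n. (cmod (indicator (I n) x * H x))\<^sup>2) \<longlonglongrightarrow> 0"
    proof eventually_elim
      case (elim x)
      have "\<forall>\<^sub>F n in sequentially. inverse (real (Suc n)) < \<bar>x - c\<bar>"
        using elim by (intro order_tendstoD[OF LIMSEQ_inverse_real_of_nat]) auto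
      then have "\<forall>\<^sub>F n in sequentially. (cmod (indicator (I n) x * H x))\<^sup>2 = 0"
        by eventually_elim (auto simp: I_def indicator_def)
      then show ?case by (rule tendsto_eventually)
    qed
    show "AE x in lborel. norm ((cmod (indicator (I n) x * H x))\<^sup>2) \<le> (cmod (H x))\<^sup>2" for n
      by (auto simp: indicator_def)
    show "(\<lambda>x. (cmod (indicator (I n) x * H x))\<^sup>2) \<in> borel_measurable lborel" for n
      unfolding I_def by measurable
  qed (use sq_integrable[OF H] in auto)
  then have "\<forall>\<^sub>F n in sequentially. (LINT x|lborel. (cmod (indicator (I n) x * H x))\<^sup>2) < e\<^sup>2"
    using e by (intro order_tendstoD) auto
  then obtain n where n: "(LINT x|lborel. (cmod (indicator (I n) x * H x))\<^sup>2) < e\<^sup>2" by (auto simp: eventually_sequentially)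
  have In: "nrm (\<lambda>x. indicator (I n) x * H x) < e"
    using n e unfolding nrm_def by (intro real_less_lsqrt) auto
  show thesis
  proof (rule that[of "inverse (real (Suc n))"])
    fix A assume A: "A \<in> sets borel" "A \<subseteq> {c - inverse (real (Suc n))<..<c + inverse (real (Suc n))}"
    have "nrm (\<lambda>x. indicator A x * (indicator (I n) x * H x)) \<le> 1 * nrm (\<lambda>x. indicator (I n) x * H x)"
      using A by (intro nrm_mult_bounded sq_indicator H) (auto simp: I_def indicator_def)
    moreover have "indicator A x * (indicator (I n) x * H x) = indicator A x * H x" for x
      using A(2) by (auto simp: indicator_def I_def)
    ultimately show "nrm (\<lambda>x. indicator A x * H x) < e" using In by simp
  qed simp
qed

lemma mscale_mult_left: "mscale c A ** B = mscale c (A ** B)"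
  by (simp add: vec_eq_iff mscale_def matrix_matrix_mult_def sum_distrib_left mult.assoc)

lemma mscale_mult_right: "A ** mscale c B = mscale c (A ** B)"
  by (simp add: vec_eq_iff mscale_def matrix_matrix_mult_def sum_distrib_left mult.left_commute)

lemma mscale_add: "mscale c (A + B) = mscale c A + mscale c B"
  by (simp add: vec_eq_iff mscale_def distrib_left)

lemma mscale_mscale: "mscale c (mscale d A) = mscale (c * d) A"
  by (simp add: vec_eq_iff mscale_def mult.assoc)

lemma mscale_minus: "mscale (- c) A = - mscale c A"
  by (simp add: vec_eq_iff mscale_def)

lemma mscale_diff: "mscale c (A - B) = mscale c A - mscale c B"
  by (simp add: vec_eq_iff mscale_def right_diff_distrib)

lemma Jmat_mult_nth: "(Jmat ** A) $ i $ j = (if i = 1 then - 1 else 1) * A $ i $ j"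
  using exhaust_2[of i] by (auto simp: matrix_matrix_mult_def sum_2 Jmat_def vector_2)

context coercive_kernel_op
begin

definition Fc :: "2 \<Rightarrow> real \<Rightarrow> complex" where
  "Fc i x = indicator {a<..<b} x * F1 \<phi> x $ i"

lemma F1_nth: "F1 \<phi> x $ 1 = \<phi> x" "F1 \<phi> x $ 2 = - cnj (\<phi> x)"
  by (simp_all add: F1_def vector_2)

lemma L2s_Fc: "L2s a b (Fc i)"
proof -
  have m: "(\<lambda>x. F1 \<phi> x $ i) \<in> borel_measurable borel" and le: "cmod (F1 \<phi> x $ i) \<le> B" for x
    using exhaust_2[of i] phi_bound by (auto simp: F1_nth)
  have "emeasure lborel {a<..<b} < \<infinity>" by (rule emeasure_bounded_finite) simp
  then have "sq (indicator {a<..<b})" by (intro sq_indicator_bounded) auto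
  then have "sq (\<lambda>x. F1 \<phi> x $ i * indicator {a<..<b} x)" using m le by (rule sq_mult_bounded)
  moreover have "(\<lambda>x. F1 \<phi> x $ i * indicator {a<..<b} x) = Fc i" by (simp add: fun_eq_iff Fc_def)
  ultimately have "sq (Fc i)" by simp
  then show ?thesis by (auto simp: L2s_def Fc_def)
qed

lemma Fc_bound: "cmod (Fc i x) \<le> B"
  using exhaust_2[of i] phi_bound[of x] B_nonneg by (auto simp: Fc_def F1_nth indicator_def)

text \<open>The solution of the equation cut off at \<open>c\<close>; at \<open>c = a\<close> it is the zero function.\<close>

definition u :: "real \<Rightarrow> 2 \<Rightarrow> real \<Rightarrow> complex" where
  "u c i = (SOME f. L2s a c f \<and> (AE x in lborel. x \<in> {a<..<c} \<longrightarrow> S f x = Fc i x))"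

definition v :: "real \<Rightarrow> 2 \<Rightarrow> real \<Rightarrow> complex" where
  "v c i x = cnj (u c i x)"

definition Gc :: "2 \<Rightarrow> real \<Rightarrow> complex" where
  "Gc i x = cnj (Fc i x)"

lemma u_props:
  assumes "c \<le> b"
  shows "L2s a c (u c i)" "AE x in lborel. x \<in> {a<..<c} \<longrightarrow> S (u c i) x = Fc i x"
proof -
  have "\<exists>f. L2s a c f \<and> (AE x in lborel. x \<in> {a<..<c} \<longrightarrow> S f x = Fc i x)"
    using solution_exists[OF assms L2s_sq[OF L2s_Fc[of i]]] by metis
  from someI_ex[OF this] show "L2s a c (u c i)" "AE x in lborel. x \<in> {a<..<c} \<longrightarrow> S (u c i) x = Fc i x"
    by (auto simp: u_def)
qed

lemma L2s_Gc: "L2s a b (Gc i)" unfolding Gc_def[abs_def] by (rule L2s_cnj[OF L2s_Fc])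

lemma v_props:
  assumes "c \<le> b"
  shows "L2s a c (v c i)" "AE x in lborel. x \<in> {a<..<c} \<longrightarrow> S (v c i) x = Gc i x"
proof -
  show "L2s a c (v c i)" unfolding v_def[abs_def] by (rule L2s_cnj[OF u_props(1)[OF assms]])
  show "AE x in lborel. x \<in> {a<..<c} \<longrightarrow> S (v c i) x = Gc i x"
    using u_props(2)[OF assms, of i] S_cnj[OF L2s_mono[OF u_props(1)[OF assms] assms], of i]
    by eventually_elim (simp add: v_def[abs_def] Gc_def)
qed

lemma u_at_a: "u a i = (\<lambda>x. 0)"
  using L2s_outside[OF u_props(1)] ab by (auto simp: fun_eq_iff)

text \<open>A bound for the norms of all the solutions, uniform in the end point.\<close>

definition U :: real where "U = (nrm (Fc 1) + nrm (Fc 2)) / \<delta>"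

lemma U_nonneg: "0 \<le> U" using delta_pos by (simp add: U_def)

lemma u_bound: assumes "c \<le> b" shows "nrm (u c i) \<le> U"
proof -
  have "\<delta> * nrm (u c i) \<le> nrm (Fc i)"
    using coercive_solution_bound[OF u_props(1)[OF assms] assms L2s_sq[OF L2s_Fc] u_props(2)[OF assms]] .
  also have "\<dots> \<le> nrm (Fc 1) + nrm (Fc 2)" using exhaust_2[of i] by auto
  finally show ?thesis using delta_pos by (simp add: U_def field_simps)
qed

lemma v_bound: "c \<le> b \<Longrightarrow> nrm (v c i) \<le> U"
  using u_bound[of c i] by (simp add: v_def[abs_def])

text \<open>The entries of \<open>2 \<pi> \<sigma>\<^sub>1\<close>.\<close>

definition sig :: "real \<Rightarrow> 2 \<Rightarrow> 2 \<Rightarrow> complex" where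
  "sig c i j = (LINT x|lborel. Fc i x * v c j x)"

definition w :: "real \<Rightarrow> real \<Rightarrow> 2 \<Rightarrow> real \<Rightarrow> complex" where
  "w c1 c2 i x = u c2 i x - u c1 i x"

lemma sig_sym:
  assumes "c \<le> b"
  shows "sig c i j = (LINT x|lborel. u c i x * Gc j x)"
proof -
  have ub: "L2s a b (u c i)" and vb: "L2s a b (v c j)"
    using u_props(1)[OF assms] v_props(1)[OF assms] assms by (auto intro: L2s_mono)
  have "sig c i j = (LINT x|lborel. S (u c i) x * v c j x)"
    unfolding sig_def using u_props(2)[OF assms, of i]
    by (intro pair_cong[OF v_props(1)[OF assms]] S_bounded L2s_sq[OF L2s_Fc] ub) auto
  also have "\<dots> = (LINT x|lborel. u c i x * S (v c j) x)" by (rule S_symmetric[OF ub vb])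
  also have "\<dots> = (LINT x|lborel. S (v c j) x * u c i x)" by (simp only: mult.commute)
  also have "\<dots> = (LINT x|lborel. Gc j x * u c i x)"
    by (rule pair_cong[OF u_props(1)[OF assms] S_bounded(1)[OF vb] L2s_sq[OF L2s_Gc] v_props(2)[OF assms]])
  also have "\<dots> = (LINT x|lborel. u c i x * Gc j x)" by (simp only: mult.commute)
  finally show ?thesis .
qed

text \<open>The image \<open>S w\<close> vanishes on \<open>(a, c1)\<close>, where both functions solve the same equation, and beyond \<open>c1\<close> the function
  \<open>v c2\<close> is the conjugate of \<open>w\<close>. So all integrals below are concentrated on \<open>(c1, c2)\<close>.\<close>

lemma w_props:
  assumes "c1 \<le> c2" "c2 \<le> b"
  shows "L2s a c2 (w c1 c2 i)" "L2s a b (w c1 c2 i)"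
    "AE x in lborel. x \<in> {a<..<c1} \<longrightarrow> S (w c1 c2 i) x = 0"
    "AE x in lborel. S (w c1 c2 i) x = S (u c2 i) x - S (u c1 i) x"
    "AE x in lborel. S (w c1 c2 i) x * v c2 k x = S (w c1 c2 i) x * cnj (w c1 c2 k x)"
proof -
  have c1: "c1 \<le> b" using assms by simp
  note u1 = u_props[OF c1] and u2 = u_props[OF assms(2)]
  show L: "L2s a c2 (w c1 c2 i)" unfolding w_def[abs_def]
    using u2(1) L2s_mono[OF u1(1) assms(1)] by (rule L2s_diff)
  then show "L2s a b (w c1 c2 i)" using assms(2) by (rule L2s_mono)
  show eq: "AE x in lborel. S (w c1 c2 i) x = S (u c2 i) x - S (u c1 i) x"
    unfolding w_def[abs_def] by (rule S_diff[OF L2s_mono[OF u2(1) assms(2)] L2s_mono[OF u1(1) c1]])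
  show z: "AE x in lborel. x \<in> {a<..<c1} \<longrightarrow> S (w c1 c2 i) x = 0"
    using eq u1(2)[of i] u2(2)[of i] by eventually_elim (use assms in auto)
  show "AE x in lborel. S (w c1 c2 i) x * v c2 k x = S (w c1 c2 i) x * cnj (w c1 c2 k x)"
    using z
  proof eventually_elim
    case (elim x)
    then show ?case using L2s_outside[OF u1(1), of x k] by (cases "x \<in> {a<..<c1}") (auto simp: w_def v_def)
  qed
qed

text \<open>By symmetry of \<open>S\<close> the equation for \<open>v c2\<close> can be moved to \<open>w\<close>; the second form shows that the increments of \<open>\<sigma>\<^sub>1\<close>
  are positive semidefinite.\<close>

lemma sig_diff:
  assumes "c1 \<le> c2" "c2 \<le> b"
  shows "sig c2 i k - sig c1 i k = (LINT x|lborel. S (w c1 c2 i) x * v c2 k x)"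
    and "sig c2 i k - sig c1 i k = form (w c1 c2 i) (w c1 c2 k)"
proof -
  have c1: "c1 \<le> b" using assms by simp
  have int: "integrable lborel (\<lambda>x. u c i x * Gc k x)" if "c \<le> b" for c
    by (intro sq_prod_integrable L2s_sq[OF u_props(1)[OF that]] L2s_sq[OF L2s_Gc])
  note W = w_props[OF assms]
  have vb: "L2s a b (v c2 k)" using v_props(1)[OF assms(2)] assms(2) by (rule L2s_mono)
  have "sig c2 i k - sig c1 i k = (LINT x|lborel. Gc k x * w c1 c2 i x)"
    unfolding sig_sym[OF assms(2)] sig_sym[OF c1] w_def using int[OF assms(2)] int[OF c1]
    by (simp add: right_diff_distrib mult.commute)
  also have "\<dots> = (LINT x|lborel. S (v c2 k) x * w c1 c2 i x)"
    using v_props(2)[OF assms(2), of k]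
    by (intro pair_cong[OF W(1)] S_bounded(1)[OF vb] L2s_sq[OF L2s_Gc]) auto
  also have "\<dots> = (LINT x|lborel. v c2 k x * S (w c1 c2 i) x)" by (rule S_symmetric[OF vb W(2)])
  also have "\<dots> = (LINT x|lborel. S (w c1 c2 i) x * v c2 k x)" by (simp only: mult.commute)
  finally show 1: "sig c2 i k - sig c1 i k = (LINT x|lborel. S (w c1 c2 i) x * v c2 k x)" .
  also have "\<dots> = form (w c1 c2 i) (w c1 c2 k)"
    unfolding form_def
    by (rule integral_cong_AE[OF _ _ W(5)])
      (intro borel_measurable_integrable[OF form_integrable] borel_measurable_integrable[OF sq_prod_integrable] W(2) S_bounded(1)[OF W(2)] L2s_sq[OF vb])+
  finally show "sig c2 i k - sig c1 i k = form (w c1 c2 i) (w c1 c2 k)" .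
qed

text \<open>The trace of \<open>2 \<pi> \<sigma>\<^sub>1\<close>, which dominates all increments.\<close>

definition s :: "real \<Rightarrow> real" where "s c = Re (sig c 1 1) + Re (sig c 2 2)"

lemma s_diff_ge:
  assumes "c1 \<le> c2" "c2 \<le> b"
  shows "\<delta> * ((nrm (w c1 c2 1))\<^sup>2 + (nrm (w c1 c2 2))\<^sup>2) \<le> s c2 - s c1"
  using coercive[OF w_props(2)[OF assms], of 1] coercive[OF w_props(2)[OF assms], of 2]
    arg_cong[OF sig_diff(2)[OF assms, of 1 1], of Re] arg_cong[OF sig_diff(2)[OF assms, of 2 2], of Re]
  by (simp add: s_def distrib_left)

lemma s_mono: "c1 \<le> c2 \<Longrightarrow> c2 \<le> b \<Longrightarrow> s c1 \<le> s c2"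
  using s_diff_ge[of c1 c2] delta_pos by (smt (verit) mult_nonneg_nonneg zero_le_power2)

lemma w_nrm_prod:
  assumes "c1 \<le> c2" "c2 \<le> b"
  shows "nrm (w c1 c2 i) * nrm (w c1 c2 k) \<le> (s c2 - s c1) / \<delta>"
proof -
  let ?n = "\<lambda>i. nrm (w c1 c2 i)"
  have n: "?n i \<in> {?n 1, ?n 2}" for i using exhaust_2[of i] by auto
  have "?n i * ?n k \<le> (?n 1)\<^sup>2 + (?n 2)\<^sup>2"
  proof -
    have "2 * (?n i * ?n k) \<le> (?n i)\<^sup>2 + (?n k)\<^sup>2" using sum_squares_bound[of "?n i" "?n k"] by (simp only: mult.assoc)
    moreover have T: "(?n j)\<^sup>2 \<le> (?n 1)\<^sup>2 + (?n 2)\<^sup>2" for j using exhaust_2[of j] by auto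
    ultimately show ?thesis using T[of i] T[of k] by linarith
  qed
  also have "\<dots> \<le> (s c2 - s c1) / \<delta>"
    using s_diff_ge[OF assms] delta_pos by (simp add: pos_le_divide_eq mult.commute)
  finally show ?thesis .
qed

lemma sig_diff_bound:
  assumes "c1 \<le> c2" "c2 \<le> b"
  shows "cmod (sig c2 i k - sig c1 i k) \<le> (1 + B\<^sup>2) / \<delta> * (s c2 - s c1)"
proof -
  have "cmod (sig c2 i k - sig c1 i k) \<le> (1 + B\<^sup>2) * (nrm (w c1 c2 i) * nrm (w c1 c2 k))"
    unfolding sig_diff(2)[OF assms] using form_bound[OF w_props(2)[OF assms] w_props(2)[OF assms], of i k] by (simp only: mult.assoc)
  also have "\<dots> \<le> (1 + B\<^sup>2) * ((s c2 - s c1) / \<delta>)"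
    by (intro mult_left_mono w_nrm_prod assms) auto
  finally show ?thesis by simp
qed

text \<open>An increment is an integral over \<open>(c1, c2)\<close> of a product of two factors, one of which can be chosen to belong to the
  fixed end point; its norm on the short interval is small, and the other factor is bounded.\<close>

lemma s_continuous: "continuous_on {a..b} s"
proof -
  have le: "s c2 - s c1 \<le> E + E"
    if c: "c1 \<le> c2" "c2 \<le> b" and E: "\<And>i. cmod (LINT x|lborel. S (w c1 c2 i) x * v c2 i x) \<le> E" for c1 c2 E
  proof -
    have "Re (sig c2 i i - sig c1 i i) \<le> E" for i
      unfolding sig_diff(1)[OF c] by (rule order_trans[OF complex_Re_le_cmod E])
    from this[of 1] this[of 2] show ?thesis by (simp add: s_def)
  qed
  have wn: "nrm (w c1 c2 i) \<le> 2 * U" if c: "c1 \<le> c2" "c2 \<le> b" for c1 c2 i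
  proof -
    have "nrm (\<lambda>x. u c2 i x - u c1 i x) \<le> nrm (\<lambda>x. u c2 i x - 0) + nrm (\<lambda>x. 0 - u c1 i x)"
      using c by (intro nrm_triangle3 L2s_sq[OF u_props(1)]) auto
    also have "nrm (\<lambda>x. 0 - u c1 i x) = nrm (u c1 i)" by (simp add: nrm_def)
    finally show ?thesis using u_bound[of c2 i] u_bound[of c1 i] c by (simp add: w_def[abs_def])
  qed
  \<comment> \<open>on the left of \<open>c\<close> the increment lives where \<open>u\<^sub>c\<close> has small norm\<close>
  have left: "cmod (LINT x|lborel. S (w c1 c i) x * v c i x) \<le> (1 + B\<^sup>2) * (2 * U) * nrm (\<lambda>x. indicator {c1..<c} x * v c i x)"
    if c: "c1 \<le> c" "c \<le> b" "a \<le> c1" for c1 c i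
  proof -
    have sv: "sq (\<lambda>x. indicator {c1..<c} x * v c i x)" by (rule sq_indicator[OF L2s_sq[OF v_props(1)[OF c(2)]]]) simp
    note W = w_props[OF c(1,2)]
    have eq: "(LINT x|lborel. S (w c1 c i) x * v c i x) = (LINT x|lborel. S (w c1 c i) x * (indicator {c1..<c} x * v c i x))"
    proof (rule integral_cong_AE)
      show "AE x in lborel. S (w c1 c i) x * v c i x = S (w c1 c i) x * (indicator {c1..<c} x * v c i x)"
        using W(3)[of i]
      proof eventually_elim
        case (elim x)
        show ?case
        proof (cases "x \<in> {c1..<c}")
          case False
          have "S (w c1 c i) x = 0 \<or> v c i x = 0"
          proof (cases "x \<in> {a<..<c1}")
            case True
            then show ?thesis using elim by simp
          next
            assume "x \<notin> {a<..<c1}"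
            with False c have "x \<notin> {a<..<c}" by auto
            then have "v c i x = 0" by (rule L2s_outside[OF v_props(1)[OF c(2)]])
            then show ?thesis ..
          qed
          then show ?thesis using False by auto
        qed simp
      qed
      show "(\<lambda>x. S (w c1 c i) x * v c i x) \<in> borel_measurable lborel"
        by (rule borel_measurable_integrable[OF sq_prod_integrable[OF S_bounded(1)[OF W(2)] L2s_sq[OF v_props(1)[OF c(2)]]]])
      show "(\<lambda>x. S (w c1 c i) x * (indicator {c1..<c} x * v c i x)) \<in> borel_measurable lborel"
        by (rule borel_measurable_integrable[OF sq_prod_integrable[OF S_bounded(1)[OF W(2)] sv]])
    qed
    have "cmod (LINT x|lborel. S (w c1 c i) x * v c i x) \<le> nrm (S (w c1 c i)) * nrm (\<lambda>x. indicator {c1..<c} x * v c i x)"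
      unfolding eq by (rule Cauchy_Schwarz[OF S_bounded(1)[OF W(2)] sv])
    also have "\<dots> \<le> ((1 + B\<^sup>2) * (2 * U)) * nrm (\<lambda>x. indicator {c1..<c} x * v c i x)"
    proof (rule mult_right_mono)
      have "nrm (S (w c1 c i)) \<le> (1 + B\<^sup>2) * nrm (w c1 c i)" by (rule S_bounded(2)[OF W(2)])
      also have "\<dots> \<le> (1 + B\<^sup>2) * (2 * U)" by (intro mult_left_mono wn c) auto
      finally show "nrm (S (w c1 c i)) \<le> (1 + B\<^sup>2) * (2 * U)" .
    qed simp
    finally show ?thesis .
  qed
  \<comment> \<open>on the right of \<open>c\<close> the residual \<open>F - S u\<^sub>c\<close> has small norm\<close>
  have right: "cmod (LINT x|lborel. S (w c c2 i) x * v c2 i x) \<le> U * nrm (\<lambda>x. indicator {c..<c2} x * (Fc i x - S (u c i) x))"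
    if c: "c \<le> c2" "c2 \<le> b" "a \<le> c" for c c2 i
  proof -
    have cb: "c \<le> b" using c by simp
    have sd: "sq (\<lambda>x. Fc i x - S (u c i) x)"
      by (intro sq_diff L2s_sq[OF L2s_Fc] S_bounded(1) L2s_mono[OF u_props(1)[OF cb] cb])
    then have sd': "sq (\<lambda>x. indicator {c..<c2} x * (Fc i x - S (u c i) x))" by (rule sq_indicator) simp
    note W = w_props[OF c(1,2)]
    have eq: "(LINT x|lborel. S (w c c2 i) x * v c2 i x) = (LINT x|lborel. (indicator {c..<c2} x * (Fc i x - S (u c i) x)) * v c2 i x)"
    proof (rule pair_cong[OF v_props(1)[OF c(2)] S_bounded(1)[OF W(2)] sd'])
      show "AE x in lborel. x \<in> {a<..<c2} \<longrightarrow> S (w c c2 i) x = indicator {c..<c2} x * (Fc i x - S (u c i) x)"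
        using W(3)[of i] W(4)[of i] u_props(2)[OF c(2), of i]
      proof eventually_elim
        case (elim x)
        then show ?case using c by (cases "x \<in> {a<..<c}") auto
      qed
    qed
    have "cmod (LINT x|lborel. S (w c c2 i) x * v c2 i x) \<le> nrm (\<lambda>x. indicator {c..<c2} x * (Fc i x - S (u c i) x)) * nrm (v c2 i)"
      unfolding eq by (rule Cauchy_Schwarz[OF sd' L2s_sq[OF v_props(1)[OF c(2)]]])
    also have "\<dots> \<le> nrm (\<lambda>x. indicator {c..<c2} x * (Fc i x - S (u c i) x)) * U"
      by (intro mult_left_mono v_bound c) auto
    finally show ?thesis by (simp only: mult.commute)
  qed
  show ?thesis
    unfolding continuous_on_iff
  proof (intro ballI allI impI)
    fix c e :: real assume c: "c \<in> {a..b}" and e: "0 < e"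
    have cb: "c \<le> b" "a \<le> c" using c by auto
    define K where "K = (1 + B\<^sup>2) * (2 * U) + U + 1"
    have K: "0 < K" "(1 + B\<^sup>2) * (2 * U) \<le> K" "U \<le> K"
      using U_nonneg by (simp_all add: K_def add_nonneg_pos)
    define e' where "e' = e / (4 * K)"
    have e': "0 < e'" using e K by (simp add: e'_def)
    define small where "small H r \<longleftrightarrow> 0 < r \<and> (\<forall>A. A \<in> sets borel \<longrightarrow> A \<subseteq> {c - r<..<c + r} \<longrightarrow> nrm (\<lambda>x. indicator A x * H x) < e')" for H r
    have ex: "\<exists>r. small H r" if "sq H" for H
      using small_interval_nrm[OF that e', of c] unfolding small_def by metis
    have sH: "sq (v c i)" "sq (\<lambda>x. Fc i x - S (u c i) x)" for i
      by (rule L2s_sq[OF v_props(1)[OF cb(1)]])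
        (intro sq_diff L2s_sq[OF L2s_Fc] S_bounded(1) L2s_mono[OF u_props(1)[OF cb(1)] cb(1)])
    obtain r where r: "\<And>i. small (v c i) (r i)" using ex[OF sH(1)] by metis
    obtain q where q: "\<And>i. small (\<lambda>x. Fc i x - S (u c i) x) (q i)" using ex[OF sH(2)] by metis
    define \<rho> where "\<rho> = min (min (r 1) (r 2)) (min (q 1) (q 2))"
    have \<rho>: "0 < \<rho>" "\<rho> \<le> r i" "\<rho> \<le> q i" for i
      using r q exhaust_2[of i] by (auto simp: \<rho>_def small_def)
    show "\<exists>d>0. \<forall>x'\<in>{a..b}. dist x' c < d \<longrightarrow> dist (s x') (s c) < e"
    proof (intro exI conjI ballI impI)
      show "0 < \<rho>" by (rule \<rho>(1))
      fix c' assume c': "c' \<in> {a..b}" "dist c' c < \<rho>"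
      have Ke: "K * e' + K * e' < e" using K e by (simp add: e'_def)
      show "dist (s c') (s c) < e"
      proof (cases "c' \<le> c")
        case True
        have "s c - s c' \<le> K * e' + K * e'"
        proof (rule le[OF True cb(1)])
          fix i
          have "nrm (\<lambda>x. indicator {c'..<c} x * v c i x) < e'"
            using r[of i] c' True \<rho>(2)[of i] unfolding small_def
            by (elim conjE allE[of _ "{c'..<c}"]) (auto simp: dist_real_def)
          then have "(1 + B\<^sup>2) * (2 * U) * nrm (\<lambda>x. indicator {c'..<c} x * v c i x) \<le> K * e'"
            using K by (intro mult_mono) auto
          then show "cmod (LINT x|lborel. S (w c' c i) x * v c i x) \<le> K * e'" using left[OF True cb(1), of i] c' by simp
        qed
        then show ?thesis using s_mono[OF True cb(1)] Ke by (simp add: dist_real_def)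
      next
        case False
        then have cc: "c \<le> c'" "c' \<le> b" using c' by auto
        have "s c' - s c \<le> K * e' + K * e'"
        proof (rule le[OF cc])
          fix i
          have "nrm (\<lambda>x. indicator {c..<c'} x * (Fc i x - S (u c i) x)) < e'"
            using q[of i] c' cc \<rho>(3)[of i] unfolding small_def
            by (elim conjE allE[of _ "{c..<c'}"]) (auto simp: dist_real_def)
          then have "U * nrm (\<lambda>x. indicator {c..<c'} x * (Fc i x - S (u c i) x)) \<le> K * e'"
            using K U_nonneg by (intro mult_mono) auto
          then show "cmod (LINT x|lborel. S (w c c' i) x * v c' i x) \<le> K * e'" using right[OF cc cb(2), of i] by simp
        qed
        then show ?thesis using s_mono[OF cc] Ke by (simp add: dist_real_def)
      qed
    qed
  qed
qed

end

section \<open>Matrix estimates\<close>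

lemma matmul_add_rdistrib: "((A :: complex ^ 2 ^ 2) + B) ** (C :: complex ^ 2 ^ 2) = A ** C + B ** C"
  by (simp add: vec_eq_iff matrix_matrix_mult_def distrib_right sum.distrib)

lemma matmul_diff_rdistrib: "((A :: complex ^ 2 ^ 2) - B) ** (C :: complex ^ 2 ^ 2) = A ** C - B ** C"
  by (simp add: vec_eq_iff matrix_matrix_mult_def left_diff_distrib sum_subtractf)

lemma matmul_diff_ldistrib: "(A :: complex ^ 2 ^ 2) ** (B - (C :: complex ^ 2 ^ 2)) = A ** B - A ** C"
  by (simp add: vec_eq_iff matrix_matrix_mult_def right_diff_distrib sum_subtractf)

lemma cmod_entry_le_norm: "cmod (A $ i $ j) \<le> norm (A :: complex ^ 2 ^ 2)"
  using Finite_Cartesian_Product.norm_nth_le[of "A $ i" j] Finite_Cartesian_Product.norm_nth_le[of A i] by linarith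

lemma norm_le_entries:
  assumes "\<And>i j. cmod ((A :: complex ^ 2 ^ 2) $ i $ j) \<le> e"
  shows "norm A \<le> 4 * e"
proof -
  have r: "norm (A $ i) \<le> 2 * e" for i
  proof -
    have "norm (A $ i) \<le> (\<Sum>j\<in>UNIV. norm (A $ i $ j))" unfolding norm_vec_def by (rule L2_set_le_sum) simp
    also have "\<dots> \<le> 2 * e" using assms[of i 1] assms[of i 2] by (simp add: sum_2)
    finally show ?thesis .
  qed
  have "norm A \<le> (\<Sum>i\<in>UNIV. norm (A $ i))" unfolding norm_vec_def[of A] by (rule L2_set_le_sum) simp
  also have "\<dots> \<le> 4 * e" using r[of 1] r[of 2] by (simp add: sum_2)
  finally show ?thesis .
qed

lemma norm_matmul_le: "norm (A ** B) \<le> 8 * norm (A :: complex ^ 2 ^ 2) * norm (B :: complex ^ 2 ^ 2)"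
proof -
  have "cmod ((A ** B) $ i $ j) \<le> 2 * (norm A * norm B)" for i j
  proof -
    have "cmod ((A ** B) $ i $ j) \<le> cmod (A $ i $ 1) * cmod (B $ 1 $ j) + cmod (A $ i $ 2) * cmod (B $ 2 $ j)"
      unfolding matrix_matrix_mult_def by (simp add: sum_2 norm_triangle_le norm_mult)
    also have "\<dots> \<le> norm A * norm B + norm A * norm B"
      by (intro add_mono mult_mono cmod_entry_le_norm) auto
    finally show ?thesis by simp
  qed
  from norm_le_entries[OF this] show ?thesis by simp
qed

lemma norm_mscale: "norm (mscale c A) \<le> 4 * (cmod c * norm A)"
  by (rule norm_le_entries) (simp add: mscale_def norm_mult mult_left_mono cmod_entry_le_norm)

lemma norm_Jmat_mult: "norm (Jmat ** A) \<le> 4 * norm (A :: complex ^ 2 ^ 2)"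
  by (rule norm_le_entries) (simp add: Jmat_mult_nth norm_mult cmod_entry_le_norm)

lemma matpow_norm: "norm (matpow A (Suc n)) \<le> (8 * norm A) ^ Suc n"
proof (induction n)
  case 0 then show ?case by simp
next
  case (Suc n)
  have "norm (matpow A (Suc (Suc n))) \<le> 8 * norm A * norm (matpow A (Suc n))"
    unfolding matpow.simps(2)[of A "Suc n"] by (rule norm_matmul_le)
  also have "\<dots> \<le> 8 * norm A * (8 * norm A) ^ Suc n" by (intro mult_left_mono Suc) auto
  finally show ?case by simp
qed

text \<open>The number 8 is a submultiplicativity constant of the Euclidean norm of matrices.\<close>

lemma matexp_remainder:
  assumes y: "8 * norm A \<le> 1"
  shows "norm (matexp A - mat 1 - A) \<le> (8 * norm A)\<^sup>2"
proof -
  define f where "f n = (1 / fact n) *\<^sub>R matpow A n" for n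
  define y where "y = 8 * norm A"
  have y01: "0 \<le> y" "y \<le> 1" using assms by (auto simp: y_def)
  have b: "norm (f (n + 2)) \<le> y\<^sup>2 * (1/2) ^ Suc n" for n
  proof -
    have "norm (f (n + 2)) \<le> (1 / fact (n + 2)) * y ^ Suc (Suc n)"
      unfolding f_def norm_scaleR using matpow_norm[of A "Suc n"] by (intro mult_mono) (auto simp: y_def)
    also have "\<dots> \<le> (1/2) ^ Suc n * y\<^sup>2"
    proof (intro mult_mono)
      have "(2::real) ^ Suc n \<le> fact (n + 2)"
      proof (induction n)
        case (Suc n)
        have "(2::real) ^ Suc (Suc n) = 2 * 2 ^ Suc n" by simp
        also have "\<dots> \<le> real (n + 3) * fact (n + 2)" using Suc by (intro mult_mono) auto
        also have "\<dots> = fact (Suc n + 2)" by (simp add: algebra_simps)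
        finally show ?case .
      qed simp
      then show "1 / fact (n + 2) \<le> (1/2::real) ^ Suc n" by (simp add: power_one_over frac_le)
      have "y ^ Suc (Suc n) = y\<^sup>2 * y ^ n" by (simp add: power2_eq_square)
      also have "\<dots> \<le> y\<^sup>2 * 1" using y01 by (intro mult_left_mono power_le_one) auto
      finally show "y ^ Suc (Suc n) \<le> y\<^sup>2" by simp
    qed (use y01 in auto)
    finally show ?thesis by (simp only: mult.commute)
  qed
  have geo: "(\<lambda>n. y\<^sup>2 * (1/2::real) ^ Suc n) sums (y\<^sup>2 * 1)"
    by (intro sums_mult power_half_series)
  have ns: "summable (\<lambda>n. norm (f (n + 2)))"
    by (rule summable_comparison_test'[OF sums_summable[OF geo], of 0]) (use b in simp)
  then have "summable (\<lambda>n. f (n + 2))" by (rule summable_norm_cancel)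
  then have sf: "summable f" by (simp only: summable_iff_shift)
  have f01: "f 0 = mat 1" "f 1 = A" by (simp_all add: f_def)
  have "matexp A = suminf f" by (simp add: matexp_def f_def[abs_def])
  also have "\<dots> = (\<Sum>n. f (n + 2)) + (\<Sum>n<2. f n)" by (rule suminf_split_initial_segment[OF sf])
  also have "(\<Sum>n<2. f n) = mat 1 + A" using f01 by (simp add: numeral_2_eq_2)
  finally have eq: "matexp A - mat 1 - A = (\<Sum>n. f (n + 2))" by simp
  have "norm (matexp A - mat 1 - A) \<le> (\<Sum>n. norm (f (n + 2)))"
    unfolding eq by (rule summable_norm[OF ns])
  also have "\<dots> \<le> (\<Sum>n. y\<^sup>2 * (1/2) ^ Suc n)" by (intro suminf_le b ns sums_summable[OF geo])
  also have "\<dots> = y\<^sup>2" using sums_unique[OF geo] by simp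
  finally show ?thesis by (simp add: y_def)
qed

section \<open>Convergence of multiplicative integrals\<close>

lemma tagged_partition_points:
  assumes "tagged_partition a b n t \<tau>" "k \<le> n"
  shows "a \<le> t k" "t k \<le> b"
proof -
  have m: "t i \<le> t j" if "i \<le> j" "j \<le> n" for i j
    using that
  proof (induction j)
    case (Suc j)
    show ?case
    proof (cases "i = Suc j")
      case False
      have "t j < t (Suc j)" using assms(1) Suc.prems by (auto simp: tagged_partition_def)
      then show ?thesis using Suc False by simp
    qed simp
  qed simp
  show "a \<le> t k" "t k \<le> b" using m[of 0 k] m[of k n] assms by (auto simp: tagged_partition_def)
qed

text \<open>A solution of the implicit difference equation \<open>W\<^sub>2 - W\<^sub>1 = X W\<^sub>2\<close>, where \<open>X\<close> is the exponent of the
  corresponding factor up to an error of higher order, is approximated by the partial products: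
  the local error is of the order of the mesh times the variation, and a discrete Gronwall argument
  controls its propagation.\<close>

theorem has_mult_integral_of_difference_equation:
  fixes \<sigma> :: "real \<Rightarrow> complex ^ 2 ^ 2" and s :: "real \<Rightarrow> real" and W :: "real \<Rightarrow> complex ^ 2 ^ 2"
  assumes C: "0 \<le> C" and d: "0 < d" "\<And>x. x \<in> {a..b} \<Longrightarrow> d \<le> cmod (of_real x - z)"
    and s: "continuous_on {a..b} s" "\<And>c1 c2. a \<le> c1 \<Longrightarrow> c1 \<le> c2 \<Longrightarrow> c2 \<le> b \<Longrightarrow> s c1 \<le> s c2"
    and \<sigma>: "\<And>c1 c2. a \<le> c1 \<Longrightarrow> c1 \<le> c2 \<Longrightarrow> c2 \<le> b \<Longrightarrow> norm (\<sigma> c2 - \<sigma> c1) \<le> C * (s c2 - s c1)"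
    and W: "\<And>c. a \<le> c \<Longrightarrow> c \<le> b \<Longrightarrow> norm (W c) \<le> C" and Wa: "W a = mat 1"
    and step: "\<And>c1 c2 \<tau>. a \<le> c1 \<Longrightarrow> c1 \<le> \<tau> \<Longrightarrow> \<tau> \<le> c2 \<Longrightarrow> c2 \<le> b \<Longrightarrow>
      \<exists>E. norm E \<le> C * ((c2 - c1) * (s c2 - s c1)) \<and>
          W c2 - W c1 = (mscale (- \<i> / (of_real \<tau> - z)) (Jmat ** (\<sigma> c2 - \<sigma> c1)) + E) ** W c2"
    and ab: "a < b"
  shows "has_mult_integral \<sigma> a b z (W b)"
proof -
  define T where "T = s b - s a"
  have T: "0 \<le> T" using s(2)[of a b] ab by (simp add: T_def)
  \<comment> \<open>\<open>C2 \<Delta>\<close> bounds the exponent, \<open>C3 \<Delta>\<close> the coefficient \<open>X\<close>, \<open>C5\<close> the local error and \<open>C6\<close> the growth of a factor\<close>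
  define C2 where "C2 = 16 * C / d"
  have C2: "0 \<le> C2" using C d by (simp add: C2_def)
  define C3 where "C3 = C2 + C * (b - a)"
  have C3: "0 \<le> C3" "C2 \<le> C3" using C2 C ab by (simp_all add: C3_def)
  define C5 where "C5 = 8 * C2 * (8 * C3 * C) + 8 * C * C + 8 * (64 * C2\<^sup>2) * C"
  have C5: "0 \<le> C5" using C C2 C3 by (simp add: C5_def)
  define C6 where "C6 = 8 * (C2 + 64 * C2\<^sup>2 * T)"
  have C6: "0 \<le> C6" using C2 T by (simp add: C6_def)
  define ex where "ex c1 c2 \<tau> = matexp (mscale (- \<i> / (of_real \<tau> - z)) (Jmat ** (\<sigma> c2 - \<sigma> c1)))" for c1 c2 \<tau>
  have local: "norm (W c2 - ex c1 c2 \<tau> ** W c1) \<le> C5 * ((s c2 - s c1) * ((s c2 - s c1) + (c2 - c1)))"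
    "norm (ex c1 c2 \<tau> - mat 1) \<le> C6 / 8 * (s c2 - s c1)"
    if c: "a \<le> c1" "c1 \<le> \<tau>" "\<tau> \<le> c2" "c2 \<le> b" and small: "8 * C2 * (s c2 - s c1) \<le> 1" for c1 c2 \<tau>
  proof -
    have c12: "c1 \<le> c2" using c by simp
    define \<Delta> where "\<Delta> = s c2 - s c1"
    define l where "l = c2 - c1"
    have \<Delta>: "0 \<le> \<Delta>" "\<Delta> \<le> T" using s(2)[OF c(1) c12 c(4)] s(2)[of a c1] s(2)[of c2 b] c c12 by (auto simp: \<Delta>_def T_def)
    have l: "0 \<le> l" "l \<le> b - a" using c c12 by (auto simp: l_def)
    define Y where "Y = mscale (- \<i> / (of_real \<tau> - z)) (Jmat ** (\<sigma> c2 - \<sigma> c1))"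
    obtain E where E: "norm E \<le> C * (l * \<Delta>)" "W c2 - W c1 = (Y + E) ** W c2"
      using step[OF c] unfolding Y_def l_def \<Delta>_def by blast
    have Y: "norm Y \<le> C2 * \<Delta>"
    proof -
      have dt: "d \<le> cmod (of_real \<tau> - z)" using c by (intro d(2)) auto
      have "cmod (- \<i> / (of_real \<tau> - z)) \<le> 1 / d"
        using dt d(1) by (simp add: norm_divide frac_le)
      moreover have "norm (Jmat ** (\<sigma> c2 - \<sigma> c1)) \<le> 4 * (C * \<Delta>)"
        using norm_Jmat_mult[of "\<sigma> c2 - \<sigma> c1"] \<sigma>[OF c(1) c12 c(4)] by (simp add: \<Delta>_def)
      ultimately have "4 * (cmod (- \<i> / (of_real \<tau> - z)) * norm (Jmat ** (\<sigma> c2 - \<sigma> c1))) \<le> 4 * (1 / d * (4 * (C * \<Delta>)))"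
        using d(1) by (intro mult_left_mono mult_mono) auto
      then show ?thesis using norm_mscale[of "- \<i> / (of_real \<tau> - z)" "Jmat ** (\<sigma> c2 - \<sigma> c1)"]
        unfolding Y_def C2_def by simp
    qed
    have YE: "norm (Y + E) \<le> C3 * \<Delta>"
    proof -
      have "norm (Y + E) \<le> C2 * \<Delta> + C * (l * \<Delta>)" using norm_triangle_ineq[of Y E] Y E(1) by linarith
      also have "C * (l * \<Delta>) \<le> C * ((b - a) * \<Delta>)" using C \<Delta> l by (intro mult_left_mono mult_right_mono) auto
      finally show ?thesis by (simp add: C3_def algebra_simps)
    qed
    have WW: "norm (W c2 - W c1) \<le> 8 * (C3 * \<Delta>) * C"
      unfolding E(2) using W[of c2] c c12 C C3 \<Delta>
      by (intro order_trans[OF norm_matmul_le] mult_mono mult_nonneg_nonneg YE) auto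
    define R where "R = matexp Y - mat 1 - Y"
    have y1: "8 * norm Y \<le> 1" using Y small by (simp add: \<Delta>_def)
    have R: "norm R \<le> 64 * C2\<^sup>2 * \<Delta>\<^sup>2"
    proof -
      have "norm R \<le> (8 * norm Y)\<^sup>2" unfolding R_def by (rule matexp_remainder[OF y1])
      also have "\<dots> \<le> (8 * (C2 * \<Delta>))\<^sup>2" using Y by (intro power_mono mult_left_mono) auto
      finally show ?thesis by (simp add: power_mult_distrib)
    qed
    have exY: "ex c1 c2 \<tau> = mat 1 + Y + R" by (simp add: ex_def R_def Y_def)
    have dec: "W c2 - ex c1 c2 \<tau> ** W c1 = Y ** (W c2 - W c1) + E ** W c2 - R ** W c1"
    proof -
      have "W c2 = W c1 + (Y + E) ** W c2" using E(2) by (metis add.commute diff_add_cancel)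
      then have "W c2 - (mat 1 + Y + R) ** W c1 = (W c1 + (Y + E) ** W c2) - (mat 1 + Y + R) ** W c1" by simp
      also have "\<dots> = Y ** (W c2 - W c1) + E ** W c2 - R ** W c1"
        by (simp add: matmul_add_rdistrib matmul_diff_ldistrib)
      finally show ?thesis unfolding exY .
    qed
    have n1: "norm (Y ** (W c2 - W c1)) \<le> 8 * (C2 * \<Delta>) * (8 * (C3 * \<Delta>) * C)"
      using C C2 C3 \<Delta> by (intro order_trans[OF norm_matmul_le] mult_mono mult_nonneg_nonneg WW Y) auto
    have n2: "norm (E ** W c2) \<le> 8 * (C * (l * \<Delta>)) * C"
      using W[of c2] c c12 C \<Delta> l by (intro order_trans[OF norm_matmul_le] mult_mono mult_nonneg_nonneg E(1)) auto
    have n3: "norm (R ** W c1) \<le> 8 * (64 * C2\<^sup>2 * \<Delta>\<^sup>2) * C"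
      using W[of c1] c c12 C \<Delta> by (intro order_trans[OF norm_matmul_le] mult_mono mult_nonneg_nonneg R) auto
    have "norm (W c2 - ex c1 c2 \<tau> ** W c1) \<le> norm (Y ** (W c2 - W c1)) + norm (E ** W c2) + norm (R ** W c1)"
      unfolding dec by (rule order_trans[OF norm_triangle_ineq4 add_right_mono[OF norm_triangle_ineq]])
    also have "\<dots> \<le> 8 * (C2 * \<Delta>) * (8 * (C3 * \<Delta>) * C) + 8 * (C * (l * \<Delta>)) * C + 8 * (64 * C2\<^sup>2 * \<Delta>\<^sup>2) * C"
      using n1 n2 n3 by linarith
    also have "\<dots> = (8 * C2 * (8 * C3 * C) + 8 * (64 * C2\<^sup>2) * C) * (\<Delta> * \<Delta>) + 8 * C * C * (\<Delta> * l)"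
      by (simp add: algebra_simps power2_eq_square)
    also have "\<dots> \<le> C5 * (\<Delta> * \<Delta>) + C5 * (\<Delta> * l)"
      using C C2 C3 \<Delta> l by (intro add_mono mult_right_mono) (auto simp: C5_def)
    finally show "norm (W c2 - ex c1 c2 \<tau> ** W c1) \<le> C5 * ((s c2 - s c1) * ((s c2 - s c1) + (c2 - c1)))"
      by (simp add: \<Delta>_def[symmetric] l_def[symmetric] distrib_left)
    have "norm (ex c1 c2 \<tau> - mat 1) \<le> norm Y + norm R" unfolding exY by (simp add: norm_triangle_ineq)
    also have "\<dots> \<le> C2 * \<Delta> + 64 * C2\<^sup>2 * (T * \<Delta>)"
    proof -
      have "64 * C2\<^sup>2 * \<Delta>\<^sup>2 \<le> 64 * C2\<^sup>2 * (T * \<Delta>)"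
        unfolding power2_eq_square[of \<Delta>] using \<Delta> by (intro mult_left_mono mult_right_mono) auto
      then show ?thesis using Y R by linarith
    qed
    also have "\<dots> = C6 / 8 * \<Delta>" by (simp add: C6_def algebra_simps)
    finally show "norm (ex c1 c2 \<tau> - mat 1) \<le> C6 / 8 * (s c2 - s c1)" by (simp add: \<Delta>_def)
  qed
  have unif: "uniformly_continuous_on {a..b} s" using s(1) by (intro compact_uniformly_continuous) auto
  show ?thesis
    unfolding has_mult_integral_def
  proof (intro allI impI)
    fix \<epsilon> :: real assume \<epsilon>: "0 < \<epsilon>"
    define Q where "Q = C5 * exp (C6 * T) * T + 1"
    have Q: "0 < Q" using C5 T by (simp add: Q_def add_nonneg_pos)
    define \<eta> where "\<eta> = min (\<epsilon> / (2 * Q)) (1 / (8 * C2 + 1))"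
    have \<eta>: "0 < \<eta>" using \<epsilon> Q C2 by (simp add: \<eta>_def add_nonneg_pos)
    obtain \<delta>0 where \<delta>0: "0 < \<delta>0" "\<And>x y. x \<in> {a..b} \<Longrightarrow> y \<in> {a..b} \<Longrightarrow> dist y x < \<delta>0 \<Longrightarrow> dist (s y) (s x) < \<eta> / 2"
      using unif \<eta> unfolding uniformly_continuous_on_def by (metis half_gt_zero)
    define \<delta>' where "\<delta>' = min \<delta>0 (\<eta> / 2)"
    show "\<exists>\<delta>>0. \<forall>n t \<tau>. tagged_partition a b n t \<tau> \<and> (\<forall>k<n. t (Suc k) - t k < \<delta>) \<longrightarrow> dist (mult_product \<sigma> z n t \<tau>) (W b) < \<epsilon>"
    proof (intro exI[of _ \<delta>'] conjI allI impI)
      show "0 < \<delta>'" using \<delta>0 \<eta> by (simp add: \<delta>'_def)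
      fix n t \<tau> assume tp: "tagged_partition a b n t \<tau> \<and> (\<forall>k<n. t (Suc k) - t k < \<delta>')"
      note pts = tagged_partition_points[OF conjunct1[OF tp]]
      define e where "e k = ex (t k) (t (Suc k)) (\<tau> k)" for k
      define S where "S k = s (t k) - s a" for k
      have S: "0 \<le> S k" "S k \<le> T" if "k \<le> n" for k
        using s(2)[of a "t k"] s(2)[of "t k" b] pts[OF that] by (auto simp: S_def T_def)
      have prodeq: "mult_product \<sigma> z n t \<tau> = left_prod e n"
        by (simp add: mult_product_def e_def[abs_def] ex_def)
      have claim: "k \<le> n \<Longrightarrow> norm (W (t k) - left_prod e k) \<le> C5 * \<eta> * exp (C6 * S k) * S k" for k
      proof (induction k)
        case 0
        have "t 0 = a" using tp by (simp add: tagged_partition_def)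
        then show ?case by (simp add: Wa S_def)
      next
        case (Suc k)
        then have kn: "k < n" "k \<le> n" by auto
        have tk: "t k \<le> \<tau> k" "\<tau> k \<le> t (Suc k)" "t k \<le> t (Suc k)" using tp kn by (auto simp: tagged_partition_def)
        have in1: "t k \<in> {a..b}" "t (Suc k) \<in> {a..b}" using pts[of k] pts[of "Suc k"] Suc.prems by auto
        define \<Delta> where "\<Delta> = s (t (Suc k)) - s (t k)"
        have \<Delta>0: "0 \<le> \<Delta>" using s(2)[of "t k" "t (Suc k)"] in1 tk by (simp add: \<Delta>_def)
        have len: "t (Suc k) - t k < \<delta>'" using tp kn by auto
        have \<Delta>1: "\<Delta> < \<eta> / 2" 
        proof -
          have "dist (t (Suc k)) (t k) < \<delta>0" using len tk by (simp add: dist_real_def \<delta>'_def)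
          from \<delta>0(2)[OF in1 this] show ?thesis
            unfolding \<Delta>_def dist_real_def by (rule le_less_trans[OF abs_ge_self])
        qed
        have small: "8 * C2 * (s (t (Suc k)) - s (t k)) \<le> 1"
        proof -
          have "8 * C2 * \<Delta> \<le> 8 * C2 * (1 / (8 * C2 + 1))" 
          proof (rule mult_left_mono)
            have "\<eta> \<le> 1 / (8 * C2 + 1)" by (simp add: \<eta>_def)
            then show "\<Delta> \<le> 1 / (8 * C2 + 1)" by (rule order_trans[rotated]) (use \<Delta>1 \<eta> in linarith)
          qed (use C2 in simp)
          also have "\<dots> \<le> 1" using C2 by simp
          finally show ?thesis by (simp add: \<Delta>_def)
        qed
        have loc: "norm (W (t (Suc k)) - e k ** W (t k)) \<le> C5 * (\<Delta> * (\<Delta> + (t (Suc k) - t k)))" "norm (e k - mat 1) \<le> C6 / 8 * \<Delta>"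
          using local[of "t k" "\<tau> k" "t (Suc k)"] in1 tk small unfolding e_def \<Delta>_def by auto
        have l1: "norm (W (t (Suc k)) - e k ** W (t k)) \<le> C5 * \<eta> * \<Delta>"
        proof -
          have "\<Delta> + (t (Suc k) - t k) \<le> \<eta>" using \<Delta>1 len by (simp add: \<delta>'_def)
          then have "C5 * (\<Delta> * (\<Delta> + (t (Suc k) - t k))) \<le> C5 * (\<Delta> * \<eta>)" using C5 \<Delta>0 by (intro mult_left_mono) auto
          then show ?thesis using loc(1) by (simp add: mult.commute mult.left_commute)
        qed
        let ?D = "W (t k) - left_prod e k"
        have D: "norm ?D \<le> C5 * \<eta> * exp (C6 * S k) * S k" using Suc.IH kn by simp
        have eq: "W (t (Suc k)) - left_prod e (Suc k) = (W (t (Suc k)) - e k ** W (t k)) + (?D + (e k - mat 1) ** ?D)"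
          by (simp add: matmul_diff_ldistrib matmul_diff_rdistrib)
        have n8: "norm ((e k - mat 1) ** ?D) \<le> C6 * \<Delta> * norm ?D"
        proof -
          have "8 * norm (e k - mat 1) * norm ?D \<le> 8 * (C6 / 8 * \<Delta>) * norm ?D"
            by (intro mult_right_mono mult_left_mono loc(2)) auto
          then show ?thesis using norm_matmul_le[of "e k - mat 1" ?D] by linarith
        qed
        have n9: "norm (W (t (Suc k)) - left_prod e (Suc k)) \<le> C5 * \<eta> * \<Delta> + (norm ?D + C6 * \<Delta> * norm ?D)"
          unfolding eq using n8 l1 norm_triangle_ineq[of "W (t (Suc k)) - e k ** W (t k)" "?D + (e k - mat 1) ** ?D"]
              norm_triangle_ineq[of ?D "(e k - mat 1) ** ?D"] by linarith
        have n10: "norm ?D + C6 * \<Delta> * norm ?D \<le> C5 * \<eta> * exp (C6 * S (Suc k)) * S k"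
        proof -
          have Sk: "S (Suc k) = \<Delta> + S k" by (simp add: S_def \<Delta>_def)
          have "norm ?D + C6 * \<Delta> * norm ?D = (1 + C6 * \<Delta>) * norm ?D" by (simp add: distrib_right)
          also have "\<dots> \<le> exp (C6 * \<Delta>) * (C5 * \<eta> * exp (C6 * S k) * S k)"
            using C6 \<Delta>0 by (intro mult_mono exp_ge_add_one_self D) auto
          also have "\<dots> = C5 * \<eta> * exp (C6 * S (Suc k)) * S k"
            unfolding Sk distrib_left exp_add by (simp only: ac_simps)
          finally show ?thesis .
        qed
        have n11: "C5 * \<eta> * \<Delta> \<le> C5 * \<eta> * exp (C6 * S (Suc k)) * \<Delta>"
        proof -
          have "0 \<le> C6 * S (Suc k)" using C6 S(1)[OF Suc.prems] by (rule mult_nonneg_nonneg)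
          then have "1 \<le> exp (C6 * S (Suc k))" by simp
          then have "C5 * \<eta> * 1 \<le> C5 * \<eta> * exp (C6 * S (Suc k))"
            using C5 \<eta> by (intro mult_left_mono mult_nonneg_nonneg) auto
          then have "C5 * \<eta> * 1 * \<Delta> \<le> C5 * \<eta> * exp (C6 * S (Suc k)) * \<Delta>" using \<Delta>0 by (rule mult_right_mono)
          then show ?thesis by simp
        qed
        have "C5 * \<eta> * exp (C6 * S (Suc k)) * \<Delta> + C5 * \<eta> * exp (C6 * S (Suc k)) * S k = C5 * \<eta> * exp (C6 * S (Suc k)) * S (Suc k)"
          unfolding distrib_left[symmetric] by (simp add: S_def \<Delta>_def)
        then show ?case using n9 n10 n11 by linarith
      qed
      have "norm (W b - left_prod e n) \<le> C5 * \<eta> * exp (C6 * S n) * S n"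
        using claim[of n] tp by (simp add: tagged_partition_def)
      also have "\<dots> \<le> C5 * \<eta> * exp (C6 * T) * T"
        using S[of n] C5 C6 \<eta> T by (intro mult_mono mult_nonneg_nonneg) (auto intro!: mult_left_mono)
      also have "\<dots> \<le> \<eta> * Q" using \<eta> by (simp add: Q_def algebra_simps)
      also have "\<dots> \<le> \<epsilon> / (2 * Q) * Q" using Q by (intro mult_right_mono) (auto simp: \<eta>_def)
      also have "\<dots> < \<epsilon>" using Q \<epsilon> by simp
      finally show "dist (mult_product \<sigma> z n t \<tau>) (W b) < \<epsilon>" unfolding prodeq by (simp add: dist_norm norm_minus_commute)
    qed
  qed
qed

lemma has_mult_integral_unique:
  assumes ab: "a < b" and M: "has_mult_integral \<sigma> a b z M" "has_mult_integral \<sigma> a b z M'"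
  shows "M = M'"
proof (rule ccontr)
  assume "M \<noteq> M'"
  then have e: "0 < dist M M' / 2" by simp
  obtain d where d: "0 < d" "\<And>n t \<tau>. tagged_partition a b n t \<tau> \<Longrightarrow> \<forall>k<n. t (Suc k) - t k < d \<Longrightarrow> dist (mult_product \<sigma> z n t \<tau>) M < dist M M' / 2"
    using M(1)[unfolded has_mult_integral_def, rule_format, OF e] by metis
  obtain d' where d': "0 < d'" "\<And>n t \<tau>. tagged_partition a b n t \<tau> \<Longrightarrow> \<forall>k<n. t (Suc k) - t k < d' \<Longrightarrow> dist (mult_product \<sigma> z n t \<tau>) M' < dist M M' / 2"
    using M(2)[unfolded has_mult_integral_def, rule_format, OF e] by metis
  obtain n where n: "(b - a) / min d d' < real n" using reals_Archimedean2[of "(b - a) / min d d'"] by auto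
  have dd: "0 < min d d'" using d d' by simp
  have "0 < (b - a) / min d d'" using ab dd by (intro divide_pos_pos) auto
  then have n0: "0 < real n" using n by linarith
  define h where "h = (b - a) / real n"
  define t where "t k = a + real k * h" for k
  have st: "t (Suc k) - t k = (b - a) / real n" for k by (simp add: t_def distrib_right) (simp add: h_def)
  have pos: "0 < (b - a) / real n" using ab n0 by simp
  have sm: "(b - a) / real n < min d d'"
    using n by (simp only: pos_divide_less_eq[OF dd] pos_divide_less_eq[OF n0] mult.commute)
  have lt: "t k < t (Suc k)" for k using st[of k] pos by linarith
  have t0: "t 0 = a" by (simp add: t_def)
  have tn: "t n = b" using n0 by (simp add: t_def h_def)
  have tp: "tagged_partition a b n t t"
    unfolding tagged_partition_def
  proof (intro conjI allI impI t0 tn lt)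
    show "t k \<in> {t k..t (Suc k)}" for k using less_imp_le[OF lt[of k]] by (simp only: atLeastAtMost_iff order_refl)
  qed
  note sm' = sm[unfolded min_less_iff_conj]
  have mesh: "\<forall>k<n. t (Suc k) - t k < d" "\<forall>k<n. t (Suc k) - t k < d'"
    unfolding st by (intro allI impI conjunct1[OF sm'], intro allI impI conjunct2[OF sm'])
  have "dist (mult_product \<sigma> z n t t) M < dist M M' / 2" "dist (mult_product \<sigma> z n t t) M' < dist M M' / 2"
    by (rule d(2)[OF tp mesh(1)], rule d'(2)[OF tp mesh(2)])
  then show False using dist_triangle3[of M M' "mult_product \<sigma> z n t t"] by linarith
qed

lemma mult_integral_eq:
  assumes ab: "a < b" and M: "has_mult_integral \<sigma> a b z M"
  shows "mult_integral \<sigma> a b z = M"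
proof -
  have uniq: "M' = M" if "has_mult_integral \<sigma> a b z M'" for M'
    by (rule has_mult_integral_unique[OF ab that M])
  show ?thesis
    unfolding mult_integral_def using M uniq by (rule the_equality)
qed

section \<open>The difference equation for the resolvent matrix\<close>

context coercive_kernel_op
begin

text \<open>The point \<open>z\<close> has distance at least \<open>d\<close> from the segment.\<close>

definition far :: "complex \<Rightarrow> real \<Rightarrow> bool" where
  "far z d \<longleftrightarrow> 0 < d \<and> (\<forall>x\<in>{a..b}. d \<le> cmod (of_real x - z))"

text \<open>The resolvent kernel of multiplication by \<open>x\<close>, cut off so as to be bounded on the whole line.\<close>

definition rz :: "complex \<Rightarrow> real \<Rightarrow> complex" where
  "rz z x = indicator {a<..<b} x / (of_real x - z)"

definition \<kappa> :: complex where "\<kappa> = \<i> / (2 * of_real pi)"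

definition Amat :: "(2 \<Rightarrow> real \<Rightarrow> complex) \<Rightarrow> complex \<Rightarrow> complex ^ 2 ^ 2" where
  "Amat f z = (\<chi> i j. LINT x|lborel. f i x * (Gc j x * rz z x))"

definition Nmat :: "(2 \<Rightarrow> real \<Rightarrow> complex) \<Rightarrow> real \<Rightarrow> complex \<Rightarrow> complex ^ 2 ^ 2" where
  "Nmat g c z = (\<chi> i j. LINT x|lborel. g i x * (rz z x * v c j x))"

definition Wm :: "real \<Rightarrow> complex \<Rightarrow> complex ^ 2 ^ 2" where
  "Wm c z = mat 1 - mscale \<kappa> (Jmat ** Amat (u c) z)"

text \<open>This will turn out to be the inverse of \<open>Wm\<close>.\<close>

definition Mm :: "real \<Rightarrow> complex \<Rightarrow> complex ^ 2 ^ 2" where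
  "Mm c z = mat 1 + mscale \<kappa> (Jmat ** Nmat Fc c z)"

definition Sg :: "real \<Rightarrow> complex ^ 2 ^ 2" where
  "Sg c = (\<chi> i j. sig c i j)"

lemma rz_measurable[measurable]: "rz z \<in> borel_measurable borel"
  unfolding rz_def[abs_def] by measurable

lemma far_nonzero:
  assumes "far z d" "x \<in> {a..b}"
  shows "of_real x - z \<noteq> 0"
proof
  assume "of_real x - z = 0"
  moreover have "d \<le> cmod (of_real x - z)" "0 < d" using assms by (auto simp: far_def)
  ultimately show False by simp
qed

lemma rz_bound:
  assumes "far z d"
  shows "cmod (rz z x) \<le> 1 / d"
proof (cases "x \<in> {a<..<b}")
  case True
  then have "d \<le> cmod (of_real x - z)" "0 < d" using assms by (auto simp: far_def)
  then have "1 / cmod (of_real x - z) \<le> 1 / d" by (intro divide_left_mono mult_pos_pos) auto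
  then show ?thesis using True by (simp add: rz_def norm_divide)
next
  case False
  then show ?thesis using assms by (simp add: rz_def far_def)
qed

lemma L2s_rz: "far z d \<Longrightarrow> L2s a c f \<Longrightarrow> L2s a c (\<lambda>x. rz z x * f x)"
  by (rule L2s_mult[OF _ rz_measurable rz_bound])

text \<open>The commutator of \<open>S\<close> with multiplication by \<open>x - z\<close>, applied to \<open>v / (x - z)\<close>: its rank-two right-hand side is
  the linear combination of the \<open>G\<^sub>l\<close> with coefficients from \<open>Mm - I\<close>.\<close>

lemma resolvent_equation:
  assumes z: "far z d" and c: "c \<le> b"
  shows "AE x in lborel. x \<in> {a<..<c} \<longrightarrow> S (\<lambda>t. rz z t * v c k t) x = (\<Sum>l\<in>UNIV. (Gc l x * rz z x) * Mm c z $ l $ k)"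
proof -
  have h: "L2s a b (\<lambda>t. rz z t * v c k t)" by (intro L2s_rz[OF z] L2s_mono[OF v_props(1)[OF c] c])
  have eq: "(\<lambda>t. (of_real t - z) * (rz z t * v c k t)) = v c k"
  proof
    fix t
    show "(of_real t - z) * (rz z t * v c k t) = v c k t"
    proof (cases "t \<in> {a<..<b}")
      case True
      then show ?thesis using far_nonzero[OF z, of t] by (simp add: rz_def)
    next
      case False
      then show ?thesis using L2s_outside[OF L2s_mono[OF v_props(1)[OF c] c]] by simp
    qed
  qed
  have phi: "\<phi> t * (rz z t * v c k t) = Fc 1 t * (rz z t * v c k t)" "cnj (\<phi> t) * (rz z t * v c k t) = - (Fc 2 t * (rz z t * v c k t))" for t
    by (cases "t \<in> {a<..<b}"; simp add: Fc_def F1_nth rz_def)+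
  have N: "(LINT t|lborel. \<phi> t * (rz z t * v c k t)) = Nmat Fc c z $ 1 $ k"
    "(LINT t|lborel. cnj (\<phi> t) * (rz z t * v c k t)) = - (Nmat Fc c z $ 2 $ k)"
    unfolding phi Bochner_Integration.integral_minus by (simp_all add: Nmat_def)
  show ?thesis
    using S_commutator[OF h, of z] v_props(2)[OF c, of k] unfolding eq N
  proof eventually_elim
    case (elim x)
    show ?case
    proof
      assume x: "x \<in> {a<..<c}"
      then have xb: "x \<in> {a<..<b}" using c by auto
      then have nz: "of_real x - z \<noteq> 0" by (intro far_nonzero[OF z]) auto
      have G: "Gc 1 x = cnj (\<phi> x)" "Gc 2 x = - \<phi> x" using xb by (simp_all add: Gc_def Fc_def F1_nth)
      have Mk: "Mm c z $ 1 $ k = (if 1 = k then 1 else 0) - \<kappa> * Nmat Fc c z $ 1 $ k"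
        "Mm c z $ 2 $ k = (if 2 = k then 1 else 0) + \<kappa> * Nmat Fc c z $ 2 $ k"
        by (simp_all add: Mm_def mscale_def Jmat_mult_nth mat_def)
      have "(of_real x - z) * S (\<lambda>t. rz z t * v c k t) x = Gc k x + \<kappa> * (\<phi> x * - (Nmat Fc c z $ 2 $ k) - cnj (\<phi> x) * Nmat Fc c z $ 1 $ k)"
        using elim x unfolding \<kappa>_def by (simp only: diff_eq_eq) (simp add: add.commute)
      also have "\<dots> = Gc 1 x * Mm c z $ 1 $ k + Gc 2 x * Mm c z $ 2 $ k"
        unfolding Mk using exhaust_2[of k] by (auto simp: G algebra_simps)
      finally have e: "(of_real x - z) * S (\<lambda>t. rz z t * v c k t) x = Gc 1 x * Mm c z $ 1 $ k + Gc 2 x * Mm c z $ 2 $ k" .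
      have "S (\<lambda>t. rz z t * v c k t) x = rz z x * ((of_real x - z) * S (\<lambda>t. rz z t * v c k t) x)"
        using nz xb by (simp add: rz_def)
      then show "S (\<lambda>t. rz z t * v c k t) x = (\<Sum>l\<in>UNIV. (Gc l x * rz z x) * Mm c z $ l $ k)"
        unfolding e by (simp add: sum_2 algebra_simps)
    qed
  qed
qed

text \<open>Pair \<open>f\<close> with the resolvent equation and use the symmetry of \<open>S\<close>.\<close>

lemma Nmat_S_eq:
  assumes z: "far z d" and c: "c \<le> b" and f: "\<And>i. L2s a c (f i)"
  shows "Nmat (\<lambda>i. S (f i)) c z = Amat f z ** Mm c z"
proof -
  have "(Nmat (\<lambda>i. S (f i)) c z) $ i $ k = (Amat f z ** Mm c z) $ i $ k" for i k
  proof -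
    have h: "L2s a b (\<lambda>t. rz z t * v c k t)" by (intro L2s_rz[OF z] L2s_mono[OF v_props(1)[OF c] c])
    have fb: "L2s a b (f i)" using f c by (rule L2s_mono)
    have sG: "sq (\<lambda>x. Gc l x * rz z x)" for l
      using L2s_sq[OF L2s_rz[OF z L2s_Gc]] by (simp add: mult.commute)
    have iG: "integrable lborel (\<lambda>x. f i x * (Gc l x * rz z x))" for l
      by (intro sq_prod_integrable sG L2s_sq[OF f])
    have sR: "sq (\<lambda>x. \<Sum>l\<in>UNIV. (Gc l x * rz z x) * Mm c z $ l $ k)"
      using sq_scale[OF sG] by (intro sq_sum) (simp add: mult.commute)
    have "(LINT x|lborel. S (f i) x * (rz z x * v c k x)) = (LINT x|lborel. f i x * S (\<lambda>t. rz z t * v c k t) x)"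
      by (rule S_symmetric[OF fb h])
    also have "\<dots> = (LINT x|lborel. S (\<lambda>t. rz z t * v c k t) x * f i x)" by (simp only: mult.commute)
    also have "\<dots> = (LINT x|lborel. (\<Sum>l\<in>UNIV. (Gc l x * rz z x) * Mm c z $ l $ k) * f i x)"
      by (rule pair_cong[OF f S_bounded(1)[OF h] sR resolvent_equation[OF z c]])
    also have "\<dots> = (LINT x|lborel. (f i x * (Gc 1 x * rz z x)) * Mm c z $ 1 $ k + (f i x * (Gc 2 x * rz z x)) * Mm c z $ 2 $ k)"
      by (simp add: sum_2 algebra_simps)
    also have "\<dots> = Amat f z $ i $ 1 * Mm c z $ 1 $ k + Amat f z $ i $ 2 * Mm c z $ 2 $ k"
      using iG[of 1] iG[of 2] by (simp add: Amat_def)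
    finally show ?thesis by (simp add: Nmat_def matrix_matrix_mult_def sum_2)
  qed
  then show ?thesis by (simp add: vec_eq_iff)
qed

text \<open>For \<open>f = u\<close> the preceding identity says that the two Cauchy transforms \<open>A\<close> and \<open>N\<close> are related by \<open>N = A M\<close>.\<close>

lemma Wm_Mm_inverse:
  assumes z: "far z d" and c: "c \<le> b"
  shows "Wm c z ** Mm c z = mat 1" "Mm c z ** Wm c z = mat 1"
proof -
  have cb: "L2s a b (u c i)" for i using u_props(1)[OF c] c by (rule L2s_mono)
  have "Nmat (\<lambda>i. S (u c i)) c z = Nmat Fc c z"
  proof -
    have "(LINT x|lborel. S (u c i) x * (rz z x * v c k x)) = (LINT x|lborel. Fc i x * (rz z x * v c k x))" for i k
      by (rule pair_cong[OF L2s_rz[OF z v_props(1)[OF c]] S_bounded(1)[OF cb] L2s_sq[OF L2s_Fc] u_props(2)[OF c]])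
    then show ?thesis by (simp add: Nmat_def)
  qed
  then have AM: "Amat (u c) z ** Mm c z = Nmat Fc c z" using Nmat_S_eq[OF z c u_props(1)[OF c]] by simp
  have "Wm c z ** Mm c z = Mm c z - mscale \<kappa> (Jmat ** (Amat (u c) z ** Mm c z))"
    by (simp add: Wm_def matmul_diff_rdistrib mscale_mult_left matrix_mul_assoc)
  also have "\<dots> = mat 1" unfolding AM by (simp add: Mm_def)
  finally show "Wm c z ** Mm c z = mat 1" .
  then show "Mm c z ** Wm c z = mat 1" by (simp add: matrix_left_right_inverse)
qed

text \<open>The same identity for \<open>f = w\<close>, multiplied from the right by \<open>W = M\<inverse>\<close>.\<close>

lemma Wm_difference:
  assumes z: "far z d" and c: "c1 \<le> c2" "c2 \<le> b"
  shows "Wm c2 z - Wm c1 z = - mscale \<kappa> (Jmat ** Nmat (\<lambda>i. S (w c1 c2 i)) c2 z) ** Wm c2 z"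
proof -
  have c1: "c1 \<le> b" using c by simp
  have "Amat (w c1 c2) z = Amat (u c2) z - Amat (u c1) z"
  proof -
    have int: "integrable lborel (\<lambda>x. u c i x * (Gc j x * rz z x))" if "c \<le> b" for c i j
      using sq_prod_integrable[OF L2s_sq[OF u_props(1)[OF that]] L2s_sq[OF L2s_rz[OF z L2s_Gc]]] by (simp add: mult.commute)
    have "Amat (w c1 c2) z $ i $ j = (Amat (u c2) z - Amat (u c1) z) $ i $ j" for i j
      using int[OF c(2), of i j] int[OF c1, of i j] by (simp add: Amat_def w_def left_diff_distrib)
    then show ?thesis by (simp add: vec_eq_iff)
  qed
  moreover have "Nmat (\<lambda>i. S (w c1 c2 i)) c2 z ** Wm c2 z = Amat (w c1 c2) z"
    unfolding Nmat_S_eq[OF z c(2) w_props(1)[OF c]] matrix_mul_assoc[symmetric] Wm_Mm_inverse(2)[OF z c(2)] by simp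
  moreover have "Wm c2 z - Wm c1 z = - mscale \<kappa> (Jmat ** (Amat (u c2) z - Amat (u c1) z))"
    by (simp add: Wm_def matmul_diff_ldistrib mscale_diff)
  ultimately have "Wm c2 z - Wm c1 z = mscale (- \<kappa>) (Jmat ** (Nmat (\<lambda>i. S (w c1 c2 i)) c2 z ** Wm c2 z))"
    by (simp add: mscale_minus)
  then show ?thesis by (simp add: mscale_minus[symmetric] mscale_mult_left matrix_mul_assoc)
qed

text \<open>On \<open>(c1, c2)\<close> the resolvent kernel differs from \<open>1 / (\<tau> - z)\<close> by at most \<open>(c2 - c1) / d\<^sup>2\<close>, and the remaining
  integrand is \<open>|S w| |w|\<close>, whose integral is controlled by the increment of the trace.\<close>

lemma Nmat_approx:
  assumes z: "far z d" and c: "a \<le> c1" "c1 \<le> \<tau>" "\<tau> \<le> c2" "c2 \<le> b"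
  shows "cmod (Nmat (\<lambda>i. S (w c1 c2 i)) c2 z $ i $ k - 1 / (of_real \<tau> - z) * (sig c2 i k - sig c1 i k))
    \<le> (1 + B\<^sup>2) / (\<delta> * d\<^sup>2) * ((c2 - c1) * (s c2 - s c1))"
proof -
  have c12: "c1 \<le> c2" using c by simp
  have d: "0 < d" using z by (simp add: far_def)
  note W = w_props[OF c12 c(4)]
  have vs: "sq (v c2 k)" by (rule L2s_sq[OF v_props(1)[OF c(4)]])
  have i1: "integrable lborel (\<lambda>x. S (w c1 c2 i) x * (rz z x * v c2 k x))"
    by (intro sq_prod_integrable S_bounded(1)[OF W(2)] L2s_sq[OF L2s_rz[OF z v_props(1)[OF c(4)]]])
  have i2: "integrable lborel (\<lambda>x. S (w c1 c2 i) x * v c2 k x)"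
    by (intro sq_prod_integrable S_bounded(1)[OF W(2)] vs)
  have eq: "Nmat (\<lambda>i. S (w c1 c2 i)) c2 z $ i $ k - 1 / (of_real \<tau> - z) * (sig c2 i k - sig c1 i k) =
    (LINT x|lborel. S (w c1 c2 i) x * (rz z x * v c2 k x) - 1 / (of_real \<tau> - z) * (S (w c1 c2 i) x * v c2 k x))"
    unfolding sig_diff(1)[OF c12 c(4)]
    by (simp only: Nmat_def vec_lambda_beta Bochner_Integration.integral_diff[OF i1 integrable_mult_right[OF i2]] integral_mult_right_zero)
  have "cmod (Nmat (\<lambda>i. S (w c1 c2 i)) c2 z $ i $ k - 1 / (of_real \<tau> - z) * (sig c2 i k - sig c1 i k)) \<le>
    (LINT x|lborel. cmod (S (w c1 c2 i) x * (rz z x * v c2 k x) - 1 / (of_real \<tau> - z) * (S (w c1 c2 i) x * v c2 k x)))"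
    unfolding eq by (rule integral_norm_bound)
  also have "\<dots> \<le> (LINT x|lborel. (c2 - c1) / d\<^sup>2 * (cmod (S (w c1 c2 i) x) * cmod (w c1 c2 k x)))"
  proof (rule integral_mono_AE)
    show "integrable lborel (\<lambda>x. cmod (S (w c1 c2 i) x * (rz z x * v c2 k x) - 1 / (of_real \<tau> - z) * (S (w c1 c2 i) x * v c2 k x)))"
      by (intro integrable_norm Bochner_Integration.integrable_diff integrable_mult_right i1 i2)
    show "integrable lborel (\<lambda>x. (c2 - c1) / d\<^sup>2 * (cmod (S (w c1 c2 i) x) * cmod (w c1 c2 k x)))"
      by (intro integrable_mult_right sq_prod_integrable_norm S_bounded(1)[OF W(2)] L2s_sq[OF W(2)])
    show "AE x in lborel. cmod (S (w c1 c2 i) x * (rz z x * v c2 k x) - 1 / (of_real \<tau> - z) * (S (w c1 c2 i) x * v c2 k x))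
       \<le> (c2 - c1) / d\<^sup>2 * (cmod (S (w c1 c2 i) x) * cmod (w c1 c2 k x))"
      using W(3)[of i] W(5)[of i k]
    proof eventually_elim
      case (elim x)
      have e1: "S (w c1 c2 i) x * (rz z x * v c2 k x) - 1 / (of_real \<tau> - z) * (S (w c1 c2 i) x * v c2 k x) =
        (S (w c1 c2 i) x * v c2 k x) * (rz z x - 1 / (of_real \<tau> - z))" 
      proof -
        have "p * (r * q) - y * (p * q) = (p * q) * (r - y)" for p q r y :: complex by (simp add: algebra_simps)
        then show ?thesis .
      qed
      have e2: "cmod (S (w c1 c2 i) x) * cmod (w c1 c2 k x) = cmod (S (w c1 c2 i) x * v c2 k x)"
        unfolding elim(2) by (simp add: norm_mult)
      show ?case
      proof (cases "S (w c1 c2 i) x * v c2 k x = 0")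
        case True
        show ?thesis unfolding e1 e2 unfolding True by simp
      next
        case False
        then have "x \<notin> {a<..<c1}" "x \<in> {a<..<c2}"
          using elim(1) L2s_outside[OF v_props(1)[OF c(4)], of x k] by auto
        then have x: "c1 \<le> x" "x < c2" "x \<in> {a<..<b}" using c by auto
        have dx: "d \<le> cmod (of_real x - z)" "d \<le> cmod (of_real \<tau> - z)" using z x c unfolding far_def by auto
        then have nz: "of_real x - z \<noteq> 0" "of_real \<tau> - z \<noteq> 0" using d by auto
        have "rz z x - 1 / (of_real \<tau> - z) = of_real (\<tau> - x) / ((of_real x - z) * (of_real \<tau> - z))"
          using x nz by (simp add: rz_def diff_frac_eq)
        then have "cmod (rz z x - 1 / (of_real \<tau> - z)) = \<bar>\<tau> - x\<bar> / (cmod (of_real x - z) * cmod (of_real \<tau> - z))"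
          by (simp add: norm_divide norm_mult del: of_real_diff)
        also have "\<dots> \<le> (c2 - c1) / (d * d)"
        proof (rule frac_le)
          show "d * d \<le> cmod (of_real x - z) * cmod (of_real \<tau> - z)" using d dx by (intro mult_mono) auto
          show "\<bar>\<tau> - x\<bar> \<le> c2 - c1" using x c by (auto simp: abs_le_iff)
        qed (use d c12 in auto)
        finally have "cmod (rz z x - 1 / (of_real \<tau> - z)) \<le> (c2 - c1) / d\<^sup>2" by (simp add: power2_eq_square)
        then have "cmod (S (w c1 c2 i) x * v c2 k x) * cmod (rz z x - 1 / (of_real \<tau> - z)) \<le> cmod (S (w c1 c2 i) x * v c2 k x) * ((c2 - c1) / d\<^sup>2)"
          by (rule mult_left_mono) simp
        then show ?thesis unfolding e1 e2 norm_mult[of "S (w c1 c2 i) x * v c2 k x"] by (simp only: mult.commute)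
      qed
    qed
  qed
  also have "\<dots> = (c2 - c1) / d\<^sup>2 * (LINT x|lborel. cmod (S (w c1 c2 i) x) * cmod (w c1 c2 k x))"
    by (rule integral_mult_right_zero)
  also have "\<dots> \<le> (c2 - c1) / d\<^sup>2 * ((1 + B\<^sup>2) * ((s c2 - s c1) / \<delta>))"
  proof (rule mult_left_mono)
    have "(LINT x|lborel. cmod (S (w c1 c2 i) x) * cmod (w c1 c2 k x)) \<le> nrm (S (w c1 c2 i)) * nrm (w c1 c2 k)"
      by (intro Cauchy_Schwarz_norm S_bounded(1)[OF W(2)] L2s_sq[OF W(2)])
    also have "\<dots> \<le> (1 + B\<^sup>2) * nrm (w c1 c2 i) * nrm (w c1 c2 k)"
      by (intro mult_right_mono S_bounded(2)[OF W(2)]) auto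
    also have "\<dots> \<le> (1 + B\<^sup>2) * ((s c2 - s c1) / \<delta>)"
      unfolding mult.assoc by (intro mult_left_mono w_nrm_prod c12 c(4)) auto
    finally show "(LINT x|lborel. cmod (S (w c1 c2 i) x) * cmod (w c1 c2 k x)) \<le> (1 + B\<^sup>2) * ((s c2 - s c1) / \<delta>)" .
  qed (use c12 in simp)
  finally show ?thesis by (simp add: ac_simps)
qed

lemma Amat_bound:
  assumes z: "far z d" and c: "c \<le> b"
  shows "norm (Amat (u c) z) \<le> 4 * (U * (1 / d * (nrm (Fc 1) + nrm (Fc 2))))"
proof (rule norm_le_entries)
  fix i j
  have s: "sq (\<lambda>x. rz z x * Gc j x)" by (rule L2s_sq[OF L2s_rz[OF z L2s_Gc]])
  have d: "0 < d" using z by (simp add: far_def)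
  have "cmod (LINT x|lborel. u c i x * (rz z x * Gc j x)) \<le> nrm (u c i) * nrm (\<lambda>x. rz z x * Gc j x)"
    by (rule Cauchy_Schwarz[OF L2s_sq[OF u_props(1)[OF c]] s])
  also have "\<dots> \<le> U * (1 / d * (nrm (Fc 1) + nrm (Fc 2)))"
  proof (intro mult_mono u_bound c U_nonneg nrm_nonneg)
    have "nrm (\<lambda>x. rz z x * Gc j x) \<le> 1 / d * nrm (Gc j)"
      by (rule nrm_mult_bounded[OF L2s_sq[OF L2s_Gc] rz_measurable rz_bound[OF z]])
    also have "nrm (Gc j) = nrm (Fc j)" by (simp add: Gc_def[abs_def])
    also have "1 / d * nrm (Fc j) \<le> 1 / d * (nrm (Fc 1) + nrm (Fc 2))"
      using exhaust_2[of j] d by (intro mult_left_mono) auto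
    finally show "nrm (\<lambda>x. rz z x * Gc j x) \<le> 1 / d * (nrm (Fc 1) + nrm (Fc 2))" .
  qed
  finally show "cmod (Amat (u c) z $ i $ j) \<le> U * (1 / d * (nrm (Fc 1) + nrm (Fc 2)))"
    by (simp add: Amat_def mult.commute)
qed

text \<open>The constants collect the estimates above; the factors 4 come from comparing entries with the norm.\<close>

theorem Wm_has_mult_integral:
  assumes z: "far z d"
  shows "has_mult_integral (\<lambda>c. mscale (1 / (2 * of_real pi)) (Sg c)) a b z (Wm b z)"
proof -
  define \<sigma> where "\<sigma> c = mscale (1 / (2 * of_real pi)) (Sg c)" for c
  have d: "0 < d" "\<And>x. x \<in> {a..b} \<Longrightarrow> d \<le> cmod (of_real x - z)" using z by (auto simp: far_def)
  define C1 where "C1 = 4 * ((1 + B\<^sup>2) / \<delta>)"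
  define C2 where "C2 = 2 + 16 * (4 * (U * (1 / d * (nrm (Fc 1) + nrm (Fc 2)))))"
  define C3 where "C3 = 16 * (4 * ((1 + B\<^sup>2) / (\<delta> * d\<^sup>2)))"
  define C where "C = max (4 * C1) (max (4 * C2) C3)"
  have C1: "0 \<le> C1" using delta_pos by (simp add: C1_def add_nonneg_nonneg)
  have C0: "0 \<le> C" using C1 by (simp add: C_def)
  have \<kappa>n: "cmod \<kappa> \<le> 1" "cmod (1 / (2 * of_real pi)) \<le> 1"
    using pi_ge_two by (simp_all add: \<kappa>_def norm_divide norm_mult)
  have sdiff: "0 \<le> s c2 - s c1" if "c1 \<le> c2" "c2 \<le> b" for c1 c2 using s_mono[OF that] by simp
  have ms: "norm (mscale k A) \<le> 4 * norm A" if "cmod k \<le> 1" for k A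
    using norm_mscale[of k A] mult_right_mono[OF that, of "norm A"] by simp
  have "has_mult_integral \<sigma> a b z (Wm b z)"
  proof (rule has_mult_integral_of_difference_equation[where W="\<lambda>c. Wm c z", OF C0 d s_continuous])
    show "s c1 \<le> s c2" if "a \<le> c1" "c1 \<le> c2" "c2 \<le> b" for c1 c2 using s_mono that by simp
    show "norm (\<sigma> c2 - \<sigma> c1) \<le> C * (s c2 - s c1)" if "a \<le> c1" "c1 \<le> c2" "c2 \<le> b" for c1 c2
    proof -
      have "norm (Sg c2 - Sg c1) \<le> 4 * ((1 + B\<^sup>2) / \<delta> * (s c2 - s c1))"
        by (rule norm_le_entries) (use sig_diff_bound[OF that(2,3)] in \<open>simp add: Sg_def\<close>)
      have "norm (\<sigma> c2 - \<sigma> c1) \<le> 4 * C1 * (s c2 - s c1)"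
      proof -
        have "4 * ((1 + B\<^sup>2) / \<delta> * (s c2 - s c1)) = C1 * (s c2 - s c1)" by (simp add: C1_def)
        then show ?thesis unfolding \<sigma>_def mscale_diff[symmetric]
          using ms[OF \<kappa>n(2), of "Sg c2 - Sg c1"] \<open>norm (Sg c2 - Sg c1) \<le> _\<close> by linarith
      qed
      also have "\<dots> \<le> C * (s c2 - s c1)" using sdiff[OF that(2,3)] by (intro mult_right_mono) (simp_all add: C_def)
      finally show ?thesis .
    qed
    show "norm (Wm c z) \<le> C" if "a \<le> c" "c \<le> b" for c
    proof -
      have "norm (mat 1 :: complex ^ 2 ^ 2) \<le> 4 * 1" by (rule norm_le_entries) (simp add: mat_def)
      moreover have "norm (mscale \<kappa> (Jmat ** Amat (u c) z)) \<le> 4 * (4 * (4 * (U * (1 / d * (nrm (Fc 1) + nrm (Fc 2))))))"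
        using ms[OF \<kappa>n(1), of "Jmat ** Amat (u c) z"] norm_Jmat_mult[of "Amat (u c) z"] Amat_bound[OF z that(2)] by linarith
      ultimately have "norm (Wm c z) \<le> 4 + 4 * (4 * (4 * (U * (1 / d * (nrm (Fc 1) + nrm (Fc 2))))))"
        unfolding Wm_def using norm_triangle_ineq4[of "mat 1" "mscale \<kappa> (Jmat ** Amat (u c) z)"] by linarith
      also have "\<dots> \<le> 4 * C2"
      proof -
        have "0 \<le> U * (1 / d * (nrm (Fc 1) + nrm (Fc 2)))" using U_nonneg d(1) by simp
        moreover have "4 + 4 * (4 * (4 * Q)) \<le> 4 * (2 + 16 * (4 * Q))" if "0 \<le> Q" for Q :: real using that by simp
        ultimately show ?thesis unfolding C2_def by blast
      qed
      also have "\<dots> \<le> C" by (simp add: C_def)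
      finally show ?thesis .
    qed
    show "Wm a z = mat 1"
    proof -
      have "Amat (u a) z = 0" by (simp add: Amat_def u_at_a vec_eq_iff)
      then have "Wm a z $ i $ j = mat 1 $ i $ j" for i j by (simp add: Wm_def mscale_def Jmat_mult_nth)
      then show ?thesis by (simp add: vec_eq_iff)
    qed
    show "\<exists>E. norm E \<le> C * ((c2 - c1) * (s c2 - s c1)) \<and>
          Wm c2 z - Wm c1 z = (mscale (- \<i> / (of_real \<tau> - z)) (Jmat ** (\<sigma> c2 - \<sigma> c1)) + E) ** Wm c2 z"
      if c: "a \<le> c1" "c1 \<le> \<tau>" "\<tau> \<le> c2" "c2 \<le> b" for c1 c2 \<tau>
    proof -
      have c12: "c1 \<le> c2" using c by simp
      define N where "N = Nmat (\<lambda>i. S (w c1 c2 i)) c2 z"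
      define R where "R = N - mscale (1 / (of_real \<tau> - z)) (Sg c2 - Sg c1)"
      define E where "E = mscale (- \<kappa>) (Jmat ** R)"
      have R: "norm R \<le> 4 * ((1 + B\<^sup>2) / (\<delta> * d\<^sup>2) * ((c2 - c1) * (s c2 - s c1)))"
      proof (rule norm_le_entries)
        fix i k
        have "R $ i $ k = N $ i $ k - 1 / (of_real \<tau> - z) * (sig c2 i k - sig c1 i k)"
          by (simp add: R_def mscale_def Sg_def)
        then show "cmod (R $ i $ k) \<le> (1 + B\<^sup>2) / (\<delta> * d\<^sup>2) * ((c2 - c1) * (s c2 - s c1))"
          unfolding N_def using Nmat_approx[OF z c, of i k] by simp
      qed
      have "norm E \<le> 4 * norm (Jmat ** R)" unfolding E_def using \<kappa>n(1) by (intro ms) simp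
      also have "\<dots> \<le> 16 * norm R" using norm_Jmat_mult[of R] by simp
      also have "\<dots> \<le> 16 * (4 * ((1 + B\<^sup>2) / (\<delta> * d\<^sup>2) * ((c2 - c1) * (s c2 - s c1))))"
        by (rule mult_left_mono[OF R]) simp
      also have "\<dots> = C3 * ((c2 - c1) * (s c2 - s c1))" by (simp only: C3_def mult.assoc)
      also have "\<dots> \<le> C * ((c2 - c1) * (s c2 - s c1))"
        using sdiff[OF c12 c(4)] c12 by (intro mult_right_mono mult_nonneg_nonneg) (simp_all add: C_def)
      finally have nE: "norm E \<le> C * ((c2 - c1) * (s c2 - s c1))" .
      have NR: "N = mscale (1 / (of_real \<tau> - z)) (Sg c2 - Sg c1) + R" by (simp add: R_def)
      have "- mscale \<kappa> (Jmat ** N) = mscale (- \<i> / (of_real \<tau> - z)) (Jmat ** (\<sigma> c2 - \<sigma> c1)) + E"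
        unfolding NR E_def \<sigma>_def mscale_diff[symmetric] matrix_add_ldistrib mscale_mult_right mscale_add mscale_mscale mscale_minus
        by (simp add: \<kappa>_def mscale_minus[symmetric] mult.commute)
      then show ?thesis using nE Wm_difference[OF z c12 c(4)] unfolding N_def by metis
    qed
  qed (assumption | rule ab)+
  then show ?thesis by (simp add: \<sigma>_def[abs_def])
qed

end

section \<open>Passage from Lebesgue to Borel measurable representatives\<close>

lemma AE_lebesgue_on_iff:
  assumes "A \<in> sets borel"
  shows "(AE x in lebesgue_on A. P x) \<longleftrightarrow> (AE x in lborel. x \<in> A \<longrightarrow> P x)"
  using assms by (simp add: AE_restrict_space_iff AE_completion_iff)

lemma lebesgue_borel_representative:
  fixes g :: "real \<Rightarrow> complex"
  assumes g: "g \<in> borel_measurable lebesgue"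
  obtains g0 where "g0 \<in> borel_measurable borel" "AE x in lborel. g x = g0 x"
proof -
  have "(\<lambda>x. Re (g x)) \<in> borel_measurable lebesgue" "(\<lambda>x. Im (g x)) \<in> borel_measurable lebesgue"
    using g by measurable
  from completion_ex_borel_measurable_real[OF this(1)] completion_ex_borel_measurable_real[OF this(2)]
  obtain p q where p: "p \<in> borel_measurable lborel" "AE x in lborel. Re (g x) = p x"
    and q: "q \<in> borel_measurable lborel" "AE x in lborel. Im (g x) = q x" by blast
  show thesis
  proof
    show "(\<lambda>x. complex_of_real (p x) + \<i> * complex_of_real (q x)) \<in> borel_measurable borel" using p(1) q(1) by simp
    show "AE x in lborel. g x = complex_of_real (p x) + \<i> * complex_of_real (q x)"
      using p(2) q(2) by eventually_elim (simp add: complex_eq_iff)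
  qed
qed

text \<open>Completeness of Lebesgue measure: the preimages of a set under the two functions differ by a subset of a null set.\<close>

lemma lebesgue_measurable_of_AE_eq:
  fixes g :: "real \<Rightarrow> complex"
  assumes g0: "g0 \<in> borel_measurable borel" and eq: "AE x in lborel. g x = g0 x"
  shows "g \<in> borel_measurable lebesgue"
proof (rule measurableI)
  obtain N where N: "N \<in> null_sets lborel" "{x \<in> space lborel. g x \<noteq> g0 x} \<subseteq> N"
    using eq by (elim AE_E) (auto simp: null_sets_def)
  fix X :: "complex set" assume X: "X \<in> sets borel"
  have "g -` X \<inter> space lebesgue = (g0 -` X - N) \<union> (g -` X \<inter> N)" using N(2) by auto
  moreover have "g0 -` X \<in> sets borel" using measurable_sets[OF g0 X] by simp
  then have "g0 -` X - N \<in> sets lebesgue" using N(1) by (auto simp: null_sets_def)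
  moreover have "g -` X \<inter> N \<in> sets lebesgue"
    by (rule sets_completionI_sub[OF N(1)]) auto
  ultimately show "g -` X \<inter> space lebesgue \<in> sets lebesgue" by (simp only: sets.Un)
qed simp

lemma LINT_lebesgue_on_eq:
  fixes f f0 :: "real \<Rightarrow> complex"
  assumes A: "A \<in> sets borel" and f0: "f0 \<in> borel_measurable borel" and eq: "AE x in lborel. x \<in> A \<longrightarrow> f x = f0 x"
  shows "(LINT x|lebesgue_on A. f x) = (LINT x|lborel. indicator A x * f0 x)"
    and "integrable (lebesgue_on A) f \<longleftrightarrow> integrable lborel (\<lambda>x. indicator A x * f0 x)"
    and "f \<in> borel_measurable (lebesgue_on A)"
proof -
  have m0: "(\<lambda>x. indicator A x * f0 x) \<in> borel_measurable borel" using A f0 by simp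
  have e: "AE x in lborel. indicator A x *\<^sub>R f x = indicator A x * f0 x"
    using eq by eventually_elim (simp add: indicator_def)
  have m: "(\<lambda>x. indicator A x *\<^sub>R f x) \<in> borel_measurable lebesgue" by (rule lebesgue_measurable_of_AE_eq[OF m0 e])
  have A': "A \<inter> space lebesgue \<in> sets lebesgue" using A by simp
  have e': "AE x in lebesgue. indicator A x *\<^sub>R f x = indicator A x * f0 x" using e by (simp add: AE_completion_iff)
  have m0': "(\<lambda>x. indicator A x * f0 x) \<in> borel_measurable lebesgue" using m0 by (simp add: measurable_completion)
  have "(LINT x|lebesgue_on A. f x) = (LINT x|lebesgue. indicator A x *\<^sub>R f x)" by (rule integral_restrict_space[OF A'])
  also have "\<dots> = (LINT x|lebesgue. indicator A x * f0 x)" by (rule integral_cong_AE[OF m m0' e'])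
  also have "\<dots> = (LINT x|lborel. indicator A x * f0 x)" using m0 by (intro integral_completion) simp
  finally show "(LINT x|lebesgue_on A. f x) = (LINT x|lborel. indicator A x * f0 x)" .
  have "integrable (lebesgue_on A) f \<longleftrightarrow> integrable lebesgue (\<lambda>x. indicator A x *\<^sub>R f x)" by (rule integrable_restrict_space[OF A'])
  also have "\<dots> \<longleftrightarrow> integrable lebesgue (\<lambda>x. indicator A x * f0 x)" by (rule integrable_cong_AE[OF m m0' e'])
  also have "\<dots> \<longleftrightarrow> integrable lborel (\<lambda>x. indicator A x * f0 x)" using m0 by (intro integrable_completion) simp
  finally show "integrable (lebesgue_on A) f \<longleftrightarrow> integrable lborel (\<lambda>x. indicator A x * f0 x)" .
  show "f \<in> borel_measurable (lebesgue_on A)" using m by (subst borel_measurable_restrict_space_iff[OF A'])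
qed

lemma LINT_lebesgue_on_sq:
  fixes f f0 :: "real \<Rightarrow> complex"
  assumes f0: "f0 \<in> borel_measurable borel" "\<And>x. x \<notin> A \<Longrightarrow> f0 x = 0" and A: "A \<in> sets borel"
    and eq: "AE x in lborel. x \<in> A \<longrightarrow> f x = f0 x"
  shows "integrable (lebesgue_on A) (\<lambda>x. (cmod (f x))\<^sup>2) \<longleftrightarrow> integrable lborel (\<lambda>x. (cmod (f0 x))\<^sup>2)"
    and "(LINT x|lebesgue_on A. (cmod (f x))\<^sup>2) = (LINT x|lborel. (cmod (f0 x))\<^sup>2)"
proof -
  have e: "AE x in lborel. x \<in> A \<longrightarrow> complex_of_real ((cmod (f x))\<^sup>2) = complex_of_real ((cmod (f0 x))\<^sup>2)"
    using eq by eventually_elim simp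
  have m: "(\<lambda>x. complex_of_real ((cmod (f0 x))\<^sup>2)) \<in> borel_measurable borel" using f0(1) by measurable
  have i: "indicator A x * complex_of_real ((cmod (f0 x))\<^sup>2) = complex_of_real ((cmod (f0 x))\<^sup>2)" for x
    using f0(2)[of x] by (cases "x \<in> A") auto
  show "integrable (lebesgue_on A) (\<lambda>x. (cmod (f x))\<^sup>2) \<longleftrightarrow> integrable lborel (\<lambda>x. (cmod (f0 x))\<^sup>2)"
    using LINT_lebesgue_on_eq(2)[OF A m e] unfolding i complex_of_real_integrable_eq .
  have "complex_of_real (LINT x|lebesgue_on A. (cmod (f x))\<^sup>2) = complex_of_real (LINT x|lborel. (cmod (f0 x))\<^sup>2)"
    using LINT_lebesgue_on_eq(1)[OF A m e] unfolding i integral_complex_of_real .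
  then show "(LINT x|lebesgue_on A. (cmod (f x))\<^sup>2) = (LINT x|lborel. (cmod (f0 x))\<^sup>2)" by (simp only: of_real_eq_iff)
qed

lemma L2_representative:
  assumes f: "f \<in> L2 a c"
  obtains f0 where "L2s a c f0" "AE x in lborel. x \<in> {a<..<c} \<longrightarrow> f x = f0 x" "L2_norm a c f = nrm f0"
proof -
  have A: "{a<..<c} \<inter> space lebesgue \<in> sets lebesgue" by simp
  have "(\<lambda>x. indicator {a<..<c} x *\<^sub>R f x) \<in> borel_measurable lebesgue"
    using f borel_measurable_restrict_space_iff[OF A] by (auto simp: L2_def)
  then obtain g where g: "g \<in> borel_measurable borel" "AE x in lborel. indicator {a<..<c} x *\<^sub>R f x = g x"
    by (rule lebesgue_borel_representative)
  define f0 where "f0 x = indicator {a<..<c} x * g x" for x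
  have f0: "f0 \<in> borel_measurable borel" unfolding f0_def[abs_def] using g(1) by simp
  have out: "\<And>x. x \<notin> {a<..<c} \<Longrightarrow> f0 x = 0" by (simp add: f0_def)
  have eq: "AE x in lborel. x \<in> {a<..<c} \<longrightarrow> f x = f0 x"
    using g(2) by eventually_elim (auto simp: f0_def)
  note L = LINT_lebesgue_on_sq[OF f0 out _ eq]
  show thesis
  proof
    show "L2s a c f0" using f L(1) f0 out by (simp add: L2s_def sq_def L2_def)
    show "AE x in lborel. x \<in> {a<..<c} \<longrightarrow> f x = f0 x" by (rule eq)
    show "L2_norm a c f = nrm f0" using L(2) by (simp add: L2_norm_def nrm_def)
  qed
qed

lemma L2I:
  assumes f0: "L2s a c f0" and eq: "AE x in lborel. x \<in> {a<..<c} \<longrightarrow> f x = f0 x"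
  shows "f \<in> L2 a c" "L2_norm a c f = nrm f0"
proof -
  have m: "f0 \<in> borel_measurable borel" using f0 by (rule L2s_measurable)
  note L = LINT_lebesgue_on_sq[OF m L2s_outside[OF f0] _ eq]
  show "f \<in> L2 a c" using L(1) LINT_lebesgue_on_eq(3)[OF _ m eq] sq_integrable[OF L2s_sq[OF f0]] by (simp add: L2_def)
  show "L2_norm a c f = nrm f0" using L(2) by (simp add: L2_norm_def nrm_def)
qed

context kernel_op
begin

text \<open>At a point where the truncated integrals of \<open>cnj \<phi> f\<close> and \<open>\<phi> f\<close> converge, so does the truncated integral with the
  difference kernel, since \<open>\<phi> x\<close> can be taken out of each of its two terms.\<close>

lemma S_op_eq_S:
  assumes phi: "AE x in lborel. x \<in> {a<..<b} \<longrightarrow> \<phi>' x = \<phi> x" and c: "c \<le> b"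
    and f0: "L2s a c f0" and eq: "AE x in lborel. x \<in> {a<..<c} \<longrightarrow> f x = f0 x"
  shows "AE x in lborel. x \<in> {a<..<c} \<longrightarrow> S_op \<phi>' a c f x = S f0 x"
proof -
  have fb: "L2s a b f0" using f0 c by (rule L2s_mono)
  have [measurable]: "f0 \<in> borel_measurable borel" using f0 by (rule L2s_measurable)
  note g1 = good(1,2)[OF fb] and g2 = good(3,4)[OF fb]
  show ?thesis
    using hilb_truncated[OF g1] hilb_truncated[OF g2] phi eq
  proof eventually_elim
    case (elim x)
    show ?case
    proof
      assume x: "x \<in> {a<..<c}"
      then have px: "\<phi>' x = \<phi> x" using elim(3) c by auto
      define T where "T \<epsilon> = \<phi> x * truncated \<epsilon> (\<lambda>t. cnj (\<phi> t) * f0 t) x - cnj (\<phi> x) * truncated \<epsilon> (\<lambda>t. \<phi> t * f0 t) x" for \<epsilon>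
      have T: "(T \<longlongrightarrow> \<phi> x * hilb (\<lambda>t. cnj (\<phi> t) * f0 t) x - cnj (\<phi> x) * hilb (\<lambda>t. \<phi> t * f0 t) x) (at_right 0)"
        unfolding T_def[abs_def] by (intro tendsto_intros elim(1,2))
      have key: "(LINT t|lebesgue_on {t. a < t \<and> t < c \<and> \<epsilon> < \<bar>x - t\<bar>}. (\<phi>' x * cnj (\<phi>' t) - cnj (\<phi>' x) * \<phi>' t) / of_real (x - t) * f t) = T \<epsilon>"
        if e: "0 < \<epsilon>" for \<epsilon>
      proof -
        define A where "A = {t. a < t \<and> t < c \<and> \<epsilon> < \<bar>x - t\<bar>}"
        have A: "A \<in> sets borel" unfolding A_def by measurable
        define h where "h t = (\<phi> x * cnj (\<phi> t) - cnj (\<phi> x) * \<phi> t) / of_real (x - t) * f0 t" for t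
        have hm: "h \<in> borel_measurable borel" unfolding h_def[abs_def] by measurable
        have ae: "AE t in lborel. t \<in> A \<longrightarrow> (\<phi>' x * cnj (\<phi>' t) - cnj (\<phi>' x) * \<phi>' t) / of_real (x - t) * f t = h t"
          using phi eq by eventually_elim (use c px in \<open>auto simp: A_def h_def\<close>)
        have tr: "integrable lborel (\<lambda>t. indicator {t. \<epsilon> < \<bar>x - t\<bar>} t *\<^sub>R (g t / of_real (x - t)))"
          if g: "integrable lborel g" for g :: "real \<Rightarrow> complex"
        proof (rule Bochner_Integration.integrable_bound[of _ "\<lambda>t. cmod (g t) / \<epsilon>"])
          have [measurable]: "g \<in> borel_measurable borel" using g by auto
          show "(\<lambda>t. indicator {t. \<epsilon> < \<bar>x - t\<bar>} t *\<^sub>R (g t / of_real (x - t))) \<in> borel_measurable lborel" by measurable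
          show "AE t in lborel. norm (indicator {t. \<epsilon> < \<bar>x - t\<bar>} t *\<^sub>R (g t / of_real (x - t))) \<le> norm (cmod (g t) / \<epsilon>)"
          proof (rule AE_I2)
            fix t
            show "norm (indicator {t. \<epsilon> < \<bar>x - t\<bar>} t *\<^sub>R (g t / of_real (x - t))) \<le> norm (cmod (g t) / \<epsilon>)"
            proof (cases "\<epsilon> < \<bar>x - t\<bar>")
              case True
              have "norm (g t / of_real (x - t)) = cmod (g t) / \<bar>x - t\<bar>" unfolding norm_divide norm_of_real ..
              also have "\<dots> \<le> cmod (g t) / \<epsilon>" using True e by (intro divide_left_mono) auto
              finally show ?thesis using True e by simp
            qed (use e in simp)
          qed
        qed (use g in auto)
        have pt: "indicator A t * h t = \<phi> x * (indicator {t. \<epsilon> < \<bar>x - t\<bar>} t *\<^sub>R (cnj (\<phi> t) * f0 t / of_real (x - t)))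
           - cnj (\<phi> x) * (indicator {t. \<epsilon> < \<bar>x - t\<bar>} t *\<^sub>R (\<phi> t * f0 t / of_real (x - t)))" for t
        proof (cases "t \<in> {a<..<c}")
          case True
          have "(p * q - r * s) / y * g = p * (q * g / y) - r * (s * g / y)" for p q r s y g :: complex
            by (simp add: diff_divide_distrib left_diff_distrib mult.assoc)
          then show ?thesis using True by (simp add: A_def h_def indicator_def)
        next
          case False
          then show ?thesis using L2s_outside[OF f0] by (simp add: h_def)
        qed
        have "(LINT t|lebesgue_on A. (\<phi>' x * cnj (\<phi>' t) - cnj (\<phi>' x) * \<phi>' t) / of_real (x - t) * f t) = (LINT t|lborel. indicator A t * h t)"
          by (rule LINT_lebesgue_on_eq(1)[OF A hm ae])
        also have "\<dots> = T \<epsilon>"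
          unfolding pt T_def truncated_def set_lebesgue_integral_def
          by (simp only: Bochner_Integration.integral_diff[OF integrable_mult_right[OF tr[OF g2(1)]] integrable_mult_right[OF tr[OF g1(1)]]] integral_mult_right_zero)
        finally show ?thesis unfolding A_def .
      qed
      have lim: "((\<lambda>\<epsilon>. LINT t|lebesgue_on {t. a < t \<and> t < c \<and> \<epsilon> < \<bar>x - t\<bar>}. (\<phi>' x * cnj (\<phi>' t) - cnj (\<phi>' x) * \<phi>' t) / of_real (x - t) * f t)
        \<longlongrightarrow> \<phi> x * hilb (\<lambda>t. cnj (\<phi> t) * f0 t) x - cnj (\<phi> x) * hilb (\<lambda>t. \<phi> t * f0 t) x) (at_right 0)"
        by (rule Lim_transform_eventually[OF T])
          (use eventually_at_right_less[of "0::real"] in eventually_elim, simp only: key)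
      have "f x = f0 x" using elim(4) x by simp
      then show "S_op \<phi>' a c f x = S f0 x"
        unfolding S_op_def pv_integral_def S_def tendsto_Lim[OF trivial_limit_at_right_real lim] by simp
    qed
  qed
qed

end

section \<open>Coercivity and identification of the matrix function\<close>

text \<open>Let \<open>S g = f\<close> with \<open>|g| \<le> C |f|\<close>. Positivity of the form at \<open>f - g / C\<close> gives
  \<open>0 \<le> \<langle>S f, f\<rangle> - 2 |f|\<^sup>2 / C + \<langle>S g, g\<rangle> / C\<^sup>2\<close>, and the last term is at most \<open>|f|\<^sup>2 / C\<close>.\<close>

lemma (in kernel_op) coercive_of_positive_invertible:
  assumes phi: "AE x in lborel. x \<in> {a<..<b} \<longrightarrow> \<phi>' x = \<phi> x"
    and pos: "L2_positive a b (S_op \<phi>' a b)" and inv: "L2_invertible a b (S_op \<phi>' a b)"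
  obtains \<delta> where "0 < \<delta>" "\<And>f. L2s a b f \<Longrightarrow> \<delta> * (nrm f)\<^sup>2 \<le> Re (form f f)"
proof -
  obtain T' where T': "L2_bounded_op a b T'" "\<And>f. f \<in> L2 a b \<Longrightarrow> ae_eq a b (S_op \<phi>' a b (T' f)) f"
    using inv by (auto simp: L2_invertible_def)
  obtain C0 where C0: "\<And>f. f \<in> L2 a b \<Longrightarrow> L2_norm a b (T' f) \<le> C0 * L2_norm a b f"
    using T'(1) unfolding L2_bounded_op_def by blast
  define C where "C = max C0 1"
  have C: "0 < C" "C0 \<le> C" by (auto simp: C_def)
  have nonneg: "0 \<le> Re (form h h)" if h: "L2s a b h" for h
  proof -
    have hL: "h \<in> L2 a b" by (rule L2I(1)[OF h]) simp
    have [measurable]: "h \<in> borel_measurable borel" using h by (rule L2s_measurable)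
    have "(LINT x|lebesgue_on {a<..<b}. S_op \<phi>' a b h x * cnj (h x)) = (LINT x|lborel. indicator {a<..<b} x * (S h x * cnj (h x)))"
    proof (rule LINT_lebesgue_on_eq(1))
      show "(\<lambda>x. S h x * cnj (h x)) \<in> borel_measurable borel"
        using borel_measurable_integrable[OF form_integrable[OF h h]] by simp
      show "AE x in lborel. x \<in> {a<..<b} \<longrightarrow> S_op \<phi>' a b h x * cnj (h x) = S h x * cnj (h x)"
        using S_op_eq_S[OF phi order_refl h, of h] by eventually_elim auto
    qed simp
    also have "\<dots> = form h h"
      unfolding form_def
    proof (rule Bochner_Integration.integral_cong[OF refl])
      fix x show "indicator {a<..<b} x * (S h x * cnj (h x)) = S h x * cnj (h x)"
        by (cases "x \<in> {a<..<b}") (simp_all add: L2s_outside[OF h])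
    qed
    finally have "form h h \<in> \<real>\<^sub>\<ge>\<^sub>0" using pos hL by (auto simp: L2_positive_def L2_inner_def)
    then show ?thesis by (auto simp: nonneg_Reals_def)
  qed
  show thesis
  proof (rule that[of "1 / C"])
    show "0 < 1 / C" using C by simp
    fix f assume f: "L2s a b f"
    have fL: "f \<in> L2 a b" "L2_norm a b f = nrm f" using L2I[OF f, of f] by auto
    have TL: "T' f \<in> L2 a b" using T'(1) fL(1) by (auto simp: L2_bounded_op_def)
    obtain g where g: "L2s a b g" "AE x in lborel. x \<in> {a<..<b} \<longrightarrow> T' f x = g x" "L2_norm a b (T' f) = nrm g"
      by (rule L2_representative[OF TL])
    have gn: "nrm g \<le> C * nrm f"
      using C0[OF fL(1)] mult_right_mono[OF C(2) nrm_nonneg[of f]] by (simp add: fL(2) g(3))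
    have "AE x in lborel. x \<in> {a<..<b} \<longrightarrow> S_op \<phi>' a b (T' f) x = f x"
      using T'(2)[OF fL(1)] by (simp add: ae_eq_def AE_lebesgue_on_iff)
    then have Sg: "AE x in lborel. x \<in> {a<..<b} \<longrightarrow> S g x = f x"
      using S_op_eq_S[OF phi order_refl g(1,2)] by eventually_elim auto
    note Sgs = S_bounded(1)[OF g(1)]
    define N where "N = (nrm f)\<^sup>2"
    have gf: "form g f = of_real N"
    proof -
      have "form g f = (LINT x|lborel. f x * cnj (f x))"
        unfolding form_def by (rule pair_cong[OF L2s_cnj[OF f] Sgs L2s_sq[OF f] Sg])
      also have "\<dots> = (LINT x|lborel. complex_of_real ((cmod (f x))\<^sup>2))" by (simp only: complex_norm_square)
      also have "\<dots> = of_real N" unfolding N_def nrm_sq by (rule integral_complex_of_real)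
      finally show ?thesis .
    qed
    have fg: "form f g = of_real N" using form_hermitian[OF f g(1)] gf by simp
    have gg: "Re (form g g) \<le> C * N"
    proof -
      have eq: "form g g = (LINT x|lborel. f x * cnj (g x))"
        unfolding form_def by (rule pair_cong[OF L2s_cnj[OF g(1)] Sgs L2s_sq[OF f] Sg])
      have "Re (form g g) \<le> cmod (form g g)" by (rule complex_Re_le_cmod)
      also have "\<dots> \<le> nrm f * nrm (\<lambda>x. cnj (g x))"
        unfolding eq by (rule Cauchy_Schwarz[OF L2s_sq[OF f] sq_cnj[OF L2s_sq[OF g(1)]]])
      also have "\<dots> \<le> nrm f * (C * nrm f)" using gn by (simp add: mult_left_mono)
      finally show ?thesis by (simp add: N_def power2_eq_square ac_simps)
    qed
    define t where "t = - (1 / C)"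
    have "0 \<le> Re (form (\<lambda>x. f x + of_real t * g x) (\<lambda>x. f x + of_real t * g x))"
      by (intro nonneg L2s_add L2s_scale f g(1))
    also have "\<dots> = Re (form f f) + t * (2 * N) + t\<^sup>2 * Re (form g g)"
      unfolding form_add_real[OF f g(1)] fg gf by (simp del: of_real_power)
    also have "\<dots> \<le> Re (form f f) + t * (2 * N) + t\<^sup>2 * (C * N)"
      using gg by (intro add_left_mono mult_left_mono) auto
    also have "\<dots> = Re (form f f) - 1 / C * N"
    proof -
      have "t * (2 * N) + t\<^sup>2 * (C * N) = - (1 / C * N)" using C by (simp add: t_def power2_eq_square)
      then show ?thesis by simp
    qed
    finally show "1 / C * (nrm f)\<^sup>2 \<le> Re (form f f)" by (simp add: N_def)
  qed
qed

lemma integral_matrix_nth: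
  fixes f :: "'a \<Rightarrow> complex ^ 2 ^ 2"
  assumes "\<And>i j. integrable M (\<lambda>x. f x $ i $ j)"
  shows "(integral\<^sup>L M f) $ i $ j = (LINT x|M. f x $ i $ j)"
proof -
  define E :: "2 \<Rightarrow> 2 \<Rightarrow> complex \<Rightarrow> complex ^ 2 ^ 2" where "E i j c = (\<chi> k l. if k = i \<and> l = j then c else 0)" for i j c
  have E: "bounded_linear (E i j)" for i j
  proof (rule bounded_linear_intro)
    show "E i j (x + y) = E i j x + E i j y" for x y by (simp add: E_def vec_eq_iff)
    show "E i j (r *\<^sub>R x) = r *\<^sub>R E i j x" for r x by (simp add: E_def vec_eq_iff)
    show "norm (E i j x) \<le> norm x * 4" for x
      using norm_le_entries[of "E i j x" "norm x"] by (simp add: E_def mult.commute)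
  qed
  have "f x = (\<Sum>i\<in>UNIV. \<Sum>j\<in>UNIV. E i j (f x $ i $ j))" for x
    by (simp add: vec_eq_iff sum_2 forall_2 E_def)
  moreover have "integrable M (\<lambda>x. \<Sum>i\<in>UNIV. \<Sum>j\<in>UNIV. E i j (f x $ i $ j))"
    by (intro Bochner_Integration.integrable_sum integrable_bounded_linear[OF E] assms)
  ultimately have int: "integrable M f" by simp
  have "bounded_linear (\<lambda>A :: complex ^ 2 ^ 2. A $ i $ j)"
    by (rule bounded_linear_compose[OF bounded_linear_vec_nth bounded_linear_vec_nth])
  from integral_bounded_linear[OF this int] show ?thesis by simp
qed

lemma left_prod_cong: "(\<And>k. k < n \<Longrightarrow> E k = E' k) \<Longrightarrow> left_prod E n = left_prod E' n"
  by (induction n) auto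

lemma has_mult_integral_cong:
  assumes eq: "\<And>c. a \<le> c \<Longrightarrow> c \<le> b \<Longrightarrow> \<sigma> c = \<sigma>' c" and M: "has_mult_integral \<sigma>' a b z M"
  shows "has_mult_integral \<sigma> a b z M"
proof -
  have "mult_product \<sigma> z n t \<tau> = mult_product \<sigma>' z n t \<tau>" if tp: "tagged_partition a b n t \<tau>" for n t \<tau>
    unfolding mult_product_def
  proof (rule left_prod_cong)
    fix k assume "k < n"
    then have "\<sigma> (t k) = \<sigma>' (t k)" "\<sigma> (t (Suc k)) = \<sigma>' (t (Suc k))"
      using tagged_partition_points[OF tp, of k] tagged_partition_points[OF tp, of "Suc k"] by (auto intro!: eq)
    then show "matexp (mscale (- \<i> / (of_real (\<tau> k) - z)) (Jmat ** (\<sigma> (t (Suc k)) - \<sigma> (t k)))) =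
      matexp (mscale (- \<i> / (of_real (\<tau> k) - z)) (Jmat ** (\<sigma>' (t (Suc k)) - \<sigma>' (t k))))" by simp
  qed
  then show ?thesis using M unfolding has_mult_integral_def by (metis (no_types, lifting))
qed

text \<open>The chosen representative of \<open>S\<^sub>\<zeta>\<inverse> F\<close> agrees with \<open>u\<close> almost everywhere, because coercivity makes the solution unique.\<close>

lemma (in coercive_kernel_op) sigma1_eq:
  assumes phi: "AE x in lborel. x \<in> {a<..<b} \<longrightarrow> \<phi>' x = \<phi> x" and c: "a \<le> c" "c \<le> b"
  shows "sigma1 \<phi>' a c = mscale (1 / (2 * of_real pi)) (Sg c)"
proof (cases "c = a")
  case True
  have "Sg a $ i $ j = 0" for i j by (simp add: Sg_def sig_def v_def u_at_a)
  then show ?thesis using True by (simp add: sigma1_def vec_eq_iff mscale_def)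
next
  case False
  have FF: "AE x in lborel. x \<in> {a<..<c} \<longrightarrow> F1 \<phi>' x $ i = Fc i x" for i
    using phi by eventually_elim (use c exhaust_2[of i] in \<open>auto simp: Fc_def F1_nth F1_def vector_2\<close>)
  have inv: "AE x in lborel. x \<in> {a<..<c} \<longrightarrow> L2_inv a c (S_op \<phi>' a c) (\<lambda>y. F1 \<phi>' y $ i) x = u c i x" for i
  proof -
    define P where "P f \<longleftrightarrow> f \<in> L2 a c \<and> ae_eq a c (S_op \<phi>' a c f) (\<lambda>y. F1 \<phi>' y $ i)" for f
    have "P (u c i)"
    proof -
      have "AE x in lborel. x \<in> {a<..<c} \<longrightarrow> S_op \<phi>' a c (u c i) x = F1 \<phi>' x $ i"
        using S_op_eq_S[OF phi c(2) u_props(1)[OF c(2)] AE_I2, of "u c i" i, simplified] u_props(2)[OF c(2), of i] FF[of i]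
        by eventually_elim simp
      then show ?thesis using L2I(1)[OF u_props(1)[OF c(2)], of "u c i" i] by (simp add: P_def ae_eq_def AE_lebesgue_on_iff)
    qed
    then have "P (SOME f. P f)" by (rule someI[of P])
    moreover have "L2_inv a c (S_op \<phi>' a c) (\<lambda>y. F1 \<phi>' y $ i) = (SOME f. P f)" by (simp add: L2_inv_def P_def)
    ultimately obtain h where h: "h = L2_inv a c (S_op \<phi>' a c) (\<lambda>y. F1 \<phi>' y $ i)" "h \<in> L2 a c"
      "AE x in lborel. x \<in> {a<..<c} \<longrightarrow> S_op \<phi>' a c h x = F1 \<phi>' x $ i"
      by (auto simp: P_def ae_eq_def AE_lebesgue_on_iff)
    obtain h0 where h0: "L2s a c h0" "AE x in lborel. x \<in> {a<..<c} \<longrightarrow> h x = h0 x" by (rule L2_representative[OF h(2)])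
    have "AE x in lborel. x \<in> {a<..<c} \<longrightarrow> S h0 x = S (u c i) x"
      using S_op_eq_S[OF phi c(2) h0] h(3) u_props(2)[OF c(2), of i] FF[of i] by eventually_elim auto
    from solution_unique[OF h0(1) u_props(1)[OF c(2)] c(2) this] h0(2)
    show ?thesis unfolding h(1)[symmetric] by eventually_elim simp
  qed
  have int: "integrable (lebesgue_on {a<..<c}) (\<lambda>x. outer (F1 \<phi>' x) (Phi \<phi>' a c x) $ i $ j)"
    "(LINT x|lebesgue_on {a<..<c}. outer (F1 \<phi>' x) (Phi \<phi>' a c x) $ i $ j) = sig c i j" for i j
  proof -
    have A: "{a<..<c} \<in> sets borel" by simp
    have iFv: "integrable lborel (\<lambda>x. Fc i x * v c j x)"
      by (rule sq_prod_integrable[OF L2s_sq[OF L2s_Fc] L2s_sq[OF v_props(1)[OF c(2)]]])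
    have m: "(\<lambda>x. Fc i x * v c j x) \<in> borel_measurable borel" using borel_measurable_integrable[OF iFv] by simp
    have ae: "AE x in lborel. x \<in> {a<..<c} \<longrightarrow> outer (F1 \<phi>' x) (Phi \<phi>' a c x) $ i $ j = Fc i x * v c j x"
      using FF[of i] inv[of j] by eventually_elim (auto simp: outer_def Phi_def v_def)
    have ind: "indicator {a<..<c} x * (Fc i x * v c j x) = Fc i x * v c j x" for x
      by (cases "x \<in> {a<..<c}") (simp_all add: L2s_outside[OF v_props(1)[OF c(2)]])
    show "integrable (lebesgue_on {a<..<c}) (\<lambda>x. outer (F1 \<phi>' x) (Phi \<phi>' a c x) $ i $ j)"
      using LINT_lebesgue_on_eq(2)[OF A m ae] iFv unfolding ind by simp
    show "(LINT x|lebesgue_on {a<..<c}. outer (F1 \<phi>' x) (Phi \<phi>' a c x) $ i $ j) = sig c i j"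
      using LINT_lebesgue_on_eq(1)[OF A m ae] unfolding ind sig_def .
  qed
  have "sigma1 \<phi>' a c $ i $ j = mscale (1 / (2 * of_real pi)) (Sg c) $ i $ j" for i j
  proof -
    have "sigma1 \<phi>' a c $ i $ j = (1 / (2 * pi)) *\<^sub>R sig c i j"
      unfolding int(2)[of i j, symmetric] integral_matrix_nth[OF int(1), of i j, symmetric] using False
      by (simp only: sigma1_def if_False vector_scaleR_component)
    also have "\<dots> = 1 / (2 * of_real pi) * sig c i j" by (simp add: scaleR_conv_of_real)
    finally show ?thesis by (simp add: mscale_def Sg_def)
  qed
  then show ?thesis by (simp add: vec_eq_iff)
qed

section \<open>Analyticity, normalization and jump\<close>

lemma L2s_kernel_bound:
  assumes g: "L2s a b g" and k: "k \<in> borel_measurable borel" "\<And>x. x \<in> {a<..<b} \<Longrightarrow> cmod (k x) \<le> K"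
  shows "integrable lborel (\<lambda>x. g x * k x)" "cmod (LINT x|lborel. g x * k x) \<le> K * (LINT x|lborel. cmod (g x))"
proof -
  have gi: "integrable lborel g" using g by (rule L2s_integrable)
  have le: "cmod (g x * k x) \<le> K * cmod (g x)" for x
  proof (cases "x \<in> {a<..<b}")
    case True
    then show ?thesis using mult_right_mono[OF k(2)[OF True], of "cmod (g x)"] by (simp add: norm_mult mult.commute)
  qed (simp add: L2s_outside[OF g])
  show int: "integrable lborel (\<lambda>x. g x * k x)"
  proof (rule Bochner_Integration.integrable_bound[of _ "\<lambda>x. K * cmod (g x)"])
    show "(\<lambda>x. g x * k x) \<in> borel_measurable lborel" using gi k(1) by measurable
    show "AE x in lborel. norm (g x * k x) \<le> norm (K * cmod (g x))"
      using le by (intro AE_I2) (simp add: order_trans[OF _ abs_ge_self])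
  qed (use gi in simp)
  have "cmod (LINT x|lborel. g x * k x) \<le> (LINT x|lborel. cmod (g x * k x))" by (rule integral_norm_bound)
  also have "\<dots> \<le> (LINT x|lborel. K * cmod (g x))" using int gi le by (intro integral_mono integrable_norm) auto
  finally show "cmod (LINT x|lborel. g x * k x) \<le> K * (LINT x|lborel. cmod (g x))" by simp
qed

lemma far_from_segment:
  fixes a b :: real
  assumes "z \<notin> complex_of_real ` {a..b}"
  obtains d where "0 < d" "\<And>x. x \<in> {a..b} \<Longrightarrow> d \<le> cmod (of_real x - z)"
proof -
  have "closed (complex_of_real ` {a..b})"
    by (intro compact_imp_closed compact_continuous_image continuous_intros) auto
  from separate_point_closed[OF this assms] obtain d where d: "0 < d" "\<forall>x\<in>complex_of_real ` {a..b}. d \<le> dist z x" by blast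
  show thesis by (rule that[OF d(1)]) (use d(2) in \<open>auto simp: dist_norm norm_minus_commute\<close>)
qed

text \<open>The difference quotient minus the expected derivative is \<open>w - z\<close> times an integral with bounded kernel.\<close>

lemma cauchy_tr_holomorphic:
  assumes g: "L2s a b g"
  shows "cauchy_tr g holomorphic_on - (complex_of_real ` {a..b})"
  unfolding holomorphic_on_def
proof (intro ballI)
  fix z assume "z \<in> - (complex_of_real ` {a..b})"
  then have "z \<notin> complex_of_real ` {a..b}" by simp
  then obtain d where d: "0 < d" "\<And>x. x \<in> {a..b} \<Longrightarrow> d \<le> cmod (of_real x - z)" by (rule far_from_segment) blast
  define L where "L = (LINT x|lborel. cmod (g x))"
  define D where "D = (LINT x|lborel. g x * (1 / (of_real x - z)\<^sup>2))"
  have dw: "d / 2 \<le> cmod (of_real x - w)" if w: "dist w z < d / 2" and x: "x \<in> {a..b}" for w x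
    using d(2)[OF x] w norm_triangle_ineq[of "of_real x - w" "w - z"] by (simp add: dist_norm)
  have int: "integrable lborel (\<lambda>x. g x * (1 / (of_real x - w)))" if w: "dist w z < d / 2" for w
  proof (rule L2s_kernel_bound(1)[OF g, where K="2 / d"])
    fix x assume "x \<in> {a<..<b}"
    then have "d / 2 \<le> cmod (of_real x - w)" using w by (intro dw) auto
    then have "1 / cmod (of_real x - w) \<le> 1 / (d / 2)" using d(1) by (intro divide_left_mono mult_pos_pos) auto
    then show "cmod (1 / (of_real x - w)) \<le> 2 / d" by (simp add: norm_divide)
  qed simp
  have bound: "norm ((cauchy_tr g w - cauchy_tr g z) / (w - z) - D) \<le> dist w z * (2 / d ^ 3 * L)"
    if w: "dist w z < d / 2" "w \<noteq> z" for w
  proof -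
    have wz: "w - z \<noteq> 0" using w by simp
    have kb: "cmod ((w - z) / ((of_real x - w) * (of_real x - z)\<^sup>2)) \<le> dist w z * (2 / d ^ 3)" if x: "x \<in> {a<..<b}" for x
    proof -
      have 1: "d / 2 \<le> cmod (of_real x - w)" "d \<le> cmod (of_real x - z)"
        by (rule dw[OF w(1)], use x in simp) (rule d(2), use x in simp)
      have "(d / 2) * d\<^sup>2 \<le> cmod (of_real x - w) * (cmod (of_real x - z))\<^sup>2"
        using 1 d(1) by (intro mult_mono power_mono) auto
      then have "cmod (w - z) / (cmod (of_real x - w) * (cmod (of_real x - z))\<^sup>2) \<le> cmod (w - z) / ((d / 2) * d\<^sup>2)"
        using d(1) by (intro frac_le) auto
      also have "\<dots> = dist w z * (2 / d ^ 3)" by (simp add: dist_norm power3_eq_cube power2_eq_square)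
      finally show ?thesis by (simp add: norm_divide norm_mult norm_power)
    qed
    note K = L2s_kernel_bound[OF g _ kb]
    have iz: "integrable lborel (\<lambda>x. g x * (1 / (of_real x - z)\<^sup>2))"
    proof (rule L2s_kernel_bound(1)[OF g, where K="1 / d\<^sup>2"])
      fix x assume "x \<in> {a<..<b}"
      then have "d \<le> cmod (of_real x - z)" by (intro d) auto
      then have "1 / (cmod (of_real x - z))\<^sup>2 \<le> 1 / d\<^sup>2" using d(1) by (intro frac_le power_mono) auto
      then show "cmod (1 / (of_real x - z)\<^sup>2) \<le> 1 / d\<^sup>2" by (simp add: norm_divide norm_power)
    qed simp
    have dz: "dist z z < d / 2" using d(1) by simp
    have "(cauchy_tr g w - cauchy_tr g z) / (w - z) - D =
      (LINT x|lborel. (g x * (1 / (of_real x - w)) - g x * (1 / (of_real x - z))) / (w - z) - g x * (1 / (of_real x - z)\<^sup>2))"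
      unfolding D_def cauchy_tr_def using int[OF w(1)] int[OF dz] iz by simp
    also have "\<dots> = (LINT x|lborel. g x * ((w - z) / ((of_real x - w) * (of_real x - z)\<^sup>2)))"
    proof (rule Bochner_Integration.integral_cong[OF refl])
      fix x
      show "(g x * (1 / (of_real x - w)) - g x * (1 / (of_real x - z))) / (w - z) - g x * (1 / (of_real x - z)\<^sup>2) =
        g x * ((w - z) / ((of_real x - w) * (of_real x - z)\<^sup>2))"
      proof (cases "x \<in> {a<..<b}")
        case True
        have "d / 2 \<le> cmod (of_real x - w)" "d \<le> cmod (of_real x - z)"
          by (rule dw[OF w(1)], use True in simp) (rule d(2), use True in simp)
        then have nz: "of_real x - w \<noteq> 0" "of_real x - z \<noteq> 0" using d(1) by auto
        have alg: "(G * (1 / p) - G * (1 / q)) / (q - p) - G * (1 / q\<^sup>2) = G * ((q - p) / (p * q\<^sup>2))"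
          if "p \<noteq> 0" "q \<noteq> 0" "q - p \<noteq> 0" for G p q :: complex
        proof -
          have "(G * (1 / p) - G * (1 / q)) / (q - p) = G / (p * q)"
          proof -
            have "G * (1 / p) - G * (1 / q) = G * (q - p) / (p * q)" using that by (simp add: field_simps)
            then show ?thesis using that by simp
          qed
          then show ?thesis using that by (simp add: field_simps power2_eq_square)
        qed
        have "(of_real x - z) - (of_real x - w) = w - z" by simp
        then show ?thesis using alg[OF nz, of "g x"] wz by simp
      qed (simp add: L2s_outside[OF g])
    qed
    finally show ?thesis using K(2) by (simp add: L_def mult.assoc)
  qed
  have "((\<lambda>w. (cauchy_tr g w - cauchy_tr g z) / (w - z) - D) \<longlongrightarrow> 0) (at z)"
  proof (rule Lim_null_comparison)
    show "\<forall>\<^sub>F w in at z. norm ((cauchy_tr g w - cauchy_tr g z) / (w - z) - D) \<le> dist w z * (2 / d ^ 3 * L)"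
      unfolding eventually_at using d(1) bound by (intro exI[of _ "d / 2"]) auto
    have "((\<lambda>w. dist w z * (2 / d ^ 3 * L)) \<longlongrightarrow> dist z z * (2 / d ^ 3 * L)) (at z)" by (intro tendsto_intros)
    then show "((\<lambda>w. dist w z * (2 / d ^ 3 * L)) \<longlongrightarrow> 0) (at z)" by simp
  qed
  then have "(cauchy_tr g has_field_derivative D) (at z)" by (simp add: has_field_derivative_iff LIM_zero_iff)
  then show "cauchy_tr g field_differentiable at z within - complex_of_real ` {a..b}"
    using field_differentiable_at_within field_differentiable_def by blast
qed

lemma cauchy_tr_at_infinity:
  assumes g: "L2s a b g"
  shows "(cauchy_tr g \<longlongrightarrow> 0) at_infinity"
proof -
  define K where "K = \<bar>a\<bar> + \<bar>b\<bar>"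
  define L where "L = (LINT x|lborel. cmod (g x))"
  show ?thesis
  proof (rule Lim_null_comparison)
    show "\<forall>\<^sub>F z in at_infinity. norm (cauchy_tr g z) \<le> L / (norm z - K)"
      unfolding eventually_at_infinity
    proof (intro exI[of _ "K + 1"] allI impI)
      fix z :: complex assume z: "K + 1 \<le> norm z"
      have "cmod (LINT x|lborel. g x * (1 / (of_real x - z))) \<le> 1 / (norm z - K) * L"
        unfolding L_def
      proof (rule L2s_kernel_bound(2)[OF g])
        fix x assume "x \<in> {a<..<b}"
        then have "norm z - K \<le> cmod (of_real x - z)"
          using norm_triangle_ineq2[of z "of_real x"] by (auto simp: K_def norm_minus_commute)
        then show "cmod (1 / (of_real x - z)) \<le> 1 / (norm z - K)" using z by (simp add: norm_divide frac_le)
      qed simp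
      then show "norm (cauchy_tr g z) \<le> L / (norm z - K)" by (simp add: cauchy_tr_def)
    qed
    have "filterlim (\<lambda>z::complex. - K + norm z) at_top at_infinity"
      by (intro filterlim_tendsto_add_at_top[OF tendsto_const] filterlim_norm_at_top)
    then have "filterlim (\<lambda>z::complex. - K + norm z) at_infinity at_infinity" by (rule filterlim_at_top_imp_at_infinity)
    then have "((\<lambda>z::complex. L / (- K + norm z)) \<longlongrightarrow> 0) at_infinity" by (rule tendsto_divide_0[OF tendsto_const])
    then show "((\<lambda>z::complex. L / (norm z - K)) \<longlongrightarrow> 0) at_infinity" by simp
  qed
qed

context coercive_kernel_op
begin

text \<open>The densities of the Cauchy transforms that make up \<open>Wm b\<close>.\<close>

definition dens :: "2 \<Rightarrow> 2 \<Rightarrow> real \<Rightarrow> complex" where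
  "dens i j x = Gc j x * u b i x"

lemma L2s_dens: "L2s a b (dens i j)"
  unfolding dens_def[abs_def]
  by (rule L2s_mult[OF u_props(1)[OF order_refl] L2s_measurable[OF L2s_Gc], where B=B]) (simp add: Gc_def Fc_bound)

lemma Wm_nth: "Wm b z $ i $ j = mat 1 $ i $ j - \<kappa> * ((if i = 1 then - 1 else 1) * cauchy_tr (dens i j) z)"
proof -
  have "Amat (u b) z $ i $ j = cauchy_tr (dens i j) z"
    unfolding Amat_def cauchy_tr_def vec_lambda_beta
  proof (rule Bochner_Integration.integral_cong[OF refl])
    fix x
    show "u b i x * (Gc j x * rz z x) = dens i j x / (of_real x - z)"
      by (cases "x \<in> {a<..<b}") (simp_all add: rz_def dens_def L2s_outside[OF u_props(1)[OF order_refl]])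
  qed
  then show ?thesis by (simp add: Wm_def mscale_def Jmat_mult_nth)
qed

lemma Wm_analytic: "(\<lambda>z. Wm b z $ i $ j) holomorphic_on - (complex_of_real ` {a..b})"
  unfolding Wm_nth by (intro holomorphic_intros cauchy_tr_holomorphic[OF L2s_dens])

lemma Wm_at_infinity: "(Wm b \<longlongrightarrow> mat 1) at_infinity"
proof (intro vec_tendstoI)
  fix i j
  have "((\<lambda>z. Wm b z $ i $ j) \<longlongrightarrow> mat 1 $ i $ j - \<kappa> * ((if i = 1 then - 1 else 1) * 0)) at_infinity"
    unfolding Wm_nth by (intro tendsto_intros cauchy_tr_at_infinity[OF L2s_dens])
  then show "((\<lambda>z. Wm b z $ i $ j) \<longlongrightarrow> mat 1 $ i $ j) at_infinity" by simp
qed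

text \<open>With boundary values \<open>- H \<plusminus> i \<pi> g\<close> of the Cauchy transforms the jump is \<open>J u G\<^sup>T\<close>. In \<open>Wn J F\<close> the terms
  without Hilbert transform cancel since \<open>G\<^sup>T J F = 0\<close>, and the Hilbert transforms combine to those in \<open>S u\<close>.\<close>

lemma Wm_jump:
  "AE x in lborel. x \<in> {a<..<b} \<longrightarrow> (\<exists>Wp Wn.
     ((\<lambda>y. Wm b (Complex x y)) \<longlongrightarrow> Wp) (at_right 0) \<and>
     ((\<lambda>y. Wm b (Complex x y)) \<longlongrightarrow> Wn) (at_left 0) \<and>
     Wp = Wn ** (\<chi> i j. mat 1 $ i $ j + (if i = 1 then - 1 else 1) * (Fc i x * Gc j x)))"
proof -
  note D = L2s_integrable[OF L2s_dens] L2s_sq[OF L2s_dens]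
  have up: "AE x in lborel. \<forall>i j. ((\<lambda>y. cauchy_tr (dens i j) (Complex x y)) \<longlongrightarrow> - hilb (dens i j) x + \<i> * pi * dens i j x) (at_right 0)"
    unfolding forall_2 using hilb_upper[OF D, of 1 1] hilb_upper[OF D, of 1 2] hilb_upper[OF D, of 2 1] hilb_upper[OF D, of 2 2]
    by eventually_elim blast
  have lo: "AE x in lborel. \<forall>i j. ((\<lambda>y. cauchy_tr (dens i j) (Complex x (- y))) \<longlongrightarrow> - hilb (dens i j) x - \<i> * pi * dens i j x) (at_right 0)"
    unfolding forall_2 using hilb_lower[OF D, of 1 1] hilb_lower[OF D, of 1 2] hilb_lower[OF D, of 2 1] hilb_lower[OF D, of 2 2]
    by eventually_elim blast
  have SF: "AE x in lborel. \<forall>i. x \<in> {a<..<b} \<longrightarrow> S (u b i) x = Fc i x"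
    unfolding forall_2 using u_props(2)[OF order_refl, of 1] u_props(2)[OF order_refl, of 2] by eventually_elim blast
  have ub: "L2s a b (u b i)" for i by (rule u_props(1)[OF order_refl])
  have d1: "(\<lambda>t. cnj (\<phi> t) * u b i t) = dens i 1" for i
  proof
    fix t show "cnj (\<phi> t) * u b i t = dens i 1 t"
      by (cases "t \<in> {a<..<b}") (simp_all add: dens_def Gc_def Fc_def F1_nth L2s_outside[OF ub])
  qed
  have d2: "AE x in lborel. \<forall>i. hilb (\<lambda>t. \<phi> t * u b i t) x = - hilb (dens i 2) x"
  proof -
    have eq: "(\<lambda>t. \<phi> t * u b i t) = (\<lambda>t. - 1 * dens i 2 t)" for i
    proof
      fix t show "\<phi> t * u b i t = - 1 * dens i 2 t"
        by (cases "t \<in> {a<..<b}") (simp_all add: dens_def Gc_def Fc_def F1_nth L2s_outside[OF ub])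
    qed
    show ?thesis unfolding eq forall_2
      using hilb_scale[OF D, of "- 1" 1 2] hilb_scale[OF D, of "- 1" 2 2] by eventually_elim simp
  qed
  show ?thesis using up lo SF d2
  proof eventually_elim
    case (elim x)
    define J :: "2 \<Rightarrow> complex" where "J i = (if i = 1 then - 1 else 1)" for i
    define H where "H i j = hilb (dens i j) x" for i j
    define Wp :: "complex ^ 2 ^ 2" where "Wp = (\<chi> i j. mat 1 $ i $ j - \<kappa> * (J i * (- H i j + \<i> * pi * dens i j x)))"
    define Wn :: "complex ^ 2 ^ 2" where "Wn = (\<chi> i j. mat 1 $ i $ j - \<kappa> * (J i * (- H i j - \<i> * pi * dens i j x)))"
    show ?case
    proof
      assume x: "x \<in> {a<..<b}"
      have right: "((\<lambda>y. Wm b (Complex x y) $ i $ j) \<longlongrightarrow> Wp $ i $ j) (at_right 0)" for i j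
        unfolding Wm_nth Wp_def vec_lambda_beta J_def H_def using elim(1) by (intro tendsto_intros) auto
      have 1: "((\<lambda>y. Wm b (Complex x y)) \<longlongrightarrow> Wp) (at_right 0)"
        by (rule vec_tendstoI)+ (rule right)
      have left: "((\<lambda>y. Wm b (Complex x y) $ i $ j) \<longlongrightarrow> Wn $ i $ j) (at_left 0)" for i j
      proof -
        have "((\<lambda>y. Wm b (Complex x (- y)) $ i $ j) \<longlongrightarrow> Wn $ i $ j) (at_right 0)"
          unfolding Wm_nth Wn_def vec_lambda_beta J_def H_def using elim(2) by (intro tendsto_intros) auto
        then show ?thesis by (subst filterlim_at_left_to_right) simp
      qed
      have 2: "((\<lambda>y. Wm b (Complex x y)) \<longlongrightarrow> Wn) (at_left 0)"
        by (rule vec_tendstoI)+ (rule left)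
      have FG: "Fc 1 x = \<phi> x" "Fc 2 x = - cnj (\<phi> x)" "Gc 1 x = cnj (\<phi> x)" "Gc 2 x = - \<phi> x"
        using x by (simp_all add: Gc_def Fc_def F1_nth)
      have de: "dens i j x = Gc j x * u b i x" for i j by (simp add: dens_def)
      \<comment> \<open>the integral equation for \<open>u\<close>, read pointwise\<close>
      have key: "u b i x + \<kappa> * (\<phi> x * H i 1 + cnj (\<phi> x) * H i 2) = Fc i x" for i
      proof -
        have "S (u b i) x = Fc i x" using elim(3) x by blast
        then show ?thesis using elim(4) unfolding S_def d1 H_def \<kappa>_def by simp
      qed
      have kp: "\<kappa> * (\<i> * of_real pi) = - 1 / 2" by (simp add: \<kappa>_def)
      have jump: "Wp $ i $ j = Wn $ i $ j + J i * (u b i x * Gc j x)" for i j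
      proof -
        have "Wp $ i $ j - Wn $ i $ j = - 2 * (\<kappa> * (\<i> * of_real pi)) * (J i * dens i j x)"
          by (simp add: Wp_def Wn_def algebra_simps)
        also have "\<dots> = J i * (u b i x * Gc j x)" unfolding kp de by simp
        finally show ?thesis by (simp add: algebra_simps)
      qed
      have WJF: "Wn $ i $ 1 * (- Fc 1 x) + Wn $ i $ 2 * Fc 2 x = J i * u b i x" for i
      proof -
        have "Wn $ i $ 1 * (- Fc 1 x) + Wn $ i $ 2 * Fc 2 x =
          (mat 1 $ i $ 1 * (- Fc 1 x) + mat 1 $ i $ 2 * Fc 2 x) - J i * (\<kappa> * (\<phi> x * H i 1 + cnj (\<phi> x) * H i 2))"
          unfolding Wn_def vec_lambda_beta de FG by (simp add: algebra_simps)
        also have "mat 1 $ i $ 1 * (- Fc 1 x) + mat 1 $ i $ 2 * Fc 2 x = J i * Fc i x"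
          using exhaust_2[of i] by (auto simp: mat_def J_def)
        also have "\<kappa> * (\<phi> x * H i 1 + cnj (\<phi> x) * H i 2) = Fc i x - u b i x" using key[of i] by (simp add: algebra_simps)
        finally show ?thesis by (simp add: algebra_simps)
      qed
      have "Wp $ i $ j = (Wn ** (\<chi> i j. mat 1 $ i $ j + (if i = 1 then - 1 else 1) * (Fc i x * Gc j x))) $ i $ j" for i j
      proof -
        have "(Wn ** (\<chi> i j. mat 1 $ i $ j + (if i = 1 then - 1 else 1) * (Fc i x * Gc j x))) $ i $ j =
          (Wn $ i $ 1 * mat 1 $ 1 $ j + Wn $ i $ 2 * mat 1 $ 2 $ j) + (Wn $ i $ 1 * (- Fc 1 x) + Wn $ i $ 2 * Fc 2 x) * Gc j x"
          by (simp add: matrix_matrix_mult_def sum_2 algebra_simps)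
        also have "Wn $ i $ 1 * mat 1 $ 1 $ j + Wn $ i $ 2 * mat 1 $ 2 $ j = Wn $ i $ j"
          using exhaust_2[of j] by (auto simp: mat_def)
        finally show ?thesis unfolding WJF jump by simp
      qed
      then have 3: "Wp = Wn ** (\<chi> i j. mat 1 $ i $ j + (if i = 1 then - 1 else 1) * (Fc i x * Gc j x))"
        by (simp add: vec_eq_iff)
      from 1 2 3 show "\<exists>Wp Wn.
          ((\<lambda>y. Wm b (Complex x y)) \<longlongrightarrow> Wp) (at_right 0) \<and>
          ((\<lambda>y. Wm b (Complex x y)) \<longlongrightarrow> Wn) (at_left 0) \<and>
          Wp = Wn ** (\<chi> i j. mat 1 $ i $ j + (if i = 1 then - 1 else 1) * (Fc i x * Gc j x))"
        by blast
    qed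
  qed
qed

end

text \<open>\<open>(R - I)\<^sup>2 = 0\<close>, so that \<open>R\<^sup>2 = I + 2 (R - I) = I + J F F\<^sup>*\<close>.\<close>

lemma Rmat_square:
  assumes "p\<^sup>2 = 2 * \<psi> x"
  shows "Rmat \<psi> x ** Rmat \<psi> x = (\<chi> i j. mat 1 $ i $ j + (if i = 1 then - 1 else 1) * (F1 (\<lambda>_. p) x $ i * cnj (F1 (\<lambda>_. p) x $ j)))"
proof -
  have psi: "\<psi> x = p * p / 2" using assms by (simp add: power2_eq_square)
  have m: "complex_of_real (cmod (\<psi> x)) = p * cnj p / 2"
  proof -
    have "complex_of_real (cmod (\<psi> x)) = complex_of_real ((cmod p)\<^sup>2) / 2"
      unfolding psi by (simp add: norm_divide norm_mult power2_eq_square)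
    then show ?thesis by (simp only: complex_norm_square)
  qed
  show ?thesis
    unfolding Rmat_def m unfolding psi
    by (simp add: vec_eq_iff forall_2 matrix_matrix_mult_def sum_2 vector_2 F1_def mat_def) (simp add: field_simps)
qed

theorem theorem6p3:
  fixes a b :: real and \<psi> \<phi> :: "real \<Rightarrow> complex"
  assumes "a < b"
    and "\<psi> \<in> borel_measurable (lebesgue_on {a..b})"
    and "bounded (\<psi> ` {a..b})"
    and "\<phi> \<in> borel_measurable (lebesgue_on {a..b})"
    and "\<forall>x\<in>{a..b}. (\<phi> x)\<^sup>2 = 2 * \<psi> x"
    and "L2_positive a b (S_op \<phi> a b)"
    and "L2_invertible a b (S_op \<phi> a b)"
  shows "(\<forall>z. z \<notin> complex_of_real ` {a..b} \<longrightarrow>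
            has_mult_integral (sigma1 \<phi> a) a b z (mult_integral (sigma1 \<phi> a) a b z)) \<and>
         solves_RH (Rmat \<psi>) a b (mult_integral (sigma1 \<phi> a) a b)"
proof -
  obtain K where K0: "\<forall>y\<in>\<psi> ` {a..b}. cmod y \<le> K" using assms(3) unfolding bounded_iff by blast
  then have K: "cmod (\<psi> x) \<le> K" if "x \<in> {a..b}" for x using that by blast
  define B where "B = sqrt (2 * K)"
  have B: "cmod (\<phi> x) \<le> B" if "x \<in> {a..b}" for x
  proof -
    have "(cmod (\<phi> x))\<^sup>2 = 2 * cmod (\<psi> x)" using assms(5) that by (metis norm_mult norm_numeral norm_power)
    then have "(cmod (\<phi> x))\<^sup>2 \<le> 2 * K" using K[OF that] by simp
    then show ?thesis unfolding B_def by (rule real_le_rsqrt)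
  qed
  have B0: "0 \<le> B" using order_trans[OF norm_ge_zero B[of a]] assms(1) by simp
  have "(\<lambda>x. indicator {a..b} x *\<^sub>R \<phi> x) \<in> borel_measurable lebesgue"
    using assms(4) by (subst (asm) borel_measurable_restrict_space_iff) auto
  then obtain p where p: "p \<in> borel_measurable borel" "AE x in lborel. indicator {a..b} x *\<^sub>R \<phi> x = p x"
    by (rule lebesgue_borel_representative)
  \<comment> \<open>a Borel function, bounded everywhere, that agrees with \<open>\<phi>\<close> almost everywhere on the segment\<close>
  define \<phi>0 where "\<phi>0 x = (if cmod (p x) \<le> B then p x else 0)" for x
  have [measurable]: "\<phi>0 \<in> borel_measurable borel" unfolding \<phi>0_def[abs_def] using p(1) by measurable
  interpret kernel_op a b \<phi>0 B
    by unfold_locales (use assms(1) B0 in \<open>auto simp: \<phi>0_def\<close>)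
  have phi: "AE x in lborel. x \<in> {a<..<b} \<longrightarrow> \<phi> x = \<phi>0 x"
    using p(2)
  proof eventually_elim
    case (elim x)
    show ?case
    proof
      assume "x \<in> {a<..<b}"
      then have "x \<in> {a..b}" by simp
      then show "\<phi> x = \<phi>0 x" using elim B[of x] by (simp add: \<phi>0_def)
    qed
  qed
  obtain \<delta> where \<delta>: "0 < \<delta>" "\<And>f. L2s a b f \<Longrightarrow> \<delta> * (nrm f)\<^sup>2 \<le> Re (form f f)"
    by (rule coercive_of_positive_invertible[OF phi assms(6,7)]) blast
  interpret coercive_kernel_op a b \<phi>0 B \<delta> by unfold_locales (rule \<delta>; assumption?)+
  have MI: "has_mult_integral (sigma1 \<phi> a) a b z (Wm b z)" if z: "z \<notin> complex_of_real ` {a..b}" for z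
  proof -
    obtain d where "0 < d" "\<And>x. x \<in> {a..b} \<Longrightarrow> d \<le> cmod (of_real x - z)" by (rule far_from_segment[OF z]) blast
    then have "far z d" by (simp add: far_def)
    from Wm_has_mult_integral[OF this] show ?thesis
      by (rule has_mult_integral_cong[rotated]) (rule sigma1_eq[OF phi])
  qed
  have eq: "mult_integral (sigma1 \<phi> a) a b z = Wm b z" if "z \<notin> complex_of_real ` {a..b}" for z
    by (rule mult_integral_eq[OF assms(1) MI[OF that]])
  have off: "Complex x y \<notin> complex_of_real ` {a..b}" if "y \<noteq> 0" for x y
    using that by (auto simp: complex_eq_iff)
  have "solves_RH (Rmat \<psi>) a b (mult_integral (sigma1 \<phi> a) a b)"
    unfolding solves_RH_def
  proof (intro conjI allI)
    fix i j
    have op: "open (- (complex_of_real ` {a..b}))"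
      by (intro open_Compl compact_imp_closed compact_continuous_image continuous_intros) auto
    have "(\<lambda>z. mult_integral (sigma1 \<phi> a) a b z $ i $ j) holomorphic_on - (complex_of_real ` {a..b})"
      by (rule holomorphic_transform[OF Wm_analytic[of i j]]) (simp add: eq)
    then show "(\<lambda>z. mult_integral (sigma1 \<phi> a) a b z $ i $ j) analytic_on - (complex_of_real ` {a..b})"
      using op by (simp add: analytic_on_open)
  next
    show "(mult_integral (sigma1 \<phi> a) a b \<longlongrightarrow> mat 1) at_infinity"
    proof (rule Lim_transform_eventually[OF Wm_at_infinity])
      show "\<forall>\<^sub>F z in at_infinity. Wm b z = mult_integral (sigma1 \<phi> a) a b z"
        unfolding eventually_at_infinity
      proof (intro exI[of _ "\<bar>a\<bar> + \<bar>b\<bar> + 1"] allI impI)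
        fix z :: complex assume "\<bar>a\<bar> + \<bar>b\<bar> + 1 \<le> norm z"
        then have "z \<notin> complex_of_real ` {a..b}" by auto
        then show "Wm b z = mult_integral (sigma1 \<phi> a) a b z" by (simp add: eq)
      qed
    qed
  next
    have ends: "AE x in lborel. x \<noteq> a" "AE x in lborel. x \<noteq> b" by (rule AE_lborel_singleton)+
    have "AE x in lborel. x \<in> {a..b} \<longrightarrow> (\<exists>Wp Wm.
        ((\<lambda>y. mult_integral (sigma1 \<phi> a) a b (Complex x y)) \<longlongrightarrow> Wp) (at_right 0) \<and>
        ((\<lambda>y. mult_integral (sigma1 \<phi> a) a b (Complex x y)) \<longlongrightarrow> Wm) (at_left 0) \<and>
        Wp = Wm ** (Rmat \<psi> x ** Rmat \<psi> x))"
      using Wm_jump phi ends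
    proof eventually_elim
      case (elim x)
      show ?case
      proof
        assume "x \<in> {a..b}"
        then have x: "x \<in> {a<..<b}" "x \<in> {a..b}" using elim by auto
        obtain Wp Wn where W: "((\<lambda>y. Wm b (Complex x y)) \<longlongrightarrow> Wp) (at_right 0)" "((\<lambda>y. Wm b (Complex x y)) \<longlongrightarrow> Wn) (at_left 0)"
          "Wp = Wn ** (\<chi> i j. mat 1 $ i $ j + (if i = 1 then - 1 else 1) * (Fc i x * Gc j x))"
          using elim(1) x(1) by blast
        have sq2: "(\<phi>0 x)\<^sup>2 = 2 * \<psi> x" using bspec[OF assms(5) x(2)] elim(2) x(1) by simp
        have "Fc i x = F1 (\<lambda>_. \<phi>0 x) x $ i" for i using x(1) by (simp add: Fc_def F1_def)
        then have R: "Rmat \<psi> x ** Rmat \<psi> x = (\<chi> i j. mat 1 $ i $ j + (if i = 1 then - 1 else 1) * (Fc i x * Gc j x))"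
          unfolding Rmat_square[of "\<phi>0 x" \<psi> x, OF sq2] by (simp add: Gc_def)
        have "((\<lambda>y. mult_integral (sigma1 \<phi> a) a b (Complex x y)) \<longlongrightarrow> Wp) (at_right 0)"
          by (rule Lim_transform_eventually[OF W(1)])
            (use eventually_at_right_less[of "0::real"] in eventually_elim, simp add: eq off)
        moreover have "((\<lambda>y. mult_integral (sigma1 \<phi> a) a b (Complex x y)) \<longlongrightarrow> Wn) (at_left 0)"
          by (rule Lim_transform_eventually[OF W(2)])
            (simp add: eventually_at_filter eq off)
        ultimately show "\<exists>Wp Wm.
          ((\<lambda>y. mult_integral (sigma1 \<phi> a) a b (Complex x y)) \<longlongrightarrow> Wp) (at_right 0) \<and>
          ((\<lambda>y. mult_integral (sigma1 \<phi> a) a b (Complex x y)) \<longlongrightarrow> Wm) (at_left 0) \<and>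
          Wp = Wm ** (Rmat \<psi> x ** Rmat \<psi> x)" using W(3) unfolding R by blast
      qed
    qed
    then show "AE x in lebesgue_on {a..b}. \<exists>Wp Wm.
        ((\<lambda>y. mult_integral (sigma1 \<phi> a) a b (Complex x y)) \<longlongrightarrow> Wp) (at_right 0) \<and>
        ((\<lambda>y. mult_integral (sigma1 \<phi> a) a b (Complex x y)) \<longlongrightarrow> Wm) (at_left 0) \<and>
        Wp = Wm ** (Rmat \<psi> x ** Rmat \<psi> x)"
      by (simp add: AE_lebesgue_on_iff)
  qed
  then show ?thesis using MI eq by simp
qed

end
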